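(* Let the step-size $\Delta t>0$ be fixed, $t_n=n\Delta t$, and let $X^\dagger$, $X^{(\epsilon)}$, $M$, the filters' initial value $\Theta_0$, and the gains $K_n$, $K_n^{(\epsilon)}$ be as defined in the context. (a) Let $\Theta_n^{(\epsilon)}$ and $\Theta_n$, $n\ge0$, be given by $$\Theta_{n+1}^{(\epsilon)}=\Theta_n^{(\epsilon)}+K_n^{(\epsilon)}\left\{(X^{(\epsilon)}_{t_{n+1}}-X^{(\epsilon)}_{t_n})-\tfrac12\left(\Theta_n^{(\epsilon)}+\pi_n^{(\epsilon)}[\theta]\right)AX^{(\epsilon)}_{t_n}\Delta t\right\},$$ $$\Theta_{n+1}=\Theta_n+K_n\left\{(X^{\dagger}_{t_{n+1}}-X^{\dagger}_{t_n})-\tfrac12\left(\Theta_n+\pi_n[\theta]\right)AX^{\dagger}_{t_n}\Delta t\right\},$$ with $\Theta_0^{(\epsilon)}=\Theta_0$. Then the first scheme converges to the second as $\epsilon\to0$: for every $n\ge0$, $\Theta_n^{(\epsilon)}\to\Theta_n$ in $L^2$. (b) Let $\Theta_n^{(\epsilon)}$ and $\Theta_n$, $n\ge0$, be given by $$\Theta_{n+1}^{(\epsilon)}=\Theta_n^{(\epsilon)}+\frac{\sigma_n^{(\epsilon)}}{\gamma}\int_{t_n}^{t_{n+1}}(AX_t^{(\epsilon)})^{\rm T}{\rm d}X_t^{(\epsilon)}-\frac{\Delta t}{2}\sigma_n^{(\epsilon)}A^{\rm T}:M-\tfrac12K_n^{(\epsilon)}AX^{(\epsilon)}_{t_n}\left(\Theta_n^{(\epsilon)}+\pi_n^{(\epsilon)}[\theta]\right)\Delta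 t,$$ $$\Theta_{n+1}=\Theta_n+\frac{\sigma_n}{\gamma}\int_{t_n}^{t_{n+1}}(AX_t^{\dagger})^{\rm T}{\rm d}X_t^{\dagger}-\tfrac12K_nAX^{\dagger}_{t_n}\left(\Theta_n+\pi_n[\theta]\right)\Delta t,$$ with $\Theta_0^{(\epsilon)}=\Theta_0$, where the integral against ${\rm d}X^\dagger_t$ is an It\^o integral. Then the first scheme converges to the second as $\epsilon\to0$: for every $n\ge0$, $\Theta_n^{(\epsilon)}\to\Theta_n$ in $L^2$.
   Context: The state dimension is $d=2$. Let $\gamma>0$ and let $A\in\mathbb{R}^{2\times2}$ be a normal matrix all of whose eigenvalues have negative real part. For matrices write $B_1:B_2=\mathrm{tr}(B_1^{\rm T}B_2)$. Let $$M=\begin{pmatrix}1&\beta\\-\beta&1\end{pmatrix},\qquad \beta=2 .$$ Let $W^\dagger$ be a standard $2$-dimensional Brownian motion and let $C=-\gamma(A+A^{\rm T})^{-1}$. The reference process $X^\dagger$ solves $${\rm d}X^\dagger_t=AX^\dagger_t\,{\rm d}t+\gamma^{1/2}\,{\rm d}W^\dagger_t,\qquad X^\dagger_0\sim{\rm N}(0,C),$$ and for $\epsilon>0$ the two-scale process $(X^{(\epsilon)},P^{(\epsilon)})$, driven by the same Brownian motion $W^\dagger$, solves $${\rm d}X^{(\epsilon)}_t=AX^{(\epsilon)}_t\,{\rm d}t+\frac{\gamma^{1/2}}{\epsilon}MP^{(\epsilon)}_t\,{\rm d}t,\qquad {\rm d}P^{(\epsilon)}_t=-\frac1\epsilon MP^{(\epsilon)}_t\,{\rm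 d}t+{\rm d}W^\dagger_t,$$ with $X^{(\epsilon)}_0=X^\dagger_0$ and $P^{(\epsilon)}$ stationary, i.e. $P^{(\epsilon)}_0\sim{\rm N}(0,\tfrac{\epsilon}{2}I)$. The initial values $X^\dagger_0$ and $P^{(\epsilon)}_0$ are independent of each other and of $W^\dagger$. Integrals against ${\rm d}X^{(\epsilon)}_t$ are ordinary (Riemann--Stieltjes) integrals, since $X^{(\epsilon)}$ has continuously differentiable paths. Filter notation: $\Theta_0$ is a scalar Gaussian random variable (the prior), with mean $m_{\rm prior}$ and variance $\sigma_{\rm prior}>0$, independent of $(X_0^\dagger,P_0^{(\epsilon)},W^\dagger)$. In each scheme $\pi_n$ (resp. $\pi_n^{(\epsilon)}$) denotes the conditional distribution of $\Theta_n$ (resp. $\Theta_n^{(\epsilon)}$) given the driving observation path $X^\dagger$ (resp. $X^{(\epsilon)}$), i.e. the law over the randomness of $\Theta_0$ with the observation path held fixed; $\pi_n[\theta]$ and $\pi_n^{(\epsilon)}[\theta]$ are its means, and $\sigma_n=\pi_n[(\theta-\pi_n[\theta])^2]$, $\sigma_n^{(\epsilon)}=\pi_n^{(\epsilon)}[(\theta-\pi_n^{(\epsilon)}[\theta])^2]$ its variances. The Kalman gains (row vectors) are $$K_n=\sigma_n(AX^\dagger_{t_n})^{\rm T}\left(\gamma+\Delta t\,\sigma_n(AX^\dagger_{t_n})^{\rm T}AX^\dagger_{t_n}\right)^{-1},\qquad K_n^{(\epsilon)}=\sigma_n^{(\epsilon)}(AX^{(\epsilon)}_{t_n})^{\rm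 T}\left(\gamma+\Delta t\,\sigma_n^{(\epsilon)}(AX^{(\epsilon)}_{t_n})^{\rm T}AX^{(\epsilon)}_{t_n}\right)^{-1}.$$ *)

theory Defs
  imports "HOL-Probability.Probability"
begin

section \<open>Matrices\<close>

definition normal_matrix :: "real^'n^'n \<Rightarrow> bool" where
  "normal_matrix A \<longleftrightarrow> A ** transpose A = transpose A ** A"

definition complex_eigenvalue :: "real^'n^'n \<Rightarrow> complex \<Rightarrow> bool" where
  "complex_eigenvalue A z \<longleftrightarrow>
     (\<exists>v :: complex^'n. v \<noteq> 0 \<and> (\<chi> i j. complex_of_real (A $ i $ j)) *v v = z *s v)"

definition frob :: "real^'n^'m \<Rightarrow> real^'n^'m \<Rightarrow> real"  (infix \<open>::\<^sub>F\<close> 60) where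
  "B1 ::\<^sub>F B2 = trace (transpose B1 ** B2)"

definition mat_M :: "real \<Rightarrow> real^2^2" where
  "mat_M \<beta> = vector [vector [1, \<beta>], vector [- \<beta>, 1]]"

section \<open>Gaussian vectors, independence, Brownian motion\<close>

text \<open>A random vector is \<open>N(m, C)\<close> iff each linear functional \<open>v \<bullet> Y\<close> is
  \<open>N(v \<bullet> m, v \<bullet> C v)\<close>; the degenerate normal law with variance zero is a point mass.\<close>

definition gaussian_rv :: "'w measure \<Rightarrow> real^'n \<Rightarrow> real^'n^'n \<Rightarrow> ('w \<Rightarrow> real^'n) \<Rightarrow> bool" where
  "gaussian_rv \<Omega> m C Y \<longleftrightarrow> Y \<in> borel_measurable \<Omega> \<and>
     (\<forall>v. if v \<bullet> (C *v v) = 0 then AE \<omega> in \<Omega>. v \<bullet> Y \<omega> = v \<bullet> m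
          else distributed \<Omega> lborel (\<lambda>\<omega>. v \<bullet> Y \<omega>)
                 (\<lambda>x. ennreal (normal_density (v \<bullet> m) (sqrt (v \<bullet> (C *v v))) x)))"

text \<open>Independence of two random elements whose values may have different types, which
  \<^const>\<open>prob_space.indep_var\<close> does not cover.\<close>

definition indep_rv :: "'w measure \<Rightarrow> 'a measure \<Rightarrow> ('w \<Rightarrow> 'a) \<Rightarrow> 'b measure \<Rightarrow> ('w \<Rightarrow> 'b) \<Rightarrow> bool" where
  "indep_rv \<Omega> N Y N' Z \<longleftrightarrow> Y \<in> measurable \<Omega> N \<and> Z \<in> measurable \<Omega> N' \<and>
     prob_space.indep_set \<Omega> (sets (vimage_algebra (space \<Omega>) Y N))
                            (sets (vimage_algebra (space \<Omega>) Z N'))"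

definition traj :: "real set \<Rightarrow> (real \<Rightarrow> 'w \<Rightarrow> 'a) \<Rightarrow> 'w \<Rightarrow> real \<Rightarrow> 'a" where
  "traj T Y \<omega> = (\<lambda>t\<in>T. Y t \<omega>)"

abbreviation path_space :: "real set \<Rightarrow> (real \<Rightarrow> 'a::topological_space) measure" where
  "path_space T \<equiv> PiM T (\<lambda>_. borel)"

definition brownian_motion :: "'w measure \<Rightarrow> (real \<Rightarrow> 'w \<Rightarrow> real^'n) \<Rightarrow> bool" where
  "brownian_motion \<Omega> W \<longleftrightarrow>
     (\<forall>t\<ge>0. W t \<in> borel_measurable \<Omega>) \<and>
     (AE \<omega> in \<Omega>. W 0 \<omega> = 0 \<and> continuous_on {0..} (\<lambda>t. W t \<omega>)) \<and>
     (\<forall>s t. 0 \<le> s \<and> s \<le> t \<longrightarrow>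
        gaussian_rv \<Omega> 0 ((t - s) *\<^sub>R mat 1) (\<lambda>\<omega>. W t \<omega> - W s \<omega>) \<and>
        indep_rv \<Omega> borel (\<lambda>\<omega>. W t \<omega> - W s \<omega>) (path_space {0..s}) (traj {0..s} W))"

section \<open>Processes with additive noise and the Ito integral\<close>

text \<open>\<open>dX = b dt + c dW\<close> with a scalar constant \<open>c\<close>, as an integral equation. If \<open>b\<close>
  depends on \<open>X\<close>, this says that \<open>X\<close> solves the corresponding stochastic differential equation.\<close>

definition additive_process ::
  "'w measure \<Rightarrow> (real \<Rightarrow> 'w \<Rightarrow> real^'n) \<Rightarrow> (real \<Rightarrow> 'w \<Rightarrow> real^'n) \<Rightarrow> real \<Rightarrow> (real \<Rightarrow> 'w \<Rightarrow> real^'n) \<Rightarrow> bool"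
where
  "additive_process \<Omega> W b c X \<longleftrightarrow>
     (\<forall>t\<ge>0. X t \<in> borel_measurable \<Omega>) \<and>
     (AE \<omega> in \<Omega>. continuous_on {0..} (\<lambda>t. X t \<omega>) \<and>
        (\<forall>t\<ge>0. (\<lambda>s. b s \<omega>) integrable_on {0..t} \<and>
               X t \<omega> = X 0 \<omega> + integral {0..t} (\<lambda>s. b s \<omega>) + c *\<^sub>R W t \<omega>))"

text \<open>The filtration generated by an initial value \<open>X0\<close> and by \<open>W\<close>.\<close>

definition init_filtration :: "'w measure \<Rightarrow> ('w \<Rightarrow> real^'n) \<Rightarrow> (real \<Rightarrow> 'w \<Rightarrow> real^'n) \<Rightarrow> real \<Rightarrow> 'w measure"
where
  "init_filtration \<Omega> X0 W t =
     vimage_algebra (space \<Omega>) (\<lambda>\<omega>. (X0 \<omega>, traj {0..t} W \<omega>)) (borel \<Otimes>\<^sub>M path_space {0..t})"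

text \<open>A simple adapted process on \<open>[a, b]\<close> takes the bounded \<open>F (\<tau> i)\<close>-measurable value
  \<open>\<xi> i\<close> on \<open>[\<tau> i, \<tau> (i + 1))\<close>, for \<open>i < m\<close>.\<close>

definition simple_process ::
  "(real \<Rightarrow> 'w measure) \<Rightarrow> real \<Rightarrow> real \<Rightarrow> nat \<Rightarrow> (nat \<Rightarrow> real) \<Rightarrow> (nat \<Rightarrow> 'w \<Rightarrow> real^'n) \<Rightarrow> bool" where
  "simple_process F a b m \<tau> \<xi> \<longleftrightarrow> \<tau> 0 = a \<and> \<tau> m = b \<and>
     (\<forall>i<m. \<tau> i \<le> \<tau> (Suc i) \<and> \<xi> i \<in> borel_measurable (F (\<tau> i)) \<and>
            bounded (\<xi> i ` space (F (\<tau> i))))"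

definition simple_value :: "nat \<Rightarrow> (nat \<Rightarrow> real) \<Rightarrow> (nat \<Rightarrow> 'w \<Rightarrow> real^'n) \<Rightarrow> real \<Rightarrow> 'w \<Rightarrow> real^'n" where
  "simple_value m \<tau> \<xi> t \<omega> = (\<Sum>i<m. indicator {\<tau> i..<\<tau> (Suc i)} t *\<^sub>R \<xi> i \<omega>)"

definition simple_integral ::
  "(real \<Rightarrow> 'w \<Rightarrow> real^'n) \<Rightarrow> nat \<Rightarrow> (nat \<Rightarrow> real) \<Rightarrow> (nat \<Rightarrow> 'w \<Rightarrow> real^'n) \<Rightarrow> 'w \<Rightarrow> real" where
  "simple_integral W m \<tau> \<xi> \<omega> = (\<Sum>i<m. \<xi> i \<omega> \<bullet> (W (\<tau> (Suc i)) \<omega> - W (\<tau> i) \<omega>))"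

text \<open>\<open>J\<close> is a version of \<open>\<integral>\<^sub>a\<^sup>b H\<^sup>T dW\<close>, the \<open>L\<^sup>2\<close> limit of the integrals of simple adapted
  processes that approximate \<open>H\<close> in \<open>L\<^sup>2(dt \<times> P)\<close>. By the Ito isometry it is unique up to
  null sets.\<close>

definition has_ito_integral ::
  "'w measure \<Rightarrow> (real \<Rightarrow> 'w measure) \<Rightarrow> (real \<Rightarrow> 'w \<Rightarrow> real^'n) \<Rightarrow>
   (real \<Rightarrow> 'w \<Rightarrow> real^'n) \<Rightarrow> real \<Rightarrow> real \<Rightarrow> ('w \<Rightarrow> real) \<Rightarrow> bool" where
  "has_ito_integral \<Omega> F W H a b J \<longleftrightarrow> J \<in> borel_measurable \<Omega> \<and>
     (\<exists>m \<tau> \<xi>. (\<forall>k. simple_process F a b (m k) (\<tau> k) (\<xi> k)) \<and>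
       (\<lambda>k. \<integral>\<^sup>+\<omega>. (\<integral>\<^sup>+t\<in>{a..b}. ennreal ((norm (simple_value (m k) (\<tau> k) (\<xi> k) t \<omega> - H t \<omega>))\<^sup>2) \<partial>lborel) \<partial>\<Omega>)
          \<longlonglongrightarrow> 0 \<and>
       (\<lambda>k. \<integral>\<^sup>+\<omega>. ennreal ((simple_integral W (m k) (\<tau> k) (\<xi> k) \<omega> - J \<omega>)\<^sup>2) \<partial>\<Omega>)
          \<longlonglongrightarrow> 0)"

text \<open>\<open>J\<close> is a version of \<open>\<integral>\<^sub>a\<^sup>b H\<^sup>T dX\<close> for \<open>dX = B dt + c dW\<close>, i.e. of
  \<open>\<integral>\<^sub>a\<^sup>b H\<^sup>T B dt + c \<integral>\<^sub>a\<^sup>b H\<^sup>T dW\<close>.\<close>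

definition has_ito_integral_process ::
  "'w measure \<Rightarrow> (real \<Rightarrow> 'w measure) \<Rightarrow> (real \<Rightarrow> 'w \<Rightarrow> real^'n) \<Rightarrow>
   (real \<Rightarrow> 'w \<Rightarrow> real^'n) \<Rightarrow> real \<Rightarrow> (real \<Rightarrow> 'w \<Rightarrow> real^'n) \<Rightarrow> real \<Rightarrow> real \<Rightarrow> ('w \<Rightarrow> real) \<Rightarrow> bool" where
  "has_ito_integral_process \<Omega> F W B c H a b J \<longleftrightarrow>
     (\<exists>I. has_ito_integral \<Omega> F W H a b I \<and>
       (AE \<omega> in \<Omega>. (\<lambda>t. H t \<omega> \<bullet> B t \<omega>) integrable_on {a..b} \<and>
          J \<omega> = integral {a..b} (\<lambda>t. H t \<omega> \<bullet> B t \<omega>) + c * I \<omega>))"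

section \<open>The Riemann--Stieltjes integral\<close>

text \<open>Limit of tagged Riemann--Stieltjes sums of \<open>f\<^sup>T dg\<close> over \<open>[a, b]\<close> as the mesh tends to zero.\<close>

definition has_rs_integral ::
  "(real \<Rightarrow> real^'n) \<Rightarrow> (real \<Rightarrow> real^'n) \<Rightarrow> real \<Rightarrow> real \<Rightarrow> real \<Rightarrow> bool" where
  "has_rs_integral f g a b I \<longleftrightarrow>
     (\<forall>e>0. \<exists>d>0. \<forall>p. p tagged_division_of {a..b} \<and> (\<forall>(x, K)\<in>p. diameter K < d) \<longrightarrow>
        \<bar>(\<Sum>(x, K)\<in>p. f x \<bullet> (g (Sup K) - g (Inf K))) - I\<bar> < e)"

definition rs_integral :: "(real \<Rightarrow> real^'n) \<Rightarrow> (real \<Rightarrow> real^'n) \<Rightarrow> real \<Rightarrow> real \<Rightarrow> real" where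
  "rs_integral f g a b = (THE I. has_rs_integral f g a b I)"

section \<open>Convergence in \<open>L\<^sup>2\<close>\<close>

text \<open>Elements of \<open>L\<^sup>2\<close> are determined only up to null sets, hence the completion.\<close>

definition in_L2 :: "'w measure \<Rightarrow> ('w \<Rightarrow> real) \<Rightarrow> bool" where
  "in_L2 \<Omega> f \<longleftrightarrow> f \<in> borel_measurable (completion \<Omega>) \<and> integrable (completion \<Omega>) (\<lambda>\<omega>. (f \<omega>)\<^sup>2)"

definition tendsto_L2 :: "'w measure \<Rightarrow> ('e \<Rightarrow> 'w \<Rightarrow> real) \<Rightarrow> ('w \<Rightarrow> real) \<Rightarrow> 'e filter \<Rightarrow> bool" where
  "tendsto_L2 \<Omega> f g F \<longleftrightarrow> in_L2 \<Omega> g \<and> (\<forall>\<^sub>F e in F. in_L2 \<Omega> (f e)) \<and>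
     ((\<lambda>e. \<integral>\<omega>. (f e \<omega> - g \<omega>)\<^sup>2 \<partial>(completion \<Omega>)) \<longlongrightarrow> 0) F"

section \<open>The filters\<close>

definition law_mean :: "real measure \<Rightarrow> real" where
  "law_mean \<pi> = (\<integral>\<theta>. \<theta> \<partial>\<pi>)"

definition law_var :: "real measure \<Rightarrow> real" where
  "law_var \<pi> = (\<integral>\<theta>. (\<theta> - law_mean \<pi>)\<^sup>2 \<partial>\<pi>)"

text \<open>The gain is a row vector, here identified with a vector that acts by the inner product.\<close>

definition gain :: "real \<Rightarrow> real^2^2 \<Rightarrow> real \<Rightarrow> real \<Rightarrow> real^2 \<Rightarrow> real^2" where
  "gain \<gamma> A h \<sigma> x = (\<sigma> * inverse (\<gamma> + h * \<sigma> * ((A *v x) \<bullet> (A *v x)))) *\<^sub>R (A *v x)"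

text \<open>In each scheme the observation path \<open>x\<close> is held fixed, \<open>h\<close> is the step size and \<open>\<mu>\<close> is the
  law of the initial value. The \<open>n\<close>-th iterate is a function of the initial value, and the
  conditional distribution \<open>\<pi>\<close> given the observation path is its image measure under \<open>\<mu>\<close>.\<close>

primrec filter_increments ::
  "real \<Rightarrow> real^2^2 \<Rightarrow> real \<Rightarrow> real measure \<Rightarrow> (real \<Rightarrow> real^2) \<Rightarrow> nat \<Rightarrow> real \<Rightarrow> real" where
  "filter_increments \<gamma> A h \<mu> x 0 = (\<lambda>\<theta>\<^sub>0. \<theta>\<^sub>0)"
| "filter_increments \<gamma> A h \<mu> x (Suc n) = (\<lambda>\<theta>\<^sub>0.
     let \<theta> = filter_increments \<gamma> A h \<mu> x n \<theta>\<^sub>0;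
         \<pi> = distr \<mu> borel (filter_increments \<gamma> A h \<mu> x n);
         t = real n * h; t' = real (Suc n) * h;
         K = gain \<gamma> A h (law_var \<pi>) (x t)
     in \<theta> + K \<bullet> ((x t' - x t) - (1/2 * (\<theta> + law_mean \<pi>) * h) *\<^sub>R (A *v x t)))"

primrec filter_corrected ::
  "real \<Rightarrow> real^2^2 \<Rightarrow> real^2^2 \<Rightarrow> real \<Rightarrow> real measure \<Rightarrow> (real \<Rightarrow> real^2) \<Rightarrow> nat \<Rightarrow> real \<Rightarrow> real" where
  "filter_corrected \<gamma> A M h \<mu> x 0 = (\<lambda>\<theta>\<^sub>0. \<theta>\<^sub>0)"
| "filter_corrected \<gamma> A M h \<mu> x (Suc n) = (\<lambda>\<theta>\<^sub>0.
     let \<theta> = filter_corrected \<gamma> A M h \<mu> x n \<theta>\<^sub>0;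
         \<pi> = distr \<mu> borel (filter_corrected \<gamma> A M h \<mu> x n);
         \<sigma> = law_var \<pi>;
         t = real n * h; t' = real (Suc n) * h;
         K = gain \<gamma> A h \<sigma> (x t)
     in \<theta> + \<sigma> / \<gamma> * rs_integral (\<lambda>s. A *v x s) x t t'
          - h / 2 * \<sigma> * (transpose A ::\<^sub>F M)
          - 1/2 * (K \<bullet> (A *v x t)) * (\<theta> + law_mean \<pi>) * h)"

text \<open>Here \<open>J n\<close> is the value, for the given realisation, of the Ito integral
  \<open>\<integral> (A x)\<^sup>T dx\<close> over the \<open>n\<close>-th step.\<close>

primrec filter_ito ::
  "real \<Rightarrow> real^2^2 \<Rightarrow> real \<Rightarrow> real measure \<Rightarrow> (real \<Rightarrow> real^2) \<Rightarrow> (nat \<Rightarrow> real) \<Rightarrow> nat \<Rightarrow> real \<Rightarrow> real" where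
  "filter_ito \<gamma> A h \<mu> x J 0 = (\<lambda>\<theta>\<^sub>0. \<theta>\<^sub>0)"
| "filter_ito \<gamma> A h \<mu> x J (Suc n) = (\<lambda>\<theta>\<^sub>0.
     let \<theta> = filter_ito \<gamma> A h \<mu> x J n \<theta>\<^sub>0;
         \<pi> = distr \<mu> borel (filter_ito \<gamma> A h \<mu> x J n);
         \<sigma> = law_var \<pi>;
         t = real n * h;
         K = gain \<gamma> A h \<sigma> (x t)
     in \<theta> + \<sigma> / \<gamma> * J n
          - 1/2 * (K \<bullet> (A *v x t)) * (\<theta> + law_mean \<pi>) * h)"

end

theory Submission
  imports Defs
begin

text \<open>
  Put \<open>V = W - P\<close>. The equation of the fast process says \<open>dV = (1/\<epsilon>) M P dt\<close>, so \<open>X\<^sub>\<epsilon>\<close> solves the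
  reference equation with the smooth path \<open>V\<close> in place of \<open>W\<close>. Since \<open>P\<close> starts in its stationary
  law of covariance \<open>(\<epsilon>/2) I\<close>, its fourth moments are \<open>O(\<epsilon>\<^sup>2)\<close> (\<open>fast_process_mom4\<close>). The
  difference \<open>X\<^sub>\<epsilon> - X\<close> solves a linear equation forced by \<open>\<surd>\<gamma> (P\<^sub>0 - P)\<close>, and Gronwall's
  inequality makes its fourth moments \<open>O(\<epsilon>\<^sup>2)\<close> too (\<open>D_order\<close>).

  The integral \<open>\<integral> (A X\<^sub>\<epsilon>)\<^sup>T dX\<^sub>\<epsilon>\<close> of the smooth path does not in general converge to the Ito
  integral. Expand
  \<open>dX\<^sub>\<epsilon> = A X\<^sub>\<epsilon> dt + \<surd>\<gamma> (dW - dP)\<close> and integrate the term with \<open>dP\<close> by parts. The boundary terms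
  vanish with \<open>P\<close>, but \<open>\<integral> P\<^sup>T A dX\<^sub>\<epsilon>\<close> contains \<open>(\<surd>\<gamma>/\<epsilon>) \<integral> P\<^sup>T A M P dt\<close>, which is of order one. To
  evaluate it, take a symmetric matrix \<open>G\<close> whose product \<open>G M\<close> has the same quadratic form as
  \<open>A M\<close> (\<open>quadratic_corrector_exists\<close>). By Ito's formula
  \<open>d(P\<^sup>T G P) = -(2/\<epsilon>) P\<^sup>T A M P dt + 2 (G P)\<^sup>T dW + tr G dt\<close>, and as \<open>P\<close> is small this leaves
  \<open>(1/\<epsilon>) \<integral> P\<^sup>T A M P dt \<approx> (1/2) tr G \<cdot> (b - a)\<close> with \<open>tr G = A\<^sup>T : M\<close>: the correction of the
  second scheme. What remains is \<open>\<integral> (A X\<^sub>\<epsilon>)\<^sup>T dW\<close>, and the Ito isometry compares it with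
  \<open>\<integral> (A X)\<^sup>T dW\<close>. The lemmas are \<open>rs_integral_decomposition\<close> (the identity along a single path),
  \<open>left_limit_order\<close> and \<open>square_limit_order\<close> (its two stochastic terms) and
  \<open>smooth_integral_order\<close> (the squared \<open>L\<^sup>2\<close> distance is \<open>O(\<epsilon>)\<close>).

  All integrals against \<open>W\<close> are handled as limits, along uniform partitions, of left-point sums with
  adapted coefficients. The sums converge almost surely by ordinary calculus, because \<open>V\<close> and
  \<open>X\<^sub>\<epsilon>\<close> are continuously differentiable; their second moments are computed with the isometry; and
  Fatou's lemma carries the bounds to the limit (\<open>mom_tendsto\<close>). Time integrals are treated in the
  same way as limits of Riemann sums (\<open>mom_time_integral\<close>), and solutions of the equations as
  limits of Euler schemes (\<open>euler_tendsto\<close>), which shows that they are adapted.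

  For a fixed observation path each filter is an affine function of its initial value,
  \<open>\<theta>\<^sub>n = c\<^sub>n + a\<^sub>n (\<theta>\<^sub>0 - m)\<close> with \<open>0 \<le> a\<^sub>n \<le> 1\<close>, so that \<open>\<sigma>\<^sub>n\<close> is \<open>a\<^sub>n\<^sup>2\<close> times the prior variance. The
  gain is a bounded Lipschitz function of the state (\<open>sat_bounded\<close>, \<open>sat_lipschitz_right\<close>), and a
  product of a bounded and an unbounded factor that both converge in \<open>L\<^sup>2\<close> converges in \<open>L\<^sup>2\<close>
  (\<open>l2_tendsto_inner_bounded\<close>). Induction on \<open>n\<close> gives the convergence of \<open>a\<^sub>n\<close>, of the gains and
  of \<open>c\<^sub>n\<close>, for both pairs of schemes at once.
\<close>

section \<open>Riemann--Stieltjes sums with a continuously differentiable integrator\<close>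

definition grid :: "real \<Rightarrow> real \<Rightarrow> nat \<Rightarrow> nat \<Rightarrow> real" where
  "grid a b N i = a + real i * ((b - a) / real N)"

lemma grid_0 [simp]: "grid a b N 0 = a"
  by (simp add: grid_def)

lemma grid_N [simp]: "N > 0 \<Longrightarrow> grid a b N N = b"
  by (simp add: grid_def)

lemma grid_Suc: "grid a b N (Suc i) = grid a b N i + (b - a) / real N"
  by (simp add: grid_def distrib_right add_divide_distrib)

lemma grid_mono: "a \<le> b \<Longrightarrow> i \<le> j \<Longrightarrow> grid a b N i \<le> grid a b N j"
  by (simp add: grid_def divide_right_mono mult_right_mono)

lemma grid_bounds: 
  assumes "a \<le> b" "i \<le> N" shows "a \<le> grid a b N i" "grid a b N i \<le> b"
proof -
  show "a \<le> grid a b N i" using assms by (simp add: grid_def)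
  show "grid a b N i \<le> b"
  proof (cases "N = 0")
    case True then show ?thesis using assms by (simp add: grid_def)
  next
    case False
    then show ?thesis using grid_mono[OF assms, of N] by simp
  qed
qed

lemma grid_cell: 
  assumes "a \<le> b" "i < N"
  shows "{grid a b N i..grid a b N (Suc i)} \<subseteq> {a..b}" "grid a b N i \<le> grid a b N (Suc i)"
  using assms grid_bounds[of a b i N] grid_bounds[of a b "Suc i" N] grid_mono[of a b i "Suc i" N] by auto

lemma sum_integral_grid:
  fixes f :: "real \<Rightarrow> 'a::banach"
  assumes "f integrable_on {a..b}" "a \<le> b" "N > 0"
  shows "(\<Sum>i<N. integral {grid a b N i..grid a b N (Suc i)} f) = integral {a..b} f"
proof -
  have "k \<le> N \<Longrightarrow> (\<Sum>i<k. integral {grid a b N i..grid a b N (Suc i)} f) = integral {a..grid a b N k} f" for k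
  proof (induction k)
    case 0 then show ?case by simp
  next
    case (Suc k)
    have "f integrable_on {a..grid a b N (Suc k)}"
      using grid_bounds[OF assms(2) Suc.prems] by (intro integrable_on_subinterval[OF assms(1)]) auto
    moreover have "a \<le> grid a b N k" "grid a b N k \<le> grid a b N (Suc k)"
      using grid_bounds[OF assms(2), of k N] Suc.prems grid_mono[OF assms(2), of k "Suc k"] by auto
    ultimately show ?case
      using Suc Henstock_Kurzweil_Integration.integral_combine[of a "grid a b N k" "grid a b N (Suc k)" f] by simp
  qed
  from this[of N] show ?thesis using assms by simp
qed

text \<open>The increment of \<open>g\<close> is \<open>\<integral> v\<close>, so the error is \<open>\<integral> (f s - f t) \<bullet> v t\<close>: oscillation of \<open>f\<close> times
  a bound for \<open>v\<close> times length.\<close>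

lemma rs_cell_bound:
  fixes f g v :: "real \<Rightarrow> 'a::euclidean_space"
  assumes cd: "c \<le> d" and f: "continuous_on {c..d} f" and v: "continuous_on {c..d} v"
    and g: "g d - g c = integral {c..d} v" and s: "s \<in> {c..d}"
    and e: "\<And>t. t \<in> {c..d} \<Longrightarrow> norm (f s - f t) \<le> e"
    and V: "\<And>t. t \<in> {c..d} \<Longrightarrow> norm (v t) \<le> V"
  shows "\<bar>f s \<bullet> (g d - g c) - integral {c..d} (\<lambda>t. f t \<bullet> v t)\<bar> \<le> e * V * (d - c)"
proof -
  have vi: "v integrable_on {c..d}" using v by (rule integrable_continuous_real)
  have "f s \<bullet> integral {c..d} v = integral {c..d} (\<lambda>t. f s \<bullet> v t)"
    using integral_linear[OF vi bounded_linear_inner_right[of "f s"]] by (simp add: o_def)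
  moreover have "integral {c..d} (\<lambda>t. f s \<bullet> v t) - integral {c..d} (\<lambda>t. f t \<bullet> v t)
      = integral {c..d} (\<lambda>t. (f s - f t) \<bullet> v t)"
    by (subst integral_diff[symmetric])
       (auto intro!: integrable_continuous_real continuous_intros f v simp: inner_diff_left)
  moreover have "norm (integral {c..d} (\<lambda>t. (f s - f t) \<bullet> v t)) \<le> e * V * (d - c)"
  proof (rule integral_bound[OF cd])
    show "continuous_on {c..d} (\<lambda>t. (f s - f t) \<bullet> v t)" by (intro continuous_intros f v)
    fix t assume t: "t \<in> {c..d}"
    have "\<bar>(f s - f t) \<bullet> v t\<bar> \<le> norm (f s - f t) * norm (v t)" by (rule Cauchy_Schwarz_ineq2)
    also have "\<dots> \<le> e * V"
      using e[OF t] V[OF t] order_trans[OF norm_ge_zero e[OF t]] by (intro mult_mono) auto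
    finally show "norm ((f s - f t) \<bullet> v t) \<le> e * V" by simp
  qed
  ultimately show ?thesis using g by simp
qed

lemma uniform_oscillation:
  fixes f :: "real \<Rightarrow> 'a::real_normed_vector"
  assumes f: "continuous_on {a..b} f" and "e > 0"
  shows "\<exists>d>0. \<forall>s\<in>{a..b}. \<forall>t\<in>{a..b}. \<bar>s - t\<bar> < d \<longrightarrow> norm (f s - f t) \<le> e"
proof -
  have "uniformly_continuous_on {a..b} f" using f by (simp add: compact_uniformly_continuous)
  then obtain d where "d > 0" "\<forall>s\<in>{a..b}. \<forall>t\<in>{a..b}. dist t s < d \<longrightarrow> dist (f t) (f s) < e"
    unfolding uniformly_continuous_on_def using \<open>e > 0\<close> by metis
  then show ?thesis by (intro exI[of _ d]) (auto simp: dist_norm norm_minus_commute less_imp_le abs_minus_commute)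
qed

lemma continuous_bound:
  fixes v :: "real \<Rightarrow> 'a::real_normed_vector"
  assumes "continuous_on {a..b} v"
  shows "\<exists>V>0. \<forall>t\<in>{a..b}. norm (v t) \<le> V"
proof -
  have "bounded (v ` {a..b})" using assms by (intro compact_imp_bounded compact_continuous_image) auto
  then show ?thesis unfolding bounded_pos by auto
qed

lemma has_rs_integral_C1:
  fixes f g v :: "real \<Rightarrow> real^'n"
  assumes ab: "a \<le> b" and f: "continuous_on {a..b} f" and v: "continuous_on {a..b} v"
    and g: "\<And>c d. a \<le> c \<Longrightarrow> c \<le> d \<Longrightarrow> d \<le> b \<Longrightarrow> g d - g c = integral {c..d} v"
  shows "has_rs_integral f g a b (integral {a..b} (\<lambda>t. f t \<bullet> v t))"
  unfolding has_rs_integral_def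
proof (intro allI impI)
  fix e :: real assume e: "e > 0"
  obtain V where V: "V > 0" "\<And>t. t \<in> {a..b} \<Longrightarrow> norm (v t) \<le> V" using continuous_bound[OF v] by blast
  \<comment> \<open>The cells contribute at most \<open>e' * V * (b - a) \<le> e / 2\<close>; the summand 1 keeps \<open>w\<close> positive if \<open>a = b\<close>.\<close>
  define w where "w = V * (b - a + 1)"
  have w: "w > 0" using V ab by (simp add: w_def)
  define e' where "e' = e / 2 / w"
  have e': "e' > 0" using e w by (simp add: e'_def)
  obtain d where d: "d > 0" "\<And>s t. s \<in> {a..b} \<Longrightarrow> t \<in> {a..b} \<Longrightarrow> \<bar>s - t\<bar> < d \<Longrightarrow> norm (f s - f t) \<le> e'"
    using uniform_oscillation[OF f e'] by blast
  show "\<exists>d>0. \<forall>p. p tagged_division_of {a..b} \<and> (\<forall>(x, K)\<in>p. diameter K < d) \<longrightarrow>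
        \<bar>(\<Sum>(x, K)\<in>p. f x \<bullet> (g (Sup K) - g (Inf K))) - integral {a..b} (\<lambda>t. f t \<bullet> v t)\<bar> < e"
  proof (intro exI[of _ d] conjI allI impI d(1))
    fix p assume "p tagged_division_of {a..b} \<and> (\<forall>(x, K)\<in>p. diameter K < d)"
    then have p: "p tagged_division_of {a..b}" and diam: "\<And>x K. (x,K) \<in> p \<Longrightarrow> diameter K < d" by auto
    have int: "(\<lambda>t. f t \<bullet> v t) integrable_on cbox a b"
      using f v by (auto intro!: integrable_continuous_real continuous_intros)
    have cell: "\<bar>f x \<bullet> (g (Sup K) - g (Inf K)) - integral K (\<lambda>t. f t \<bullet> v t)\<bar> \<le> e' * V * measure lborel K"
      if xK: "(x,K) \<in> p" for x K
    proof -
      obtain c k where K: "K = {c..k}" using tagged_division_ofD(4)[OF p xK] by auto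
      have x: "x \<in> K" "K \<subseteq> {a..b}" using tagged_division_ofD(2,3)[OF p xK] by auto
      then have ck: "c \<le> k" and sub: "a \<le> c" "k \<le> b" using K by auto
      have "norm (f x - f t) \<le> e'" if "t \<in> {c..k}" for t
      proof (rule d(2))
        have "dist x t \<le> diameter K" using x that K by (intro diameter_bounded_bound) auto
        then show "\<bar>x - t\<bar> < d" using diam[OF xK] by (simp add: dist_real_def)
      qed (use x that K in auto)
      moreover have "norm (v t) \<le> V" if "t \<in> {c..k}" for t using V(2)[of t] x K that by auto
      moreover have "continuous_on {c..k} f" "continuous_on {c..k} v"
        using f v sub by (auto elim!: continuous_on_subset)
      ultimately have "\<bar>f x \<bullet> (g k - g c) - integral {c..k} (\<lambda>t. f t \<bullet> v t)\<bar> \<le> e' * V * (k - c)"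
        using x K by (intro rs_cell_bound[OF ck _ _ g[OF sub(1) ck sub(2)]]) auto
      then show ?thesis using K ck by simp
    qed
    have "(\<Sum>(x, K)\<in>p. f x \<bullet> (g (Sup K) - g (Inf K))) - integral {a..b} (\<lambda>t. f t \<bullet> v t)
        = (\<Sum>(x, K)\<in>p. f x \<bullet> (g (Sup K) - g (Inf K)) - integral K (\<lambda>t. f t \<bullet> v t))"
      using integral_combine_tagged_division_topdown[OF int] p
      by (simp add: sum_subtractf split_def)
    also have "\<bar>\<dots>\<bar> \<le> (\<Sum>(x, K)\<in>p. e' * V * measure lborel K)"
      by (rule order_trans[OF sum_abs]) (auto intro!: sum_mono cell simp: split_def)
    also have "\<dots> = e' * V * (b - a)"
      using additive_content_tagged_division[of p a b] p ab by (simp add: split_def flip: sum_distrib_left)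
    also have "\<dots> < e"
    proof -
      have "e' * V * (b - a) \<le> e' * V * (b - a + 1)" using e' V by (intro mult_left_mono) auto
      also have "\<dots> = e' * w" by (simp add: w_def)
      also have "\<dots> = e / 2" using w by (simp add: e'_def)
      finally show ?thesis using e by simp
    qed
    finally show "\<bar>(\<Sum>(x, K)\<in>p. f x \<bullet> (g (Sup K) - g (Inf K))) - integral {a..b} (\<lambda>t. f t \<bullet> v t)\<bar> < e" .
  qed
qed

text \<open>A tagged division finer than both tolerances exists, and both values are close to its sum.\<close>

lemma has_rs_integral_unique:
  assumes I: "has_rs_integral f g a b I" and J: "has_rs_integral f g a b J"
  shows "I = J"
proof (rule ccontr)
  assume "I \<noteq> J"
  define e where "e = \<bar>I - J\<bar> / 2"
  have e: "e > 0" using \<open>I \<noteq> J\<close> by (simp add: e_def)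
  define S where "S p = (\<Sum>(x, K)\<in>p. f x \<bullet> (g (Sup K) - g (Inf K)))" for p :: "(real \<times> real set) set"
  have "\<exists>d>0. \<forall>p. p tagged_division_of {a..b} \<longrightarrow> (\<forall>(x, K)\<in>p. diameter K < d) \<longrightarrow> \<bar>S p - I\<bar> < e"
    using I[unfolded has_rs_integral_def, rule_format, OF e] by (auto simp: S_def)
  then obtain d1 where d1: "d1 > 0" "\<forall>p. p tagged_division_of {a..b} \<longrightarrow> (\<forall>(x, K)\<in>p. diameter K < d1) \<longrightarrow> \<bar>S p - I\<bar> < e"
    by auto
  have "\<exists>d>0. \<forall>p. p tagged_division_of {a..b} \<longrightarrow> (\<forall>(x, K)\<in>p. diameter K < d) \<longrightarrow> \<bar>S p - J\<bar> < e"
    using J[unfolded has_rs_integral_def, rule_format, OF e] by (auto simp: S_def)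
  then obtain d2 where d2: "d2 > 0" "\<forall>p. p tagged_division_of {a..b} \<longrightarrow> (\<forall>(x, K)\<in>p. diameter K < d2) \<longrightarrow> \<bar>S p - J\<bar> < e"
    by auto
  define d where "d = min d1 d2"
  have "gauge (\<lambda>x::real. ball x (d/3))" using d1 d2 by (auto simp: d_def gauge_def)
  then obtain p where p: "p tagged_division_of {a..b}" "(\<lambda>x. ball x (d/3)) fine p"
    using fine_division_exists_real by blast
  have "diameter K < d" if "(x,K) \<in> p" for x K
  proof -
    have "K \<subseteq> ball x (d/3)" using p(2) that by (auto simp: fine_def)
    then have "diameter K \<le> diameter (ball x (d/3))" by (rule diameter_subset) auto
    also have "\<dots> < d" using d1 d2 by (auto simp: d_def)
    finally show ?thesis .
  qed
  then have "\<forall>(x, K)\<in>p. diameter K < d1" "\<forall>(x, K)\<in>p. diameter K < d2" by (auto simp: d_def)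
  then have "\<bar>S p - I\<bar> < e" "\<bar>S p - J\<bar> < e" using d1(2) d2(2) p(1) by blast+
  then have "\<bar>I - J\<bar> < e + e" by linarith
  then show False by (simp add: e_def)
qed

lemma rs_integral_C1:
  fixes f g v :: "real \<Rightarrow> real^'n"
  assumes "a \<le> b" "continuous_on {a..b} f" "continuous_on {a..b} v"
    and "\<And>c d. a \<le> c \<Longrightarrow> c \<le> d \<Longrightarrow> d \<le> b \<Longrightarrow> g d - g c = integral {c..d} v"
  shows "rs_integral f g a b = integral {a..b} (\<lambda>t. f t \<bullet> v t)"
  unfolding rs_integral_def
  using has_rs_integral_C1[OF assms] has_rs_integral_unique by blast

text \<open>The tags are free because summation by parts produces right end points, whereas stochastic sums
  have left end points.\<close>

lemma grid_sums_tendsto: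
  fixes f g v :: "real \<Rightarrow> 'a::euclidean_space"
  assumes ab: "a \<le> b" and f: "continuous_on {a..b} f" and v: "continuous_on {a..b} v"
    and g: "\<And>c d. a \<le> c \<Longrightarrow> c \<le> d \<Longrightarrow> d \<le> b \<Longrightarrow> g d - g c = integral {c..d} v"
    and s: "\<And>N i. i < N \<Longrightarrow> s N i \<in> {grid a b N i..grid a b N (Suc i)}"
  shows "(\<lambda>N. \<Sum>i<N. f (s N i) \<bullet> (g (grid a b N (Suc i)) - g (grid a b N i)))
           \<longlonglongrightarrow> integral {a..b} (\<lambda>t. f t \<bullet> v t)"
proof (rule LIMSEQ_I)
  fix e :: real assume e: "e > 0"
  obtain V where V: "V > 0" "\<And>t. t \<in> {a..b} \<Longrightarrow> norm (v t) \<le> V" using continuous_bound[OF v] by blast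
  \<comment> \<open>The cells contribute at most \<open>e' * V * (b - a) \<le> e / 2\<close>; the summand 1 keeps \<open>w\<close> positive if \<open>a = b\<close>.\<close>
  define w where "w = V * (b - a + 1)"
  have w: "w > 0" using V ab by (simp add: w_def)
  define e' where "e' = e / 2 / w"
  have e': "e' > 0" using e w by (simp add: e'_def)
  obtain d where d: "d > 0" "\<And>s t. s \<in> {a..b} \<Longrightarrow> t \<in> {a..b} \<Longrightarrow> \<bar>s - t\<bar> < d \<Longrightarrow> norm (f s - f t) \<le> e'"
    using uniform_oscillation[OF f e'] by blast
  obtain n where n: "(b - a) / d < real n" using reals_Archimedean2 by blast
  show "\<exists>no. \<forall>N\<ge>no. norm ((\<Sum>i<N. f (s N i) \<bullet> (g (grid a b N (Suc i)) - g (grid a b N i)))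
           - integral {a..b} (\<lambda>t. f t \<bullet> v t)) < e"
  proof (intro exI[of _ "Suc n"] allI impI)
    fix N assume N: "Suc n \<le> N"
    then have Npos: "N > 0" by simp
    have "(b - a) / d < real N" using n N by linarith
    then have mesh: "(b - a) / real N < d" using d(1) Npos by (simp add: field_simps)
    have int: "(\<lambda>t. f t \<bullet> v t) integrable_on {a..b}"
      using f v by (auto intro!: integrable_continuous_real continuous_intros)
    have cell: "\<bar>f (s N i) \<bullet> (g (grid a b N (Suc i)) - g (grid a b N i)) -
       integral {grid a b N i..grid a b N (Suc i)} (\<lambda>t. f t \<bullet> v t)\<bar> \<le> e' * V * ((b - a) / real N)"
      if i: "i < N" for i
    proof -
      let ?c = "grid a b N i" and ?k = "grid a b N (Suc i)"
      note c = grid_cell[OF ab i] grid_bounds[OF ab less_imp_le[OF i]] 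
      have k: "?k \<le> b" using grid_bounds[OF ab, of "Suc i" N] i by simp
      have sub: "t \<in> {a..b}" if "t \<in> {?c..?k}" for t using that c by auto
      have "norm (f (s N i) - f t) \<le> e'" if "t \<in> {?c..?k}" for t
        using that s[OF i] mesh grid_Suc[of a b N i] by (intro d(2) sub) auto
      moreover have "norm (v t) \<le> V" if "t \<in> {?c..?k}" for t using V(2)[OF sub[OF that]] .
      moreover have "continuous_on {?c..?k} f" "continuous_on {?c..?k} v"
        using f v c(1) by (auto elim!: continuous_on_subset)
      ultimately have "\<bar>f (s N i) \<bullet> (g ?k - g ?c) - integral {?c..?k} (\<lambda>t. f t \<bullet> v t)\<bar> \<le> e' * V * (?k - ?c)"
        using s[OF i] c k by (intro rs_cell_bound[OF c(2) _ _ g]) auto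
      then show ?thesis by (simp add: grid_Suc)
    qed
    have "(\<Sum>i<N. f (s N i) \<bullet> (g (grid a b N (Suc i)) - g (grid a b N i))) - integral {a..b} (\<lambda>t. f t \<bullet> v t)
      = (\<Sum>i<N. f (s N i) \<bullet> (g (grid a b N (Suc i)) - g (grid a b N i)) -
            integral {grid a b N i..grid a b N (Suc i)} (\<lambda>t. f t \<bullet> v t))"
      using sum_integral_grid[OF int ab Npos] by (simp add: sum_subtractf)
    also have "\<bar>\<dots>\<bar> \<le> (\<Sum>i<N. e' * V * ((b - a) / real N))"
      by (rule order_trans[OF sum_abs], rule sum_mono, rule cell) simp
    also have "\<dots> = e' * V * (b - a)" using Npos by simp
    also have "\<dots> < e"
    proof -
      have "e' * V * (b - a) \<le> e' * V * (b - a + 1)" using e' V by (intro mult_left_mono) auto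
      also have "\<dots> = e' * w" by (simp add: w_def)
      also have "\<dots> = e / 2" using w by (simp add: e'_def)
      finally show ?thesis using e by simp
    qed
    finally show "norm ((\<Sum>i<N. f (s N i) \<bullet> (g (grid a b N (Suc i)) - g (grid a b N i)))
           - integral {a..b} (\<lambda>t. f t \<bullet> v t)) < e" by simp
  qed
qed

lemma riemann_sums_tendsto:
  fixes f :: "real \<Rightarrow> real"
  assumes ab: "a \<le> b" and f: "continuous_on {a..b} f"
  shows "(\<lambda>N. \<Sum>i<N. f (grid a b N i) * ((b - a) / real N)) \<longlonglongrightarrow> integral {a..b} f"
  using grid_sums_tendsto[OF ab f, of "\<lambda>_. 1" "\<lambda>x. x" "\<lambda>N i. grid a b N i"] ab
  by (simp add: grid_Suc)

section \<open>Linear integral equations with additive forcing\<close>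

text \<open>With \<open>u\<close> the integral of \<open>y\<close>, the function \<open>exp (- L t) u t - \<integral>\<^sub>0\<^sup>t g\<close> has a nonpositive
  derivative.\<close>

lemma gronwall_pathwise:
  fixes y g :: "real \<Rightarrow> real"
  assumes T: "0 \<le> T" and L: "0 \<le> L"
    and y: "continuous_on {0..T} y" and g: "continuous_on {0..T} g" and g0: "\<And>t. t \<in> {0..T} \<Longrightarrow> 0 \<le> g t"
    and le: "\<And>t. t \<in> {0..T} \<Longrightarrow> y t \<le> g t + L * integral {0..t} y"
  shows "y T \<le> g T + L * exp (L * T) * integral {0..T} g"
proof -
  define u where "u t = integral {0..t} y" for t
  define h where "h t = exp (- L * t) * u t - integral {0..t} g" for t
  have du: "(u has_real_derivative y t) (at t within {0..T})" if "t \<in> {0..T}" for t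
    unfolding u_def using integral_has_real_derivative[OF y that] .
  have dg: "((\<lambda>t. integral {0..t} g) has_real_derivative g t) (at t within {0..T})" if "t \<in> {0..T}" for t
    using integral_has_real_derivative[OF g that] .
  have dh: "(h has_real_derivative (exp (- L * t) * y t - L * exp (-L*t) * u t - g t)) (at t within {0..T})" if "t \<in> {0..T}" for t
    unfolding h_def by (rule derivative_eq_intros du[OF that] dg[OF that] refl | simp add: algebra_simps)+
  have "h T \<le> h 0"
  proof (rule DERIV_nonpos_imp_decreasing_open[OF T])
    fix x assume x: "0 < x" "x < T"
    then have "x \<in> {0..T}" by simp
    have "y x \<le> g x + L * u x" using le \<open>x \<in> {0..T}\<close> by (simp add: u_def)
    then have "y x - L * u x \<le> g x" by simp
    then have "exp (-L*x) * (y x - L * u x) \<le> exp (-L*x) * g x" by (rule mult_left_mono) simp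
    also have "\<dots> \<le> 1 * g x" 
      by (rule mult_right_mono) (use L x g0[OF \<open>x \<in> {0..T}\<close>] in simp_all)
    finally have "exp (- L * x) * y x - L * exp (-L*x) * u x - g x \<le> 0" by (simp add: algebra_simps)
    moreover have "(h has_real_derivative (exp (- L * x) * y x - L * exp (-L*x) * u x - g x)) (at x)"
      using dh[OF \<open>x \<in> {0..T}\<close>] by (simp only: at_within_Icc_at[OF x])
    ultimately show "\<exists>z. (h has_real_derivative z) (at x) \<and> z \<le> 0" by blast
  next
    show "continuous_on {0..T} h" by (rule DERIV_continuous_on[OF dh])
  qed
  then have "exp (-L*T) * u T \<le> integral {0..T} g" by (simp add: h_def u_def)
  then have "exp (L*T) * (exp (-L*T) * u T) \<le> exp (L*T) * integral {0..T} g" by (intro mult_left_mono) auto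
  then have "u T \<le> exp (L*T) * integral {0..T} g" by (simp add: mult.assoc[symmetric] flip: exp_add)
  then have "L * u T \<le> L * (exp (L*T) * integral {0..T} g)" using L by (rule mult_left_mono)
  then show ?thesis using le[of T] T by (simp add: u_def algebra_simps)
qed

text \<open>The Euler scheme for \<open>Y = y0 + \<integral> B Y + G\<close> with a rough path \<open>G\<close>. An iterate depends on finitely
  many values of \<open>G\<close> only, which makes adaptedness and moments of the solution accessible.\<close>

primrec euler :: "real^'n^'n \<Rightarrow> real^'n \<Rightarrow> (real \<Rightarrow> real^'n) \<Rightarrow> real \<Rightarrow> nat \<Rightarrow> nat \<Rightarrow> real^'n" where
  "euler B y0 G t N 0 = y0"
| "euler B y0 G t N (Suc k) = euler B y0 G t N k + (t / real N) *\<^sub>R (B *v euler B y0 G t N k)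
      + (G (grid 0 t N (Suc k)) - G (grid 0 t N k))"

lemma norm_matrix_vector_le: "norm ((B::real^'n^'m) *v x) \<le> onorm ((*v) B) * norm x"
  by (rule onorm[OF matrix_vector_mul_bounded_linear])

lemma onorm_matrix_nonneg: "0 \<le> onorm ((*v) (B::real^'n^'m))"
  by (rule onorm_pos_le[OF matrix_vector_mul_bounded_linear])

lemma continuous_on_matrix_vector [continuous_intros]:
  "continuous_on S f \<Longrightarrow> continuous_on S (\<lambda>t. (B::real^'n^'m) *v f t)"
  by (rule bounded_linear.continuous_on[OF matrix_vector_mul_bounded_linear])

text \<open>The scheme uses the exact increments of \<open>G\<close>, so \<open>G\<close> cancels from the error. One step multiplies
  the error by \<open>q = 1 + L t / N\<close> and adds at most \<open>(q - 1) e'\<close>, where \<open>e'\<close> bounds the oscillation of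
  \<open>Y\<close> on a cell.\<close>

lemma euler_tendsto:
  fixes Y G :: "real \<Rightarrow> real^'n"
  assumes t: "0 \<le> t" and Y: "continuous_on {0..t} Y"
    and eq: "\<And>s. s \<in> {0..t} \<Longrightarrow> Y s = Y 0 + integral {0..s} (\<lambda>r. B *v Y r) + G s"
  shows "(\<lambda>N. euler B (Y 0) G t N N) \<longlonglongrightarrow> Y t"
proof (rule LIMSEQ_I)
  fix e :: real assume e: "e > 0"
  define L where "L = onorm ((*v) B)"
  have L: "L \<ge> 0" unfolding L_def by (rule onorm_matrix_nonneg)
  define e' where "e' = e / (2 * exp (L * t))"
  have e': "e' > 0" using e by (simp add: e'_def)
  obtain d where d: "d > 0" "\<And>s r. s \<in> {0..t} \<Longrightarrow> r \<in> {0..t} \<Longrightarrow> \<bar>s - r\<bar> < d \<Longrightarrow> norm (Y s - Y r) \<le> e'"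
    using uniform_oscillation[OF Y e'] by blast
  obtain n where n: "t / d < real n" using reals_Archimedean2 by blast
  show "\<exists>no. \<forall>N\<ge>no. norm (euler B (Y 0) G t N N - Y t) < e"
  proof (intro exI[of _ "Suc n"] allI impI)
    fix N assume N: "Suc n \<le> N"
    then have Npos: "N > 0" by simp
    have "t / d < real N" using n N by linarith
    then have mesh: "t / real N < d" using d(1) Npos by (simp add: field_simps)
    define q where "q = 1 + L * (t / real N)"
    have q1: "q \<ge> 1" using L t by (simp add: q_def)
    let ?E = "\<lambda>k. euler B (Y 0) G t N k" and ?y = "\<lambda>k. Y (grid 0 t N k)"
    have step: "norm (?E (Suc k) - ?y (Suc k)) \<le> q * norm (?E k - ?y k) + L * (t / real N) * e'" if k: "k < N" for k
    proof -
      let ?c = "grid 0 t N k" and ?d = "grid 0 t N (Suc k)"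
      note c = grid_cell[OF t k] 
      have cb: "?c \<in> {0..t}" "?d \<in> {0..t}" using grid_bounds[OF t, of k N] grid_bounds[OF t, of "Suc k" N] k by auto
      have cont: "continuous_on {?c..?d} (\<lambda>r. B *v Y r)" "continuous_on {0..?d} (\<lambda>r. B *v Y r)"
        using c cb by (auto intro!: continuous_intros continuous_on_subset[OF Y])
      have inc: "?y (Suc k) - ?y k = integral {?c..?d} (\<lambda>r. B *v Y r) + (G ?d - G ?c)"
        using eq[OF cb(1)] eq[OF cb(2)] Henstock_Kurzweil_Integration.integral_combine[of 0 ?c ?d "\<lambda>r. B *v Y r"] c(2) cb cont(2)
        by (simp add: integrable_continuous_real algebra_simps)
      have len: "?d - ?c = t / real N" by (simp add: grid_Suc)
      have loc: "norm (integral {?c..?d} (\<lambda>r. B *v Y r) - (t / real N) *\<^sub>R (B *v Y ?c)) \<le> L * e' * (t / real N)"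
      proof -
        have "integral {?c..?d} (\<lambda>r. B *v Y r) - (t / real N) *\<^sub>R (B *v Y ?c) = integral {?c..?d} (\<lambda>r. B *v Y r - B *v Y ?c)"
          using cont c(2) len by (subst integral_diff) (auto intro!: integrable_continuous_real)
        also have "norm \<dots> \<le> L * e' * (?d - ?c)"
        proof (rule integral_bound[OF c(2)])
          show "continuous_on {?c..?d} (\<lambda>r. B *v Y r - B *v Y ?c)" by (intro continuous_intros cont)
          fix r assume r: "r \<in> {?c..?d}"
          have "norm (B *v Y r - B *v Y ?c) = norm (B *v (Y r - Y ?c))" by (simp add: matrix_vector_mult_diff_distrib)
          also have "\<dots> \<le> L * norm (Y r - Y ?c)" unfolding L_def by (rule norm_matrix_vector_le)
          also have "\<dots> \<le> L * e'"
            using r c cb mesh len by (intro mult_left_mono L d(2)) auto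
          finally show "norm (B *v Y r - B *v Y ?c) \<le> L * e'" .
        qed
        finally show ?thesis using len by simp
      qed
      have "?E (Suc k) - ?y (Suc k) = (?E k - ?y k) + (t / real N) *\<^sub>R (B *v (?E k - ?y k))
            - (integral {?c..?d} (\<lambda>r. B *v Y r) - (t / real N) *\<^sub>R (B *v Y ?c))"
        using inc by (simp add: matrix_vector_mult_diff_distrib algebra_simps)
      also have "norm \<dots> \<le> norm (?E k - ?y k) + norm ((t / real N) *\<^sub>R (B *v (?E k - ?y k))) + L * e' * (t / real N)"
        by (rule order_trans[OF norm_triangle_ineq4 add_mono[OF norm_triangle_ineq loc]])
      also have "norm ((t / real N) *\<^sub>R (B *v (?E k - ?y k))) \<le> (t / real N) * (L * norm (?E k - ?y k))"
        using t norm_matrix_vector_le[of B "?E k - ?y k"] unfolding L_def by (simp add: mult_left_mono divide_right_mono)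
      finally show ?thesis by (simp add: q_def algebra_simps)
    qed
    have "k \<le> N \<Longrightarrow> norm (?E k - ?y k) \<le> e' * (q ^ k - 1)" for k
    proof (induction k)
      case 0 then show ?case by simp
    next
      case (Suc k)
      have "norm (?E (Suc k) - ?y (Suc k)) \<le> q * norm (?E k - ?y k) + L * (t / real N) * e'"
        using Suc.prems by (intro step) auto
      also have "\<dots> \<le> q * (e' * (q ^ k - 1)) + (q - 1) * e'"
        using Suc q1 by (intro add_mono mult_left_mono) (auto simp: q_def)
      also have "\<dots> = e' * (q ^ Suc k - 1)" by (simp add: algebra_simps)
      finally show ?case .
    qed
    from this[of N] have "norm (?E N - Y t) \<le> e' * (q ^ N - 1)" using Npos by simp
    also have "q ^ N \<le> exp (L * (t / real N)) ^ N" using q1 by (intro power_mono) (auto simp: q_def)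
    also have "\<dots> = exp (L * t)" using Npos by (simp flip: exp_of_nat_mult)
    finally have "norm (?E N - Y t) \<le> e' * (exp (L * t) - 1)" using e' by (auto simp: mult_left_mono)
    also have "\<dots> < e"
    proof -
      have "e' * (exp (L * t) - 1) = e / 2 - e'" by (simp add: e'_def right_diff_distrib)
      then show ?thesis using e e' by simp
    qed
    finally show "norm (?E N - Y t) < e" .
  qed
qed

section \<open>Moment bounds\<close>

text \<open>Almost sure limits are in general measurable for the completion only; this is why moments below
  refer to the completion.\<close>

lemma borel_measurable_completion_AE_cong:
  fixes f g :: "'w \<Rightarrow> 'b::topological_space"
  assumes f: "f \<in> borel_measurable (completion M)" and eq: "AE \<omega> in M. f \<omega> = g \<omega>"
  shows "g \<in> borel_measurable (completion M)"
proof (rule borel_measurableI)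
  fix S :: "'b set" assume "open S"
  obtain N where N: "N \<in> null_sets M" "{\<omega> \<in> space M. f \<omega> \<noteq> g \<omega>} \<subseteq> N"
    using eq unfolding eventually_ae_filter by auto
  let ?A = "f -` S \<inter> space M" and ?B = "g -` S \<inter> space M"
  have A: "?A \<in> sets (completion M)" using measurable_sets[OF f borel_open[OF \<open>open S\<close>]] by simp
  have 1: "?B \<inter> N \<in> sets (completion M)"
    by (rule sets_completionI[of "?B \<inter> N" "{}" "?B \<inter> N" N]) (use N in auto)
  have 2: "?A - N \<in> sets (completion M)" using A N by auto
  have "?B = (?A - N) \<union> (?B \<inter> N)" using N by auto
  then show "g -` S \<inter> space (completion M) \<in> sets (completion M)" using 1 2 by (metis sets.Un space_completion)
qed

lemma borel_measurable_completion_AE_limit: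
  fixes f :: "nat \<Rightarrow> 'w \<Rightarrow> 'b::{banach, second_countable_topology}"
  assumes f: "\<And>n. f n \<in> borel_measurable (completion M)" and lim: "AE \<omega> in M. (\<lambda>n. f n \<omega>) \<longlonglongrightarrow> g \<omega>"
  shows "g \<in> borel_measurable (completion M)"
proof -
  have "(\<lambda>\<omega>. lim (\<lambda>n. f n \<omega>)) \<in> borel_measurable (completion M)"
    using f by (rule borel_measurable_lim_metric)
  moreover have "AE \<omega> in M. lim (\<lambda>n. f n \<omega>) = g \<omega>" using lim by eventually_elim (rule limI)
  ultimately show ?thesis by (rule borel_measurable_completion_AE_cong)
qed

text \<open>The nonnegative integral does not change under completion and is accessible to Fatou's lemma; a
  real bound also yields integrability.\<close>

definition mom :: "'w measure \<Rightarrow> nat \<Rightarrow> ('w \<Rightarrow> 'b::{banach, second_countable_topology}) \<Rightarrow> real \<Rightarrow> bool" where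
  "mom M p f c \<longleftrightarrow> f \<in> borel_measurable (completion M) \<and> 0 \<le> c \<and>
     (\<integral>\<^sup>+\<omega>. ennreal (norm (f \<omega>) ^ p) \<partial>M) \<le> ennreal c"

lemma mom_measurable: "mom M p f c \<Longrightarrow> f \<in> borel_measurable (completion M)"
  and mom_nonneg: "mom M p f c \<Longrightarrow> 0 \<le> c"
  by (simp_all add: mom_def)

lemma mom_mono: "mom M p f c \<Longrightarrow> c \<le> d \<Longrightarrow> mom M p f d"
  unfolding mom_def by (auto intro: order_trans ennreal_leI)

lemma mom_dominated:
  assumes g: "mom M p g c" and f: "f \<in> borel_measurable (completion M)"
    and le: "AE \<omega> in M. norm (f \<omega>) \<le> norm (g \<omega>)"
  shows "mom M p f c"
proof -
  have "(\<integral>\<^sup>+\<omega>. ennreal (norm (f \<omega>) ^ p) \<partial>M) \<le> (\<integral>\<^sup>+\<omega>. ennreal (norm (g \<omega>) ^ p) \<partial>M)"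
    by (rule nn_integral_mono_AE) (use le in \<open>auto intro!: ennreal_leI power_mono\<close>)
  then show ?thesis using g f unfolding mom_def by auto
qed

lemma mom_AE_cong: "mom M p f c \<Longrightarrow> AE \<omega> in M. f \<omega> = g \<omega> \<Longrightarrow> mom M p g c"
  by (rule mom_dominated, assumption, rule borel_measurable_completion_AE_cong, erule mom_measurable) auto

lemma mom_norm: "mom M p f c \<Longrightarrow> mom M p (\<lambda>\<omega>. norm (f \<omega>)) c"
  by (rule mom_dominated) (auto dest: mom_measurable)

lemma mom_integrable:
  assumes "mom M p f c" "f \<in> borel_measurable M"
  shows "integrable M (\<lambda>\<omega>. norm (f \<omega>) ^ p)"
  using assms unfolding mom_def
  by (intro integrableI_bounded) (auto simp: top_unique less_top[symmetric] intro: le_less_trans)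

lemma mom_expectation_le:
  assumes "mom M p f c" shows "(\<integral>\<omega>. norm (f \<omega>) ^ p \<partial>completion M) \<le> c"
  using assms unfolding mom_def
  by (intro integral_real_bounded) (auto simp: nn_integral_completion)

lemma mom_expectation_le':
  assumes "mom M p f c" "f \<in> borel_measurable M" shows "(\<integral>\<omega>. norm (f \<omega>) ^ p \<partial>M) \<le> c"
  using assms unfolding mom_def by (intro integral_real_bounded) auto

lemma momI:
  assumes f: "f \<in> borel_measurable M" and i: "integrable M (\<lambda>\<omega>. norm (f \<omega>) ^ p)"
    and le: "(\<integral>\<omega>. norm (f \<omega>) ^ p \<partial>M) \<le> c"
  shows "mom M p f c"
proof -
  have "0 \<le> (\<integral>\<omega>. norm (f \<omega>) ^ p \<partial>M)" by (rule integral_nonneg_AE) auto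
  then have "0 \<le> c" using le by linarith
  then show ?thesis unfolding mom_def
    using f le by (subst nn_integral_eq_integral[OF i]) (auto intro: measurable_completion ennreal_leI)
qed

text \<open>Fatou's lemma, in the form in which estimates for partition sums pass to the limiting
  integrals.\<close>

lemma mom_tendsto:
  fixes f :: "nat \<Rightarrow> 'w \<Rightarrow> 'b::{banach, second_countable_topology}"
  assumes f: "\<And>n. mom M p (f n) (c n)" and lim: "AE \<omega> in M. (\<lambda>n. f n \<omega>) \<longlonglongrightarrow> g \<omega>"
    and c: "c \<longlonglongrightarrow> c'"
  shows "mom M p g c'"
proof -
  have m: "g \<in> borel_measurable (completion M)"
    by (rule borel_measurable_completion_AE_limit[OF mom_measurable[OF f] lim])
  have c0: "0 \<le> c n" for n using f[of n] by (rule mom_nonneg)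
  have c': "0 \<le> c'" by (rule LIMSEQ_le_const[OF c]) (use c0 in blast)
  have "(\<integral>\<^sup>+\<omega>. ennreal (norm (g \<omega>) ^ p) \<partial>M) = (\<integral>\<^sup>+\<omega>. liminf (\<lambda>n. ennreal (norm (f n \<omega>) ^ p)) \<partial>M)"
  proof (rule nn_integral_cong_AE)
    show "AE \<omega> in M. ennreal (norm (g \<omega>) ^ p) = liminf (\<lambda>n. ennreal (norm (f n \<omega>) ^ p))"
      using lim
    proof eventually_elim
      case (elim \<omega>)
      have "(\<lambda>n. ennreal (norm (f n \<omega>) ^ p)) \<longlonglongrightarrow> ennreal (norm (g \<omega>) ^ p)"
        by (intro tendsto_ennrealI tendsto_power tendsto_norm elim)
      then show ?case by (metis lim_imp_Liminf trivial_limit_sequentially)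
    qed
  qed
  also have "\<dots> = (\<integral>\<^sup>+\<omega>. liminf (\<lambda>n. ennreal (norm (f n \<omega>) ^ p)) \<partial>completion M)"
    by (simp add: nn_integral_completion)
  also have "\<dots> \<le> liminf (\<lambda>n. \<integral>\<^sup>+\<omega>. ennreal (norm (f n \<omega>) ^ p) \<partial>completion M)"
    using mom_measurable[OF f, measurable] by (intro nn_integral_liminf) measurable
  also have "\<dots> \<le> liminf (\<lambda>n. ennreal (c n))"
    using f by (intro Liminf_mono) (auto simp: mom_def nn_integral_completion)
  also have "\<dots> = ennreal c'" using tendsto_ennrealI[OF c] by (metis lim_imp_Liminf trivial_limit_sequentially)
  finally show ?thesis using m c' by (simp add: mom_def)
qed

text \<open>Only orders of magnitude matter later, hence the crude factor \<open>2 ^ p\<close>.\<close>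

lemma mom_add:
  assumes f: "mom M p f c" and g: "mom M p g d"
  shows "mom M p (\<lambda>\<omega>. f \<omega> + g \<omega>) (2 ^ p * (c + d))"
proof -
  have [measurable]: "f \<in> borel_measurable (completion M)" "g \<in> borel_measurable (completion M)"
    using f g by (auto simp: mom_def)
  have "ennreal (norm (f \<omega> + g \<omega>) ^ p) \<le> ennreal (2 ^ p) * (ennreal (norm (f \<omega>) ^ p) + ennreal (norm (g \<omega>) ^ p))" for \<omega>
  proof -
    have "norm (f \<omega> + g \<omega>) \<le> 2 * max (norm (f \<omega>)) (norm (g \<omega>))" by norm
    then have "norm (f \<omega> + g \<omega>) ^ p \<le> (2 * max (norm (f \<omega>)) (norm (g \<omega>))) ^ p" by (rule power_mono) auto
    also have "\<dots> = 2 ^ p * max (norm (f \<omega>)) (norm (g \<omega>)) ^ p" by (simp add: power_mult_distrib)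
    also have "\<dots> \<le> 2 ^ p * (norm (f \<omega>) ^ p + norm (g \<omega>) ^ p)"
      by (intro mult_left_mono) (auto simp: max_def)
    finally show ?thesis by (simp flip: ennreal_mult ennreal_plus add: ennreal_leI)
  qed
  then have "(\<integral>\<^sup>+\<omega>. ennreal (norm (f \<omega> + g \<omega>) ^ p) \<partial>completion M)
      \<le> (\<integral>\<^sup>+\<omega>. ennreal (2 ^ p) * (ennreal (norm (f \<omega>) ^ p) + ennreal (norm (g \<omega>) ^ p)) \<partial>completion M)"
    by (intro nn_integral_mono)
  also have "\<dots> = ennreal (2 ^ p) * ((\<integral>\<^sup>+\<omega>. ennreal (norm (f \<omega>) ^ p) \<partial>completion M) + (\<integral>\<^sup>+\<omega>. ennreal (norm (g \<omega>) ^ p) \<partial>completion M))"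
    by (subst nn_integral_cmult) (auto simp: nn_integral_add)
  also have "\<dots> \<le> ennreal (2 ^ p) * (ennreal c + ennreal d)"
    using f g by (intro mult_left_mono add_mono) (auto simp: mom_def nn_integral_completion)
  also have "\<dots> = ennreal (2 ^ p * (c + d))"
    using f g by (simp add: mom_def ennreal_mult ennreal_plus)
  finally show ?thesis using f g by (simp add: mom_def nn_integral_completion)
qed

lemma mom_bounded_scale:
  assumes f: "mom M p f c" and g: "g \<in> borel_measurable (completion M)"
    and le: "AE \<omega> in M. norm (g \<omega>) \<le> k * norm (f \<omega>)" and k: "0 \<le> k"
  shows "mom M p g (k ^ p * c)"
proof -
  have [measurable]: "f \<in> borel_measurable (completion M)" using f by (auto simp: mom_def)
  have "(\<integral>\<^sup>+\<omega>. ennreal (norm (g \<omega>) ^ p) \<partial>M) \<le> (\<integral>\<^sup>+\<omega>. ennreal (k ^ p) * ennreal (norm (f \<omega>) ^ p) \<partial>M)"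
  proof (rule nn_integral_mono_AE)
    show "AE \<omega> in M. ennreal (norm (g \<omega>) ^ p) \<le> ennreal (k ^ p) * ennreal (norm (f \<omega>) ^ p)"
      using le
    proof eventually_elim
      case (elim \<omega>)
      then have "norm (g \<omega>) ^ p \<le> (k * norm (f \<omega>)) ^ p" by (rule power_mono) auto
      then show ?case using k by (simp add: power_mult_distrib ennreal_leI flip: ennreal_mult)
    qed
  qed
  also have "\<dots> = (\<integral>\<^sup>+\<omega>. ennreal (k ^ p) * ennreal (norm (f \<omega>) ^ p) \<partial>completion M)"
    by (simp add: nn_integral_completion)
  also have "\<dots> = ennreal (k ^ p) * (\<integral>\<^sup>+\<omega>. ennreal (norm (f \<omega>) ^ p) \<partial>completion M)"
    by (rule nn_integral_cmult) simp
  also have "\<dots> \<le> ennreal (k ^ p) * ennreal c"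
    using f by (intro mult_left_mono) (auto simp: mom_def nn_integral_completion)
  finally show ?thesis using f g k by (simp add: mom_def ennreal_mult)
qed

lemma mom_scaleR:
  assumes "mom M p f c" shows "mom M p (\<lambda>\<omega>. k *\<^sub>R f \<omega>) (\<bar>k\<bar> ^ p * c)"
  using assms by (intro mom_bounded_scale[OF assms]) (auto simp: mom_def)

lemma borel_measurable_matrix_vector [measurable (raw)]:
  "f \<in> borel_measurable M \<Longrightarrow> (\<lambda>\<omega>. (B::real^'n^'m) *v f \<omega>) \<in> borel_measurable M"
  by (rule borel_measurable_continuous_on[OF linear_continuous_on[OF matrix_vector_mul_bounded_linear]])

lemma mom_matrix:
  fixes B :: "real^'n^'m"
  assumes "mom M p f c" shows "mom M p (\<lambda>\<omega>. B *v f \<omega>) (onorm ((*v) B) ^ p * c)"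
  using assms by (intro mom_bounded_scale[OF assms])
    (auto simp: mom_def norm_matrix_vector_le onorm_matrix_nonneg)

text \<open>From \<open>x y \<le> \<delta> x\<^sup>2 + y\<^sup>2 / \<delta>\<close> for \<open>x = (norm f)\<^sup>2\<close> and \<open>y = (norm g)\<^sup>2\<close>. The parameter \<open>\<delta>\<close> serves to
  balance factors of different size.\<close>

lemma mom_mult:
  fixes h :: "'w \<Rightarrow> real"
  assumes f: "mom M 4 f c" and g: "mom M 4 g d" and h: "h \<in> borel_measurable (completion M)"
    and le: "AE \<omega> in M. \<bar>h \<omega>\<bar> \<le> norm (f \<omega>) * norm (g \<omega>)" and \<delta>: "\<delta> > 0"
  shows "mom M 2 h (\<delta> * c + d / \<delta>)"
proof -
  have [measurable]: "f \<in> borel_measurable (completion M)" "g \<in> borel_measurable (completion M)"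
    using f g by (auto simp: mom_def)
  have "(\<integral>\<^sup>+\<omega>. ennreal (norm (h \<omega>) ^ 2) \<partial>M) \<le>
     (\<integral>\<^sup>+\<omega>. ennreal \<delta> * ennreal (norm (f \<omega>) ^ 4) + ennreal (1 / \<delta>) * ennreal (norm (g \<omega>) ^ 4) \<partial>M)"
  proof (rule nn_integral_mono_AE)
    show "AE \<omega> in M. ennreal (norm (h \<omega>) ^ 2) \<le> ennreal \<delta> * ennreal (norm (f \<omega>) ^ 4) + ennreal (1 / \<delta>) * ennreal (norm (g \<omega>) ^ 4)"
      using le
    proof eventually_elim
      case (elim \<omega>)
      define x y where "x = norm (f \<omega>) ^ 2" and "y = norm (g \<omega>) ^ 2"
      have "norm (h \<omega>) ^ 2 \<le> (norm (f \<omega>) * norm (g \<omega>)) ^ 2" using elim by (intro power_mono) auto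
      also have "\<dots> = x * y" by (simp add: x_def y_def power_mult_distrib)
      also have "\<dots> \<le> \<delta> * x ^ 2 + (1 / \<delta>) * y ^ 2"
      proof -
        have "0 \<le> (\<delta> * x - y) ^ 2 + \<delta> * x * y" using \<delta> by (simp add: x_def y_def)
        then have "\<delta> * (x * y) \<le> \<delta> * (\<delta> * x ^ 2 + (1 / \<delta>) * y ^ 2)"
          using \<delta> by (simp add: power2_eq_square algebra_simps)
        then show ?thesis using \<delta> by simp
      qed
      finally have "norm (h \<omega>) ^ 2 \<le> \<delta> * norm (f \<omega>) ^ 4 + (1 / \<delta>) * norm (g \<omega>) ^ 4"
        by (simp add: x_def y_def flip: power_mult)
      then show ?case using \<delta> by (simp flip: ennreal_mult ennreal_plus add: ennreal_leI)
    qed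
  qed
  also have "\<dots> = (\<integral>\<^sup>+\<omega>. ennreal \<delta> * ennreal (norm (f \<omega>) ^ 4) + ennreal (1 / \<delta>) * ennreal (norm (g \<omega>) ^ 4) \<partial>completion M)"
    by (simp add: nn_integral_completion)
  also have "\<dots> = ennreal \<delta> * (\<integral>\<^sup>+\<omega>. ennreal (norm (f \<omega>) ^ 4) \<partial>completion M) + ennreal (1 / \<delta>) * (\<integral>\<^sup>+\<omega>. ennreal (norm (g \<omega>) ^ 4) \<partial>completion M)"
    by (simp add: nn_integral_add nn_integral_cmult)
  also have "\<dots> \<le> ennreal \<delta> * ennreal c + ennreal (1 / \<delta>) * ennreal d"
    using f g by (intro mult_left_mono add_mono) (auto simp: mom_def nn_integral_completion)
  also have "\<dots> = ennreal (\<delta> * c + d / \<delta>)"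
    using f g \<delta> by (simp add: mom_def ennreal_plus flip: ennreal_mult)
  finally show ?thesis using f g h \<delta> by (simp add: mom_def)
qed

lemma (in prob_space) mom_4_imp_2:
  assumes f: "mom M 4 f c" and \<delta>: "\<delta> > 0"
  shows "mom M 2 f (\<delta> + c / \<delta>)"
proof -
  have "mom M 4 (\<lambda>_. 1::real) 1" by (simp add: mom_def emeasure_space_1)
  from mom_mult[OF this mom_norm[OF f] _ _ \<delta>, of "\<lambda>\<omega>. norm (f \<omega>)"]
  have "mom M 2 (\<lambda>\<omega>. norm (f \<omega>)) (\<delta> + c / \<delta>)" using f by (auto simp: mom_def)
  then show ?thesis using f by (auto simp: mom_def)
qed

text \<open>Jensen's inequality for the convex function \<open>x ^ p\<close> and the uniform distribution on the cells.\<close>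

lemma power_mean_le:
  fixes x :: "nat \<Rightarrow> real"
  assumes N: "N > 0" and w: "0 \<le> w"
  shows "\<bar>\<Sum>i<N. x i * (w / real N)\<bar> ^ p \<le> w ^ p * (\<Sum>i<N. \<bar>x i\<bar> ^ p) / real N"
proof -
  have conv: "convex_on {0..} (\<lambda>x::real. x ^ p)"
  proof (cases "even p")
    case True
    then show ?thesis using convex_on_subset[OF convex_power_even[of p] _] by simp
  qed (rule convex_power_odd)
  have "\<bar>\<Sum>i<N. x i * (w / real N)\<bar> \<le> (\<Sum>i<N. \<bar>x i\<bar> * (w / real N))"
    using w by (intro order_trans[OF sum_abs] sum_mono) (auto simp: abs_mult)
  also have "\<dots> = w * (\<Sum>i<N. (1 / real N) *\<^sub>R \<bar>x i\<bar>)" by (simp add: sum_distrib_left mult.commute)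
  finally have "\<bar>\<Sum>i<N. x i * (w / real N)\<bar> ^ p \<le> w ^ p * (\<Sum>i<N. (1 / real N) *\<^sub>R \<bar>x i\<bar>) ^ p"
    by (simp add: power_mono flip: power_mult_distrib)
  also have "\<dots> \<le> w ^ p * (\<Sum>i<N. (1 / real N) * \<bar>x i\<bar> ^ p)"
    using N w by (intro mult_left_mono convex_on_sum[OF _ _ conv]) (auto intro: convex_real_interval)
  also have "\<dots> = w ^ p * (\<Sum>i<N. \<bar>x i\<bar> ^ p) / real N" by (simp flip: sum_divide_distrib)
  finally show ?thesis .
qed

text \<open>Jensen's inequality bounds the Riemann sums. Taking the limit by Fatou's lemma needs \<open>f\<close> to be
  measurable at each fixed time and continuous in time, but not jointly measurable.\<close>

lemma mom_time_integral:
  fixes f :: "real \<Rightarrow> 'w \<Rightarrow> real"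
  assumes ab: "a \<le> b" and f: "\<And>s. s \<in> {a..b} \<Longrightarrow> mom M p (f s) c"
    and cont: "AE \<omega> in M. continuous_on {a..b} (\<lambda>s. f s \<omega>)"
  shows "mom M p (\<lambda>\<omega>. integral {a..b} (\<lambda>s. f s \<omega>)) ((b - a) ^ p * c)"
proof (rule mom_tendsto)
  let ?R = "\<lambda>N \<omega>. \<Sum>i<Suc N. f (grid a b (Suc N) i) \<omega> * ((b - a) / real (Suc N))"
  show "AE \<omega> in M. (\<lambda>N. ?R N \<omega>) \<longlonglongrightarrow> integral {a..b} (\<lambda>s. f s \<omega>)"
    using cont
  proof eventually_elim
    case (elim \<omega>)
    show ?case by (rule LIMSEQ_Suc[OF riemann_sums_tendsto[OF ab elim]])
  qed
  show "(\<lambda>_. (b - a) ^ p * c) \<longlonglongrightarrow> (b - a) ^ p * c" by simp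
  show "mom M p (?R N) ((b - a) ^ p * c)" for N
  proof -
    have g: "mom M p (f (grid a b (Suc N) i)) c" if "i < Suc N" for i
      using that grid_bounds[OF ab, of i "Suc N"] by (intro f) auto
    have [measurable]: "f (grid a b (Suc N) i) \<in> borel_measurable (completion M)" if "i < Suc N" for i
      using g[OF that] by (simp add: mom_def)
    let ?k = "(b - a) ^ p / real (Suc N)"
    have k: "?k \<ge> 0" using ab by simp
    have c0: "c \<ge> 0" using g[of 0] by (simp add: mom_def)
    have "(\<integral>\<^sup>+\<omega>. ennreal (norm (?R N \<omega>) ^ p) \<partial>completion M)
        \<le> (\<integral>\<^sup>+\<omega>. ennreal ?k * (\<Sum>i<Suc N. ennreal (norm (f (grid a b (Suc N) i) \<omega>) ^ p)) \<partial>completion M)"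
    proof (rule nn_integral_mono)
      fix \<omega>
      have "norm (?R N \<omega>) ^ p \<le> ?k * (\<Sum>i<Suc N. \<bar>f (grid a b (Suc N) i) \<omega>\<bar> ^ p)"
        using power_mean_le[of "Suc N" "b - a" "\<lambda>i. f (grid a b (Suc N) i) \<omega>" p] ab by simp
      then show "ennreal (norm (?R N \<omega>) ^ p) \<le> ennreal ?k * (\<Sum>i<Suc N. ennreal (norm (f (grid a b (Suc N) i) \<omega>) ^ p))"
        using k by (subst sum_ennreal) (auto simp flip: ennreal_mult simp: sum_nonneg ennreal_leI simp del: sum.lessThan_Suc)
    qed
    also have "\<dots> = ennreal ?k * (\<integral>\<^sup>+\<omega>. (\<Sum>i<Suc N. ennreal (norm (f (grid a b (Suc N) i) \<omega>) ^ p)) \<partial>completion M)"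
      by (rule nn_integral_cmult) (intro borel_measurable_sum, simp)
    also have "(\<integral>\<^sup>+\<omega>. (\<Sum>i<Suc N. ennreal (norm (f (grid a b (Suc N) i) \<omega>) ^ p)) \<partial>completion M)
        = (\<Sum>i<Suc N. \<integral>\<^sup>+\<omega>. ennreal (norm (f (grid a b (Suc N) i) \<omega>) ^ p) \<partial>completion M)"
      by (rule nn_integral_sum) simp
    also have "ennreal ?k * \<dots> \<le> ennreal ?k * (\<Sum>i<Suc N. ennreal c)"
      using g by (intro mult_left_mono sum_mono) (auto simp: mom_def nn_integral_completion simp del: sum.lessThan_Suc)
    also have "(\<Sum>i<Suc N. ennreal c) = ennreal (real (Suc N) * c)"
      using c0 by (subst sum_ennreal) auto
    also have "ennreal ?k * \<dots> = ennreal (?k * (real (Suc N) * c))"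
      using k c0 by (subst ennreal_mult) auto
    also have "?k * (real (Suc N) * c) = (b - a) ^ p * c" by simp
    finally show ?thesis using ab c0
      by (simp add: mom_def nn_integral_completion del: sum.lessThan_Suc)
  qed
qed

section \<open>Gaussian moments\<close>

lemma (in prob_space) normal_moments:
  fixes Y :: "'a \<Rightarrow> real"
  assumes D: "distributed M lborel Y (\<lambda>x. ennreal (normal_density m \<sigma> x))" and \<sigma>: "\<sigma> > 0"
  shows "integrable M (\<lambda>\<omega>. (Y \<omega> - m) ^ k)"
    and "expectation (\<lambda>\<omega>. (Y \<omega> - m) ^ 2) = \<sigma>\<^sup>2" and "expectation (\<lambda>\<omega>. Y \<omega> - m) = 0"
    and "expectation (\<lambda>\<omega>. (Y \<omega> - m) ^ 4) = 3 * (\<sigma>\<^sup>2)\<^sup>2"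
proof -
  have int: "(\<integral>\<omega>. (Y \<omega> - m) ^ k \<partial>M) = (\<integral>x. normal_density m \<sigma> x * (x - m) ^ k \<partial>lborel)" for k
    by (rule distributed_integral[OF D, symmetric]) auto
  show "integrable M (\<lambda>\<omega>. (Y \<omega> - m) ^ k)"
    using distributed_integrable[OF D, of "\<lambda>x. (x - m) ^ k"] integrable_normal_moment[OF \<sigma>, of m k] by simp
  show "expectation (\<lambda>\<omega>. (Y \<omega> - m) ^ 2) = \<sigma>\<^sup>2"
    using int[of 2] integral_normal_moment_even[OF \<sigma>, of m 1] by (simp add: fact_numeral)
  show "expectation (\<lambda>\<omega>. Y \<omega> - m) = 0"
    using int[of 1] integral_normal_moment_odd[OF \<sigma>, of m 0] by simp
  show "expectation (\<lambda>\<omega>. (Y \<omega> - m) ^ 4) = 3 * (\<sigma>\<^sup>2)\<^sup>2"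
    using int[of 4] integral_normal_moment_even[OF \<sigma>, of m 2]
    by (simp add: fact_numeral power2_eq_square field_simps)
qed

text \<open>The density sees only the square of its second parameter. For \<open>c < 0\<close> the parameter \<open>sqrt c\<close>, a
  negative number, therefore stands for the variance \<open>\<bar>c\<bar>\<close>.\<close>

lemma normal_density_abs: "normal_density m \<sigma> = normal_density m \<bar>\<sigma>\<bar>"
  by (simp add: normal_density_def fun_eq_iff)

lemma (in prob_space) gaussian_functional_moments:
  assumes Y: "gaussian_rv M 0 C Y"
  shows "integrable M (\<lambda>\<omega>. (v \<bullet> Y \<omega>) ^ k)"
    and "expectation (\<lambda>\<omega>. (v \<bullet> Y \<omega>) ^ 2) = \<bar>v \<bullet> (C *v v)\<bar>" and "expectation (\<lambda>\<omega>. v \<bullet> Y \<omega>) = 0"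
    and "expectation (\<lambda>\<omega>. (v \<bullet> Y \<omega>) ^ 4) = 3 * (v \<bullet> (C *v v))\<^sup>2"
proof -
  let ?c = "v \<bullet> (C *v v)"
  have [measurable]: "Y \<in> borel_measurable M" using Y by (simp add: gaussian_rv_def)
  have "integrable M (\<lambda>\<omega>. (v \<bullet> Y \<omega>) ^ k) \<and> expectation (\<lambda>\<omega>. (v \<bullet> Y \<omega>) ^ 2) = \<bar>?c\<bar>
    \<and> expectation (\<lambda>\<omega>. v \<bullet> Y \<omega>) = 0 \<and> expectation (\<lambda>\<omega>. (v \<bullet> Y \<omega>) ^ 4) = 3 * ?c\<^sup>2"
  proof (cases "?c = 0")
    case True
    then have ae: "AE \<omega> in M. v \<bullet> Y \<omega> = 0" using Y by (auto simp: gaussian_rv_def split: if_splits)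
    have e: "expectation (\<lambda>\<omega>. (v \<bullet> Y \<omega>) ^ j) = (if j = 0 then 1 else 0)" for j
    proof -
      have "expectation (\<lambda>\<omega>. (v \<bullet> Y \<omega>) ^ j) = expectation (\<lambda>_. 0 ^ j)"
        by (rule integral_cong_AE) (use ae in auto)
      then show ?thesis by (simp add: prob_space power_0_left)
    qed
    have "integrable M (\<lambda>\<omega>. (v \<bullet> Y \<omega>) ^ k) \<longleftrightarrow> integrable M (\<lambda>_. 0 ^ k :: real)"
      by (rule integrable_cong_AE) (use ae in auto)
    then show ?thesis using True e[of 2] e[of 1] e[of 4] by simp
  next
    case False
    then have "distributed M lborel (\<lambda>\<omega>. v \<bullet> Y \<omega>) (\<lambda>x. ennreal (normal_density (v \<bullet> 0) (sqrt ?c) x))"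
      using Y unfolding gaussian_rv_def by metis
    then have D: "distributed M lborel (\<lambda>\<omega>. v \<bullet> Y \<omega>) (\<lambda>x. ennreal (normal_density 0 \<bar>sqrt ?c\<bar> x))"
      by (simp add: normal_density_abs[of 0 "sqrt ?c"])
    have s: "\<bar>sqrt ?c\<bar> > 0" using False by simp
    have sq: "(\<bar>sqrt ?c\<bar>)\<^sup>2 = \<bar>?c\<bar>" by (metis abs_ge_zero real_sqrt_abs2 real_sqrt_pow2 power2_abs real_sqrt_abs real_sqrt_mult power2_eq_square abs_mult_self_eq)
    have "(\<bar>sqrt ?c\<bar>\<^sup>2)\<^sup>2 = ?c\<^sup>2" using sq by simp
    then show ?thesis
      using normal_moments(1,3)[OF D s] normal_moments(2)[OF D s, unfolded sq] normal_moments(4)[OF D s, unfolded sq]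
      by simp
  qed
  then show "integrable M (\<lambda>\<omega>. (v \<bullet> Y \<omega>) ^ k)" "expectation (\<lambda>\<omega>. (v \<bullet> Y \<omega>) ^ 2) = \<bar>?c\<bar>"
    "expectation (\<lambda>\<omega>. v \<bullet> Y \<omega>) = 0" "expectation (\<lambda>\<omega>. (v \<bullet> Y \<omega>) ^ 4) = 3 * ?c\<^sup>2" by blast+
qed

lemma norm_power4_le_components:
  fixes x :: "real^2"
  shows "norm x ^ 4 \<le> 2 * ((axis 1 1 \<bullet> x) ^ 4 + (axis 2 1 \<bullet> x) ^ 4)"
proof -
  have "norm x ^ 2 = (x$1)^2 + (x$2)^2"
    unfolding power2_norm_eq_inner inner_vec_def sum_2 by (simp add: power2_eq_square)
  then have "norm x ^ 4 = ((x$1)^2 + (x$2)^2)^2" by (metis power2_eq_square power4_eq_xxxx mult.assoc)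
  also have "\<dots> \<le> 2 * (((x$1)^2)^2 + ((x$2)^2)^2)"
    using sum_squares_bound[of "(x$1)^2" "(x$2)^2"] by (simp add: power2_sum)
  finally show ?thesis by (simp add: inner_axis' flip: power_mult)
qed

lemma (in prob_space) gaussian_mom4:
  fixes Y :: "'a \<Rightarrow> real^2"
  assumes Y: "gaussian_rv M 0 C Y"
  shows "mom M 4 Y (6 * ((axis 1 1 \<bullet> (C *v axis 1 1))\<^sup>2 + (axis 2 1 \<bullet> (C *v axis 2 1))\<^sup>2))"
proof -
  have [measurable]: "Y \<in> borel_measurable M" using Y by (simp add: gaussian_rv_def)
  note g = gaussian_functional_moments[OF Y]
  have i: "integrable M (\<lambda>\<omega>. norm (Y \<omega>) ^ 4)"
  proof (rule Bochner_Integration.integrable_bound)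
    show "integrable M (\<lambda>\<omega>. 2 * ((axis 1 1 \<bullet> Y \<omega>) ^ 4 + (axis 2 1 \<bullet> Y \<omega>) ^ 4))"
      by (intro integrable_mult_right Bochner_Integration.integrable_add g)
    show "AE \<omega> in M. norm (norm (Y \<omega>) ^ 4) \<le> norm (2 * ((axis 1 1 \<bullet> Y \<omega>) ^ 4 + (axis 2 1 \<bullet> Y \<omega>) ^ 4))"
      using norm_power4_le_components by (intro AE_I2) (auto intro: order_trans[OF _ abs_ge_self])
  qed measurable
  have "(\<integral>\<omega>. norm (Y \<omega>) ^ 4 \<partial>M) \<le> (\<integral>\<omega>. 2 * ((axis 1 1 \<bullet> Y \<omega>) ^ 4 + (axis 2 1 \<bullet> Y \<omega>) ^ 4) \<partial>M)"
    by (intro integral_mono i integrable_mult_right Bochner_Integration.integrable_add g norm_power4_le_components)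
  also have "\<dots> = 6 * ((axis 1 1 \<bullet> (C *v axis 1 1))\<^sup>2 + (axis 2 1 \<bullet> (C *v axis 2 1))\<^sup>2)"
    using g(1,4) by simp
  finally show ?thesis using i by (intro momI) auto
qed

lemma gaussian_mom4_scalar:
  fixes Y :: "'a \<Rightarrow> real^2"
  assumes M: "prob_space M" and Y: "gaussian_rv M 0 (h *\<^sub>R mat 1) Y"
  shows "mom M 4 Y (12 * h\<^sup>2)"
  using prob_space.gaussian_mom4[OF M Y]
  by (simp add: scaleR_matrix_vector_assoc[symmetric] norm_axis_1 inner_axis_axis)

text \<open>Polarisation: products of components are differences of squares of linear functionals.\<close>

lemma (in prob_space) gaussian_covariance:
  fixes Y :: "'a \<Rightarrow> real^'n"
  assumes Y: "gaussian_rv M 0 (h *\<^sub>R mat 1) Y" and h: "h \<ge> 0"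
  shows "integrable M (\<lambda>\<omega>. Y \<omega> $ i)" "expectation (\<lambda>\<omega>. Y \<omega> $ i) = 0"
    "integrable M (\<lambda>\<omega>. Y \<omega> $ i * Y \<omega> $ j)" "expectation (\<lambda>\<omega>. Y \<omega> $ i * Y \<omega> $ j) = (if i = j then h else 0)"
proof -
  note g = gaussian_functional_moments[OF Y]
  have ax: "axis i 1 \<bullet> Y \<omega> = Y \<omega> $ i" for i \<omega> by (simp add: inner_axis')
  show "integrable M (\<lambda>\<omega>. Y \<omega> $ i)" "expectation (\<lambda>\<omega>. Y \<omega> $ i) = 0"
    using g(1)[of "axis i 1" 1] g(3)[of "axis i 1"] by (simp_all add: ax)
  have pol: "Y \<omega> $ i * Y \<omega> $ j = (1/4) * (((axis i 1 + axis j 1) \<bullet> Y \<omega>)^2 - ((axis i 1 - axis j 1) \<bullet> Y \<omega>)^2)" for \<omega>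
    by (simp add: inner_add_left inner_diff_left ax power2_eq_square algebra_simps)
  show "integrable M (\<lambda>\<omega>. Y \<omega> $ i * Y \<omega> $ j)" unfolding pol
    by (intro integrable_mult_right Bochner_Integration.integrable_diff g)
  have q: "v \<bullet> (h *\<^sub>R mat 1 *v v) = h * (v \<bullet> v)" for v :: "real^'n"
    by (simp add: scaleR_matrix_vector_assoc[symmetric])
  have "expectation (\<lambda>\<omega>. Y \<omega> $ i * Y \<omega> $ j) = (1/4) * (h * ((axis i 1 + axis j 1) \<bullet> (axis i 1 + axis j 1 :: real^'n)) - h * ((axis i 1 - axis j 1) \<bullet> (axis i 1 - axis j 1 :: real^'n)))"
    unfolding pol using g(1,2) h by (simp add: q abs_mult)
  also have "\<dots> = (if i = j then h else 0)"
    by (simp add: inner_add_left inner_diff_left inner_add_right inner_diff_right inner_axis_axis)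
  finally show "expectation (\<lambda>\<omega>. Y \<omega> $ i * Y \<omega> $ j) = (if i = j then h else 0)" .
qed

section \<open>Adapted random variables and independent increments\<close>

lemma Int_stable_vimage: "Int_stable {f -` A \<inter> S | A. A \<in> sets N}"
proof (rule Int_stableI)
  fix E F assume "E \<in> {f -` A \<inter> S | A. A \<in> sets N}" "F \<in> {f -` A \<inter> S | A. A \<in> sets N}"
  then obtain A B where "E = f -` A \<inter> S" "F = f -` B \<inter> S" "A \<in> sets N" "B \<in> sets N" by blast
  then have "E \<inter> F = f -` (A \<inter> B) \<inter> S" "A \<inter> B \<in> sets N" by auto
  then show "E \<inter> F \<in> {f -` A \<inter> S | A. A \<in> sets N}" by blast
qed

lemma (in prob_space) indep_rvD:
  assumes "indep_rv M N Y N' Z" "A \<in> sets N" "B \<in> sets N'"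
  shows "prob ((Y -` A \<inter> space M) \<inter> (Z -` B \<inter> space M)) = prob (Y -` A \<inter> space M) * prob (Z -` B \<inter> space M)"
proof -
  have "Y \<in> measurable M N" "Z \<in> measurable M N'" using assms(1) by (auto simp: indep_rv_def)
  then have "Y \<in> space M \<rightarrow> space N" "Z \<in> space M \<rightarrow> space N'" by (auto dest: measurable_space)
  then show ?thesis
    using assms unfolding indep_rv_def
    by (intro indep_setD[of "sets (vimage_algebra (space M) Y N)" "sets (vimage_algebra (space M) Z N')"])
      (auto simp: sets_vimage_algebra2)
qed

text \<open>The sources of randomness of the two-scale system: the initial values and the Brownian motion,
  mutually independent.\<close>

locale brownian_inputs = prob_space M for M :: "'w measure" +
  fixes W :: "real \<Rightarrow> 'w \<Rightarrow> real^2" and X0 P0 :: "'w \<Rightarrow> real^2"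
  assumes bm: "brownian_motion M W"
    and indX: "indep_rv M borel X0 (borel \<Otimes>\<^sub>M path_space {0..}) (\<lambda>\<omega>. (P0 \<omega>, traj {0..} W \<omega>))"
    and indP: "indep_rv M borel P0 (path_space {0..}) (traj {0..} W)"
begin

lemma X0_meas [measurable]: "X0 \<in> borel_measurable M" using indX by (simp add: indep_rv_def)
lemma P0_meas [measurable]: "P0 \<in> borel_measurable M" using indP by (simp add: indep_rv_def)
lemma W_meas [measurable]: "0 \<le> t \<Longrightarrow> W t \<in> borel_measurable M" using bm by (simp add: brownian_motion_def)

lemma traj_meas [measurable]: "T \<subseteq> {0..} \<Longrightarrow> traj T W \<in> measurable M (path_space T)"
  unfolding traj_def[abs_def] by (rule measurable_restrict) auto

lemma W_gauss: "0 \<le> s \<Longrightarrow> s \<le> t \<Longrightarrow> gaussian_rv M 0 ((t - s) *\<^sub>R mat 1) (\<lambda>\<omega>. W t \<omega> - W s \<omega>)"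
  using bm by (simp add: brownian_motion_def)

text \<open>Rectangles in the initial values and the path up to time \<open>s\<close>. They generate the filtration and are
  closed under intersection, as Dynkin's theorem requires.\<close>

definition filt_gen :: "real \<Rightarrow> 'w set set" where
  "filt_gen s = {X0 -` A \<inter> P0 -` B \<inter> traj {0..s} W -` C \<inter> space M | A B C.
      A \<in> sets borel \<and> B \<in> sets borel \<and> C \<in> sets (path_space {0..s})}"

definition filt :: "real \<Rightarrow> 'w measure" where "filt s = sigma (space M) (filt_gen s)"

lemma filt_gen_sub: "filt_gen s \<subseteq> Pow (space M)" by (auto simp: filt_gen_def)

lemma space_filt [simp]: "space (filt s) = space M"
  by (simp add: filt_def filt_gen_sub)

lemma filt_gen_events: "filt_gen s \<subseteq> sets M"
proof
  fix E assume "E \<in> filt_gen s"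
  then obtain A B C where E: "E = X0 -` A \<inter> P0 -` B \<inter> traj {0..s} W -` C \<inter> space M"
    and ABC: "A \<in> sets borel" "B \<in> sets borel" "C \<in> sets (path_space {0..s})" by (auto simp: filt_gen_def)
  have "X0 -` A \<inter> space M \<in> sets M" "P0 -` B \<inter> space M \<in> sets M" "traj {0..s} W -` C \<inter> space M \<in> sets M"
    using ABC by (auto intro: measurable_sets[OF X0_meas] measurable_sets[OF P0_meas] measurable_sets[OF traj_meas])
  moreover have "E = (X0 -` A \<inter> space M) \<inter> (P0 -` B \<inter> space M) \<inter> (traj {0..s} W -` C \<inter> space M)" using E by auto
  ultimately show "E \<in> sets M" by auto
qed

lemma sets_filt: "sets (filt s) = sigma_sets (space M) (filt_gen s)"
  by (simp add: filt_def filt_gen_sub)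

lemma filt_sub: "sets (filt s) \<subseteq> sets M"
  unfolding sets_filt using filt_gen_events by (rule sets.sigma_sets_subset)

lemma measurable_filt_M: "f \<in> measurable (filt s) N \<Longrightarrow> f \<in> measurable M N"
  using filt_sub by (auto simp: measurable_def)

lemma filt_genI: "A \<in> sets borel \<Longrightarrow> B \<in> sets borel \<Longrightarrow> C \<in> sets (path_space {0..s}) \<Longrightarrow>
    X0 -` A \<inter> P0 -` B \<inter> traj {0..s} W -` C \<inter> space M \<in> sets (filt s)"
  unfolding sets_filt by (rule sigma_sets.Basic) (auto simp: filt_gen_def)

lemma traj_space: "traj T W \<omega> \<in> space (path_space T)"
  by (auto simp: traj_def space_PiM)

lemma X0_filt: "X0 \<in> borel_measurable (filt s)"
proof (rule measurableI)
  fix A :: "(real^2) set" assume "A \<in> sets borel"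
  from filt_genI[OF this, of UNIV "space (path_space {0..s})" s]
  show "X0 -` A \<inter> space (filt s) \<in> sets (filt s)" using traj_space[of "{0..s}"] by (auto simp: vimage_def Int_def)
qed simp

lemma P0_filt: "P0 \<in> borel_measurable (filt s)"
proof (rule measurableI)
  fix A :: "(real^2) set" assume "A \<in> sets borel"
  from filt_genI[OF _ this, of UNIV "space (path_space {0..s})" s]
  show "P0 -` A \<inter> space (filt s) \<in> sets (filt s)" using traj_space[of "{0..s}"] by (auto simp: vimage_def Int_def)
qed simp

lemma traj_filt: "traj {0..s} W \<in> measurable (filt s) (path_space {0..s})"
proof (rule measurableI)
  fix A assume "A \<in> sets (path_space {0..s} :: (real \<Rightarrow> real^2) measure)"
  from filt_genI[OF _ _ this, of UNIV UNIV]
  show "traj {0..s} W -` A \<inter> space (filt s) \<in> sets (filt s)" by simp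
qed (use traj_space in auto)

lemma W_filt: assumes "0 \<le> r" "r \<le> s" shows "W r \<in> borel_measurable (filt s)"
proof -
  have "(\<lambda>\<omega>. traj {0..s} W \<omega> r) \<in> borel_measurable (filt s)"
    by (rule measurable_compose[OF traj_filt measurable_component_singleton]) (use assms in auto)
  then show ?thesis using assms by (simp add: traj_def)
qed

lemma filt_mono: assumes "s \<le> t" shows "sets (filt s) \<subseteq> sets (filt t)"
  unfolding sets_filt[of s]
proof (rule sets.sigma_sets_subset[of _ "filt t", simplified])
  have tr: "traj {0..s} W \<in> measurable (filt t) (path_space {0..s})"
    unfolding traj_def[abs_def] using assms by (intro measurable_restrict W_filt) auto
  show "filt_gen s \<subseteq> sets (filt t)"
  proof
    fix E assume "E \<in> filt_gen s"
    then obtain A B C where E: "E = X0 -` A \<inter> P0 -` B \<inter> traj {0..s} W -` C \<inter> space M"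
      and ABC: "A \<in> sets borel" "B \<in> sets borel" "C \<in> sets (path_space {0..s})" by (auto simp: filt_gen_def)
    have "X0 -` A \<inter> space (filt t) \<in> sets (filt t)" "P0 -` B \<inter> space (filt t) \<in> sets (filt t)"
      "traj {0..s} W -` C \<inter> space (filt t) \<in> sets (filt t)"
      using ABC by (auto intro: measurable_sets[OF X0_filt] measurable_sets[OF P0_filt] measurable_sets[OF tr] simp del: space_filt)
    moreover have "E = (X0 -` A \<inter> space (filt t)) \<inter> (P0 -` B \<inter> space (filt t)) \<inter> (traj {0..s} W -` C \<inter> space (filt t))"
      using E by auto
    ultimately show "E \<in> sets (filt t)" by auto
  qed
qed

lemma init_filtration_sub: "sets (init_filtration M X0 W s) \<subseteq> sets (filt s)"
proof -
  have "(\<lambda>\<omega>. (X0 \<omega>, traj {0..s} W \<omega>)) \<in> measurable (filt s) (borel \<Otimes>\<^sub>M path_space {0..s})"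
    by (intro measurable_Pair X0_filt traj_filt)
  from sets_image_in_sets[OF _ this] show ?thesis unfolding init_filtration_def by simp
qed

lemma filt_gen_Int_stable: "Int_stable (filt_gen s)"
proof (rule Int_stableI)
  fix E F assume "E \<in> filt_gen s" "F \<in> filt_gen s"
  then obtain A B C A' B' C' where E: "E = X0 -` A \<inter> P0 -` B \<inter> traj {0..s} W -` C \<inter> space M"
    and ABC: "A \<in> sets borel" "B \<in> sets borel" "C \<in> sets (path_space {0..s})"
    and F: "F = X0 -` A' \<inter> P0 -` B' \<inter> traj {0..s} W -` C' \<inter> space M"
    and ABC': "A' \<in> sets borel" "B' \<in> sets borel" "C' \<in> sets (path_space {0..s})"
    unfolding filt_gen_def by blast
  have "E \<inter> F = X0 -` (A \<inter> A') \<inter> P0 -` (B \<inter> B') \<inter> traj {0..s} W -` (C \<inter> C') \<inter> space M" using E F by auto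
  then show "E \<inter> F \<in> filt_gen s" unfolding filt_gen_def using ABC ABC' by blast
qed

text \<open>On a rectangle the probability factorises in three steps: the first initial value splits off, then
  the second one, then the increment of \<open>W\<close> from its past. Dynkin's theorem extends this to the
  generated sigma-algebra.\<close>

lemma filt_indep_increment:
  assumes s: "0 \<le> s" "s \<le> t" and E: "E \<in> sets (filt s)" and D: "D \<in> sets borel"
  shows "prob (E \<inter> ((\<lambda>\<omega>. W t \<omega> - W s \<omega>) -` D \<inter> space M)) = prob E * prob ((\<lambda>\<omega>. W t \<omega> - W s \<omega>) -` D \<inter> space M)"
proof -
  let ?\<Delta> = "\<lambda>\<omega>. W t \<omega> - W s \<omega>"
  have [measurable]: "?\<Delta> \<in> borel_measurable M" using s by auto
  define G where "G = {?\<Delta> -` D \<inter> space M | D. D \<in> sets borel}"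
  have "indep_set (filt_gen s) G"
  proof (rule indep_setI)
    show "filt_gen s \<subseteq> events" by (rule filt_gen_events)
    show "G \<subseteq> events" unfolding G_def by (auto intro!: measurable_sets)
    fix E F assume "E \<in> filt_gen s" "F \<in> G"
    then obtain A B C D where E: "E = X0 -` A \<inter> P0 -` B \<inter> traj {0..s} W -` C \<inter> space M"
      and ABC: "A \<in> sets borel" "B \<in> sets borel" "C \<in> sets (path_space {0..s})"
      and F: "F = ?\<Delta> -` D \<inter> space M" and D: "D \<in> sets borel"
      unfolding filt_gen_def G_def by blast
    \<comment> \<open>The past of \<open>W\<close> and the increment have to form a single event of the whole path before the initial values can be split off.\<close>
    define H where "H C' D' = {w \<in> space (path_space {0..} :: (real \<Rightarrow> real^2) measure). restrict w {0..s} \<in> C' \<and> w t - w s \<in> D'}" for C' D'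
    have H: "H C' D' \<in> sets (path_space {0..})" if "C' \<in> sets (path_space {0..s})" "D' \<in> sets borel" for C' D'
    proof -
      have r: "(\<lambda>w. restrict w {0..s}) \<in> measurable (path_space {0..}) (path_space {0..s})"
        by (rule measurable_restrict_subset) auto
      have d: "(\<lambda>w. w t - w s) \<in> borel_measurable (path_space {0..} :: (real \<Rightarrow> real^2) measure)"
        using s by (intro borel_measurable_diff measurable_component_singleton) auto
      have "H C' D' = ((\<lambda>w. restrict w {0..s}) -` C' \<inter> space (path_space {0..})) \<inter> ((\<lambda>w. w t - w s) -` D' \<inter> space (path_space {0..}))"
        by (auto simp: H_def)
      then show ?thesis using measurable_sets[OF r that(1)] measurable_sets[OF d that(2)] by auto
    qed
    have Hv: "traj {0..} W -` H C' D' \<inter> space M = (traj {0..s} W -` C' \<inter> space M) \<inter> (?\<Delta> -` D' \<inter> space M)" for C' D'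
    proof -
      have "restrict (traj {0..} W \<omega>) {0..s} = traj {0..s} W \<omega>" for \<omega> using s by (auto simp: traj_def restrict_def)
      then show ?thesis using s traj_space[of "{0..}"] by (auto simp: H_def traj_def[of "{0..}" _ _] )
    qed
    have fac: "prob ((X0 -` A \<inter> P0 -` B \<inter> traj {0..s} W -` C \<inter> space M) \<inter> (?\<Delta> -` D' \<inter> space M))
       = prob (X0 -` A \<inter> space M) * (prob (P0 -` B \<inter> space M) * (prob (traj {0..s} W -` C \<inter> space M) * prob (?\<Delta> -` D' \<inter> space M)))"
      if D': "D' \<in> sets borel" for D'
    proof -
      have BH: "B \<times> H C D' \<in> sets (borel \<Otimes>\<^sub>M path_space {0..})" using ABC H D' by auto
      have "(X0 -` A \<inter> P0 -` B \<inter> traj {0..s} W -` C \<inter> space M) \<inter> (?\<Delta> -` D' \<inter> space M)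
         = (X0 -` A \<inter> space M) \<inter> ((\<lambda>\<omega>. (P0 \<omega>, traj {0..} W \<omega>)) -` (B \<times> H C D') \<inter> space M)"
        using Hv[of C D'] by auto
      then have "prob ((X0 -` A \<inter> P0 -` B \<inter> traj {0..s} W -` C \<inter> space M) \<inter> (?\<Delta> -` D' \<inter> space M))
         = prob (X0 -` A \<inter> space M) * prob ((\<lambda>\<omega>. (P0 \<omega>, traj {0..} W \<omega>)) -` (B \<times> H C D') \<inter> space M)"
        using indep_rvD[OF indX ABC(1) BH] by simp
      also have "(\<lambda>\<omega>. (P0 \<omega>, traj {0..} W \<omega>)) -` (B \<times> H C D') \<inter> space M = (P0 -` B \<inter> space M) \<inter> (traj {0..} W -` H C D' \<inter> space M)"
        by auto
      also have "prob \<dots> = prob (P0 -` B \<inter> space M) * prob (traj {0..} W -` H C D' \<inter> space M)"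
        by (rule indep_rvD[OF indP ABC(2) H[OF ABC(3) D']])
      also have "traj {0..} W -` H C D' \<inter> space M = (?\<Delta> -` D' \<inter> space M) \<inter> (traj {0..s} W -` C \<inter> space M)"
        using Hv by auto
      also have "prob \<dots> = prob (?\<Delta> -` D' \<inter> space M) * prob (traj {0..s} W -` C \<inter> space M)"
        by (rule indep_rvD[OF _ D' ABC(3)]) (use bm s in \<open>auto simp: brownian_motion_def\<close>)
      finally show ?thesis by (simp add: mult.commute)
    qed
    from fac[of UNIV] have "prob E = prob (X0 -` A \<inter> space M) * (prob (P0 -` B \<inter> space M) * prob (traj {0..s} W -` C \<inter> space M))"
      using E by (simp add: prob_space Int_assoc)
    then show "prob (E \<inter> F) = prob E * prob F" using fac[OF D] E F by simp
  qed
  moreover have "Int_stable G" unfolding G_def by (rule Int_stable_vimage)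
  ultimately have "indep_set (sigma_sets (space M) (filt_gen s)) (sigma_sets (space M) G)"
    by (intro indep_set_sigma_sets filt_gen_Int_stable)
  from indep_setD[OF this, of E "?\<Delta> -` D \<inter> space M"] show ?thesis
    using E D unfolding sets_filt by (auto simp: G_def)
qed

text \<open>Adaptedness up to null sets, since solutions are determined by \<open>W\<close> and the initial values only
  almost surely.\<close>

definition adp :: "real \<Rightarrow> ('w \<Rightarrow> 'b::{banach, second_countable_topology}) \<Rightarrow> bool" where
  "adp s f \<longleftrightarrow> f \<in> borel_measurable M \<and> (\<exists>g\<in>borel_measurable (filt s). AE \<omega> in M. f \<omega> = g \<omega>)"

lemma adp_measurable: "adp s f \<Longrightarrow> f \<in> borel_measurable M" by (simp add: adp_def)

lemma adpI: "f \<in> borel_measurable (filt s) \<Longrightarrow> adp s f"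
  unfolding adp_def using measurable_filt_M by blast

lemma adp_mono: "adp s f \<Longrightarrow> s \<le> t \<Longrightarrow> adp t f"
  unfolding adp_def using filt_mono[of s t] by (auto simp: measurable_def)

lemma adp_const: "adp s (\<lambda>_. c)" by (rule adpI) simp

lemma adp_compose2:
  assumes f: "adp s f" and g: "adp s g" and h: "(\<lambda>(x, y). h x y) \<in> borel_measurable (borel \<Otimes>\<^sub>M borel)"
  shows "adp s (\<lambda>\<omega>. h (f \<omega>) (g \<omega>))"
proof -
  obtain f' g' where f': "f' \<in> borel_measurable (filt s)" "AE \<omega> in M. f \<omega> = f' \<omega>"
    and g': "g' \<in> borel_measurable (filt s)" "AE \<omega> in M. g \<omega> = g' \<omega>" using f g by (auto simp: adp_def)
  have comp: "(\<lambda>\<omega>. h (F \<omega>) (G \<omega>)) \<in> borel_measurable N" if "F \<in> borel_measurable N" "G \<in> borel_measurable N" for F G N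
    using measurable_compose[OF measurable_Pair[OF that] h] by simp
  show ?thesis unfolding adp_def
    using f' g' comp[OF adp_measurable[OF f] adp_measurable[OF g]] comp[OF f'(1) g'(1)]
    by (intro conjI bexI[of _ "\<lambda>\<omega>. h (f' \<omega>) (g' \<omega>)"]) auto
qed

lemma adp_limit:
  assumes f: "\<And>n. adp s (f n)" and g: "g \<in> borel_measurable M" and lim: "AE \<omega> in M. (\<lambda>n. f n \<omega>) \<longlonglongrightarrow> g \<omega>"
  shows "adp s g"
proof -
  have "\<forall>n. \<exists>h. h \<in> borel_measurable (filt s) \<and> (AE \<omega> in M. f n \<omega> = h \<omega>)" using f by (auto simp: adp_def)
  then obtain h where h: "\<And>n. h n \<in> borel_measurable (filt s)" "\<And>n. AE \<omega> in M. f n \<omega> = h n \<omega>" by metis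
  have "AE \<omega> in M. \<forall>n. f n \<omega> = h n \<omega>" using h(2) by (simp add: AE_all_countable)
  then have ae: "AE \<omega> in M. g \<omega> = lim (\<lambda>n. h n \<omega>)" using lim
  proof eventually_elim
    case (elim \<omega>)
    then have "(\<lambda>n. h n \<omega>) \<longlonglongrightarrow> g \<omega>" by simp
    then show ?case by (simp add: limI)
  qed
  have "(\<lambda>\<omega>. lim (\<lambda>n. h n \<omega>)) \<in> borel_measurable (filt s)" using h(1) by (rule borel_measurable_lim_metric)
  then show ?thesis unfolding adp_def using g ae by (intro conjI bexI[of _ "\<lambda>\<omega>. lim (\<lambda>n. h n \<omega>)"])
qed

lemma adp_add: "adp s f \<Longrightarrow> adp s g \<Longrightarrow> adp s (\<lambda>\<omega>. f \<omega> + g \<omega>)"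
  by (rule adp_compose2) (auto simp: split_def)
lemma adp_diff: "adp s f \<Longrightarrow> adp s g \<Longrightarrow> adp s (\<lambda>\<omega>. f \<omega> - g \<omega>)"
  by (rule adp_compose2) (auto simp: split_def)
lemma adp_mult: "adp s f \<Longrightarrow> adp s g \<Longrightarrow> adp s (\<lambda>\<omega>. f \<omega> * g \<omega> :: real)"
  by (rule adp_compose2) (auto simp: split_def)
lemma adp_inner: "adp s f \<Longrightarrow> adp s g \<Longrightarrow> adp s (\<lambda>\<omega>. (f \<omega> :: real^2) \<bullet> g \<omega>)"
  by (rule adp_compose2) (auto simp: split_def)
lemma adp_scaleR: "adp s f \<Longrightarrow> adp s (\<lambda>\<omega>. c *\<^sub>R f \<omega>)"
  by (rule adp_compose2[of s f f "\<lambda>x y. c *\<^sub>R x"]) (auto simp: split_def)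
lemma adp_matrix: "adp s f \<Longrightarrow> adp s (\<lambda>\<omega>. (B :: real^2^2) *v f \<omega>)"
  by (rule adp_compose2[of s f f "\<lambda>x y. B *v x"]) (auto simp: split_def)
lemma adp_nth: "adp s f \<Longrightarrow> adp s (\<lambda>\<omega>. (f \<omega> :: real^2) $ i)"
  using adp_inner[OF _ adp_const[of s "axis i 1"], of f] by (simp add: inner_axis)
lemma adp_X0: "adp s X0" by (rule adpI[OF X0_filt])
lemma adp_P0: "adp s P0" by (rule adpI[OF P0_filt])
lemma adp_W: "0 \<le> r \<Longrightarrow> r \<le> s \<Longrightarrow> adp s (W r)" by (rule adpI[OF W_filt])
lemma adp_init_filtration: "f \<in> borel_measurable (init_filtration M X0 W s) \<Longrightarrow> adp s f"
  using init_filtration_sub[of s] by (intro adpI) (auto simp: measurable_def init_filtration_def)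

text \<open>A version of \<open>Z\<close> that is measurable for the filtration is independent of the increment.\<close>

lemma adp_times_increment:
  fixes Z :: "'w \<Rightarrow> real" and \<phi> :: "real^2 \<Rightarrow> real"
  assumes s: "0 \<le> s" "s \<le> t" and Z: "adp s Z" "integrable M Z"
    and \<phi>: "\<phi> \<in> borel_measurable borel" "integrable M (\<lambda>\<omega>. \<phi> (W t \<omega> - W s \<omega>))"
  shows "integrable M (\<lambda>\<omega>. Z \<omega> * \<phi> (W t \<omega> - W s \<omega>))"
    and "expectation (\<lambda>\<omega>. Z \<omega> * \<phi> (W t \<omega> - W s \<omega>)) = expectation Z * expectation (\<lambda>\<omega>. \<phi> (W t \<omega> - W s \<omega>))"
proof -
  let ?\<Delta> = "\<lambda>\<omega>. W t \<omega> - W s \<omega>"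
  have [measurable]: "?\<Delta> \<in> borel_measurable M" "\<phi> \<in> borel_measurable borel" using s \<phi> by auto
  obtain g where g: "g \<in> borel_measurable (filt s)" "AE \<omega> in M. Z \<omega> = g \<omega>" using Z(1) by (auto simp: adp_def)
  have [measurable]: "g \<in> borel_measurable M" using g(1) by (rule measurable_filt_M)
  have [measurable]: "Z \<in> borel_measurable M" using Z(1) by (rule adp_measurable)
  have ig: "integrable M g" using integrable_cong_AE[OF _ _ g(2)] Z by auto
  let ?S1 = "{g -` A \<inter> space M | A. A \<in> sets borel}" and ?S2 = "{(\<lambda>\<omega>. \<phi> (?\<Delta> \<omega>)) -` A \<inter> space M | A. A \<in> sets borel}"
  have "indep_set ?S1 ?S2"
  proof (rule indep_setI)
    show "?S1 \<subseteq> events" "?S2 \<subseteq> events" by (auto intro!: measurable_sets)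
    fix E F assume "E \<in> ?S1" "F \<in> ?S2"
    then obtain A B where E: "E = g -` A \<inter> space M" "A \<in> sets borel" and F: "F = ?\<Delta> -` (\<phi> -` B) \<inter> space M" "B \<in> sets borel" by auto
    have "E \<in> sets (filt s)" using measurable_sets[OF g(1) E(2)] E(1) by simp
    moreover have "\<phi> -` B \<in> sets borel" using measurable_sets[OF \<phi>(1) F(2)] by simp
    ultimately show "prob (E \<inter> F) = prob E * prob F" unfolding F by (rule filt_indep_increment[OF s])
  qed
  moreover have "Int_stable ?S1" "Int_stable ?S2"
    by (rule Int_stable_vimage)+
  ultimately have iv: "indep_var borel g borel (\<lambda>\<omega>. \<phi> (?\<Delta> \<omega>))"
    unfolding indep_var_eq by (auto intro: indep_set_sigma_sets)
  have eq: "AE \<omega> in M. Z \<omega> * \<phi> (?\<Delta> \<omega>) = g \<omega> * \<phi> (?\<Delta> \<omega>)" using g(2) by auto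
  show "integrable M (\<lambda>\<omega>. Z \<omega> * \<phi> (?\<Delta> \<omega>))"
    using indep_var_integrable[OF iv ig \<phi>(2)] integrable_cong_AE[OF _ _ eq] by auto
  have "expectation (\<lambda>\<omega>. Z \<omega> * \<phi> (?\<Delta> \<omega>)) = expectation (\<lambda>\<omega>. g \<omega> * \<phi> (?\<Delta> \<omega>))"
    by (rule integral_cong_AE[OF _ _ eq]) auto
  also have "\<dots> = expectation g * expectation (\<lambda>\<omega>. \<phi> (?\<Delta> \<omega>))" by (rule indep_var_lebesgue_integral[OF iv ig \<phi>(2)])
  also have "expectation g = expectation Z" by (rule integral_cong_AE) (use g(2) in auto)
  finally show "expectation (\<lambda>\<omega>. Z \<omega> * \<phi> (?\<Delta> \<omega>)) = expectation Z * expectation (\<lambda>\<omega>. \<phi> (?\<Delta> \<omega>))" .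
qed

end

section \<open>The Ito isometry\<close>

lemma integrable_mult_square:
  fixes f g :: "'w \<Rightarrow> real"
  assumes [measurable]: "f \<in> borel_measurable M" "g \<in> borel_measurable M"
    and f: "integrable M (\<lambda>\<omega>. (f \<omega>)\<^sup>2)" and g: "integrable M (\<lambda>\<omega>. (g \<omega>)\<^sup>2)"
  shows "integrable M (\<lambda>\<omega>. f \<omega> * g \<omega>)"
proof (rule Bochner_Integration.integrable_bound)
  show "integrable M (\<lambda>\<omega>. (f \<omega>)\<^sup>2 + (g \<omega>)\<^sup>2)" using f g by (rule Bochner_Integration.integrable_add)
  have "\<bar>f \<omega> * g \<omega>\<bar> \<le> (f \<omega>)\<^sup>2 + (g \<omega>)\<^sup>2" for \<omega>
  proof -
    have "2 * (\<bar>f \<omega>\<bar> * \<bar>g \<omega>\<bar>) \<le> (f \<omega>)\<^sup>2 + (g \<omega>)\<^sup>2" using sum_squares_bound[of "\<bar>f \<omega>\<bar>" "\<bar>g \<omega>\<bar>"] by simp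
    moreover have "0 \<le> \<bar>f \<omega>\<bar> * \<bar>g \<omega>\<bar>" by simp
    ultimately show ?thesis by (simp only: abs_mult)
  qed
  then show "AE \<omega> in M. norm (f \<omega> * g \<omega>) \<le> norm ((f \<omega>)\<^sup>2 + (g \<omega>)\<^sup>2)"
    by (intro AE_I2) (simp only: real_norm_def order_trans[OF _ abs_ge_self])
qed measurable

lemma inner_sum2: "x \<bullet> y = x $ 1 * y $ 1 + x $ 2 * y $ (2::2)" for x y :: "real^2"
  by (simp add: inner_vec_def sum_2)

lemma norm_nth_square_le: "(x $ i)\<^sup>2 \<le> (norm x)\<^sup>2" for x :: "real^'n"
  using component_le_norm_cart[of x i] by (metis abs_ge_zero power2_abs power_mono)

context brownian_inputs begin

definition sq_adp :: "real \<Rightarrow> ('w \<Rightarrow> real^2) \<Rightarrow> bool" where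
  "sq_adp s \<eta> \<longleftrightarrow> adp s \<eta> \<and> integrable M (\<lambda>\<omega>. (norm (\<eta> \<omega>))\<^sup>2)"

text \<open>The Ito integral of the one-step process that equals \<open>\<eta>\<close> on \<open>[s, t)\<close> and vanishes elsewhere.\<close>

definition incr :: "real \<Rightarrow> real \<Rightarrow> ('w \<Rightarrow> real^2) \<Rightarrow> 'w \<Rightarrow> real" where
  "incr s t \<eta> \<omega> = \<eta> \<omega> \<bullet> (W t \<omega> - W s \<omega>)"

lemma sq_adp_mono: "sq_adp s \<eta> \<Longrightarrow> s \<le> t \<Longrightarrow> sq_adp t \<eta>"
  by (auto simp: sq_adp_def intro: adp_mono)

lemma sq_adp_measurable: "sq_adp s \<eta> \<Longrightarrow> \<eta> \<in> borel_measurable M"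
  by (auto simp: sq_adp_def intro: adp_measurable)

lemma sq_adp_nth:
  assumes "sq_adp s \<eta>" shows "adp s (\<lambda>\<omega>. \<eta> \<omega> $ i)" "integrable M (\<lambda>\<omega>. (\<eta> \<omega> $ i)\<^sup>2)"
proof -
  show a: "adp s (\<lambda>\<omega>. \<eta> \<omega> $ i)" using assms by (simp add: sq_adp_def adp_nth)
  show "integrable M (\<lambda>\<omega>. (\<eta> \<omega> $ i)\<^sup>2)"
  proof (rule Bochner_Integration.integrable_bound)
    show "integrable M (\<lambda>\<omega>. (norm (\<eta> \<omega>))\<^sup>2)" using assms by (simp add: sq_adp_def)
    show "AE \<omega> in M. norm ((\<eta> \<omega> $ i)\<^sup>2) \<le> norm ((norm (\<eta> \<omega>))\<^sup>2)" by (simp add: norm_nth_square_le)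
  qed (use adp_measurable[OF a] in simp)
qed

lemma sq_adp_nth_mult:
  assumes "sq_adp s \<eta>" "sq_adp s \<xi>"
  shows "integrable M (\<lambda>\<omega>. \<eta> \<omega> $ i * \<xi> \<omega> $ j)" "adp s (\<lambda>\<omega>. \<eta> \<omega> $ i * \<xi> \<omega> $ j)"
  using sq_adp_nth[OF assms(1), of i] sq_adp_nth[OF assms(2), of j]
  by (auto intro!: integrable_mult_square adp_mult dest: adp_measurable)

lemma increment_moments:
  assumes "0 \<le> s" "s \<le> t"
  shows "integrable M (\<lambda>\<omega>. (W t \<omega> - W s \<omega>) $ i)" "expectation (\<lambda>\<omega>. (W t \<omega> - W s \<omega>) $ i) = 0"
    "integrable M (\<lambda>\<omega>. (W t \<omega> - W s \<omega>) $ i * (W t \<omega> - W s \<omega>) $ j)"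
    "expectation (\<lambda>\<omega>. (W t \<omega> - W s \<omega>) $ i * (W t \<omega> - W s \<omega>) $ j) = (if i = j then t - s else 0)"
  using gaussian_covariance(1,2)[OF W_gauss[OF assms], of i]
    gaussian_covariance(3,4)[OF W_gauss[OF assms], of i j] assms by simp_all

lemma adp_increment_mean:
  assumes "0 \<le> s" "s \<le> t" "adp s Z" "integrable M Z"
  shows "integrable M (\<lambda>\<omega>. Z \<omega> * (W t \<omega> - W s \<omega>) $ i)" "expectation (\<lambda>\<omega>. Z \<omega> * (W t \<omega> - W s \<omega>) $ i) = 0"
  using adp_times_increment[OF assms, of "\<lambda>x. x $ i"] increment_moments[OF assms(1,2), of i] by simp_all

lemma adp_increment_cov:
  assumes "0 \<le> s" "s \<le> t" "adp s Z" "integrable M Z"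
  shows "integrable M (\<lambda>\<omega>. Z \<omega> * ((W t \<omega> - W s \<omega>) $ i * (W t \<omega> - W s \<omega>) $ j))"
    "expectation (\<lambda>\<omega>. Z \<omega> * ((W t \<omega> - W s \<omega>) $ i * (W t \<omega> - W s \<omega>) $ j)) = (if i = j then t - s else 0) * expectation Z"
  using adp_times_increment[OF assms, of "\<lambda>x. x $ i * x $ j"] increment_moments(3,4)[OF assms(1,2), of i j] by simp_all

lemma incr_measurable: "0 \<le> s \<Longrightarrow> s \<le> t \<Longrightarrow> sq_adp s \<eta> \<Longrightarrow> incr s t \<eta> \<in> borel_measurable M"
  unfolding incr_def[abs_def] using sq_adp_measurable[of s \<eta>] by measurable

lemma adp_incr:
  assumes "0 \<le> s" "s \<le> t" "t \<le> u" "sq_adp s \<eta>" shows "adp u (incr s t \<eta>)"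
  unfolding incr_def[abs_def] using assms
  by (intro adp_inner adp_diff adp_W) (auto simp: sq_adp_def intro: adp_mono)

lemma incr_product_same:
  assumes "0 \<le> s" "s \<le> t" "sq_adp s \<eta>" "sq_adp s \<xi>"
  shows "integrable M (\<lambda>\<omega>. incr s t \<eta> \<omega> * incr s t \<xi> \<omega>)"
    and "expectation (\<lambda>\<omega>. incr s t \<eta> \<omega> * incr s t \<xi> \<omega>) = (t - s) * expectation (\<lambda>\<omega>. \<eta> \<omega> \<bullet> \<xi> \<omega>)"
proof -
  let ?d = "\<lambda>\<omega>. W t \<omega> - W s \<omega>"
  have eq: "incr s t \<eta> \<omega> * incr s t \<xi> \<omega> =
      (\<eta> \<omega> $ 1 * \<xi> \<omega> $ 1) * (?d \<omega> $ 1 * ?d \<omega> $ 1) + (\<eta> \<omega> $ 1 * \<xi> \<omega> $ 2) * (?d \<omega> $ 1 * ?d \<omega> $ 2) +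
      (\<eta> \<omega> $ 2 * \<xi> \<omega> $ 1) * (?d \<omega> $ 2 * ?d \<omega> $ 1) + (\<eta> \<omega> $ 2 * \<xi> \<omega> $ 2) * (?d \<omega> $ 2 * ?d \<omega> $ 2)" for \<omega>
    unfolding incr_def inner_sum2 by algebra
  note c = adp_increment_cov[OF assms(1,2) sq_adp_nth_mult(2)[OF assms(3,4)] sq_adp_nth_mult(1)[OF assms(3,4)]]
  show "integrable M (\<lambda>\<omega>. incr s t \<eta> \<omega> * incr s t \<xi> \<omega>)" unfolding eq
    by (intro Bochner_Integration.integrable_add c)
  have "expectation (\<lambda>\<omega>. incr s t \<eta> \<omega> * incr s t \<xi> \<omega>) =
     (t - s) * (expectation (\<lambda>\<omega>. \<eta> \<omega> $ 1 * \<xi> \<omega> $ 1) + expectation (\<lambda>\<omega>. \<eta> \<omega> $ 2 * \<xi> \<omega> $ 2))"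
    unfolding eq by (simp add: Bochner_Integration.integral_add Bochner_Integration.integrable_add c distrib_left del: vector_minus_component)
  also have "expectation (\<lambda>\<omega>. \<eta> \<omega> $ 1 * \<xi> \<omega> $ 1) + expectation (\<lambda>\<omega>. \<eta> \<omega> $ 2 * \<xi> \<omega> $ 2) = expectation (\<lambda>\<omega>. \<eta> \<omega> \<bullet> \<xi> \<omega>)"
    unfolding inner_sum2 by (rule Bochner_Integration.integral_add[symmetric]) (rule sq_adp_nth_mult(1)[OF assms(3,4)])+
  finally show "expectation (\<lambda>\<omega>. incr s t \<eta> \<omega> * incr s t \<xi> \<omega>) = (t - s) * expectation (\<lambda>\<omega>. \<eta> \<omega> \<bullet> \<xi> \<omega>)" .
qed

lemma incr_square_integrable:
  assumes "0 \<le> s" "s \<le> t" "sq_adp s \<eta>" shows "integrable M (\<lambda>\<omega>. (incr s t \<eta> \<omega>)\<^sup>2)"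
  using incr_product_same(1)[OF assms assms(3)] by (simp add: power2_eq_square)

lemma incr_product_integrable:
  assumes "0 \<le> s" "s \<le> t" "sq_adp s \<eta>" "0 \<le> u" "u \<le> v" "sq_adp u \<xi>"
  shows "integrable M (\<lambda>\<omega>. incr s t \<eta> \<omega> * incr u v \<xi> \<omega>)"
  using assms by (intro integrable_mult_square incr_measurable incr_square_integrable) auto

text \<open>Given the past at time \<open>u\<close>, the later increment has mean zero and all else is known.\<close>

lemma incr_product_disjoint:
  assumes s: "0 \<le> s" "s \<le> t" "sq_adp s \<eta>" and u: "t \<le> u" "u \<le> v" "sq_adp u \<xi>"
  shows "expectation (\<lambda>\<omega>. incr s t \<eta> \<omega> * incr u v \<xi> \<omega>) = 0"
proof -
  let ?d = "\<lambda>\<omega>. W v \<omega> - W u \<omega>"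
  have u0: "0 \<le> u" using s u by linarith
  have eq: "incr s t \<eta> \<omega> * incr u v \<xi> \<omega> = (incr s t \<eta> \<omega> * \<xi> \<omega> $ 1) * ?d \<omega> $ 1 + (incr s t \<eta> \<omega> * \<xi> \<omega> $ 2) * ?d \<omega> $ 2" for \<omega>
    unfolding incr_def inner_sum2 by algebra
  have a: "adp u (\<lambda>\<omega>. incr s t \<eta> \<omega> * \<xi> \<omega> $ i)" for i
    using s u by (intro adp_mult adp_incr sq_adp_nth)
  have i: "integrable M (\<lambda>\<omega>. incr s t \<eta> \<omega> * \<xi> \<omega> $ i)" for i
    using s u adp_measurable[OF sq_adp_nth(1)[OF u(3)]]
    by (intro integrable_mult_square incr_measurable incr_square_integrable sq_adp_nth[OF u(3)]) auto
  show ?thesis unfolding eq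
    using adp_increment_mean[OF u0 u(2) a i] by (simp add: Bochner_Integration.integral_add del: vector_minus_component)
qed

lemma incr_split: "s \<le> r \<Longrightarrow> r \<le> t \<Longrightarrow> incr s t \<eta> \<omega> = incr s r \<eta> \<omega> + incr r t \<eta> \<omega>"
  by (simp add: incr_def inner_diff_right)

lemma incr_trivial [simp]: "incr s s \<eta> = (\<lambda>_. 0)" by (simp add: incr_def fun_eq_iff)

text \<open>The length of \<open>[s, t) \<inter> [u, v)\<close>.\<close>

definition overlap :: "real \<Rightarrow> real \<Rightarrow> real \<Rightarrow> real \<Rightarrow> real" where
  "overlap s t u v = max 0 (min t v - max s u)"

text \<open>Cut both intervals at \<open>u\<close> and at \<open>w = min t v\<close>. Only the common piece \<open>[u, w)\<close> contributes, since
  the other products belong to disjoint intervals.\<close>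

lemma incr_product_ordered:
  assumes s: "0 \<le> s" "s \<le> t" "sq_adp s \<eta>" and u: "s \<le> u" "u \<le> v" "sq_adp u \<xi>"
  shows "expectation (\<lambda>\<omega>. incr s t \<eta> \<omega> * incr u v \<xi> \<omega>) = overlap s t u v * expectation (\<lambda>\<omega>. \<eta> \<omega> \<bullet> \<xi> \<omega>)"
proof (cases "t \<le> u")
  case True
  then show ?thesis using incr_product_disjoint[OF s True u(2,3)] u by (simp add: overlap_def)
next
  case False
  then have ut: "u \<le> t" by simp
  define w where "w = min t v"
  have w: "u \<le> w" "w \<le> t" "w \<le> v" using u ut by (auto simp: w_def)
  have u0: "0 \<le> u" and w0: "0 \<le> w" using s u w by linarith+
  have \<eta>: "sq_adp u \<eta>" "sq_adp w \<eta>" and \<xi>: "sq_adp w \<xi>" using s u w by (auto intro: sq_adp_mono)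
  have "incr s t \<eta> \<omega> * incr u v \<xi> \<omega> = incr s u \<eta> \<omega> * incr u v \<xi> \<omega> + (incr u w \<eta> \<omega> * incr u w \<xi> \<omega>
      + (incr u w \<eta> \<omega> * incr w v \<xi> \<omega> + incr u w \<xi> \<omega> * incr w t \<eta> \<omega>))" for \<omega>
  proof -
    have "incr w t \<eta> \<omega> = 0 \<or> incr w v \<xi> \<omega> = 0" by (cases "t \<le> v") (auto simp: w_def min_def)
    moreover have "incr s t \<eta> \<omega> = incr s u \<eta> \<omega> + incr u w \<eta> \<omega> + incr w t \<eta> \<omega>" "incr u v \<xi> \<omega> = incr u w \<xi> \<omega> + incr w v \<xi> \<omega>"
      using incr_split[of s u t \<eta> \<omega>] incr_split[of u w t \<eta> \<omega>] incr_split[of u w v \<xi> \<omega>] u w ut by auto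
    ultimately show ?thesis by (auto simp: algebra_simps)
  qed
  moreover have "expectation (\<lambda>\<omega>. incr s u \<eta> \<omega> * incr u v \<xi> \<omega>) = 0"
    using s u by (intro incr_product_disjoint) auto
  moreover have "expectation (\<lambda>\<omega>. incr u w \<eta> \<omega> * incr w v \<xi> \<omega>) = 0"
    using s u w u0 \<eta> \<xi> by (intro incr_product_disjoint) auto
  moreover have "expectation (\<lambda>\<omega>. incr u w \<xi> \<omega> * incr w t \<eta> \<omega>) = 0"
    using s u w u0 \<eta> \<xi> by (intro incr_product_disjoint) auto
  moreover have "expectation (\<lambda>\<omega>. incr u w \<eta> \<omega> * incr u w \<xi> \<omega>) = overlap s t u v * expectation (\<lambda>\<omega>. \<eta> \<omega> \<bullet> \<xi> \<omega>)"
    using incr_product_same(2)[OF u0 w(1) \<eta>(1) u(3)] u w by (simp add: overlap_def w_def max_def)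
  ultimately show ?thesis
    using s u w u0 w0 \<eta> \<xi>
    by (simp add: Bochner_Integration.integral_add Bochner_Integration.integrable_add incr_product_integrable)
qed

lemma incr_product:
  assumes "0 \<le> s" "s \<le> t" "sq_adp s \<eta>" "0 \<le> u" "u \<le> v" "sq_adp u \<xi>"
  shows "expectation (\<lambda>\<omega>. incr s t \<eta> \<omega> * incr u v \<xi> \<omega>) = overlap s t u v * expectation (\<lambda>\<omega>. \<eta> \<omega> \<bullet> \<xi> \<omega>)"
proof (cases "s \<le> u")
  case True
  then show ?thesis using assms by (intro incr_product_ordered)
next
  case False
  then have "expectation (\<lambda>\<omega>. incr u v \<xi> \<omega> * incr s t \<eta> \<omega>) = overlap u v s t * expectation (\<lambda>\<omega>. \<xi> \<omega> \<bullet> \<eta> \<omega>)"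
    using assms by (intro incr_product_ordered) auto
  then show ?thesis by (simp add: overlap_def mult.commute inner_commute min.commute max.commute)
qed

lemma sq_adp_inner_integrable:
  assumes "sq_adp s \<eta>" "sq_adp u \<xi>" shows "integrable M (\<lambda>\<omega>. \<eta> \<omega> \<bullet> \<xi> \<omega>)"
  using sq_adp_nth_mult(1)[OF sq_adp_mono[OF assms(1), of "max s u"] sq_adp_mono[OF assms(2), of "max s u"]]
  unfolding inner_sum2 by (intro Bochner_Integration.integrable_add) auto

text \<open>The intervals of the family may overlap. A difference of two step processes with different
  partitions is thus a family again, and no common refinement is needed.\<close>

definition step_value :: "'i set \<Rightarrow> ('i \<Rightarrow> real) \<Rightarrow> ('i \<Rightarrow> real) \<Rightarrow> ('i \<Rightarrow> 'w \<Rightarrow> real^2) \<Rightarrow> real \<Rightarrow> 'w \<Rightarrow> real^2" where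
  "step_value I s t \<eta> r \<omega> = (\<Sum>i\<in>I. indicator {s i..<t i} r *\<^sub>R \<eta> i \<omega>)"

lemma step_value_square_integral:
  assumes st: "\<And>i. i \<in> I \<Longrightarrow> s i \<le> t i"
  shows "has_bochner_integral lborel (\<lambda>r. (norm (step_value I s t \<eta> r \<omega>))\<^sup>2)
     (\<Sum>i\<in>I. \<Sum>j\<in>I. overlap (s i) (t i) (s j) (t j) * (\<eta> i \<omega> \<bullet> \<eta> j \<omega>))"
proof -
  have eq: "(norm (step_value I s t \<eta> r \<omega>))\<^sup>2
     = (\<Sum>i\<in>I. \<Sum>j\<in>I. indicator ({s i..<t i} \<inter> {s j..<t j}) r * (\<eta> i \<omega> \<bullet> \<eta> j \<omega>))" for r
    unfolding step_value_def power2_norm_eq_inner inner_sum_left inner_sum_right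
    by (intro sum.cong refl) (auto simp: indicator_def inner_commute)
  have hb: "has_bochner_integral lborel (indicator ({s i..<t i} \<inter> {s j..<t j}) :: real \<Rightarrow> real) (overlap (s i) (t i) (s j) (t j))" for i j
  proof -
    have "{s i..<t i} \<inter> {s j..<t j} = {max (s i) (s j)..<min (t i) (t j)}" by auto
    moreover have "measure lborel {max (s i) (s j)..<min (t i) (t j)} = overlap (s i) (t i) (s j) (t j)"
      by (cases "max (s i) (s j) \<le> min (t i) (t j)") (auto simp: overlap_def measure_def)
    moreover have "emeasure lborel {max (s i) (s j)..<min (t i) (t j)} < \<infinity>"
      by (cases "max (s i) (s j) \<le> min (t i) (t j)") auto
    ultimately show ?thesis
      using has_bochner_integral_real_indicator[of "{max (s i) (s j)..<min (t i) (t j)}" lborel] by simp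
  qed
  show ?thesis unfolding eq
    by (intro has_bochner_integral_sum has_bochner_integral_mult_left hb)
qed

text \<open>Both sides expand into the same double sum over pairs of intervals, by \<open>incr_product\<close> on the left
  and by integrating products of indicators on the right.\<close>

lemma ito_isometry:
  assumes st: "\<And>i. i \<in> I \<Longrightarrow> 0 \<le> s i \<and> s i \<le> t i" and \<eta>: "\<And>i. i \<in> I \<Longrightarrow> sq_adp (s i) (\<eta> i)"
  shows "(\<integral>\<^sup>+\<omega>. ennreal ((\<Sum>i\<in>I. incr (s i) (t i) (\<eta> i) \<omega>)\<^sup>2) \<partial>M)
     = (\<integral>\<^sup>+\<omega>. \<integral>\<^sup>+r. ennreal ((norm (step_value I s t \<eta> r \<omega>))\<^sup>2) \<partial>lborel \<partial>M)"
proof -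
  let ?Q = "\<lambda>\<omega>. \<Sum>i\<in>I. \<Sum>j\<in>I. overlap (s i) (t i) (s j) (t j) * (\<eta> i \<omega> \<bullet> \<eta> j \<omega>)"
  have sq: "(\<Sum>i\<in>I. incr (s i) (t i) (\<eta> i) \<omega>)\<^sup>2 = (\<Sum>i\<in>I. \<Sum>j\<in>I. incr (s i) (t i) (\<eta> i) \<omega> * incr (s j) (t j) (\<eta> j) \<omega>)" for \<omega>
    by (simp add: power2_eq_square sum_product)
  have int: "integrable M (\<lambda>\<omega>. \<Sum>i\<in>I. \<Sum>j\<in>I. incr (s i) (t i) (\<eta> i) \<omega> * incr (s j) (t j) (\<eta> j) \<omega>)"
    using st \<eta> by (intro Bochner_Integration.integrable_sum incr_product_integrable) auto
  have ii: "integrable M (\<lambda>\<omega>. \<eta> i \<omega> \<bullet> \<eta> j \<omega>)" if "i \<in> I" "j \<in> I" for i j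
    using sq_adp_inner_integrable[OF \<eta>[OF that(1)] \<eta>[OF that(2)]] .
  have intQ: "integrable M ?Q"
    using \<eta> by (intro Bochner_Integration.integrable_sum integrable_mult_right sq_adp_inner_integrable) auto
  have hb: "has_bochner_integral lborel (\<lambda>r. (norm (step_value I s t \<eta> r \<omega>))\<^sup>2) (?Q \<omega>)" for \<omega>
    by (rule step_value_square_integral) (use st in auto)
  have Q0: "0 \<le> ?Q \<omega>" for \<omega>
    unfolding has_bochner_integral_integral_eq[OF hb, symmetric] by (rule integral_nonneg_AE) auto
  have nnQ: "(\<integral>\<^sup>+r. ennreal ((norm (step_value I s t \<eta> r \<omega>))\<^sup>2) \<partial>lborel) = ennreal (?Q \<omega>)" for \<omega>
    using hb[of \<omega>] by (subst nn_integral_eq_integral) (auto simp: has_bochner_integral_iff)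
  have "(\<integral>\<^sup>+\<omega>. ennreal ((\<Sum>i\<in>I. incr (s i) (t i) (\<eta> i) \<omega>)\<^sup>2) \<partial>M) = ennreal (expectation (\<lambda>\<omega>. (\<Sum>i\<in>I. incr (s i) (t i) (\<eta> i) \<omega>)\<^sup>2))"
    using int unfolding sq[symmetric] by (intro nn_integral_eq_integral) auto
  also have "expectation (\<lambda>\<omega>. (\<Sum>i\<in>I. incr (s i) (t i) (\<eta> i) \<omega>)\<^sup>2) = (\<Sum>i\<in>I. \<Sum>j\<in>I. expectation (\<lambda>\<omega>. incr (s i) (t i) (\<eta> i) \<omega> * incr (s j) (t j) (\<eta> j) \<omega>))"
    unfolding sq using st \<eta> by (simp add: Bochner_Integration.integral_sum incr_product_integrable Bochner_Integration.integrable_sum)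
  also have "\<dots> = (\<Sum>i\<in>I. \<Sum>j\<in>I. expectation (\<lambda>\<omega>. overlap (s i) (t i) (s j) (t j) * (\<eta> i \<omega> \<bullet> \<eta> j \<omega>)))"
    using st \<eta> by (intro sum.cong refl) (simp add: incr_product)
  also have "\<dots> = expectation ?Q"
    by (simp add: Bochner_Integration.integral_sum ii Bochner_Integration.integrable_sum)
  also have "ennreal (expectation ?Q) = (\<integral>\<^sup>+\<omega>. ennreal (?Q \<omega>) \<partial>M)"
    using intQ Q0 by (intro nn_integral_eq_integral[symmetric]) auto
  also have "\<dots> = (\<integral>\<^sup>+\<omega>. \<integral>\<^sup>+r. ennreal ((norm (step_value I s t \<eta> r \<omega>))\<^sup>2) \<partial>lborel \<partial>M)"
    by (simp only: nnQ)
  finally show ?thesis .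
qed

end

section \<open>The fast process\<close>

text \<open>The term linear in \<open>w\<close> is kept because its expectation vanishes for an independent centred \<open>w\<close>;
  the term \<open>4 (y \<bullet> w) (norm w)\<^sup>2\<close> of the expansion is absorbed by the last two.\<close>

lemma norm_add_power4_le:
  fixes y w :: "'a::real_inner"
  shows "norm (y + w) ^ 4 \<le> norm y ^ 4 + 4 * ((norm y)\<^sup>2 * (y \<bullet> w)) + 8 * ((norm y)\<^sup>2 * (norm w)\<^sup>2) + 3 * norm w ^ 4"
proof -
  define a b c where "a = norm y" and "b = norm w" and "c = y \<bullet> w"
  have c: "\<bar>c\<bar> \<le> a * b" unfolding a_def b_def c_def by (rule Cauchy_Schwarz_ineq2)
  have ab: "a \<ge> 0" "b \<ge> 0" by (auto simp: a_def b_def)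
  have "norm (y + w) ^ 4 = ((norm (y + w))\<^sup>2)\<^sup>2" by (simp flip: power_mult)
  also have "(norm (y + w))\<^sup>2 = a\<^sup>2 + 2 * c + b\<^sup>2"
    by (simp add: a_def b_def c_def power2_norm_eq_inner inner_add_left inner_add_right inner_commute)
  also have "(a\<^sup>2 + 2 * c + b\<^sup>2)\<^sup>2 = a ^ 4 + 4 * (a\<^sup>2 * c) + b ^ 4 + 2 * (a\<^sup>2 * b\<^sup>2) + 4 * c\<^sup>2 + 4 * (c * b\<^sup>2)"
    by algebra
  also have "\<dots> \<le> a ^ 4 + 4 * (a\<^sup>2 * c) + 8 * (a\<^sup>2 * b\<^sup>2) + 3 * b ^ 4"
  proof -
    have c2: "c\<^sup>2 \<le> a\<^sup>2 * b\<^sup>2" using power_mono[OF c, of 2] by (simp add: power_mult_distrib)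
    have "c * b\<^sup>2 \<le> (a * b) * b\<^sup>2" using c by (intro mult_right_mono) auto
    moreover have "2 * ((a * b) * b\<^sup>2) \<le> a\<^sup>2 * b\<^sup>2 + b ^ 4"
      using zero_le_power2[of "a * b - b\<^sup>2"] by (simp add: power2_eq_square power4_eq_xxxx algebra_simps)
    ultimately show ?thesis using c2 by linarith
  qed
  finally show ?thesis by (simp add: a_def b_def c_def)
qed

lemma mat_M_vec: "(mat_M \<beta> *v x) $ 1 = x $ 1 + \<beta> * x $ 2" "(mat_M \<beta> *v x) $ 2 = - \<beta> * x $ 1 + x $ 2"
  by (simp_all add: mat_M_def matrix_vector_mult_def sum_2)

lemma norm_square2: "(norm (x::real^2))\<^sup>2 = (x $ 1)\<^sup>2 + (x $ 2)\<^sup>2"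
  unfolding power2_norm_eq_inner inner_vec_def sum_2 by (simp add: power2_eq_square)

text \<open>As \<open>mat_M \<beta>\<close> is the identity plus a skew matrix, the squared norm is multiplied by exactly
  \<open>(1 - r)\<^sup>2 + \<beta>\<^sup>2 r\<^sup>2\<close>, which is at most \<open>1 - r\<close> for small \<open>r\<close>.\<close>

lemma mat_M_contraction:
  fixes p :: "real^2"
  assumes r: "0 \<le> r" "(1 + \<beta>\<^sup>2) * r \<le> 1"
  shows "norm (p - r *\<^sub>R (mat_M \<beta> *v p)) ^ 4 \<le> (1 - r)\<^sup>2 * norm p ^ 4"
proof -
  have "(norm (p - r *\<^sub>R (mat_M \<beta> *v p)))\<^sup>2 = (1 - 2 * r + (1 + \<beta>\<^sup>2) * r\<^sup>2) * (norm p)\<^sup>2"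
    unfolding norm_square2 by (simp add: mat_M_vec power2_eq_square algebra_simps)
  also have "\<dots> \<le> (1 - r) * (norm p)\<^sup>2"
    using mult_right_mono[OF r(2) r(1)] by (intro mult_right_mono) (auto simp: power2_eq_square algebra_simps)
  finally have "((norm (p - r *\<^sub>R (mat_M \<beta> *v p)))\<^sup>2)\<^sup>2 \<le> ((1 - r) * (norm p)\<^sup>2)\<^sup>2"
    by (rule power_mono) simp
  then show ?thesis by (simp add: power_mult_distrib flip: power_mult)
qed

context brownian_inputs begin

text \<open>The Euler iterates are adapted, and adaptedness passes to almost sure limits.\<close>

lemma adp_linear_solution:
  fixes Y G :: "real \<Rightarrow> 'w \<Rightarrow> real^2" and B :: "real^2^2"
  assumes Y: "Y t \<in> borel_measurable M" and Y0: "adp 0 (Y 0)" and G: "\<And>s. 0 \<le> s \<Longrightarrow> adp s (G s)"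
    and eq: "AE \<omega> in M. continuous_on {0..} (\<lambda>s. Y s \<omega>) \<and>
        (\<forall>s\<ge>0. Y s \<omega> = Y 0 \<omega> + integral {0..s} (\<lambda>r. B *v Y r \<omega>) + G s \<omega>)"
    and t: "0 \<le> t"
  shows "adp t (Y t)"
proof (rule adp_limit[OF _ Y])
  have "k \<le> N \<Longrightarrow> adp t (\<lambda>\<omega>. euler B (Y 0 \<omega>) (\<lambda>s. G s \<omega>) t N k)" for N k
  proof (induction k)
    case 0 then show ?case using adp_mono[OF Y0 t] by simp
  next
    case (Suc k)
    have "adp t (G (grid 0 t N j))" if "j \<le> N" for j
      using grid_bounds[OF t that] G adp_mono by blast
    then show ?case using Suc by (simp, intro adp_add adp_diff adp_scaleR adp_matrix) auto
  qed
  then show "adp t (\<lambda>\<omega>. euler B (Y 0 \<omega>) (\<lambda>s. G s \<omega>) t N N)" for N by blast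
  show "AE \<omega> in M. (\<lambda>N. euler B (Y 0 \<omega>) (\<lambda>s. G s \<omega>) t N N) \<longlonglongrightarrow> Y t \<omega>"
    using eq
  proof eventually_elim
    case (elim \<omega>)
    have c: "continuous_on {0..t} (\<lambda>s. Y s \<omega>)" by (rule continuous_on_subset[OF conjunct1[OF elim]]) simp
    show ?case by (rule euler_tendsto[OF t c], rule conjunct2[OF elim, rule_format]) simp
  qed
qed

lemma increment_norm2:
  assumes "0 \<le> s" "s \<le> t"
  shows "integrable M (\<lambda>\<omega>. (norm (W t \<omega> - W s \<omega>))\<^sup>2)" "expectation (\<lambda>\<omega>. (norm (W t \<omega> - W s \<omega>))\<^sup>2) = 2 * (t - s)"
proof -
  have eq: "(norm (W t \<omega> - W s \<omega>))\<^sup>2 = (W t \<omega> - W s \<omega>) $ 1 * (W t \<omega> - W s \<omega>) $ 1 + (W t \<omega> - W s \<omega>) $ 2 * (W t \<omega> - W s \<omega>) $ 2" for \<omega>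
    unfolding norm_square2 by (simp add: power2_eq_square)
  note c = increment_moments(3,4)[OF assms]
  show "integrable M (\<lambda>\<omega>. (norm (W t \<omega> - W s \<omega>))\<^sup>2)" unfolding eq by (intro Bochner_Integration.integrable_add c)
  show "expectation (\<lambda>\<omega>. (norm (W t \<omega> - W s \<omega>))\<^sup>2) = 2 * (t - s)" unfolding eq
    by (simp add: Bochner_Integration.integral_add c del: vector_minus_component)
qed

lemma increment_mom4: "0 \<le> s \<Longrightarrow> s \<le> t \<Longrightarrow> mom M 4 (\<lambda>\<omega>. W t \<omega> - W s \<omega>) (12 * (t - s)\<^sup>2)"
  by (rule gaussian_mom4_scalar[OF prob_space_axioms W_gauss])

lemma mom4_integrable:
  assumes Y: "mom M 4 Y c" "Y \<in> borel_measurable M" and k: "k \<le> 4"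
  shows "integrable M (\<lambda>\<omega>. norm (Y \<omega>) ^ k)"
proof (rule Bochner_Integration.integrable_bound)
  show "integrable M (\<lambda>\<omega>. 1 + norm (Y \<omega>) ^ 4)" using mom_integrable[OF Y] by simp
  have "x ^ k \<le> 1 + x ^ 4" if "0 \<le> x" for x :: real
  proof (cases "x \<le> 1")
    case True then show ?thesis using power_le_one[OF that True, of k] zero_le_power[OF that, of 4] by linarith
  next
    case False
    then have "x ^ k \<le> x ^ 4" by (intro power_increasing[OF k]) auto
    then show ?thesis by simp
  qed
  then show "AE \<omega> in M. norm (norm (Y \<omega>) ^ k) \<le> norm (1 + norm (Y \<omega>) ^ 4)" by simp
qed (use Y in measurable)

text \<open>The expectation of \<open>norm_add_power4_le\<close>. The mixed term contains the second moment of \<open>y\<close>, which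
  \<open>2 x\<^sup>2 \<le> l + x\<^sup>4 / l\<close> reduces to the fourth; \<open>l\<close> is to be chosen of the order of \<open>(norm y)\<^sup>2\<close>.\<close>

lemma mom4_add_increment:
  assumes st: "0 \<le> s" "s \<le> t" and y: "adp s y" "mom M 4 y c" and l: "l > 0"
  shows "mom M 4 (\<lambda>\<omega>. y \<omega> + (W t \<omega> - W s \<omega>)) (c + 8 * (t - s) * (l + c / l) + 36 * (t - s)\<^sup>2)"
proof -
  let ?w = "\<lambda>\<omega>. W t \<omega> - W s \<omega>"
  have [measurable]: "y \<in> borel_measurable M" using y adp_measurable by blast
  have [measurable]: "?w \<in> borel_measurable M" using st by auto
  have yi: "integrable M (\<lambda>\<omega>. norm (y \<omega>) ^ k)" if "k \<le> 4" for k
    using mom4_integrable[OF y(2) _ that] by simp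
  have Z: "adp s (\<lambda>\<omega>. (norm (y \<omega>))\<^sup>2 * y \<omega> $ i)" for i
    unfolding power2_norm_eq_inner by (intro adp_mult adp_inner adp_nth y)
  have Zi: "integrable M (\<lambda>\<omega>. (norm (y \<omega>))\<^sup>2 * y \<omega> $ i)" for i
  proof (rule Bochner_Integration.integrable_bound[OF yi[of 3]])
    show "AE \<omega> in M. norm ((norm (y \<omega>))\<^sup>2 * y \<omega> $ i) \<le> norm (norm (y \<omega>) ^ 3)"
    proof (intro AE_I2)
      fix \<omega>
      have "(norm (y \<omega>))\<^sup>2 * \<bar>y \<omega> $ i\<bar> \<le> (norm (y \<omega>))\<^sup>2 * norm (y \<omega>)"
        by (intro mult_left_mono component_le_norm_cart) auto
      also have "\<dots> = norm (y \<omega>) ^ 3" by (simp add: power3_eq_cube power2_eq_square)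
      finally show "norm ((norm (y \<omega>))\<^sup>2 * y \<omega> $ i) \<le> norm (norm (y \<omega>) ^ 3)" by (simp add: abs_mult)
    qed
  qed (use yi[of 3] adp_measurable[OF Z] in auto)
  note lin = adp_increment_mean[OF st Z Zi]
  have lin_eq: "(norm (y \<omega>))\<^sup>2 * (y \<omega> \<bullet> ?w \<omega>) = (norm (y \<omega>))\<^sup>2 * y \<omega> $ 1 * ?w \<omega> $ 1 + (norm (y \<omega>))\<^sup>2 * y \<omega> $ 2 * ?w \<omega> $ 2" for \<omega>
    unfolding inner_sum2 by (simp add: algebra_simps)
  have lin0: "integrable M (\<lambda>\<omega>. (norm (y \<omega>))\<^sup>2 * (y \<omega> \<bullet> ?w \<omega>))" "expectation (\<lambda>\<omega>. (norm (y \<omega>))\<^sup>2 * (y \<omega> \<bullet> ?w \<omega>)) = 0"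
    unfolding lin_eq using lin by (simp_all add: Bochner_Integration.integral_add Bochner_Integration.integrable_add del: vector_minus_component)
  have y2: "adp s (\<lambda>\<omega>. (norm (y \<omega>))\<^sup>2)" unfolding power2_norm_eq_inner by (intro adp_inner y)
  have quad: "integrable M (\<lambda>\<omega>. (norm (y \<omega>))\<^sup>2 * (norm (?w \<omega>))\<^sup>2)"
     "expectation (\<lambda>\<omega>. (norm (y \<omega>))\<^sup>2 * (norm (?w \<omega>))\<^sup>2) = expectation (\<lambda>\<omega>. (norm (y \<omega>))\<^sup>2) * (2 * (t - s))"
    using adp_times_increment[OF st y2 yi[of 2], of "\<lambda>x. (norm x)\<^sup>2"] increment_norm2[OF st] by simp_all
  note w4 = increment_mom4[OF st]
  have w4i: "integrable M (\<lambda>\<omega>. norm (?w \<omega>) ^ 4)" by (rule mom_integrable[OF w4]) simp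
  have Ew4: "expectation (\<lambda>\<omega>. norm (?w \<omega>) ^ 4) \<le> 12 * (t - s)\<^sup>2" by (rule mom_expectation_le'[OF w4]) simp
  have Ey4: "expectation (\<lambda>\<omega>. norm (y \<omega>) ^ 4) \<le> c" by (rule mom_expectation_le'[OF y(2)]) simp
  have Ey2: "2 * expectation (\<lambda>\<omega>. (norm (y \<omega>))\<^sup>2) \<le> l + c / l"
  proof -
    have "2 * expectation (\<lambda>\<omega>. (norm (y \<omega>))\<^sup>2) = expectation (\<lambda>\<omega>. 2 * (norm (y \<omega>))\<^sup>2)" by simp
    also have "\<dots> \<le> expectation (\<lambda>\<omega>. l + (1 / l) * norm (y \<omega>) ^ 4)"
    proof (rule integral_mono)
      show "integrable M (\<lambda>\<omega>. 2 * (norm (y \<omega>))\<^sup>2)" using yi[of 2] by simp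
      show "integrable M (\<lambda>\<omega>. l + (1 / l) * norm (y \<omega>) ^ 4)" using yi[of 4] by simp
      fix \<omega>
      have "0 \<le> (l - (norm (y \<omega>))\<^sup>2)\<^sup>2" by simp
      then have "l * (2 * (norm (y \<omega>))\<^sup>2) \<le> l * (l + (1 / l) * norm (y \<omega>) ^ 4)"
        using l by (simp add: power2_eq_square power4_eq_xxxx algebra_simps)
      then show "2 * (norm (y \<omega>))\<^sup>2 \<le> l + (1 / l) * norm (y \<omega>) ^ 4" using l by simp
    qed
    also have "\<dots> = l + (1 / l) * expectation (\<lambda>\<omega>. norm (y \<omega>) ^ 4)" using yi[of 4] by (simp add: prob_space)
    also have "\<dots> \<le> l + (1 / l) * c" using Ey4 l by (intro add_left_mono mult_left_mono) auto
    finally show ?thesis by simp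
  qed
  let ?R = "\<lambda>\<omega>. norm (y \<omega>) ^ 4 + 4 * ((norm (y \<omega>))\<^sup>2 * (y \<omega> \<bullet> ?w \<omega>)) + 8 * ((norm (y \<omega>))\<^sup>2 * (norm (?w \<omega>))\<^sup>2) + 3 * norm (?w \<omega>) ^ 4"
  have Ri: "integrable M ?R" using yi[of 4] lin0 quad w4i by simp
  have i4: "integrable M (\<lambda>\<omega>. norm (y \<omega> + ?w \<omega>) ^ 4)"
  proof (rule Bochner_Integration.integrable_bound[OF Ri])
    show "AE \<omega> in M. norm (norm (y \<omega> + ?w \<omega>) ^ 4) \<le> norm (?R \<omega>)"
      using norm_add_power4_le by (intro AE_I2) (auto intro: order_trans[OF _ abs_ge_self])
  qed measurable
  have "expectation (\<lambda>\<omega>. norm (y \<omega> + ?w \<omega>) ^ 4) \<le> expectation ?R"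
    by (intro integral_mono i4 Ri norm_add_power4_le)
  also have "\<dots> = expectation (\<lambda>\<omega>. norm (y \<omega>) ^ 4) + 8 * (expectation (\<lambda>\<omega>. (norm (y \<omega>))\<^sup>2) * (2 * (t - s))) + 3 * expectation (\<lambda>\<omega>. norm (?w \<omega>) ^ 4)"
    using yi[of 4] lin0 quad w4i by simp
  also have "\<dots> \<le> c + 8 * (t - s) * (l + c / l) + 36 * (t - s)\<^sup>2"
    using Ey4 Ew4 mult_left_mono[OF Ey2, of "8 * (t - s)"] st by (simp add: algebra_simps)
  finally show ?thesis using i4 by (intro momI) auto
qed

text \<open>The bound is preserved by each Euler step: contraction by \<open>mat_M\<close> outweighs the contribution of the
  noise. Fatou's lemma carries it over to the solution. Any constant that is at least \<open>64 + 36\<close>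
  would do, where 64 and 36 come from \<open>mom4_add_increment\<close>.\<close>

lemma fast_process_mom4:
  fixes P :: "real \<Rightarrow> 'w \<Rightarrow> real^2"
  assumes \<epsilon>: "\<epsilon> > 0" and P0: "P 0 = P0" and g: "gaussian_rv M 0 ((\<epsilon> / 2) *\<^sub>R mat 1) P0"
    and eq: "AE \<omega> in M. continuous_on {0..} (\<lambda>s. P s \<omega>) \<and>
        (\<forall>s\<ge>0. P s \<omega> = P 0 \<omega> + integral {0..s} (\<lambda>r. (- (1 / \<epsilon>) *\<^sub>R mat_M \<beta>) *v P r \<omega>) + W s \<omega>)"
    and t: "0 \<le> t"
  shows "mom M 4 (P t) (100 * \<epsilon>\<^sup>2)"
proof -
  define B where "B = - (1 / \<epsilon>) *\<^sub>R mat_M \<beta>"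
  have Bv: "B *v x = - ((1 / \<epsilon>) *\<^sub>R (mat_M \<beta> *v x))" for x
  proof -
    have "B *v x = (- (1 / \<epsilon>)) *\<^sub>R (mat_M \<beta> *v x)"
      unfolding B_def by (rule scaleR_matrix_vector_assoc[symmetric])
    then show ?thesis by simp
  qed
  let ?E = "\<lambda>N k \<omega>. euler B (P 0 \<omega>) (\<lambda>s. W s \<omega>) t N k"
  \<comment> \<open>Beyond \<open>N0\<close> the step size is small enough for \<open>mat_M_contraction\<close>.\<close>
  obtain N0 :: nat where N0: "(1 + \<beta>\<^sup>2) * t / \<epsilon> < real N0" using reals_Archimedean2 by blast
  have step: "adp (grid 0 t N k) (?E N k) \<and> mom M 4 (?E N k) (100 * \<epsilon>\<^sup>2)" if N: "N0 < N" and k: "k \<le> N" for N k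
    using k
  proof (induction k)
    case 0
    have "mom M 4 P0 (100 * \<epsilon>\<^sup>2)"
      by (rule mom_mono[OF gaussian_mom4_scalar[OF prob_space_axioms g]]) (simp add: power_divide)
    then show ?case using P0 adp_P0 by simp
  next
    case (Suc k)
    define \<delta> where "\<delta> = t / real N"
    define r where "r = \<delta> / \<epsilon>"
    have Npos: "real N > 0" using N by simp
    have r0: "r \<ge> 0" using t \<epsilon> by (simp add: r_def \<delta>_def)
    have r1: "(1 + \<beta>\<^sup>2) * r \<le> 1"
    proof -
      have "(1 + \<beta>\<^sup>2) * t / \<epsilon> \<le> real N" using N0 N by linarith
      then have "((1 + \<beta>\<^sup>2) * t / \<epsilon>) / real N \<le> 1" using Npos by (simp only: divide_le_eq_1_pos)
      then show ?thesis by (simp add: r_def \<delta>_def mult.commute)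
    qed
    have "1 * r \<le> (1 + \<beta>\<^sup>2) * r" using r0 by (intro mult_right_mono) auto
    then have r2: "r \<le> 1" using r1 by linarith
    have \<delta>: "\<delta> = r * \<epsilon>" using \<epsilon> by (simp add: r_def)
    have IH: "adp (grid 0 t N k) (?E N k)" "mom M 4 (?E N k) (100 * \<epsilon>\<^sup>2)" using Suc by auto
    let ?y = "\<lambda>\<omega>. ?E N k \<omega> - r *\<^sub>R (mat_M \<beta> *v ?E N k \<omega>)"
    have gr: "0 \<le> grid 0 t N k" "grid 0 t N k \<le> grid 0 t N (Suc k)" "grid 0 t N (Suc k) - grid 0 t N k = \<delta>"
      using grid_bounds[OF t, of k N] grid_cell[OF t, of k N] Suc by (auto simp: grid_Suc \<delta>_def)
    have ya: "adp (grid 0 t N k) ?y" by (intro adp_diff adp_scaleR adp_matrix IH)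
    have ym: "mom M 4 ?y ((1 - r)\<^sup>2 * (100 * \<epsilon>\<^sup>2))"
    proof -
      have "norm (?y \<omega>) \<le> sqrt (1 - r) * norm (?E N k \<omega>)" for \<omega>
      proof (rule power_le_imp_le_base[of _ 3])
        show "norm (?y \<omega>) ^ Suc 3 \<le> (sqrt (1 - r) * norm (?E N k \<omega>)) ^ Suc 3"
        proof -
          have "sqrt (1 - r) ^ 4 = ((sqrt (1 - r))\<^sup>2)\<^sup>2" by (simp flip: power_mult)
          also have "\<dots> = (1 - r)\<^sup>2" using r2 by simp
          finally show ?thesis using mat_M_contraction[OF r0 r1, of "?E N k \<omega>"]
            by (simp add: power_mult_distrib)
        qed
      qed (use r2 in simp)
      then have "mom M 4 ?y (sqrt (1 - r) ^ 4 * (100 * \<epsilon>\<^sup>2))"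
        using r2 by (intro mom_bounded_scale[OF IH(2)] measurable_completion adp_measurable[OF ya]) auto
      moreover have "sqrt (1 - r) ^ 4 = ((sqrt (1 - r))\<^sup>2)\<^sup>2" by (simp flip: power_mult)
      ultimately show ?thesis using r2 by simp
    qed
    have Esuc: "?E N (Suc k) = (\<lambda>\<omega>. ?y \<omega> + (W (grid 0 t N (Suc k)) \<omega> - W (grid 0 t N k) \<omega>))"
      by (simp add: fun_eq_iff r_def \<delta>_def Bv)
    \<comment> \<open>The parameter \<open>8 \<epsilon>\<close> makes the mixed term cost at most \<open>r\<close> times the old moment, plus \<open>64 r \<epsilon>\<^sup>2\<close>.\<close>
    have m1: "mom M 4 (?E N (Suc k)) ((1 - r)\<^sup>2 * (100 * \<epsilon>\<^sup>2) + 8 * \<delta> * (8 * \<epsilon> + (1 - r)\<^sup>2 * (100 * \<epsilon>\<^sup>2) / (8 * \<epsilon>)) + 36 * \<delta>\<^sup>2)"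
      unfolding Esuc using mom4_add_increment[OF gr(1,2) ya ym, of "8 * \<epsilon>"] \<epsilon> gr(3) by simp
    have e1: "(1 - r)\<^sup>2 * (100 * \<epsilon>\<^sup>2) + 8 * \<delta> * (8 * \<epsilon> + (1 - r)\<^sup>2 * (100 * \<epsilon>\<^sup>2) / (8 * \<epsilon>)) + 36 * \<delta>\<^sup>2
       = \<epsilon>\<^sup>2 * (100 * ((1 - r) * ((1 - r) * (1 + r))) + 64 * r + 36 * r\<^sup>2)"
      using \<epsilon> by (simp add: \<delta> power2_eq_square field_simps)
    have l1: "\<epsilon>\<^sup>2 * (100 * ((1 - r) * ((1 - r) * (1 + r))) + 64 * r + 36 * r\<^sup>2) \<le> \<epsilon>\<^sup>2 * 100"
    proof (intro mult_left_mono)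
      define z where "z = (1 - r) * ((1 - r) * (1 + r))"
      have "z \<le> (1 - r) * 1"
        unfolding z_def using r0 r2 by (intro mult_left_mono) (auto simp: algebra_simps)
      moreover have "r\<^sup>2 \<le> r" using r0 r2 by (simp add: power2_eq_square mult_left_le)
      ultimately have "100 * z + 64 * r + 36 * r\<^sup>2 \<le> 100" by simp
      then show "100 * ((1 - r) * ((1 - r) * (1 + r))) + 64 * r + 36 * r\<^sup>2 \<le> 100" by (simp only: z_def)
    qed simp
    have "mom M 4 (?E N (Suc k)) (\<epsilon>\<^sup>2 * 100)" by (rule mom_mono[OF m1, unfolded e1, OF l1])
    then have "mom M 4 (?E N (Suc k)) (100 * \<epsilon>\<^sup>2)" by (simp only: mult.commute)
    moreover have "adp (grid 0 t N (Suc k)) (?E N (Suc k))"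
      unfolding Esuc using gr grid_bounds[OF t, of k N] Suc
      by (intro adp_add adp_diff adp_W adp_mono[OF ya]) auto
    ultimately show ?case by blast
  qed
  show ?thesis
  proof (rule mom_tendsto)
    show "mom M 4 (?E (n + Suc N0) (n + Suc N0)) (100 * \<epsilon>\<^sup>2)" for n
      using step[of "n + Suc N0" "n + Suc N0"] by simp
    show "AE \<omega> in M. (\<lambda>n. ?E (n + Suc N0) (n + Suc N0) \<omega>) \<longlonglongrightarrow> P t \<omega>"
      using eq
    proof eventually_elim
      case (elim \<omega>)
      have "(\<lambda>N. ?E N N \<omega>) \<longlonglongrightarrow> P t \<omega>"
      proof (rule euler_tendsto[OF t])
        show "continuous_on {0..t} (\<lambda>s. P s \<omega>)" by (rule continuous_on_subset[OF conjunct1[OF elim]]) simp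
      qed (unfold B_def, rule conjunct2[OF elim, rule_format], simp)
      then show ?case by (rule LIMSEQ_ignore_initial_segment)
    qed
  qed simp
qed

section \<open>Quadratic variation\<close>

text \<open>The covariance of the increment is \<open>(t - s) I\<close>, so the quadratic form has mean \<open>(t - s) tr G\<close>.\<close>

lemma increment_quadratic_form:
  fixes G :: "real^2^2"
  assumes st: "0 \<le> s" "s \<le> t"
  defines "q \<equiv> \<lambda>x. x \<bullet> (G *v x) - (t - s) * (G $ 1 $ 1 + G $ 2 $ 2)"
  shows "expectation (\<lambda>\<omega>. q (W t \<omega> - W s \<omega>)) = 0"
    and "mom M 2 (\<lambda>\<omega>. q (W t \<omega> - W s \<omega>)) (4 * (12 * (onorm ((*v) G))\<^sup>2 + (G $ 1 $ 1 + G $ 2 $ 2)\<^sup>2) * (t - s)\<^sup>2)"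
proof -
  let ?w = "\<lambda>\<omega>. W t \<omega> - W s \<omega>" and ?tr = "G $ 1 $ 1 + G $ 2 $ 2" and ?L = "onorm ((*v) G)"
  have wm[measurable]: "?w \<in> borel_measurable M" using st by auto
  have eq: "x \<bullet> (G *v x) = G $ 1 $ 1 * (x $ 1 * x $ 1) + G $ 1 $ 2 * (x $ 1 * x $ 2) + G $ 2 $ 1 * (x $ 2 * x $ 1) + G $ 2 $ 2 * (x $ 2 * x $ 2)" for x
    unfolding inner_sum2 by (simp add: matrix_vector_mult_def sum_2 algebra_simps)
  note c = increment_moments(3,4)[OF st]
  have i: "integrable M (\<lambda>\<omega>. ?w \<omega> \<bullet> (G *v ?w \<omega>))" unfolding eq
    by (intro Bochner_Integration.integrable_add integrable_mult_right c)
  have "expectation (\<lambda>\<omega>. ?w \<omega> \<bullet> (G *v ?w \<omega>)) = (t - s) * ?tr" unfolding eq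
    by (simp add: Bochner_Integration.integral_add Bochner_Integration.integrable_add c algebra_simps del: vector_minus_component)
  then show "expectation (\<lambda>\<omega>. q (?w \<omega>)) = 0" unfolding q_def using i by (simp add: prob_space)
  have "mom M 2 (\<lambda>\<omega>. ?w \<omega> \<bullet> (G *v ?w \<omega>)) (12 * ?L\<^sup>2 * (t - s)\<^sup>2)"
  proof -
    have w4: "mom M 4 ?w (12 * (t - s)\<^sup>2)" by (rule increment_mom4[OF st])
    have le: "(norm (?w \<omega> \<bullet> (G *v ?w \<omega>)))\<^sup>2 \<le> ?L\<^sup>2 * norm (?w \<omega>) ^ 4" for \<omega>
    proof -
      have "norm (?w \<omega> \<bullet> (G *v ?w \<omega>)) \<le> norm (?w \<omega>) * norm (G *v ?w \<omega>)" by (simp add: Cauchy_Schwarz_ineq2)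
      also have "\<dots> \<le> norm (?w \<omega>) * (?L * norm (?w \<omega>))" by (intro mult_left_mono norm_matrix_vector_le) auto
      finally have "(norm (?w \<omega> \<bullet> (G *v ?w \<omega>)))\<^sup>2 \<le> (?L * (norm (?w \<omega>))\<^sup>2)\<^sup>2"
        by (intro power_mono) (auto simp: power2_eq_square mult_ac)
      then show ?thesis by (simp add: power_mult_distrib flip: power_mult)
    qed
    have i4: "integrable M (\<lambda>\<omega>. ?L\<^sup>2 * norm (?w \<omega>) ^ 4)" using mom_integrable[OF w4] by simp
    have i2: "integrable M (\<lambda>\<omega>. (norm (?w \<omega> \<bullet> (G *v ?w \<omega>)))\<^sup>2)"
      by (rule Bochner_Integration.integrable_bound[OF i4]) (use le in auto)
    have "expectation (\<lambda>\<omega>. (norm (?w \<omega> \<bullet> (G *v ?w \<omega>)))\<^sup>2) \<le> expectation (\<lambda>\<omega>. ?L\<^sup>2 * norm (?w \<omega>) ^ 4)"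
      by (intro integral_mono i2 i4 le)
    also have "\<dots> \<le> ?L\<^sup>2 * (12 * (t - s)\<^sup>2)"
      using mom_expectation_le'[OF w4] by (simp add: mult_left_mono)
    finally show ?thesis using i2 by (intro momI) (auto simp: mult_ac)
  qed
  moreover have "mom M 2 (\<lambda>_. - ((t - s) * ?tr)) (?tr\<^sup>2 * (t - s)\<^sup>2)"
    by (rule momI) (auto simp: prob_space power_mult_distrib)
  ultimately have "mom M 2 (\<lambda>\<omega>. ?w \<omega> \<bullet> (G *v ?w \<omega>) + - ((t - s) * ?tr)) (2\<^sup>2 * (12 * ?L\<^sup>2 * (t - s)\<^sup>2 + ?tr\<^sup>2 * (t - s)\<^sup>2))"
    by (rule mom_add)
  then show "mom M 2 (\<lambda>\<omega>. q (?w \<omega>)) (4 * (12 * ?L\<^sup>2 + ?tr\<^sup>2) * (t - s)\<^sup>2)"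
    unfolding q_def by (simp add: algebra_simps)
qed

text \<open>The centred terms are orthogonal, and each of the \<open>N\<close> terms has a second moment of order
  \<open>((b - a) / N)\<^sup>2\<close>.\<close>

lemma quadratic_variation_mom2:
  fixes G :: "real^2^2"
  assumes ab: "0 \<le> a" "a \<le> b" and N: "N > 0"
  defines "c \<equiv> 4 * (12 * (onorm ((*v) G))\<^sup>2 + (G $ 1 $ 1 + G $ 2 $ 2)\<^sup>2)"
    and "\<Delta> \<equiv> \<lambda>i \<omega>. W (grid a b N (Suc i)) \<omega> - W (grid a b N i) \<omega>"
  shows "mom M 2 (\<lambda>\<omega>. (\<Sum>i<N. \<Delta> i \<omega> \<bullet> (G *v \<Delta> i \<omega>)) - (b - a) * (G $ 1 $ 1 + G $ 2 $ 2)) (c * (b - a)\<^sup>2 / real N)"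
proof -
  let ?tr = "G $ 1 $ 1 + G $ 2 $ 2"
  define \<delta> where "\<delta> = (b - a) / real N"
  define q where "q x = x \<bullet> (G *v x) - \<delta> * ?tr" for x
  have qm: "q \<in> borel_measurable borel" unfolding q_def by measurable
  have S: "adp (grid a b N k) (\<lambda>\<omega>. \<Sum>i<k. q (\<Delta> i \<omega>)) \<and> mom M 2 (\<lambda>\<omega>. \<Sum>i<k. q (\<Delta> i \<omega>)) (real k * (c * \<delta>\<^sup>2))" if "k \<le> N" for k
    using that
  proof (induction k)
    case 0 then show ?case by (simp add: adp_const mom_def)
  next
    case (Suc k)
    let ?S = "\<lambda>\<omega>. \<Sum>i<k. q (\<Delta> i \<omega>)"
    have g: "0 \<le> grid a b N k" "grid a b N k \<le> grid a b N (Suc k)" "grid a b N (Suc k) - grid a b N k = \<delta>"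
      using grid_bounds[OF ab(2), of k N] grid_cell[OF ab(2), of k N] Suc ab by (auto simp: grid_Suc \<delta>_def)
    have IH: "adp (grid a b N k) ?S" "mom M 2 ?S (real k * (c * \<delta>\<^sup>2))" using Suc by auto
    have Sm[measurable]: "?S \<in> borel_measurable M" using IH(1) by (rule adp_measurable)
    have q0: "expectation (\<lambda>\<omega>. q (\<Delta> k \<omega>)) = 0" and q2: "mom M 2 (\<lambda>\<omega>. q (\<Delta> k \<omega>)) (c * \<delta>\<^sup>2)"
      using increment_quadratic_form[OF g(1,2), of G] by (simp_all add: q_def \<Delta>_def c_def g(3))
    have dm[measurable]: "\<Delta> k \<in> borel_measurable M" unfolding \<Delta>_def using g by (auto intro!: borel_measurable_diff)
    have qm'[measurable]: "(\<lambda>\<omega>. q (\<Delta> k \<omega>)) \<in> borel_measurable M" using measurable_compose[OF dm qm] .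
    have i2: "integrable M (\<lambda>\<omega>. (?S \<omega>)\<^sup>2)" "integrable M (\<lambda>\<omega>. (q (\<Delta> k \<omega>))\<^sup>2)"
      using mom_integrable[OF IH(2)] mom_integrable[OF q2] by simp_all
    have i1: "integrable M ?S" "integrable M (\<lambda>\<omega>. q (\<Delta> k \<omega>))"
      using i2 by (auto intro!: square_integrable_imp_integrable)
    have cross: "integrable M (\<lambda>\<omega>. ?S \<omega> * q (\<Delta> k \<omega>))" "expectation (\<lambda>\<omega>. ?S \<omega> * q (\<Delta> k \<omega>)) = 0"
      using adp_times_increment[OF g(1,2) IH(1) i1(1) qm] i1(2) q0 by (simp_all add: \<Delta>_def)
    have sq: "(norm (?S \<omega> + q (\<Delta> k \<omega>)))\<^sup>2 = (?S \<omega>)\<^sup>2 + (q (\<Delta> k \<omega>))\<^sup>2 + 2 * (?S \<omega> * q (\<Delta> k \<omega>))" for \<omega>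
      by (simp add: power2_sum)
    have "mom M 2 (\<lambda>\<omega>. ?S \<omega> + q (\<Delta> k \<omega>)) (real k * (c * \<delta>\<^sup>2) + c * \<delta>\<^sup>2)"
    proof (rule momI)
      show "integrable M (\<lambda>\<omega>. (norm (?S \<omega> + q (\<Delta> k \<omega>)))\<^sup>2)" unfolding sq
        using i2 cross by (intro Bochner_Integration.integrable_add integrable_mult_right) auto
      have "expectation (\<lambda>\<omega>. (norm (?S \<omega> + q (\<Delta> k \<omega>)))\<^sup>2) = expectation (\<lambda>\<omega>. (?S \<omega>)\<^sup>2) + expectation (\<lambda>\<omega>. (q (\<Delta> k \<omega>))\<^sup>2)"
        unfolding sq using i2 cross by simp
      also have "\<dots> \<le> real k * (c * \<delta>\<^sup>2) + c * \<delta>\<^sup>2"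
        using mom_expectation_le'[OF IH(2)] mom_expectation_le'[OF q2] by simp
      finally show "expectation (\<lambda>\<omega>. (norm (?S \<omega> + q (\<Delta> k \<omega>)))\<^sup>2) \<le> real k * (c * \<delta>\<^sup>2) + c * \<delta>\<^sup>2" .
    qed measurable
    moreover have "adp (grid a b N (Suc k)) (\<lambda>\<omega>. ?S \<omega> + q (\<Delta> k \<omega>))"
      unfolding q_def \<Delta>_def using g
      by (intro adp_add adp_diff adp_inner adp_matrix adp_W adp_const adp_mono[OF IH(1)[unfolded q_def \<Delta>_def]]) auto
    ultimately show ?case by (simp add: algebra_simps)
  qed
  have "(\<Sum>i<N. q (\<Delta> i \<omega>)) = (\<Sum>i<N. \<Delta> i \<omega> \<bullet> (G *v \<Delta> i \<omega>)) - (b - a) * ?tr" for \<omega>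
    using N by (simp add: q_def sum_subtractf \<delta>_def)
  moreover have "real N * (c * \<delta>\<^sup>2) = c * (b - a)\<^sup>2 / real N" using N by (simp add: \<delta>_def power2_eq_square)
  ultimately show ?thesis using S[of N] by simp
qed

end

section \<open>Pathwise decomposition of the smooth stochastic integral\<close>

text \<open>Comparing the coefficients of \<open>x\<^sub>1\<^sup>2\<close>, \<open>x\<^sub>1 x\<^sub>2\<close> and \<open>x\<^sub>2\<^sup>2\<close> gives three linear equations for the entries
  of the symmetric matrix \<open>G\<close>; \<open>q\<close> is its off-diagonal entry. The traces of \<open>G M\<close> and \<open>A M\<close> agree,
  and the skew part of \<open>M\<close> contributes nothing to the trace of \<open>G M\<close>.\<close>

lemma quadratic_corrector_exists:
  fixes A :: "real^2^2"
  shows "\<exists>G :: real^2^2. (\<forall>x y. x \<bullet> (G *v y) = y \<bullet> (G *v x)) \<and>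
     (\<forall>x. (G *v x) \<bullet> (mat_M \<beta> *v x) = x \<bullet> (A *v (mat_M \<beta> *v x))) \<and>
     G $ 1 $ 1 + G $ 2 $ 2 = transpose A ::\<^sub>F mat_M \<beta>"
proof -
  define N where "N = A ** mat_M \<beta>"
  define q where "q = (N $ 1 $ 2 + N $ 2 $ 1 - \<beta> * (N $ 1 $ 1 - N $ 2 $ 2)) / (2 * (1 + \<beta>\<^sup>2))"
  define G :: "real^2^2" where "G = vector [vector [N $ 1 $ 1 + \<beta> * q, q], vector [q, N $ 2 $ 2 - \<beta> * q]]"
  have G: "G $ 1 $ 1 = N $ 1 $ 1 + \<beta> * q" "G $ 1 $ 2 = q" "G $ 2 $ 1 = q" "G $ 2 $ 2 = N $ 2 $ 2 - \<beta> * q"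
    by (simp_all add: G_def)
  have Gv: "(G *v x) $ 1 = (N $ 1 $ 1 + \<beta> * q) * x $ 1 + q * x $ 2" "(G *v x) $ 2 = q * x $ 1 + (N $ 2 $ 2 - \<beta> * q) * x $ 2" for x
    by (simp_all add: matrix_vector_mult_def sum_2 G)
  have b: "1 + \<beta>\<^sup>2 \<noteq> 0" using zero_le_power2[of \<beta>] by linarith
  have q: "2 * (1 + \<beta>\<^sup>2) * q = N $ 1 $ 2 + N $ 2 $ 1 - \<beta> * (N $ 1 $ 1 - N $ 2 $ 2)"
    using b by (simp add: q_def)
  show ?thesis
  proof (intro exI[of _ G] conjI allI)
    show "x \<bullet> (G *v y) = y \<bullet> (G *v x)" for x y by (simp add: inner_sum2 Gv algebra_simps)
    show "(G *v x) \<bullet> (mat_M \<beta> *v x) = x \<bullet> (A *v (mat_M \<beta> *v x))" for x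
    proof -
      have "x \<bullet> (A *v (mat_M \<beta> *v x)) = x \<bullet> (N *v x)" by (simp add: N_def matrix_vector_mul_assoc)
      also have "\<dots> = N $ 1 $ 1 * (x $ 1)\<^sup>2 + (N $ 1 $ 2 + N $ 2 $ 1) * (x $ 1 * x $ 2) + N $ 2 $ 2 * (x $ 2)\<^sup>2"
        by (simp add: inner_sum2 matrix_vector_mult_def sum_2 power2_eq_square algebra_simps)
      also have "N $ 1 $ 2 + N $ 2 $ 1 = 2 * (1 + \<beta>\<^sup>2) * q + \<beta> * (N $ 1 $ 1 - N $ 2 $ 2)" using q by simp
      finally show ?thesis
        by (simp add: inner_sum2 Gv mat_M_vec power2_eq_square algebra_simps)
    qed
    show "G $ 1 $ 1 + G $ 2 $ 2 = transpose A ::\<^sub>F mat_M \<beta>"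
      by (simp add: G frob_def N_def trace_def sum_2 transpose_transpose)
  qed
qed

text \<open>One realisation of the two-scale system on \<open>[a, b]\<close>, with \<open>s = \<surd>\<gamma>\<close>: here \<open>x\<close> is the slow and \<open>p\<close> the
  fast path, and \<open>w\<close> the Brownian path, of which only continuity is known.\<close>

locale smooth_path =
  fixes A G :: "real^2^2" and s \<epsilon> \<beta> a b :: real and x p w :: "real \<Rightarrow> real^2"
  assumes ab: "a \<le> b"
    and x: "continuous_on {a..b} x" and p: "continuous_on {a..b} p" and w: "continuous_on {a..b} w"
    and v_inc: "\<And>c d. a \<le> c \<Longrightarrow> c \<le> d \<Longrightarrow> d \<le> b \<Longrightarrow> (w d - p d) - (w c - p c) = integral {c..d} (\<lambda>t. (1 / \<epsilon>) *\<^sub>R (mat_M \<beta> *v p t))"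
    and x_inc: "\<And>c d. a \<le> c \<Longrightarrow> c \<le> d \<Longrightarrow> d \<le> b \<Longrightarrow> x d - x c = integral {c..d} (\<lambda>t. A *v x t + (s / \<epsilon>) *\<^sub>R (mat_M \<beta> *v p t))"
    and G_sym: "\<And>x y. x \<bullet> (G *v y) = y \<bullet> (G *v x)"
    and G_M: "\<And>x. (G *v x) \<bullet> (mat_M \<beta> *v x) = x \<bullet> (A *v (mat_M \<beta> *v x))"
begin

definition u :: "real \<Rightarrow> real^2" where "u t = (1 / \<epsilon>) *\<^sub>R (mat_M \<beta> *v p t)"

lemma u_cont: "continuous_on {a..b} u" unfolding u_def[abs_def] by (intro continuous_intros p)

lemma x_inc': "a \<le> c \<Longrightarrow> c \<le> d \<Longrightarrow> d \<le> b \<Longrightarrow> x d - x c = integral {c..d} (\<lambda>t. A *v x t + s *\<^sub>R u t)"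
  using x_inc[of c d] by (simp add: u_def)

lemma v_inc': "a \<le> c \<Longrightarrow> c \<le> d \<Longrightarrow> d \<le> b \<Longrightarrow> (w d - p d) - (w c - p c) = integral {c..d} u"
  using v_inc[of c d] by (simp add: u_def[abs_def])

lemma dx_cont: "continuous_on {a..b} (\<lambda>t. A *v x t + s *\<^sub>R u t)" by (intro continuous_intros x u_cont)

text \<open>The value of \<open>\<integral> (A x)\<^sup>T dw\<close>. It is computed as \<open>\<integral> (A x)\<^sup>T d(w - p) + \<integral> (A x)\<^sup>T dp\<close>, where \<open>w - p\<close> is
  smooth and the second integral is integrated by parts.\<close>

definition left_limit :: real where
  "left_limit = integral {a..b} (\<lambda>t. (A *v x t) \<bullet> u t) + ((A *v x b) \<bullet> p b - (A *v x a) \<bullet> p a)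
     - integral {a..b} (\<lambda>t. (transpose A *v p t) \<bullet> (A *v x t + s *\<^sub>R u t))"

lemma transpose_inner: "(A *v y) \<bullet> z = (transpose A *v z) \<bullet> y" for y z :: "real^2"
  by (metis dot_lmul_matrix inner_commute transpose_matrix_vector)

lemma left_sums_tendsto:
  "(\<lambda>N. \<Sum>i<N. (A *v x (grid a b N i)) \<bullet> (w (grid a b N (Suc i)) - w (grid a b N i))) \<longlonglongrightarrow> left_limit"
proof -
  let ?g = "grid a b"
  have 1: "(\<lambda>N. \<Sum>i<N. (A *v x (?g N i)) \<bullet> ((w (?g N (Suc i)) - p (?g N (Suc i))) - (w (?g N i) - p (?g N i))))
      \<longlonglongrightarrow> integral {a..b} (\<lambda>t. (A *v x t) \<bullet> u t)"
    by (rule grid_sums_tendsto[OF ab _ u_cont v_inc']) (auto intro!: continuous_intros x simp: grid_mono[OF ab])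
  have 2: "(\<lambda>N. \<Sum>i<N. (transpose A *v p (?g N (Suc i))) \<bullet> (x (?g N (Suc i)) - x (?g N i)))
      \<longlonglongrightarrow> integral {a..b} (\<lambda>t. (transpose A *v p t) \<bullet> (A *v x t + s *\<^sub>R u t))"
    by (rule grid_sums_tendsto[OF ab _ dx_cont x_inc', where s = "\<lambda>N i. ?g N (Suc i)"], rule continuous_on_matrix_vector[OF p])
      (auto simp: grid_mono[OF ab])
  have tel: "(\<Sum>i<N. (A *v x (?g N i)) \<bullet> (w (?g N (Suc i)) - w (?g N i))) =
     (\<Sum>i<N. (A *v x (?g N i)) \<bullet> ((w (?g N (Suc i)) - p (?g N (Suc i))) - (w (?g N i) - p (?g N i))))
     + ((A *v x b) \<bullet> p b - (A *v x a) \<bullet> p a)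
     - (\<Sum>i<N. (transpose A *v p (?g N (Suc i))) \<bullet> (x (?g N (Suc i)) - x (?g N i)))" if "N > 0" for N
  proof -
    have "(A *v x b) \<bullet> p b - (A *v x a) \<bullet> p a = (\<Sum>i<N. (A *v x (?g N (Suc i))) \<bullet> p (?g N (Suc i)) - (A *v x (?g N i)) \<bullet> p (?g N i))"
      using that sum_lessThan_telescope[of "\<lambda>i. (A *v x (?g N i)) \<bullet> p (?g N i)" N] by simp
    moreover have "(transpose A *v p (?g N (Suc i))) \<bullet> (x (?g N (Suc i)) - x (?g N i))
        = (A *v x (?g N (Suc i))) \<bullet> p (?g N (Suc i)) - (A *v x (?g N i)) \<bullet> p (?g N (Suc i))" for i
      by (simp add: transpose_inner inner_diff_right)
    ultimately show ?thesis
      by (simp add: sum.distrib[symmetric] sum_subtractf[symmetric]) (intro sum.cong refl, simp add: inner_diff_right)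
  qed
  show ?thesis unfolding left_limit_def
    by (rule Lim_transform_eventually[OF tendsto_diff[OF tendsto_add[OF 1 tendsto_const] 2]])
       (use eventually_gt_at_top[of 0] in eventually_elim, simp add: tel)
qed

text \<open>Up to terms that converge to zero, this is what the telescoping sum of \<open>p \<bullet> (G *v p)\<close> leaves: twice
  the left-point sum of \<open>\<integral> (G p)\<^sup>T dw\<close> plus the centred quadratic variation of \<open>w\<close>.\<close>

definition square_limit :: real where
  "square_limit = (p b \<bullet> (G *v p b) - p a \<bullet> (G *v p a)) + 2 * integral {a..b} (\<lambda>t. (G *v p t) \<bullet> u t)
     - (b - a) * (G $ 1 $ 1 + G $ 2 $ 2)"

lemma square_sums_tendsto:
  "(\<lambda>N. 2 * (\<Sum>i<N. (G *v p (grid a b N i)) \<bullet> (w (grid a b N (Suc i)) - w (grid a b N i)))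
     + ((\<Sum>i<N. (w (grid a b N (Suc i)) - w (grid a b N i)) \<bullet> (G *v (w (grid a b N (Suc i)) - w (grid a b N i))))
        - (b - a) * (G $ 1 $ 1 + G $ 2 $ 2))) \<longlonglongrightarrow> square_limit"
proof -
  let ?g = "grid a b"
  let ?dv = "\<lambda>N i. (w (?g N (Suc i)) - p (?g N (Suc i))) - (w (?g N i) - p (?g N i))"
  let ?dw = "\<lambda>N i. w (?g N (Suc i)) - w (?g N i)"
  have 1: "(\<lambda>N. \<Sum>i<N. (G *v p (?g N i)) \<bullet> ?dv N i) \<longlonglongrightarrow> integral {a..b} (\<lambda>t. (G *v p t) \<bullet> u t)"
    by (rule grid_sums_tendsto[OF ab _ u_cont v_inc']) (auto intro!: continuous_intros p simp: grid_mono[OF ab])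
  have 2: "(\<lambda>N. \<Sum>i<N. (G *v (p (?g N i) + w (?g N i))) \<bullet> ?dv N i) \<longlonglongrightarrow> integral {a..b} (\<lambda>t. (G *v (p t + w t)) \<bullet> u t)"
    by (rule grid_sums_tendsto[OF ab _ u_cont v_inc']) (auto intro!: continuous_intros p w simp: grid_mono[OF ab])
  have 3: "(\<lambda>N. \<Sum>i<N. (G *v (p (?g N (Suc i)) + w (?g N (Suc i)))) \<bullet> ?dv N i) \<longlonglongrightarrow> integral {a..b} (\<lambda>t. (G *v (p t + w t)) \<bullet> u t)"
    by (rule grid_sums_tendsto[OF ab _ u_cont v_inc', where s = "\<lambda>N i. ?g N (Suc i)"]) (auto intro!: continuous_intros p w simp: grid_mono[OF ab])
  have tel: "2 * (\<Sum>i<N. (G *v p (?g N i)) \<bullet> ?dw N i) + ((\<Sum>i<N. ?dw N i \<bullet> (G *v ?dw N i)) - (b - a) * (G $ 1 $ 1 + G $ 2 $ 2))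
     = (p b \<bullet> (G *v p b) - p a \<bullet> (G *v p a)) + 2 * (\<Sum>i<N. (G *v p (?g N i)) \<bullet> ?dv N i)
       + ((\<Sum>i<N. (G *v (p (?g N (Suc i)) + w (?g N (Suc i)))) \<bullet> ?dv N i) - (\<Sum>i<N. (G *v (p (?g N i) + w (?g N i))) \<bullet> ?dv N i))
       - (b - a) * (G $ 1 $ 1 + G $ 2 $ 2)" if "N > 0" for N
  proof -
    have t: "p b \<bullet> (G *v p b) - p a \<bullet> (G *v p a) = (\<Sum>i<N. p (?g N (Suc i)) \<bullet> (G *v p (?g N (Suc i))) - p (?g N i) \<bullet> (G *v p (?g N i)))"
      using that sum_lessThan_telescope[of "\<lambda>i. p (?g N i) \<bullet> (G *v p (?g N i))" N] by simp
    \<comment> \<open>With \<open>v = w - p\<close>: the cross terms of \<open>w\<close> and \<open>p\<close> combine to \<open>G (p + w)\<close> against increments of \<open>v\<close>, at both end points.\<close>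
    have alg: "2 * ((G *v p0) \<bullet> (w1 - w0)) + (w1 - w0) \<bullet> (G *v (w1 - w0)) =
        (p1 \<bullet> (G *v p1) - p0 \<bullet> (G *v p0)) + 2 * ((G *v p0) \<bullet> ((w1 - p1) - (w0 - p0)))
        + ((G *v (p1 + w1)) \<bullet> ((w1 - p1) - (w0 - p0)) - (G *v (p0 + w0)) \<bullet> ((w1 - p1) - (w0 - p0)))" for p0 p1 w0 w1
      using G_sym[of p0 p1] G_sym[of p0 w0] G_sym[of p0 w1] G_sym[of p1 w0] G_sym[of p1 w1] G_sym[of w0 w1]
      by (simp add: matrix_vector_mult_diff_distrib matrix_vector_right_distrib inner_add_left inner_add_right
          inner_diff_left inner_diff_right inner_commute[of "G *v _" _])
    have "2 * (\<Sum>i<N. (G *v p (?g N i)) \<bullet> ?dw N i) + (\<Sum>i<N. ?dw N i \<bullet> (G *v ?dw N i))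
       = (\<Sum>i<N. 2 * ((G *v p (?g N i)) \<bullet> ?dw N i) + ?dw N i \<bullet> (G *v ?dw N i))"
      by (simp add: sum.distrib sum_distrib_left)
    also have "\<dots> = (\<Sum>i<N. (p (?g N (Suc i)) \<bullet> (G *v p (?g N (Suc i))) - p (?g N i) \<bullet> (G *v p (?g N i)))
         + 2 * ((G *v p (?g N i)) \<bullet> ?dv N i)
         + ((G *v (p (?g N (Suc i)) + w (?g N (Suc i)))) \<bullet> ?dv N i - (G *v (p (?g N i) + w (?g N i))) \<bullet> ?dv N i))"
      by (intro sum.cong refl alg)
    also have "\<dots> = (p b \<bullet> (G *v p b) - p a \<bullet> (G *v p a)) + 2 * (\<Sum>i<N. (G *v p (?g N i)) \<bullet> ?dv N i)
       + ((\<Sum>i<N. (G *v (p (?g N (Suc i)) + w (?g N (Suc i)))) \<bullet> ?dv N i) - (\<Sum>i<N. (G *v (p (?g N i) + w (?g N i))) \<bullet> ?dv N i))"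
      unfolding t by (simp only: sum.distrib sum_subtractf sum_distrib_left)
    finally show ?thesis by linarith
  qed
  have "(\<lambda>N. (p b \<bullet> (G *v p b) - p a \<bullet> (G *v p a)) + 2 * (\<Sum>i<N. (G *v p (?g N i)) \<bullet> ?dv N i)
       + ((\<Sum>i<N. (G *v (p (?g N (Suc i)) + w (?g N (Suc i)))) \<bullet> ?dv N i) - (\<Sum>i<N. (G *v (p (?g N i) + w (?g N i))) \<bullet> ?dv N i))
       - (b - a) * (G $ 1 $ 1 + G $ 2 $ 2)) \<longlonglongrightarrow>
     (p b \<bullet> (G *v p b) - p a \<bullet> (G *v p a)) + 2 * integral {a..b} (\<lambda>t. (G *v p t) \<bullet> u t)
     + (integral {a..b} (\<lambda>t. (G *v (p t + w t)) \<bullet> u t) - integral {a..b} (\<lambda>t. (G *v (p t + w t)) \<bullet> u t)) - (b - a) * (G $ 1 $ 1 + G $ 2 $ 2)"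
    by (intro tendsto_intros 1 2 3)
  then have "(\<lambda>N. (p b \<bullet> (G *v p b) - p a \<bullet> (G *v p a)) + 2 * (\<Sum>i<N. (G *v p (?g N i)) \<bullet> ?dv N i)
       + ((\<Sum>i<N. (G *v (p (?g N (Suc i)) + w (?g N (Suc i)))) \<bullet> ?dv N i) - (\<Sum>i<N. (G *v (p (?g N i) + w (?g N i))) \<bullet> ?dv N i))
       - (b - a) * (G $ 1 $ 1 + G $ 2 $ 2)) \<longlonglongrightarrow> square_limit"
    by (simp add: square_limit_def)
  then show ?thesis
    by (rule Lim_transform_eventually) (use eventually_gt_at_top[of 0] in eventually_elim, simp only: tel)
qed

text \<open>The term \<open>s\<^sup>2 (b - a) tr G / 2\<close> is the correction. On the right, the first two terms converge to the
  parts of the Ito integral against \<open>dX\<close>, and the others vanish together with \<open>p\<close>.\<close>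

lemma rs_integral_decomposition:
  "rs_integral (\<lambda>t. A *v x t) x a b - s\<^sup>2 / 2 * (b - a) * (G $ 1 $ 1 + G $ 2 $ 2)
    = integral {a..b} (\<lambda>t. (A *v x t) \<bullet> (A *v x t)) + s * left_limit
      - s * ((A *v x b) \<bullet> p b - (A *v x a) \<bullet> p a)
      + s * integral {a..b} (\<lambda>t. p t \<bullet> (A *v (A *v x t)))
      + s\<^sup>2 / 2 * (square_limit - (p b \<bullet> (G *v p b) - p a \<bullet> (G *v p a)))"
proof -
  note ii = integrable_continuous_real
  have cA: "continuous_on {a..b} (\<lambda>t. A *v x t)" by (intro continuous_intros x)
  have rs: "rs_integral (\<lambda>t. A *v x t) x a b = integral {a..b} (\<lambda>t. (A *v x t) \<bullet> (A *v x t + s *\<^sub>R u t))"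
    by (rule rs_integral_C1[OF ab cA dx_cont x_inc'])
  also have "\<dots> = integral {a..b} (\<lambda>t. (A *v x t) \<bullet> (A *v x t)) + s * integral {a..b} (\<lambda>t. (A *v x t) \<bullet> u t)"
    by (simp add: inner_add_right integral_add[OF ii ii] continuous_intros cA u_cont)
  finally have J: "rs_integral (\<lambda>t. A *v x t) x a b = integral {a..b} (\<lambda>t. (A *v x t) \<bullet> (A *v x t)) + s * integral {a..b} (\<lambda>t. (A *v x t) \<bullet> u t)" .
  have "integral {a..b} (\<lambda>t. (transpose A *v p t) \<bullet> (A *v x t + s *\<^sub>R u t))
      = integral {a..b} (\<lambda>t. p t \<bullet> (A *v (A *v x t)) + s * (p t \<bullet> (A *v u t)))"
  proof (intro arg_cong[where f="integral _"] ext)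
    fix t
    have "(transpose A *v p t) \<bullet> (A *v x t + s *\<^sub>R u t) = p t \<bullet> (A *v (A *v x t + s *\<^sub>R u t))"
      by (metis transpose_inner inner_commute)
    then show "(transpose A *v p t) \<bullet> (A *v x t + s *\<^sub>R u t) = p t \<bullet> (A *v (A *v x t)) + s * (p t \<bullet> (A *v u t))"
      by (simp only: matrix_vector_right_distrib matrix_vector_mult_scaleR inner_add_right inner_scaleR_right)
  qed
  also have "\<dots> = integral {a..b} (\<lambda>t. p t \<bullet> (A *v (A *v x t))) + s * integral {a..b} (\<lambda>t. p t \<bullet> (A *v u t))"
    by (simp add: integral_add[OF ii ii] continuous_intros x p u_cont)
  also have "integral {a..b} (\<lambda>t. p t \<bullet> (A *v u t)) = integral {a..b} (\<lambda>t. (G *v p t) \<bullet> u t)"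
    by (intro arg_cong[where f="integral _"] ext)
       (simp add: u_def G_M matrix_vector_mult_scaleR)
  finally have T: "integral {a..b} (\<lambda>t. (transpose A *v p t) \<bullet> (A *v x t + s *\<^sub>R u t))
      = integral {a..b} (\<lambda>t. p t \<bullet> (A *v (A *v x t))) + s * integral {a..b} (\<lambda>t. (G *v p t) \<bullet> u t)" .
  define i1 i2 i3 i4 where "i1 = integral {a..b} (\<lambda>t. (A *v x t) \<bullet> (A *v x t))" and "i2 = integral {a..b} (\<lambda>t. (A *v x t) \<bullet> u t)"
    and "i3 = integral {a..b} (\<lambda>t. p t \<bullet> (A *v (A *v x t)))" and "i4 = integral {a..b} (\<lambda>t. (G *v p t) \<bullet> u t)"
  show ?thesis
    unfolding J left_limit_def T square_limit_def i1_def[symmetric] i2_def[symmetric] i3_def[symmetric] i4_def[symmetric]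
    by (simp add: power2_eq_square algebra_simps add_divide_distrib diff_divide_distrib)
qed

end

section \<open>Rates of moments in the scale parameter\<close>

text \<open>Uniformity in time lets the bounds survive integration over time.\<close>

definition order_mom :: "'w measure \<Rightarrow> real \<Rightarrow> nat \<Rightarrow> nat \<Rightarrow>
    (real \<Rightarrow> real \<Rightarrow> 'w \<Rightarrow> 'b::{banach, second_countable_topology}) \<Rightarrow> bool" where
  "order_mom M T p r f \<longleftrightarrow> (\<exists>c. \<forall>\<epsilon> t. 0 < \<epsilon> \<longrightarrow> \<epsilon> \<le> 1 \<longrightarrow> t \<in> {0..T} \<longrightarrow> mom M p (f \<epsilon> t) (c * \<epsilon> ^ r))"

lemma order_momI: "(\<And>\<epsilon> t. 0 < \<epsilon> \<Longrightarrow> \<epsilon> \<le> 1 \<Longrightarrow> t \<in> {0..T} \<Longrightarrow> mom M p (f \<epsilon> t) (c * \<epsilon> ^ r)) \<Longrightarrow> order_mom M T p r f"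
  unfolding order_mom_def by blast

lemma order_momE:
  assumes "order_mom M T p r f"
  obtains c where "\<And>\<epsilon> t. 0 < \<epsilon> \<Longrightarrow> \<epsilon> \<le> 1 \<Longrightarrow> t \<in> {0..T} \<Longrightarrow> mom M p (f \<epsilon> t) (c * \<epsilon> ^ r)"
  using assms unfolding order_mom_def by blast

lemma order_mom_add:
  assumes "order_mom M T p r f" "order_mom M T p r g"
  shows "order_mom M T p r (\<lambda>\<epsilon> t \<omega>. f \<epsilon> t \<omega> + g \<epsilon> t \<omega>)"
proof -
  obtain c where c: "\<And>\<epsilon> t. 0 < \<epsilon> \<Longrightarrow> \<epsilon> \<le> 1 \<Longrightarrow> t \<in> {0..T} \<Longrightarrow> mom M p (f \<epsilon> t) (c * \<epsilon> ^ r)" using order_momE[OF assms(1)] by blast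
  obtain d where d: "\<And>\<epsilon> t. 0 < \<epsilon> \<Longrightarrow> \<epsilon> \<le> 1 \<Longrightarrow> t \<in> {0..T} \<Longrightarrow> mom M p (g \<epsilon> t) (d * \<epsilon> ^ r)" using order_momE[OF assms(2)] by blast
  show ?thesis
  proof (rule order_momI[of T M p _ "2 ^ p * (c + d)"])
    fix \<epsilon> t :: real assume "0 < \<epsilon>" "\<epsilon> \<le> 1" "t \<in> {0..T}"
    from mom_add[OF c[OF this] d[OF this]] show "mom M p (\<lambda>\<omega>. f \<epsilon> t \<omega> + g \<epsilon> t \<omega>) (2 ^ p * (c + d) * \<epsilon> ^ r)"
      by (simp add: algebra_simps)
  qed
qed

lemma order_mom_scaleR:
  assumes "order_mom M T p r f" shows "order_mom M T p r (\<lambda>\<epsilon> t \<omega>. k *\<^sub>R f \<epsilon> t \<omega>)"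
proof -
  obtain c where c: "\<And>\<epsilon> t. 0 < \<epsilon> \<Longrightarrow> \<epsilon> \<le> 1 \<Longrightarrow> t \<in> {0..T} \<Longrightarrow> mom M p (f \<epsilon> t) (c * \<epsilon> ^ r)" using order_momE[OF assms] by blast
  show ?thesis
    by (rule order_momI[of T M p _ "\<bar>k\<bar> ^ p * c"]) (use mom_scaleR[OF c, of _ _ k] in \<open>simp add: mult.assoc\<close>)
qed

lemma order_mom_diff:
  assumes "order_mom M T p r f" "order_mom M T p r g"
  shows "order_mom M T p r (\<lambda>\<epsilon> t \<omega>. f \<epsilon> t \<omega> - g \<epsilon> t \<omega>)"
  using order_mom_add[OF assms(1) order_mom_scaleR[OF assms(2), of "-1"]] by simp

lemma order_mom_matrix:
  fixes f :: "real \<Rightarrow> real \<Rightarrow> 'w \<Rightarrow> real^'n" and B :: "real^'n^'m"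
  assumes "order_mom M T p r f" shows "order_mom M T p r (\<lambda>\<epsilon> t \<omega>. B *v f \<epsilon> t \<omega>)"
proof -
  obtain c where c: "\<And>\<epsilon> t. 0 < \<epsilon> \<Longrightarrow> \<epsilon> \<le> 1 \<Longrightarrow> t \<in> {0..T} \<Longrightarrow> mom M p (f \<epsilon> t) (c * \<epsilon> ^ r)" using order_momE[OF assms] by blast
  show ?thesis
    by (rule order_momI[of T M p _ "onorm ((*v) B) ^ p * c"]) (use mom_matrix[OF c, of _ _ B] in \<open>simp add: mult.assoc\<close>)
qed

lemma order_mom_weaken:
  assumes "order_mom M T p r f" "r' \<le> r" shows "order_mom M T p r' f"
proof -
  obtain c where c: "\<And>\<epsilon> t. 0 < \<epsilon> \<Longrightarrow> \<epsilon> \<le> 1 \<Longrightarrow> t \<in> {0..T} \<Longrightarrow> mom M p (f \<epsilon> t) (c * \<epsilon> ^ r)" using order_momE[OF assms(1)] by blast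
  show ?thesis
  proof (rule order_momI[of T M p _ "\<bar>c\<bar>"])
    fix \<epsilon> t :: real assume e: "0 < \<epsilon>" "\<epsilon> \<le> 1" "t \<in> {0..T}"
    have "c * \<epsilon> ^ r \<le> \<bar>c\<bar> * \<epsilon> ^ r'" using e assms(2) by (intro mult_mono power_decreasing) auto
    then show "mom M p (f \<epsilon> t) (\<bar>c\<bar> * \<epsilon> ^ r')" by (rule mom_mono[OF c[OF e]])
  qed
qed

text \<open>The choice \<open>\<delta> = \<epsilon>\<^sup>j / \<epsilon>\<^sup>i\<close> in \<open>mom_mult\<close> makes both terms of the same order.\<close>

lemma order_mom_inner:
  fixes f g :: "real \<Rightarrow> real \<Rightarrow> 'w \<Rightarrow> real^'n"
  assumes "order_mom M T 4 (2 * i) f" "order_mom M T 4 (2 * j) g"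
  shows "order_mom M T 2 (i + j) (\<lambda>\<epsilon> t \<omega>. f \<epsilon> t \<omega> \<bullet> g \<epsilon> t \<omega>)"
proof -
  obtain c where c: "\<And>\<epsilon> t. 0 < \<epsilon> \<Longrightarrow> \<epsilon> \<le> 1 \<Longrightarrow> t \<in> {0..T} \<Longrightarrow> mom M 4 (f \<epsilon> t) (c * \<epsilon> ^ (2 * i))" using order_momE[OF assms(1)] by blast
  obtain d where d: "\<And>\<epsilon> t. 0 < \<epsilon> \<Longrightarrow> \<epsilon> \<le> 1 \<Longrightarrow> t \<in> {0..T} \<Longrightarrow> mom M 4 (g \<epsilon> t) (d * \<epsilon> ^ (2 * j))" using order_momE[OF assms(2)] by blast
  show ?thesis
  proof (rule order_momI[of T M 2 _ "c + d"])
    fix \<epsilon> t :: real assume e: "0 < \<epsilon>" "\<epsilon> \<le> 1" "t \<in> {0..T}"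
    note [measurable] = mom_measurable[OF c[OF e]] mom_measurable[OF d[OF e]]
    have "mom M 2 (\<lambda>\<omega>. f \<epsilon> t \<omega> \<bullet> g \<epsilon> t \<omega>) (\<epsilon> ^ j / \<epsilon> ^ i * (c * \<epsilon> ^ (2 * i)) + d * \<epsilon> ^ (2 * j) / (\<epsilon> ^ j / \<epsilon> ^ i))"
      using e by (intro mom_mult[OF c[OF e] d[OF e]]) (auto simp: Cauchy_Schwarz_ineq2)
    also have "\<epsilon> ^ j / \<epsilon> ^ i * (c * \<epsilon> ^ (2 * i)) + d * \<epsilon> ^ (2 * j) / (\<epsilon> ^ j / \<epsilon> ^ i) = (c + d) * \<epsilon> ^ (i + j)"
    proof -
      have p: "\<epsilon> ^ (2 * i) = \<epsilon> ^ i * \<epsilon> ^ i" "\<epsilon> ^ (2 * j) = \<epsilon> ^ j * \<epsilon> ^ j" by (simp_all only: mult_2 power_add)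
      have nz: "\<epsilon> ^ i \<noteq> 0" "\<epsilon> ^ j \<noteq> 0" using e by auto
      show ?thesis unfolding p power_add using nz e by (simp add: field_simps)
    qed
    finally show "mom M 2 (\<lambda>\<omega>. f \<epsilon> t \<omega> \<bullet> g \<epsilon> t \<omega>) ((c + d) * \<epsilon> ^ (i + j))" .
  qed
qed

lemma (in prob_space) order_mom_4_imp_2:
  assumes "order_mom M T 4 (2 * r) f" shows "order_mom M T 2 r f"
proof -
  obtain c where c: "\<And>\<epsilon> t. 0 < \<epsilon> \<Longrightarrow> \<epsilon> \<le> 1 \<Longrightarrow> t \<in> {0..T} \<Longrightarrow> mom M 4 (f \<epsilon> t) (c * \<epsilon> ^ (2 * r))" using order_momE[OF assms] by blast
  show ?thesis
  proof (rule order_momI[of T M 2 _ "1 + c"])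
    fix \<epsilon> t :: real assume e: "0 < \<epsilon>" "\<epsilon> \<le> 1" "t \<in> {0..T}"
    have "mom M 2 (f \<epsilon> t) (\<epsilon> ^ r + c * \<epsilon> ^ (2 * r) / \<epsilon> ^ r)" using e by (intro mom_4_imp_2 c) auto
    also have "\<epsilon> ^ r + c * \<epsilon> ^ (2 * r) / \<epsilon> ^ r = (1 + c) * \<epsilon> ^ r"
    proof -
      have p: "\<epsilon> ^ (2 * r) = \<epsilon> ^ r * \<epsilon> ^ r" by (simp only: mult_2 power_add)
      have nz: "\<epsilon> ^ r \<noteq> 0" using e by auto
      show ?thesis unfolding p using nz e by (simp add: field_simps)
    qed
    finally show "mom M 2 (f \<epsilon> t) ((1 + c) * \<epsilon> ^ r)" .
  qed
qed

lemma order_mom_at: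
  assumes "order_mom M T p r f" "t0 \<in> {0..T}" shows "order_mom M T p r (\<lambda>\<epsilon> t. f \<epsilon> t0)"
  using assms unfolding order_mom_def by blast

lemma order_mom_AE_cong:
  assumes "order_mom M T p r f" "\<And>\<epsilon> t. 0 < \<epsilon> \<Longrightarrow> \<epsilon> \<le> 1 \<Longrightarrow> t \<in> {0..T} \<Longrightarrow> AE \<omega> in M. f \<epsilon> t \<omega> = g \<epsilon> t \<omega>"
  shows "order_mom M T p r g"
  using assms unfolding order_mom_def by (blast intro: mom_AE_cong)

lemma order_mom_integral:
  fixes f :: "real \<Rightarrow> real \<Rightarrow> 'w \<Rightarrow> real"
  assumes f: "order_mom M T p r f" and ab: "0 \<le> a" "a \<le> b" "b \<le> T"
    and cont: "\<And>\<epsilon>. 0 < \<epsilon> \<Longrightarrow> AE \<omega> in M. continuous_on {a..b} (\<lambda>t. f \<epsilon> t \<omega>)"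
  shows "order_mom M T p r (\<lambda>\<epsilon> t \<omega>. integral {a..b} (\<lambda>t. f \<epsilon> t \<omega>))"
proof -
  obtain c where c: "\<And>\<epsilon> t. 0 < \<epsilon> \<Longrightarrow> \<epsilon> \<le> 1 \<Longrightarrow> t \<in> {0..T} \<Longrightarrow> mom M p (f \<epsilon> t) (c * \<epsilon> ^ r)" using order_momE[OF f] by blast
  show ?thesis
  proof (rule order_momI[of T M p _ "(b - a) ^ p * c"])
    fix \<epsilon> t :: real assume e: "0 < \<epsilon>" "\<epsilon> \<le> 1" "t \<in> {0..T}"
    have "mom M p (\<lambda>\<omega>. integral {a..b} (\<lambda>t. f \<epsilon> t \<omega>)) ((b - a) ^ p * (c * \<epsilon> ^ r))"
      using ab e by (intro mom_time_integral c cont) auto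
    then show "mom M p (\<lambda>\<omega>. integral {a..b} (\<lambda>t. f \<epsilon> t \<omega>)) ((b - a) ^ p * c * \<epsilon> ^ r)" by (simp add: mult.assoc)
  qed
qed

text \<open>Gronwall's inequality along each path dominates \<open>Y\<close> by \<open>norm g\<close> and its time integral.\<close>

lemma gronwall_mom4:
  fixes Y g :: "real \<Rightarrow> 'w \<Rightarrow> real^'n" and A :: "real^'n^'n"
  assumes t: "t \<in> {0..T}" and Y: "Y t \<in> borel_measurable (completion M)"
    and g: "\<And>s. s \<in> {0..T} \<Longrightarrow> mom M 4 (g s) c"
    and eq: "AE \<omega> in M. continuous_on {0..T} (\<lambda>s. Y s \<omega>) \<and> continuous_on {0..T} (\<lambda>s. g s \<omega>) \<and>
       (\<forall>s\<in>{0..T}. Y s \<omega> = integral {0..s} (\<lambda>r. A *v Y r \<omega>) + g s \<omega>)"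
  defines "L \<equiv> onorm ((*v) A)"
  shows "mom M 4 (Y t) (16 * (c + (L * exp (L * T)) ^ 4 * (T ^ 4 * c)))"
proof -
  have L: "0 \<le> L" unfolding L_def by (rule onorm_matrix_nonneg)
  let ?h = "\<lambda>\<omega>. norm (g t \<omega>) + (L * exp (L * T)) *\<^sub>R integral {0..t} (\<lambda>s. norm (g s \<omega>))"
  have c0: "0 \<le> c" using g[OF t] by (rule mom_nonneg)
  have m: "mom M 4 ?h (2 ^ 4 * (c + \<bar>L * exp (L * T)\<bar> ^ 4 * ((t - 0) ^ 4 * c)))"
  proof (intro mom_add mom_norm g t mom_scaleR mom_time_integral)
    show "AE \<omega> in M. continuous_on {0..t} (\<lambda>s. norm (g s \<omega>))" using eq
    proof eventually_elim
      case (elim \<omega>)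
      then have "continuous_on {0..T} (\<lambda>s. g s \<omega>)" by blast
      then have "continuous_on {0..t} (\<lambda>s. g s \<omega>)" by (rule continuous_on_subset) (use t in auto)
      then show ?case by (rule continuous_on_norm)
    qed
  qed (use t in auto)
  have "mom M 4 (Y t) (2 ^ 4 * (c + \<bar>L * exp (L * T)\<bar> ^ 4 * ((t - 0) ^ 4 * c)))"
  proof (rule mom_dominated[OF m Y])
    show "AE \<omega> in M. norm (Y t \<omega>) \<le> norm (?h \<omega>)" using eq
    proof eventually_elim
      case (elim \<omega>)
      let ?y = "\<lambda>s. norm (Y s \<omega>)" and ?g = "\<lambda>s. norm (g s \<omega>)"
      have sub: "{0..t} \<subseteq> {0..T}" using t by auto
      have cY: "continuous_on {0..t} (\<lambda>s. Y s \<omega>)" and cg: "continuous_on {0..t} (\<lambda>s. g s \<omega>)"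
        using elim continuous_on_subset[OF _ sub] by blast+
      have "?y t \<le> ?g t + L * exp (L * t) * integral {0..t} ?g"
      proof (rule gronwall_pathwise)
        show "?y s \<le> ?g s + L * integral {0..s} ?y" if s: "s \<in> {0..t}" for s
        proof -
          have sub': "{0..s} \<subseteq> {0..t}" using s by auto
          have cYs: "continuous_on {0..s} (\<lambda>s. Y s \<omega>)" using cY sub' by (rule continuous_on_subset)
          have "norm (integral {0..s} (\<lambda>r. A *v Y r \<omega>)) \<le> integral {0..s} (\<lambda>r. L * ?y r)"
            unfolding L_def
            by (intro Henstock_Kurzweil_Integration.integral_norm_bound_integral integrable_continuous_real continuous_intros cYs norm_matrix_vector_le)
          also have "\<dots> = L * integral {0..s} ?y" by simp
          finally have b: "norm (integral {0..s} (\<lambda>r. A *v Y r \<omega>)) \<le> L * integral {0..s} ?y" .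
          have "Y s \<omega> = integral {0..s} (\<lambda>r. A *v Y r \<omega>) + g s \<omega>" using elim s sub by blast
          then have "?y s \<le> norm (integral {0..s} (\<lambda>r. A *v Y r \<omega>)) + ?g s" by (metis norm_triangle_ineq)
          then show ?thesis using b by linarith
        qed
      qed (use t L in \<open>auto intro!: continuous_intros cY cg\<close>)
      moreover have "L * exp (L * t) * integral {0..t} ?g \<le> L * exp (L * T) * integral {0..t} ?g"
        using t L by (intro mult_right_mono mult_left_mono Henstock_Kurzweil_Integration.integral_nonneg integrable_continuous_real continuous_intros cg)
          (auto intro: mult_left_mono)
      ultimately show ?case by simp
    qed
  qed
  moreover have "2 ^ 4 * (c + \<bar>L * exp (L * T)\<bar> ^ 4 * ((t - 0) ^ 4 * c)) \<le> 16 * (c + (L * exp (L * T)) ^ 4 * (T ^ 4 * c))"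
    using t L c0 by (auto intro!: mult_left_mono mult_right_mono power_mono simp: abs_mult)
  ultimately show ?thesis by (rule mom_mono)
qed

section \<open>The reference and the two-scale process\<close>

lemma integral_increment:
  fixes f :: "real \<Rightarrow> 'a::banach"
  assumes "continuous_on {0..} f" "0 \<le> c" "c \<le> d"
  shows "integral {0..d} f - integral {0..c} f = integral {c..d} f"
proof -
  have "f integrable_on {0..d}" by (rule integrable_continuous_real[OF continuous_on_subset[OF assms(1)]]) auto
  from Henstock_Kurzweil_Integration.integral_combine[OF assms(2,3) this] show ?thesis by (simp add: algebra_simps)
qed

locale two_scale = prob_space M for M :: "'w measure" +
  fixes W X :: "real \<Rightarrow> 'w \<Rightarrow> real^2" and Xe Pe :: "real \<Rightarrow> real \<Rightarrow> 'w \<Rightarrow> real^2"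
    and \<gamma> \<beta> :: real and A C :: "real^2^2"
  assumes \<gamma>: "\<gamma> > 0" and bm: "brownian_motion M W"
    and X_process: "additive_process M W (\<lambda>t \<omega>. A *v X t \<omega>) (sqrt \<gamma>) X"
    and X0_gauss: "gaussian_rv M 0 C (X 0)"
    and Xe_process: "\<And>\<epsilon>. \<epsilon> > 0 \<Longrightarrow>
           additive_process M W (\<lambda>t \<omega>. A *v Xe \<epsilon> t \<omega> + (sqrt \<gamma> / \<epsilon>) *\<^sub>R (mat_M \<beta> *v Pe \<epsilon> t \<omega>)) 0 (Xe \<epsilon>)"
    and Pe_process: "\<And>\<epsilon>. \<epsilon> > 0 \<Longrightarrow>
           additive_process M W (\<lambda>t \<omega>. - (1 / \<epsilon>) *\<^sub>R (mat_M \<beta> *v Pe \<epsilon> t \<omega>)) 1 (Pe \<epsilon>)"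
    and Xe0: "\<And>\<epsilon>. \<epsilon> > 0 \<Longrightarrow> AE \<omega> in M. Xe \<epsilon> 0 \<omega> = X 0 \<omega>"
    and Pe0_gauss: "\<And>\<epsilon>. \<epsilon> > 0 \<Longrightarrow> gaussian_rv M 0 ((\<epsilon> / 2) *\<^sub>R mat 1) (Pe \<epsilon> 0)"
    and indX: "\<And>\<epsilon>. \<epsilon> > 0 \<Longrightarrow>
           indep_rv M borel (X 0) (borel \<Otimes>\<^sub>M path_space {0..}) (\<lambda>\<omega>. (Pe \<epsilon> 0 \<omega>, traj {0..} W \<omega>))"
    and indP: "\<And>\<epsilon>. \<epsilon> > 0 \<Longrightarrow> indep_rv M borel (Pe \<epsilon> 0) (path_space {0..}) (traj {0..} W)"
begin

lemma inputs: "\<epsilon> > 0 \<Longrightarrow> brownian_inputs M W (X 0) (Pe \<epsilon> 0)"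
  by unfold_locales (auto intro: bm indX indP)

lemma X_meas: "0 \<le> t \<Longrightarrow> X t \<in> borel_measurable M" using X_process by (simp add: additive_process_def)
lemma Xe_meas: "\<epsilon> > 0 \<Longrightarrow> 0 \<le> t \<Longrightarrow> Xe \<epsilon> t \<in> borel_measurable M" using Xe_process by (simp add: additive_process_def)
lemma Pe_meas: "\<epsilon> > 0 \<Longrightarrow> 0 \<le> t \<Longrightarrow> Pe \<epsilon> t \<in> borel_measurable M" using Pe_process by (simp add: additive_process_def)

text \<open>All that is used of a realisation at scale \<open>\<epsilon>\<close>; it holds off a null set that depends on \<open>\<epsilon>\<close>.\<close>

definition regular :: "real \<Rightarrow> 'w \<Rightarrow> bool" where
  "regular \<epsilon> \<omega> \<longleftrightarrow>
     continuous_on {0..} (\<lambda>t. X t \<omega>) \<and> continuous_on {0..} (\<lambda>t. Xe \<epsilon> t \<omega>) \<and>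
     continuous_on {0..} (\<lambda>t. Pe \<epsilon> t \<omega>) \<and> continuous_on {0..} (\<lambda>t. W t \<omega>) \<and>
     Xe \<epsilon> 0 \<omega> = X 0 \<omega> \<and> W 0 \<omega> = 0 \<and>
     (\<forall>t\<ge>0. X t \<omega> = X 0 \<omega> + integral {0..t} (\<lambda>s. A *v X s \<omega>) + sqrt \<gamma> *\<^sub>R W t \<omega>) \<and>
     (\<forall>t\<ge>0. Pe \<epsilon> t \<omega> = Pe \<epsilon> 0 \<omega> + integral {0..t} (\<lambda>s. - (1 / \<epsilon>) *\<^sub>R (mat_M \<beta> *v Pe \<epsilon> s \<omega>)) + W t \<omega>) \<and>
     (\<forall>t\<ge>0. Xe \<epsilon> t \<omega> = Xe \<epsilon> 0 \<omega> + integral {0..t} (\<lambda>s. A *v Xe \<epsilon> s \<omega> + (sqrt \<gamma> / \<epsilon>) *\<^sub>R (mat_M \<beta> *v Pe \<epsilon> s \<omega>)))"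

lemma regular_AE: "\<epsilon> > 0 \<Longrightarrow> AE \<omega> in M. regular \<epsilon> \<omega>"
proof -
  assume e: "\<epsilon> > 0"
  have "AE \<omega> in M. continuous_on {0..} (\<lambda>t. X t \<omega>) \<and> (\<forall>t\<ge>0. X t \<omega> = X 0 \<omega> + integral {0..t} (\<lambda>s. A *v X s \<omega>) + sqrt \<gamma> *\<^sub>R W t \<omega>)"
    by (rule eventually_mono[OF conjunct2[OF X_process[unfolded additive_process_def]]]) blast
  moreover have "AE \<omega> in M. continuous_on {0..} (\<lambda>t. Xe \<epsilon> t \<omega>) \<and> (\<forall>t\<ge>0. Xe \<epsilon> t \<omega> = Xe \<epsilon> 0 \<omega> + integral {0..t} (\<lambda>s. A *v Xe \<epsilon> s \<omega> + (sqrt \<gamma> / \<epsilon>) *\<^sub>R (mat_M \<beta> *v Pe \<epsilon> s \<omega>)) + 0 *\<^sub>R W t \<omega>)"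
    by (rule eventually_mono[OF conjunct2[OF Xe_process[OF e, unfolded additive_process_def]]]) blast
  moreover have "AE \<omega> in M. continuous_on {0..} (\<lambda>t. Pe \<epsilon> t \<omega>) \<and> (\<forall>t\<ge>0. Pe \<epsilon> t \<omega> = Pe \<epsilon> 0 \<omega> + integral {0..t} (\<lambda>s. - (1 / \<epsilon>) *\<^sub>R (mat_M \<beta> *v Pe \<epsilon> s \<omega>)) + 1 *\<^sub>R W t \<omega>)"
    by (rule eventually_mono[OF conjunct2[OF Pe_process[OF e, unfolded additive_process_def]]]) blast
  moreover have "AE \<omega> in M. W 0 \<omega> = 0 \<and> continuous_on {0..} (\<lambda>t. W t \<omega>)" using bm by (simp add: brownian_motion_def)
  ultimately show ?thesis using Xe0[OF e]
    by eventually_elim (unfold regular_def scaleR_zero_left scaleR_one add_0_right, elim conjE, intro conjI, assumption+)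
qed

context
  fixes \<epsilon> :: real and \<omega> :: 'w
  assumes e: "\<epsilon> > 0" and reg: "regular \<epsilon> \<omega>"
begin

lemma regular_cont:
  "continuous_on {0..} (\<lambda>t. X t \<omega>)" "continuous_on {0..} (\<lambda>t. Xe \<epsilon> t \<omega>)"
  "continuous_on {0..} (\<lambda>t. Pe \<epsilon> t \<omega>)" "continuous_on {0..} (\<lambda>t. W t \<omega>)"
  using reg by (simp_all add: regular_def)

lemma regular_init: "Xe \<epsilon> 0 \<omega> = X 0 \<omega>" "W 0 \<omega> = 0"
  using reg unfolding regular_def by blast+

lemma regular_X: "0 \<le> t \<Longrightarrow> X t \<omega> = X 0 \<omega> + integral {0..t} (\<lambda>s. A *v X s \<omega>) + sqrt \<gamma> *\<^sub>R W t \<omega>"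
  and regular_P: "0 \<le> t \<Longrightarrow> Pe \<epsilon> t \<omega> = Pe \<epsilon> 0 \<omega> + integral {0..t} (\<lambda>s. - (1 / \<epsilon>) *\<^sub>R (mat_M \<beta> *v Pe \<epsilon> s \<omega>)) + W t \<omega>"
  and regular_Xe: "0 \<le> t \<Longrightarrow> Xe \<epsilon> t \<omega> = Xe \<epsilon> 0 \<omega> + integral {0..t} (\<lambda>s. A *v Xe \<epsilon> s \<omega> + (sqrt \<gamma> / \<epsilon>) *\<^sub>R (mat_M \<beta> *v Pe \<epsilon> s \<omega>))"
  using reg unfolding regular_def by blast+

lemma regular_P_matrix: "0 \<le> t \<Longrightarrow> Pe \<epsilon> t \<omega> = Pe \<epsilon> 0 \<omega> + integral {0..t} (\<lambda>s. (- (1 / \<epsilon>) *\<^sub>R mat_M \<beta>) *v Pe \<epsilon> s \<omega>) + W t \<omega>"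
  using regular_P[of t] by (simp only: scaleR_matrix_vector_assoc)

lemma regular_fast_integral:
  assumes "0 \<le> t"
  shows "integral {0..t} (\<lambda>s. (1 / \<epsilon>) *\<^sub>R (mat_M \<beta> *v Pe \<epsilon> s \<omega>)) = W t \<omega> - Pe \<epsilon> t \<omega> + Pe \<epsilon> 0 \<omega>"
  using regular_P[OF assms] by (simp add: algebra_simps)

text \<open>The fast equation eliminates the singular drift: \<open>Xe\<close> is forced by \<open>W - Pe + Pe 0\<close>.\<close>

lemma regular_Xe_forced:
  assumes "0 \<le> t"
  shows "Xe \<epsilon> t \<omega> = Xe \<epsilon> 0 \<omega> + integral {0..t} (\<lambda>s. A *v Xe \<epsilon> s \<omega>) + sqrt \<gamma> *\<^sub>R (W t \<omega> - Pe \<epsilon> t \<omega> + Pe \<epsilon> 0 \<omega>)"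
proof -
  have c: "continuous_on {0..t} (\<lambda>s. Xe \<epsilon> s \<omega>)" "continuous_on {0..t} (\<lambda>s. Pe \<epsilon> s \<omega>)"
    by (rule continuous_on_subset[OF regular_cont(2)], simp, rule continuous_on_subset[OF regular_cont(3)], simp)
  have "integral {0..t} (\<lambda>s. A *v Xe \<epsilon> s \<omega> + sqrt \<gamma> *\<^sub>R ((1 / \<epsilon>) *\<^sub>R (mat_M \<beta> *v Pe \<epsilon> s \<omega>)))
     = integral {0..t} (\<lambda>s. A *v Xe \<epsilon> s \<omega>) + integral {0..t} (\<lambda>s. sqrt \<gamma> *\<^sub>R ((1 / \<epsilon>) *\<^sub>R (mat_M \<beta> *v Pe \<epsilon> s \<omega>)))"
    by (intro Henstock_Kurzweil_Integration.integral_add integrable_continuous_real continuous_intros c)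
  also have "integral {0..t} (\<lambda>s. sqrt \<gamma> *\<^sub>R ((1 / \<epsilon>) *\<^sub>R (mat_M \<beta> *v Pe \<epsilon> s \<omega>))) = sqrt \<gamma> *\<^sub>R integral {0..t} (\<lambda>s. (1 / \<epsilon>) *\<^sub>R (mat_M \<beta> *v Pe \<epsilon> s \<omega>))"
    by (rule integral_cmul)
  also have "integral {0..t} (\<lambda>s. (1 / \<epsilon>) *\<^sub>R (mat_M \<beta> *v Pe \<epsilon> s \<omega>)) = W t \<omega> - Pe \<epsilon> t \<omega> + Pe \<epsilon> 0 \<omega>"
    by (rule regular_fast_integral[OF assms])
  finally show ?thesis using regular_Xe[OF assms] by (simp only: scaleR_scaleR times_divide_eq_right mult_1_right add.assoc)
qed

lemma regular_smooth_path:
  assumes "0 \<le> a" "a \<le> b" "\<And>x y. x \<bullet> (G *v y) = y \<bullet> (G *v x)" "\<And>x. (G *v x) \<bullet> (mat_M \<beta> *v x) = x \<bullet> (A *v (mat_M \<beta> *v x))"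
  shows "smooth_path A G (sqrt \<gamma>) \<epsilon> \<beta> a b (\<lambda>t. Xe \<epsilon> t \<omega>) (\<lambda>t. Pe \<epsilon> t \<omega>) (\<lambda>t. W t \<omega>)"
proof
  have s: "{a..b} \<subseteq> {0..}" using assms by auto
  show "continuous_on {a..b} (\<lambda>t. Xe \<epsilon> t \<omega>)" "continuous_on {a..b} (\<lambda>t. Pe \<epsilon> t \<omega>)" "continuous_on {a..b} (\<lambda>t. W t \<omega>)"
    using regular_cont(2-4) continuous_on_subset[OF _ s] by blast+
  fix c d assume cd: "a \<le> c" "c \<le> d" "d \<le> b"
  have c0: "0 \<le> c" "0 \<le> d" using cd assms by auto
  have 1: "continuous_on {0..} (\<lambda>s. (1 / \<epsilon>) *\<^sub>R (mat_M \<beta> *v Pe \<epsilon> s \<omega>))"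
    "continuous_on {0..} (\<lambda>s. A *v Xe \<epsilon> s \<omega> + (sqrt \<gamma> / \<epsilon>) *\<^sub>R (mat_M \<beta> *v Pe \<epsilon> s \<omega>))"
    by (intro continuous_intros regular_cont(2-3))+
  show "W d \<omega> - Pe \<epsilon> d \<omega> - (W c \<omega> - Pe \<epsilon> c \<omega>) = integral {c..d} (\<lambda>t. (1 / \<epsilon>) *\<^sub>R (mat_M \<beta> *v Pe \<epsilon> t \<omega>))"
    using integral_increment[OF 1(1) c0(1) cd(2)] regular_fast_integral[OF c0(1)] regular_fast_integral[OF c0(2)] by simp
  show "Xe \<epsilon> d \<omega> - Xe \<epsilon> c \<omega> = integral {c..d} (\<lambda>t. A *v Xe \<epsilon> t \<omega> + (sqrt \<gamma> / \<epsilon>) *\<^sub>R (mat_M \<beta> *v Pe \<epsilon> t \<omega>))"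
    unfolding integral_increment[OF 1(2) c0(1) cd(2), symmetric]
    by (subst regular_Xe[OF c0(2)], subst regular_Xe[OF c0(1)]) (rule add_diff_cancel_left)
qed (use assms in auto)

end

lemma Pe_order: "order_mom M T 4 2 Pe"
proof (rule order_momI[of T M 4 _ 100])
  fix \<epsilon> t :: real assume e: "0 < \<epsilon>" "\<epsilon> \<le> 1" "t \<in> {0..T}"
  interpret brownian_inputs M W "X 0" "Pe \<epsilon> 0" by (rule inputs[OF e(1)])
  show "mom M 4 (Pe \<epsilon> t) (100 * \<epsilon> ^ 2)"
  proof (rule fast_process_mom4[where \<beta> = \<beta>])
    show "AE \<omega> in M. continuous_on {0..} (\<lambda>s. Pe \<epsilon> s \<omega>) \<and>
        (\<forall>s\<ge>0. Pe \<epsilon> s \<omega> = Pe \<epsilon> 0 \<omega> + integral {0..s} (\<lambda>r. (- (1 / \<epsilon>) *\<^sub>R mat_M \<beta>) *v Pe \<epsilon> r \<omega>) + W s \<omega>)"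
      using regular_AE[OF e(1)]
    proof eventually_elim
      case (elim \<omega>)
      show ?case by (intro conjI allI impI regular_cont(3)[OF e(1) elim] regular_P_matrix[OF e(1) elim])
    qed
  qed (use e Pe0_gauss in auto)
qed

lemma W_mom4: assumes t: "t \<in> {0..T}" shows "mom M 4 (W t) (12 * T\<^sup>2)"
proof -
  interpret brownian_inputs M W "X 0" "Pe 1 0" by (rule inputs) simp
  have "mom M 4 (\<lambda>\<omega>. W t \<omega> - W 0 \<omega>) (12 * (t - 0)\<^sup>2)" using t by (intro increment_mom4) auto
  then have "mom M 4 (W t) (12 * (t - 0)\<^sup>2)"
    by (rule mom_AE_cong) (use bm in \<open>auto simp: brownian_motion_def elim!: eventually_mono\<close>)
  then show ?thesis by (rule mom_mono) (use t in \<open>auto intro!: power_mono\<close>)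
qed

lemma X_order: assumes T: "0 \<le> T" shows "order_mom M T 4 0 (\<lambda>_. X)"
proof -
  obtain c where c: "mom M 4 (X 0) c" using gaussian_mom4[OF X0_gauss] by blast
  let ?g = "\<lambda>s \<omega>. X 0 \<omega> + sqrt \<gamma> *\<^sub>R W s \<omega>"
  define d where "d = 2 ^ 4 * (c + \<bar>sqrt \<gamma>\<bar> ^ 4 * (12 * T\<^sup>2))"
  define L where "L = onorm ((*v) A)"
  have g: "mom M 4 (?g s) d" if "s \<in> {0..T}" for s
    unfolding d_def by (intro mom_add c mom_scaleR W_mom4 that)
  show ?thesis
  proof (rule order_momI[of T M 4 _ "16 * (d + (L * exp (L * T)) ^ 4 * (T ^ 4 * d))"])
    fix \<epsilon> t :: real assume t: "t \<in> {0..T}"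
    have "mom M 4 (X t) (16 * (d + (L * exp (L * T)) ^ 4 * (T ^ 4 * d)))" unfolding L_def
    proof (rule gronwall_mom4[OF t _ g])
      show "X t \<in> borel_measurable (completion M)" using t by (intro measurable_completion X_meas) auto
      show "AE \<omega> in M. continuous_on {0..T} (\<lambda>s. X s \<omega>) \<and> continuous_on {0..T} (\<lambda>s. ?g s \<omega>) \<and>
        (\<forall>s\<in>{0..T}. X s \<omega> = integral {0..s} (\<lambda>r. A *v X r \<omega>) + ?g s \<omega>)"
        using regular_AE[OF zero_less_one]
      proof eventually_elim
        case (elim \<omega>)
        note r = regular_cont[OF zero_less_one elim]
        have s: "{0..T} \<subseteq> {0..}" by auto
        have eqn: "X s \<omega> = integral {0..s} (\<lambda>r. A *v X r \<omega>) + ?g s \<omega>" if "s \<in> {0..T}" for s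
          using regular_X[OF zero_less_one elim, of s] that by simp
        show ?case
          by (intro conjI ballI eqn continuous_intros continuous_on_subset[OF r(1) s] continuous_on_subset[OF r(4) s])
      qed
    qed
    then show "mom M 4 (X t) (16 * (d + (L * exp (L * T)) ^ 4 * (T ^ 4 * d)) * \<epsilon> ^ 0)" by simp
  qed
qed

text \<open>Subtracting the two equations cancels the Brownian motion and leaves the forcing
  \<open>\<surd>\<gamma> (Pe 0 - Pe t)\<close>.\<close>

lemma D_order: assumes T: "0 \<le> T" shows "order_mom M T 4 2 (\<lambda>\<epsilon> t \<omega>. Xe \<epsilon> t \<omega> - X t \<omega>)"
proof -
  let ?g = "\<lambda>\<epsilon> s \<omega>. sqrt \<gamma> *\<^sub>R (Pe \<epsilon> 0 \<omega> - Pe \<epsilon> s \<omega>)"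
  have "order_mom M T 4 2 ?g"
    using T by (intro order_mom_scaleR order_mom_diff order_mom_at[OF Pe_order] Pe_order) auto
  then obtain c where g: "\<And>\<epsilon> t. 0 < \<epsilon> \<Longrightarrow> \<epsilon> \<le> 1 \<Longrightarrow> t \<in> {0..T} \<Longrightarrow> mom M 4 (?g \<epsilon> t) (c * \<epsilon> ^ 2)"
    using order_momE by blast
  define L where "L = onorm ((*v) A)"
  show ?thesis
  proof (rule order_momI[of T M 4 _ "16 * (c + (L * exp (L * T)) ^ 4 * (T ^ 4 * c))"])
    fix \<epsilon> t :: real assume e: "0 < \<epsilon>" "\<epsilon> \<le> 1" and t: "t \<in> {0..T}"
    let ?D = "\<lambda>t \<omega>. Xe \<epsilon> t \<omega> - X t \<omega>"
    have "mom M 4 (?D t) (16 * (c * \<epsilon>\<^sup>2 + (L * exp (L * T)) ^ 4 * (T ^ 4 * (c * \<epsilon>\<^sup>2))))" unfolding L_def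
    proof (rule gronwall_mom4[OF t, of _ _ "?g \<epsilon>"])
      show "?D t \<in> borel_measurable (completion M)"
        using t e by (intro measurable_completion borel_measurable_diff X_meas Xe_meas) auto
      show "AE \<omega> in M. continuous_on {0..T} (\<lambda>s. ?D s \<omega>) \<and> continuous_on {0..T} (\<lambda>s. ?g \<epsilon> s \<omega>) \<and>
        (\<forall>s\<in>{0..T}. ?D s \<omega> = integral {0..s} (\<lambda>r. A *v ?D r \<omega>) + ?g \<epsilon> s \<omega>)"
        using regular_AE[OF e(1)]
      proof eventually_elim
        case (elim \<omega>)
        note r = regular_cont[OF e(1) elim]
        have s: "{0..T} \<subseteq> {0..}" by auto
        have eqn: "?D s \<omega> = integral {0..s} (\<lambda>r. A *v ?D r \<omega>) + ?g \<epsilon> s \<omega>" if "s \<in> {0..T}" for s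
        proof -
          have s0: "0 \<le> s" using that by simp
          have cs: "continuous_on {0..s} (\<lambda>r. A *v Xe \<epsilon> r \<omega>)" "continuous_on {0..s} (\<lambda>r. A *v X r \<omega>)"
            by (intro continuous_intros continuous_on_subset[OF r(2)] continuous_on_subset[OF r(1)], simp)+
          have "integral {0..s} (\<lambda>r. A *v ?D r \<omega>) = integral {0..s} (\<lambda>r. A *v Xe \<epsilon> r \<omega>) - integral {0..s} (\<lambda>r. A *v X r \<omega>)"
            unfolding matrix_vector_mult_diff_distrib
            by (intro Henstock_Kurzweil_Integration.integral_diff integrable_continuous_real cs)
          then show ?thesis
            using regular_Xe_forced[OF e(1) elim s0] regular_X[OF e(1) elim s0] regular_init[OF e(1) elim]
            by (simp add: algebra_simps)
        qed
        show ?case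
          by (intro conjI ballI eqn continuous_intros continuous_on_subset[OF r(1) s] continuous_on_subset[OF r(2) s]
              continuous_on_subset[OF r(3) s])
      qed
    qed (use g e in auto)
    then show "mom M 4 (?D t) (16 * (c + (L * exp (L * T)) ^ 4 * (T ^ 4 * c)) * \<epsilon>\<^sup>2)" by (simp add: algebra_simps)
  qed
qed

lemma Xe_order: assumes T: "0 \<le> T" shows "order_mom M T 4 0 Xe"
  using order_mom_add[OF X_order[OF T] order_mom_weaken[OF D_order[OF T], of 0]] by simp

lemma X_increment_mom2:
  assumes T: "0 \<le> T"
  shows "\<exists>K. \<forall>s t. 0 \<le> s \<longrightarrow> s \<le> t \<longrightarrow> t \<le> T \<longrightarrow> mom M 2 (\<lambda>\<omega>. X t \<omega> - X s \<omega>) (K * (t - s))"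
proof -
  interpret brownian_inputs M W "X 0" "Pe 1 0" by (rule inputs) simp
  have "order_mom M T 2 0 (\<lambda>_ t \<omega>. A *v X t \<omega>)"
    using order_mom_4_imp_2[of T 0] X_order[OF T] by (intro order_mom_matrix) auto
  then obtain c where "\<And>\<epsilon> t. 0 < \<epsilon> \<Longrightarrow> \<epsilon> \<le> 1 \<Longrightarrow> t \<in> {0..T} \<Longrightarrow> mom M 2 (\<lambda>\<omega>. A *v X t \<omega>) (c * \<epsilon> ^ 0)"
    by (rule order_momE) blast
  from this[of 1] have c: "t \<in> {0..T} \<Longrightarrow> mom M 2 (\<lambda>\<omega>. A *v X t \<omega>) c" for t by simp
  have c0: "0 \<le> c" using mom_nonneg[OF c[of 0]] T by simp
  show ?thesis
  proof (intro exI[of _ "4 * (T * c + \<gamma> * 2)"] allI impI)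
    fix s t assume st: "0 \<le> s" "s \<le> t" "t \<le> T"
    let ?h = "\<lambda>\<omega>. integral {s..t} (\<lambda>r. norm (A *v X r \<omega>)) + sqrt \<gamma> *\<^sub>R norm (W t \<omega> - W s \<omega>)"
    have mW: "mom M 2 (\<lambda>\<omega>. W t \<omega> - W s \<omega>) (2 * (t - s))"
      using increment_norm2[OF st(1,2)] W_meas st by (intro momI) auto
    have cont: "AE \<omega> in M. continuous_on {s..t} (\<lambda>r. norm (A *v X r \<omega>))"
      using regular_AE[OF zero_less_one]
    proof eventually_elim
      case (elim \<omega>)
      show ?case
        by (intro continuous_intros continuous_on_subset[OF regular_cont(1)[OF zero_less_one elim]]) (use st in auto)
    qed
    have m: "mom M 2 ?h (2 ^ 2 * ((t - s) ^ 2 * c + \<bar>sqrt \<gamma>\<bar> ^ 2 * (2 * (t - s))))"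
      using st by (intro mom_add mom_time_integral cont mom_norm c mom_scaleR mW) auto
    have "mom M 2 (\<lambda>\<omega>. X t \<omega> - X s \<omega>) (2 ^ 2 * ((t - s) ^ 2 * c + \<bar>sqrt \<gamma>\<bar> ^ 2 * (2 * (t - s))))"
    proof (rule mom_dominated[OF m])
      show "(\<lambda>\<omega>. X t \<omega> - X s \<omega>) \<in> borel_measurable (completion M)"
        using st by (intro measurable_completion borel_measurable_diff X_meas) auto
      show "AE \<omega> in M. norm (X t \<omega> - X s \<omega>) \<le> norm (?h \<omega>)" using regular_AE[OF zero_less_one]
      proof eventually_elim
        case (elim \<omega>)
        have cA: "continuous_on {0..} (\<lambda>r. A *v X r \<omega>)" by (intro continuous_intros regular_cont(1)[OF zero_less_one elim])
        have cA': "continuous_on {s..t} (\<lambda>r. A *v X r \<omega>)" by (rule continuous_on_subset[OF cA]) (use st in auto)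
        have t0: "0 \<le> t" using st by simp
        have "X t \<omega> - X s \<omega> = integral {s..t} (\<lambda>r. A *v X r \<omega>) + sqrt \<gamma> *\<^sub>R (W t \<omega> - W s \<omega>)"
          unfolding integral_increment[OF cA st(1,2), symmetric]
          using regular_X[OF zero_less_one elim st(1)] regular_X[OF zero_less_one elim t0] by (simp add: algebra_simps)
        also have "norm \<dots> \<le> norm (integral {s..t} (\<lambda>r. A *v X r \<omega>)) + norm (sqrt \<gamma> *\<^sub>R (W t \<omega> - W s \<omega>))" by (rule norm_triangle_ineq)
        also have "norm (integral {s..t} (\<lambda>r. A *v X r \<omega>)) \<le> integral {s..t} (\<lambda>r. norm (A *v X r \<omega>))"
          by (intro Henstock_Kurzweil_Integration.integral_norm_bound_integral integrable_continuous_real continuous_intros cA') auto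
        finally show ?case using \<gamma> by simp
      qed
    qed
    moreover have "2 ^ 2 * ((t - s) ^ 2 * c + \<bar>sqrt \<gamma>\<bar> ^ 2 * (2 * (t - s))) \<le> 4 * (T * c + \<gamma> * 2) * (t - s)"
    proof -
      have "(t - s)\<^sup>2 * c \<le> T * (t - s) * c"
        unfolding power2_eq_square using st c0 by (intro mult_right_mono) auto
      then show ?thesis using \<gamma> by (simp add: algebra_simps)
    qed
    ultimately show "mom M 2 (\<lambda>\<omega>. X t \<omega> - X s \<omega>) (4 * (T * c + \<gamma> * 2) * (t - s))" by (rule mom_mono)
  qed
qed

end

section \<open>Left-point sums and the Ito integral\<close>

text \<open>The inner time integral in the definition of the Ito integral is not known to be measurable; this
  form of additivity allows an arbitrary summand \<open>G\<close>, because \<open>u - F \<le> G\<close>.\<close>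

lemma nn_integral_add_le:
  assumes u: "u \<in> borel_measurable M" and F: "F \<in> borel_measurable M"
    and fin: "\<And>\<omega>. F \<omega> \<noteq> \<infinity>" and le: "AE \<omega> in M. u \<omega> \<le> F \<omega> + G \<omega>"
  shows "(\<integral>\<^sup>+\<omega>. u \<omega> \<partial>M) \<le> (\<integral>\<^sup>+\<omega>. F \<omega> \<partial>M) + (\<integral>\<^sup>+\<omega>. G \<omega> \<partial>M)"
proof -
  have "(\<integral>\<^sup>+\<omega>. u \<omega> \<partial>M) \<le> (\<integral>\<^sup>+\<omega>. F \<omega> + (u \<omega> - F \<omega>) \<partial>M)"
    by (intro nn_integral_mono) (metis ennreal_minus_le_iff add.commute le_cases diff_add_self_ennreal order_refl
        ennreal_le_minus_iff add_increasing2 zero_le)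
  also have "\<dots> = (\<integral>\<^sup>+\<omega>. F \<omega> \<partial>M) + (\<integral>\<^sup>+\<omega>. u \<omega> - F \<omega> \<partial>M)"
    using u F by (intro nn_integral_add) auto
  also have "(\<integral>\<^sup>+\<omega>. u \<omega> - F \<omega> \<partial>M) \<le> (\<integral>\<^sup>+\<omega>. G \<omega> \<partial>M)"
    by (rule nn_integral_mono_AE) (use le fin in \<open>auto elim!: eventually_mono simp: ennreal_minus_le_iff\<close>)
  finally show ?thesis by (auto intro: add_left_mono)
qed

lemma ennreal_two_sum:
  fixes z :: "nat \<Rightarrow> real"
  assumes "\<And>i. 0 \<le> z i" "0 \<le> y"
  shows "ennreal (2 * (\<Sum>i<N. z i) + 2 * y) = (\<Sum>i<N. 2 * ennreal (z i)) + 2 * ennreal y"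
proof -
  have "(\<Sum>i<N. 2 * ennreal (z i)) = 2 * ennreal (\<Sum>i<N. z i)"
    using assms by (simp add: sum_distrib_left[symmetric] sum_ennreal)
  moreover have "ennreal (2 * (\<Sum>i<N. z i) + 2 * y) = ennreal (2 * (\<Sum>i<N. z i)) + ennreal (2 * y)"
    using assms by (intro ennreal_plus) (auto intro: sum_nonneg)
  ultimately show ?thesis by (simp add: ennreal_mult')
qed

lemma grid_cell_exists:
  assumes "a \<le> b" "r \<in> {a..<b}" "N > 0"
  obtains i where "i < N" "r \<in> {grid a b N i..<grid a b N (Suc i)}"
proof -
  have "k \<le> N \<Longrightarrow> r < grid a b N k \<Longrightarrow> \<exists>i<k. r \<in> {grid a b N i..<grid a b N (Suc i)}" for k
  proof (induction k)
    case 0 then show ?case using assms by auto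
  next
    case (Suc k)
    show ?case
    proof (cases "r < grid a b N k")
      case True then show ?thesis using Suc by (auto intro: less_SucI)
    next
      case False then show ?thesis using Suc by (intro exI[of _ k]) auto
    qed
  qed
  from this[of N] show ?thesis using assms that by auto
qed

lemma grid_cell_unique:
  assumes "a \<le> b" "r \<in> {grid a b N i..<grid a b N (Suc i)}" "r \<in> {grid a b N j..<grid a b N (Suc j)}"
  shows "i = j"
proof (rule ccontr)
  assume "i \<noteq> j"
  then consider "Suc i \<le> j" | "Suc j \<le> i" by linarith
  then show False
  proof cases
    case 1 then show ?thesis using grid_mono[OF assms(1) 1, of N] assms by auto
  next
    case 2 then show ?thesis using grid_mono[OF assms(1) 2, of N] assms by auto
  qed
qed

lemma grid_step_value:
  fixes f :: "nat \<Rightarrow> 'a::real_vector"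
  assumes "a \<le> b" "i < N" "r \<in> {grid a b N i..<grid a b N (Suc i)}"
  shows "(\<Sum>j<N. indicator {grid a b N j..<grid a b N (Suc j)} r *\<^sub>R f j) = f i"
proof -
  have "(\<Sum>j<N. indicator {grid a b N j..<grid a b N (Suc j)} r *\<^sub>R f j) = (\<Sum>j<N. if j = i then f j else 0)"
  proof (intro sum.cong refl)
    fix j
    show "indicator {grid a b N j..<grid a b N (Suc j)} r *\<^sub>R f j = (if j = i then f j else 0)"
    proof (cases "j = i")
      case True then show ?thesis using assms(3) by (simp add: indicator_def)
    next
      case False
      then have "r \<notin> {grid a b N j..<grid a b N (Suc j)}" using grid_cell_unique[OF assms(1,3)] by blast
      then show ?thesis using False by (simp add: indicator_def)
    qed
  qed
  then show ?thesis using assms by simp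
qed

lemma simple_process_bounds:
  assumes "simple_process F a b m \<tau> \<xi>" "i \<le> m" shows "a \<le> \<tau> i" "\<tau> i \<le> b"
proof -
  have s: "\<tau> 0 = a" "\<tau> m = b" "\<And>i. i < m \<Longrightarrow> \<tau> i \<le> \<tau> (Suc i)" using assms by (auto simp: simple_process_def)
  have up: "j \<le> k \<Longrightarrow> k \<le> m \<Longrightarrow> \<tau> j \<le> \<tau> k" for j k
  proof (induction k)
    case (Suc k)
    show ?case
    proof (cases "j = Suc k")
      case False
      then have "\<tau> j \<le> \<tau> k" using Suc by auto
      also have "\<dots> \<le> \<tau> (Suc k)" using s(3)[of k] Suc by auto
      finally show ?thesis .
    qed simp
  qed simp
  show "a \<le> \<tau> i" "\<tau> i \<le> b" using up[of 0 i] up[of i m] s assms(2) by auto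
qed

context two_scale begin

text \<open>The isometry for the difference of two step processes, one on the uniform partition and one on the
  partition of the given simple process, followed by the triangle inequality through \<open>H\<close>.\<close>

lemma left_sum_simple_integral:
  fixes H :: "real \<Rightarrow> 'w \<Rightarrow> real^2"
  assumes e: "\<epsilon> > 0" and ab: "0 \<le> a" "a \<le> b" and N: "N > 0"
    and simple: "simple_process (init_filtration M (X 0) W) a b m \<tau> \<xi>"
    and \<eta>: "\<And>i. i < N \<Longrightarrow> brownian_inputs.sq_adp M W (X 0) (Pe \<epsilon> 0) (grid a b N i) (\<eta> i)"
    and H: "AE \<omega> in M. continuous_on {a..b} (\<lambda>r. H r \<omega>)"
    and F: "\<And>i r. i < N \<Longrightarrow> r \<in> {grid a b N i..grid a b N (Suc i)} \<Longrightarrow> mom M 2 (\<lambda>\<omega>. \<eta> i \<omega> - H r \<omega>) c"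
  shows "(\<integral>\<^sup>+\<omega>. ennreal (((\<Sum>i<N. \<eta> i \<omega> \<bullet> (W (grid a b N (Suc i)) \<omega> - W (grid a b N i) \<omega>)) - simple_integral W m \<tau> \<xi> \<omega>)\<^sup>2) \<partial>M)
    \<le> ennreal (2 * ((b - a) * c)) +
       2 * (\<integral>\<^sup>+\<omega>. (\<integral>\<^sup>+t\<in>{a..b}. ennreal ((norm (simple_value m \<tau> \<xi> t \<omega> - H t \<omega>))\<^sup>2) \<partial>lborel) \<partial>M)"
proof -
  interpret brownian_inputs M W "X 0" "Pe \<epsilon> 0" by (rule inputs[OF e])
  let ?g = "grid a b N"
  let ?I = "{..<N} <+> {..<m}"
  define s where "s = case_sum ?g \<tau>"
  define t where "t = case_sum (\<lambda>i. ?g (Suc i)) (\<lambda>j. \<tau> (Suc j))"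
  \<comment> \<open>The disjoint sum of the two families of intervals, with a sign, so that its integral is the difference of the two integrals.\<close>
  define \<zeta> where "\<zeta> = case_sum \<eta> (\<lambda>j \<omega>. - \<xi> j \<omega>)"
  have sp: "\<And>i. i < m \<Longrightarrow> \<tau> i \<le> \<tau> (Suc i)" "\<And>i. i < m \<Longrightarrow> \<xi> i \<in> borel_measurable (init_filtration M (X 0) W (\<tau> i))"
    "\<And>i. i < m \<Longrightarrow> bounded (\<xi> i ` space (init_filtration M (X 0) W (\<tau> i)))"
    using simple by (auto simp: simple_process_def)
  have \<tau>b: "i \<le> m \<Longrightarrow> a \<le> \<tau> i \<and> \<tau> i \<le> b" for i using simple_process_bounds[OF simple] by auto
  have st: "0 \<le> s i \<and> s i \<le> t i" if "i \<in> ?I" for i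
    using that grid_bounds[OF ab(2), of _ N] grid_cell[OF ab(2), of _ N] \<tau>b sp(1) ab
    by (auto simp: s_def t_def intro: order_trans[OF ab(1)] less_imp_le)
  have \<xi>: "sq_adp (\<tau> j) (\<lambda>\<omega>. - \<xi> j \<omega>)" if j: "j < m" for j
  proof -
    have ad: "adp (\<tau> j) (\<xi> j)" by (rule adp_init_filtration[OF sp(2)[OF j]])
    obtain B where B: "\<And>\<omega>. \<omega> \<in> space M \<Longrightarrow> norm (\<xi> j \<omega>) \<le> B"
      using sp(3)[OF j] unfolding bounded_iff by (auto simp: init_filtration_def)
    have "integrable M (\<lambda>\<omega>. (norm (- \<xi> j \<omega>))\<^sup>2)"
    proof (rule integrable_const_bound[of _ "B\<^sup>2"])
      show "AE \<omega> in M. norm ((norm (- \<xi> j \<omega>))\<^sup>2) \<le> B\<^sup>2" using B by (intro AE_I2) (auto intro: power_mono)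
    qed (use adp_measurable[OF ad] in measurable)
    moreover have "adp (\<tau> j) (\<lambda>\<omega>. - \<xi> j \<omega>)" using adp_scaleR[OF ad, of "-1"] by simp
    ultimately show ?thesis by (simp add: sq_adp_def)
  qed
  have \<zeta>: "sq_adp (s i) (\<zeta> i)" if "i \<in> ?I" for i
    using that \<eta> \<xi> by (auto simp: s_def \<zeta>_def)
  have sum: "(\<Sum>i\<in>?I. incr (s i) (t i) (\<zeta> i) \<omega>)
     = (\<Sum>i<N. \<eta> i \<omega> \<bullet> (W (?g (Suc i)) \<omega> - W (?g i) \<omega>)) - simple_integral W m \<tau> \<xi> \<omega>" for \<omega>
    by (simp add: sum.Plus s_def t_def \<zeta>_def incr_def simple_integral_def sum_negf)
  have val: "step_value ?I s t \<zeta> r \<omega> = (\<Sum>i<N. indicator {?g i..<?g (Suc i)} r *\<^sub>R \<eta> i \<omega>) - simple_value m \<tau> \<xi> r \<omega>" for r \<omega>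
    unfolding step_value_def s_def t_def \<zeta>_def simple_value_def
    by (simp only: sum.Plus finite_lessThan o_def sum.case scaleR_minus_right sum_negf diff_conv_add_uminus)
  define Q where "Q \<omega> = (\<integral>\<^sup>+r. ennreal ((norm (step_value ?I s t \<zeta> r \<omega>))\<^sup>2) \<partial>lborel)" for \<omega>
  define f where "f i r \<omega> = (norm (\<eta> i \<omega> - H r \<omega>))\<^sup>2" for i r \<omega>
  define R where "R \<omega> = (\<Sum>i<N. integral {?g i..?g (Suc i)} (\<lambda>r. f i r \<omega>))" for \<omega>
  define E where "E \<omega> = (\<integral>\<^sup>+r\<in>{a..b}. ennreal ((norm (simple_value m \<tau> \<xi> r \<omega> - H r \<omega>))\<^sup>2) \<partial>lborel)" for \<omega>
  have cont_f: "AE \<omega> in M. continuous_on {?g i..?g (Suc i)} (\<lambda>r. f i r \<omega>)" if "i < N" for i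
    using H
  proof eventually_elim
    case (elim \<omega>)
    have "continuous_on {?g i..?g (Suc i)} (\<lambda>r. H r \<omega>)" using elim grid_cell(1)[OF ab(2) that] by (rule continuous_on_subset)
    then show ?case unfolding f_def by (intro continuous_intros)
  qed
  have mom_f: "mom M 1 (\<lambda>\<omega>. integral {?g i..?g (Suc i)} (\<lambda>r. f i r \<omega>)) ((?g (Suc i) - ?g i) ^ 1 * c)" if i: "i < N" for i
  proof (rule mom_time_integral[OF grid_cell(2)[OF ab(2) i] _ cont_f[OF i]])
    fix r assume "r \<in> {?g i..?g (Suc i)}"
    from F[OF i this] show "mom M 1 (f i r) c" unfolding f_def mom_def by (auto intro: borel_measurable_power)
  qed
  have R0: "AE \<omega> in M. 0 \<le> R \<omega>"
  proof -
    have "AE \<omega> in M. \<forall>i\<in>{..<N}. continuous_on {?g i..?g (Suc i)} (\<lambda>r. f i r \<omega>)"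
      using cont_f by (intro AE_finite_allI) auto
    then show ?thesis
    proof eventually_elim
      case (elim \<omega>)
      then show ?case unfolding R_def
        by (intro sum_nonneg Henstock_Kurzweil_Integration.integral_nonneg integrable_continuous_real) (auto simp: f_def)
    qed
  qed
  have Rm: "R \<in> borel_measurable (completion M)" unfolding R_def using mom_f by (intro borel_measurable_sum) (auto simp: mom_def)
  have ER: "(\<integral>\<^sup>+\<omega>. ennreal (R \<omega>) \<partial>M) \<le> ennreal ((b - a) * c)"
  proof -
    have c0: "0 \<le> c" using mom_nonneg[OF F[of 0 a]] N ab grid_mono[OF ab(2), of 0 "Suc 0" N] by simp
    have "(\<integral>\<^sup>+\<omega>. ennreal (R \<omega>) \<partial>M) \<le> (\<integral>\<^sup>+\<omega>. (\<Sum>i<N. ennreal (norm (integral {?g i..?g (Suc i)} (\<lambda>r. f i r \<omega>)) ^ 1)) \<partial>completion M)"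
      unfolding nn_integral_completion
    proof (rule nn_integral_mono)
      fix \<omega>
      have "R \<omega> \<le> (\<Sum>i<N. norm (integral {?g i..?g (Suc i)} (\<lambda>r. f i r \<omega>)) ^ 1)" unfolding R_def by (intro sum_mono) auto
      then show "ennreal (R \<omega>) \<le> (\<Sum>i<N. ennreal (norm (integral {?g i..?g (Suc i)} (\<lambda>r. f i r \<omega>)) ^ 1))"
        by (subst sum_ennreal) (auto intro: ennreal_leI)
    qed
    also have "\<dots> = (\<Sum>i<N. \<integral>\<^sup>+\<omega>. ennreal (norm (integral {?g i..?g (Suc i)} (\<lambda>r. f i r \<omega>)) ^ 1) \<partial>completion M)"
      using mom_measurable[OF mom_f] by (intro nn_integral_sum) auto
    also have "\<dots> \<le> (\<Sum>i<N. ennreal (((b - a) / real N) * c))"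
      using mom_f by (intro sum_mono) (auto simp: mom_def nn_integral_completion grid_Suc)
    also have "\<dots> = ennreal (\<Sum>i<N. ((b - a) / real N) * c)" using ab c0 by (subst sum_ennreal) auto
    also have "(\<Sum>i<N. ((b - a) / real N) * c) = (b - a) * c" using N by simp
    finally show ?thesis .
  qed
  have QE: "AE \<omega> in M. Q \<omega> \<le> ennreal (2 * R \<omega>) + 2 * E \<omega>"
  proof -
    have "AE \<omega> in M. \<forall>i\<in>{..<N}. continuous_on {?g i..?g (Suc i)} (\<lambda>r. f i r \<omega>)"
      using cont_f by (intro AE_finite_allI) auto
    then show ?thesis using H R0
    proof eventually_elim
      case (elim \<omega>)
      define h where "h r = indicator {a..b} r *\<^sub>R H r \<omega>" for r
      have hm[measurable]: "h \<in> borel_measurable borel" unfolding h_def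
        using borel_measurable_continuous_on_indicator[OF _ elim(2)] by simp
      have sm[measurable]: "(\<lambda>r. simple_value m \<tau> \<xi> r \<omega>) \<in> borel_measurable borel" unfolding simple_value_def by measurable
      \<comment> \<open>Inside \<open>[a, b)\<close> exactly one cell of the uniform partition contains \<open>r\<close>; outside everything vanishes.\<close>
      have step0: "(norm (step_value ?I s t \<zeta> r \<omega>))\<^sup>2 \<le>
         2 * (\<Sum>i<N. indicator {?g i..<?g (Suc i)} r * (norm (\<eta> i \<omega> - h r))\<^sup>2) + 2 * (indicator {a..b} r * (norm (simple_value m \<tau> \<xi> r \<omega> - h r))\<^sup>2)" for r
      proof (cases "r \<in> {a..<b}")
        case True
        obtain i where i: "i < N" "r \<in> {?g i..<?g (Suc i)}" using grid_cell_exists[OF ab(2) True N] .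
        have "step_value ?I s t \<zeta> r \<omega> = (\<eta> i \<omega> - h r) + - (simple_value m \<tau> \<xi> r \<omega> - h r)"
          unfolding val grid_step_value[OF ab(2) i] by simp
        then have "(norm (step_value ?I s t \<zeta> r \<omega>))\<^sup>2 \<le> (norm (\<eta> i \<omega> - h r) + norm (simple_value m \<tau> \<xi> r \<omega> - h r))\<^sup>2"
          by (metis norm_triangle_ineq norm_minus_cancel power_mono norm_ge_zero)
        also have "\<dots> \<le> 2 * (norm (\<eta> i \<omega> - h r))\<^sup>2 + 2 * (norm (simple_value m \<tau> \<xi> r \<omega> - h r))\<^sup>2"
          using sum_squares_bound[of "norm (\<eta> i \<omega> - h r)" "norm (simple_value m \<tau> \<xi> r \<omega> - h r)"] by (simp add: power2_sum)
        finally show ?thesis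
          using grid_step_value[OF ab(2) i, of "\<lambda>j. (norm (\<eta> j \<omega> - h r))\<^sup>2"] True by simp
      next
        case False
        have n1: "r \<notin> {?g i..<?g (Suc i)}" if "i < N" for i
          using grid_bounds[OF ab(2), of i N] grid_bounds[OF ab(2), of "Suc i" N] that False by auto
        have n2: "r \<notin> {\<tau> i..<\<tau> (Suc i)}" if "i < m" for i
          using \<tau>b[of i] \<tau>b[of "Suc i"] that False by auto
        have "(\<Sum>i<N. indicator {?g i..<?g (Suc i)} r *\<^sub>R \<eta> i \<omega>) = 0"
          by (rule sum.neutral) (use n1 in auto)
        moreover have "simple_value m \<tau> \<xi> r \<omega> = 0" unfolding simple_value_def
          by (rule sum.neutral) (use n2 in auto)
        ultimately have "step_value ?I s t \<zeta> r \<omega> = 0" unfolding val by simp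
        then show ?thesis by (simp add: sum_nonneg)
      qed
      have "Q \<omega> \<le> (\<integral>\<^sup>+r. (\<Sum>i<N. 2 * ennreal (indicator {?g i..<?g (Suc i)} r * (norm (\<eta> i \<omega> - h r))\<^sup>2))
            + 2 * ennreal (indicator {a..b} r * (norm (simple_value m \<tau> \<xi> r \<omega> - h r))\<^sup>2) \<partial>lborel)"
        unfolding Q_def
      proof (rule nn_integral_mono)
        fix r
        have "ennreal ((norm (step_value ?I s t \<zeta> r \<omega>))\<^sup>2) \<le>
          ennreal (2 * (\<Sum>i<N. indicator {?g i..<?g (Suc i)} r * (norm (\<eta> i \<omega> - h r))\<^sup>2) + 2 * (indicator {a..b} r * (norm (simple_value m \<tau> \<xi> r \<omega> - h r))\<^sup>2))"
          by (rule ennreal_leI[OF step0])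
        also have "\<dots> = (\<Sum>i<N. 2 * ennreal (indicator {?g i..<?g (Suc i)} r * (norm (\<eta> i \<omega> - h r))\<^sup>2))
            + 2 * ennreal (indicator {a..b} r * (norm (simple_value m \<tau> \<xi> r \<omega> - h r))\<^sup>2)"
          by (rule ennreal_two_sum) auto
        finally show "ennreal ((norm (step_value ?I s t \<zeta> r \<omega>))\<^sup>2) \<le> (\<Sum>i<N. 2 * ennreal (indicator {?g i..<?g (Suc i)} r * (norm (\<eta> i \<omega> - h r))\<^sup>2))
            + 2 * ennreal (indicator {a..b} r * (norm (simple_value m \<tau> \<xi> r \<omega> - h r))\<^sup>2)" .
      qed
      also have "\<dots> = (\<Sum>i<N. 2 * (\<integral>\<^sup>+r. ennreal (indicator {?g i..<?g (Suc i)} r * (norm (\<eta> i \<omega> - h r))\<^sup>2) \<partial>lborel))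
            + 2 * (\<integral>\<^sup>+r. ennreal (indicator {a..b} r * (norm (simple_value m \<tau> \<xi> r \<omega> - h r))\<^sup>2) \<partial>lborel)"
        by (subst nn_integral_add) (auto simp: nn_integral_sum nn_integral_cmult)
      also have "(\<integral>\<^sup>+r. ennreal (indicator {a..b} r * (norm (simple_value m \<tau> \<xi> r \<omega> - h r))\<^sup>2) \<partial>lborel) = E \<omega>"
        unfolding E_def by (intro nn_integral_cong) (auto simp: h_def indicator_def)
      also have "(\<Sum>i<N. 2 * (\<integral>\<^sup>+r. ennreal (indicator {?g i..<?g (Suc i)} r * (norm (\<eta> i \<omega> - h r))\<^sup>2) \<partial>lborel))
         \<le> (\<Sum>i<N. 2 * ennreal (integral {?g i..?g (Suc i)} (\<lambda>r. f i r \<omega>)))"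
      proof (intro sum_mono mult_left_mono)
        fix i assume "i \<in> {..<N}" then have i: "i < N" by simp
        have ci: "continuous_on {?g i..?g (Suc i)} (\<lambda>r. f i r \<omega>)" using elim(1) i by auto
        have "(\<integral>\<^sup>+r. ennreal (indicator {?g i..<?g (Suc i)} r * (norm (\<eta> i \<omega> - h r))\<^sup>2) \<partial>lborel)
          \<le> (\<integral>\<^sup>+r. ennreal (indicator {?g i..?g (Suc i)} r * f i r \<omega>) \<partial>lborel)"
          using grid_cell(1)[OF ab(2) i] by (intro nn_integral_mono ennreal_leI) (auto simp: indicator_def f_def h_def)
        also have "\<dots> = ennreal (integral {?g i..?g (Suc i)} (\<lambda>r. f i r \<omega>))"
        proof -
          have "set_integrable lborel {?g i..?g (Suc i)} (\<lambda>r. f i r \<omega>)"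
            by (rule borel_integrable_atLeastAtMost'[OF ci])
          from set_borel_integral_eq_integral[OF this] this show ?thesis
            by (subst nn_integral_eq_integral) (auto simp: set_integrable_def set_lebesgue_integral_def f_def)
        qed
        finally show "(\<integral>\<^sup>+r. ennreal (indicator {?g i..<?g (Suc i)} r * (norm (\<eta> i \<omega> - h r))\<^sup>2) \<partial>lborel)
          \<le> ennreal (integral {?g i..?g (Suc i)} (\<lambda>r. f i r \<omega>))" .
      qed auto
      also have "(\<Sum>i<N. 2 * ennreal (integral {?g i..?g (Suc i)} (\<lambda>r. f i r \<omega>))) = ennreal (2 * R \<omega>)"
      proof -
        have "0 \<le> integral {?g i..?g (Suc i)} (\<lambda>r. f i r \<omega>)" if "i < N" for i
          using elim(1) that by (intro Henstock_Kurzweil_Integration.integral_nonneg integrable_continuous_real) (auto simp: f_def)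
        then have "(\<Sum>i<N. ennreal (integral {?g i..?g (Suc i)} (\<lambda>r. f i r \<omega>))) = ennreal (R \<omega>)"
          unfolding R_def by (intro sum_ennreal) auto
        then show ?thesis by (simp add: sum_distrib_left[symmetric] ennreal_mult')
      qed
      finally show ?case by (auto intro: add_right_mono)
    qed
  qed
  \<comment> \<open>The factor 2 is divided out first, as the inner integral \<open>E\<close> may fail to be measurable.\<close>
  have half: "2 * ennreal (1/2) = 1" and half': "ennreal (1/2) * 2 = 1"
  proof -
    have "2 * ennreal (1/2) = ennreal (2 * (1/2))" by (subst ennreal_mult) auto
    then show "2 * ennreal (1/2) = 1" by simp
    then show "ennreal (1/2) * 2 = 1" by (simp only: mult.commute)
  qed
  have Qm: "Q \<in> borel_measurable (completion M)"
  proof -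
    have Qeq: "Q \<omega> = ennreal (\<Sum>i\<in>?I. \<Sum>j\<in>?I. overlap (s i) (t i) (s j) (t j) * (\<zeta> i \<omega> \<bullet> \<zeta> j \<omega>))" for \<omega>
    proof -
      have "has_bochner_integral lborel (\<lambda>r. (norm (step_value ?I s t \<zeta> r \<omega>))\<^sup>2) (\<Sum>i\<in>?I. \<Sum>j\<in>?I. overlap (s i) (t i) (s j) (t j) * (\<zeta> i \<omega> \<bullet> \<zeta> j \<omega>))"
        using st by (intro step_value_square_integral) auto
      then show ?thesis
        unfolding Q_def by (subst nn_integral_eq_integral) (auto simp: has_bochner_integral_iff)
    qed
    have z: "\<zeta> i \<in> borel_measurable (completion M)" if "i \<in> ?I" for i
      by (rule measurable_completion[OF sq_adp_measurable[OF \<zeta>[OF that]]])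
    have "(\<lambda>\<omega>. \<Sum>i\<in>?I. \<Sum>j\<in>?I. overlap (s i) (t i) (s j) (t j) * (\<zeta> i \<omega> \<bullet> \<zeta> j \<omega>)) \<in> borel_measurable (completion M)"
      by (intro borel_measurable_sum borel_measurable_times borel_measurable_const borel_measurable_inner z)
    then show ?thesis unfolding Qeq[abs_def] by measurable
  qed
  have "(\<integral>\<^sup>+\<omega>. ennreal (((\<Sum>i<N. \<eta> i \<omega> \<bullet> (W (?g (Suc i)) \<omega> - W (?g i) \<omega>)) - simple_integral W m \<tau> \<xi> \<omega>)\<^sup>2) \<partial>M) = (\<integral>\<^sup>+\<omega>. Q \<omega> \<partial>M)"
    unfolding Q_def sum[symmetric] by (rule ito_isometry[OF st \<zeta>])
  also have "\<dots> = (\<integral>\<^sup>+\<omega>. 2 * (ennreal (1/2) * Q \<omega>) \<partial>completion M)"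
    by (simp only: nn_integral_completion mult.assoc[symmetric] half mult_1)
  also have "\<dots> = 2 * (\<integral>\<^sup>+\<omega>. ennreal (1/2) * Q \<omega> \<partial>completion M)"
    by (rule nn_integral_cmult) (use Qm in measurable)
  also have "(\<integral>\<^sup>+\<omega>. ennreal (1/2) * Q \<omega> \<partial>completion M) \<le> (\<integral>\<^sup>+\<omega>. ennreal (R \<omega>) \<partial>completion M) + (\<integral>\<^sup>+\<omega>. E \<omega> \<partial>completion M)"
  proof (rule nn_integral_add_le)
    show "(\<lambda>\<omega>. ennreal (1/2) * Q \<omega>) \<in> borel_measurable (completion M)" using Qm by measurable
    show "(\<lambda>\<omega>. ennreal (R \<omega>)) \<in> borel_measurable (completion M)" using Rm by measurable
    have "AE \<omega> in M. ennreal (1/2) * Q \<omega> \<le> ennreal (R \<omega>) + E \<omega>" using QE R0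
    proof eventually_elim
      case (elim \<omega>)
      have "ennreal (1/2) * Q \<omega> \<le> ennreal (1/2) * (2 * (ennreal (R \<omega>) + E \<omega>))"
        using elim by (intro mult_left_mono) (auto simp: ennreal_mult distrib_left)
      also have "\<dots> = ennreal (R \<omega>) + E \<omega>" by (simp only: mult.assoc[symmetric] half' mult_1)
      finally show ?case .
    qed
    then show "AE \<omega> in completion M. ennreal (1/2) * Q \<omega> \<le> ennreal (R \<omega>) + E \<omega>" by (rule AE_completion)
  qed auto
  also have "\<dots> \<le> ennreal ((b - a) * c) + (\<integral>\<^sup>+\<omega>. E \<omega> \<partial>M)"
    using ER by (intro add_mono) (auto simp: nn_integral_completion)
  also have "2 * (ennreal ((b - a) * c) + (\<integral>\<^sup>+\<omega>. E \<omega> \<partial>M)) = ennreal (2 * ((b - a) * c)) + 2 * (\<integral>\<^sup>+\<omega>. E \<omega> \<partial>M)"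
    by (simp add: distrib_left ennreal_mult')
  finally show ?thesis unfolding E_def by (simp add: mult_left_mono)
qed

text \<open>Let the simple processes of the definition converge to \<open>H\<close>.\<close>

lemma left_sum_ito_integral:
  fixes H :: "real \<Rightarrow> 'w \<Rightarrow> real^2"
  assumes e: "\<epsilon> > 0" and ab: "0 \<le> a" "a \<le> b" and N: "N > 0"
    and I: "has_ito_integral M (init_filtration M (X 0) W) W H a b I"
    and \<eta>: "\<And>i. i < N \<Longrightarrow> brownian_inputs.sq_adp M W (X 0) (Pe \<epsilon> 0) (grid a b N i) (\<eta> i)"
    and H: "AE \<omega> in M. continuous_on {a..b} (\<lambda>r. H r \<omega>)"
    and F: "\<And>i r. i < N \<Longrightarrow> r \<in> {grid a b N i..grid a b N (Suc i)} \<Longrightarrow> mom M 2 (\<lambda>\<omega>. \<eta> i \<omega> - H r \<omega>) c"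
  shows "mom M 2 (\<lambda>\<omega>. (\<Sum>i<N. \<eta> i \<omega> \<bullet> (W (grid a b N (Suc i)) \<omega> - W (grid a b N i) \<omega>)) - I \<omega>) (8 * ((b - a) * c))"
proof -
  interpret brownian_inputs M W "X 0" "Pe \<epsilon> 0" by (rule inputs[OF e])
  let ?S = "\<lambda>\<omega>. \<Sum>i<N. \<eta> i \<omega> \<bullet> (W (grid a b N (Suc i)) \<omega> - W (grid a b N i) \<omega>)"
  obtain m \<tau> \<xi> where simple: "\<And>k. simple_process (init_filtration M (X 0) W) a b (m k) (\<tau> k) (\<xi> k)"
    and E: "(\<lambda>k. \<integral>\<^sup>+\<omega>. (\<integral>\<^sup>+t\<in>{a..b}. ennreal ((norm (simple_value (m k) (\<tau> k) (\<xi> k) t \<omega> - H t \<omega>))\<^sup>2) \<partial>lborel) \<partial>M) \<longlonglongrightarrow> 0"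
    and J: "(\<lambda>k. \<integral>\<^sup>+\<omega>. ennreal ((simple_integral W (m k) (\<tau> k) (\<xi> k) \<omega> - I \<omega>)\<^sup>2) \<partial>M) \<longlonglongrightarrow> 0"
    and Im: "I \<in> borel_measurable M"
    using I unfolding has_ito_integral_def by blast
  have c0: "0 \<le> c" using mom_nonneg[OF F[of 0 a]] N ab grid_mono[OF ab(2), of 0 "Suc 0" N] by simp
  have Sm: "?S \<in> borel_measurable M"
  proof (intro borel_measurable_sum borel_measurable_inner borel_measurable_diff)
    fix i assume "i \<in> {..<N}"
    then have i: "i < N" by simp
    show "\<eta> i \<in> borel_measurable M" by (rule sq_adp_measurable[OF \<eta>[OF i]])
    show "W (grid a b N (Suc i)) \<in> borel_measurable M" "W (grid a b N i) \<in> borel_measurable M"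
      using grid_bounds[OF ab(2), of i N] grid_bounds[OF ab(2), of "Suc i" N] i ab by (auto intro!: W_meas)
  qed
  have sim: "simple_integral W (m k) (\<tau> k) (\<xi> k) \<in> borel_measurable M" for k
    unfolding simple_integral_def[abs_def]
  proof (intro borel_measurable_sum borel_measurable_inner borel_measurable_diff)
    fix i assume "i \<in> {..<m k}"
    then have i: "i < m k" by simp
    have "\<xi> k i \<in> borel_measurable (init_filtration M (X 0) W (\<tau> k i))"
      using simple[of k] i by (simp add: simple_process_def)
    then show "\<xi> k i \<in> borel_measurable M" by (intro adp_measurable[OF adp_init_filtration])
    show "W (\<tau> k (Suc i)) \<in> borel_measurable M" "W (\<tau> k i) \<in> borel_measurable M"
      using simple_process_bounds[OF simple[of k], of i] simple_process_bounds[OF simple[of k], of "Suc i"] i ab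
      by (auto intro!: W_meas)
  qed
  let ?e = "\<lambda>k. \<integral>\<^sup>+\<omega>. (\<integral>\<^sup>+t\<in>{a..b}. ennreal ((norm (simple_value (m k) (\<tau> k) (\<xi> k) t \<omega> - H t \<omega>))\<^sup>2) \<partial>lborel) \<partial>M"
  let ?j = "\<lambda>k. \<integral>\<^sup>+\<omega>. ennreal ((simple_integral W (m k) (\<tau> k) (\<xi> k) \<omega> - I \<omega>)\<^sup>2) \<partial>M"
  have le: "(\<integral>\<^sup>+\<omega>. ennreal ((?S \<omega> - I \<omega>)\<^sup>2) \<partial>M) \<le> 4 * (ennreal (2 * ((b - a) * c)) + 2 * ?e k) + 4 * ?j k" for k
  proof -
    let ?T = "simple_integral W (m k) (\<tau> k) (\<xi> k)"
    have "(\<integral>\<^sup>+\<omega>. ennreal ((?S \<omega> - I \<omega>)\<^sup>2) \<partial>M) \<le> (\<integral>\<^sup>+\<omega>. 4 * ennreal ((?S \<omega> - ?T \<omega>)\<^sup>2) + 4 * ennreal ((?T \<omega> - I \<omega>)\<^sup>2) \<partial>M)"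
    proof (rule nn_integral_mono)
      fix \<omega>
      have "(x + y)\<^sup>2 \<le> 4 * x\<^sup>2 + 4 * y\<^sup>2" for x y :: real
        using sum_squares_bound[of x y] zero_le_power2[of x] zero_le_power2[of y] unfolding power2_sum by linarith
      from this[of "?S \<omega> - ?T \<omega>" "?T \<omega> - I \<omega>"]
      have "ennreal ((?S \<omega> - I \<omega>)\<^sup>2) \<le> ennreal (4 * (?S \<omega> - ?T \<omega>)\<^sup>2 + 4 * (?T \<omega> - I \<omega>)\<^sup>2)"
        by (intro ennreal_leI) simp
      also have "\<dots> = 4 * ennreal ((?S \<omega> - ?T \<omega>)\<^sup>2) + 4 * ennreal ((?T \<omega> - I \<omega>)\<^sup>2)"
        by (simp add: ennreal_plus ennreal_mult')
      finally show "ennreal ((?S \<omega> - I \<omega>)\<^sup>2) \<le> 4 * ennreal ((?S \<omega> - ?T \<omega>)\<^sup>2) + 4 * ennreal ((?T \<omega> - I \<omega>)\<^sup>2)" .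
    qed
    also have "\<dots> = 4 * (\<integral>\<^sup>+\<omega>. ennreal ((?S \<omega> - ?T \<omega>)\<^sup>2) \<partial>M) + 4 * ?j k"
      using Sm sim[of k] Im by (simp add: nn_integral_add nn_integral_cmult)
    also have "\<dots> \<le> 4 * (ennreal (2 * ((b - a) * c)) + 2 * ?e k) + 4 * ?j k"
      by (intro add_right_mono mult_left_mono left_sum_simple_integral[OF e ab N simple \<eta> H F]) auto
    finally show ?thesis .
  qed
  have "(\<lambda>k. 4 * (ennreal (2 * ((b - a) * c)) + 2 * ?e k) + 4 * ?j k) \<longlonglongrightarrow> 4 * (ennreal (2 * ((b - a) * c)) + 2 * 0) + 4 * 0"
    by (intro tendsto_add ennreal_tendsto_cmult tendsto_const E J) auto
  then have "(\<integral>\<^sup>+\<omega>. ennreal ((?S \<omega> - I \<omega>)\<^sup>2) \<partial>M) \<le> 4 * (ennreal (2 * ((b - a) * c)) + 2 * 0) + 4 * 0"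
    by (rule LIMSEQ_le_const) (use le in blast)
  also have "4 * (ennreal (2 * ((b - a) * c)) + 2 * 0) + 4 * 0 = ennreal (8 * ((b - a) * c))"
    using ab c0 by (simp flip: ennreal_numeral ennreal_mult)
  finally show ?thesis
    using Sm Im ab c0 unfolding mom_def by (auto intro!: measurable_completion simp: power2_abs)
qed

section \<open>The smooth integral converges to the Ito integral with correction\<close>

text \<open>First \<open>Pe\<close> is adapted, as it is driven by \<open>W\<close>; then \<open>Xe\<close> is, as it is driven by \<open>W\<close> and \<open>Pe\<close>.\<close>

lemma sq_adp_solution:
  assumes e: "\<epsilon> > 0" "\<epsilon> \<le> 1" and t: "0 \<le> t"
  shows "brownian_inputs.sq_adp M W (X 0) (Pe \<epsilon> 0) t (\<lambda>\<omega>. B *v Xe \<epsilon> t \<omega>)"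
    and "brownian_inputs.sq_adp M W (X 0) (Pe \<epsilon> 0) t (\<lambda>\<omega>. B *v Pe \<epsilon> t \<omega>)"
proof -
  interpret brownian_inputs M W "X 0" "Pe \<epsilon> 0" by (rule inputs[OF e(1)])
  have P: "adp r (Pe \<epsilon> r)" if r: "0 \<le> r" for r
  proof (rule adp_linear_solution[OF Pe_meas[OF e(1) r] adp_P0 _ _ r])
    show "adp s (W s)" if "0 \<le> s" for s using that by (rule adp_W) simp
    show "AE \<omega> in M. continuous_on {0..} (\<lambda>s. Pe \<epsilon> s \<omega>) \<and>
        (\<forall>s\<ge>0. Pe \<epsilon> s \<omega> = Pe \<epsilon> 0 \<omega> + integral {0..s} (\<lambda>r. (- (1 / \<epsilon>) *\<^sub>R mat_M \<beta>) *v Pe \<epsilon> r \<omega>) + W s \<omega>)"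
      using regular_AE[OF e(1)]
    proof eventually_elim
      case (elim \<omega>)
      show ?case by (intro conjI allI impI regular_cont(3)[OF e(1) elim] regular_P_matrix[OF e(1) elim])
    qed
  qed
  have X0': "adp 0 (Xe \<epsilon> 0)"
    using adp_X0[of 0] Xe0[OF e(1)] Xe_meas[OF e(1), of 0] unfolding adp_def by (auto elim!: eventually_elim2 intro!: bexI)
  have "adp t (Xe \<epsilon> t)"
  proof (rule adp_linear_solution[OF Xe_meas[OF e(1) t] X0' _ _ t])
    show "adp s (\<lambda>\<omega>. sqrt \<gamma> *\<^sub>R (W s \<omega> - Pe \<epsilon> s \<omega> + Pe \<epsilon> 0 \<omega>))" if "0 \<le> s" for s
      using that by (intro adp_scaleR adp_add adp_diff adp_W P adp_P0) auto
    show "AE \<omega> in M. continuous_on {0..} (\<lambda>s. Xe \<epsilon> s \<omega>) \<and>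
        (\<forall>s\<ge>0. Xe \<epsilon> s \<omega> = Xe \<epsilon> 0 \<omega> + integral {0..s} (\<lambda>r. A *v Xe \<epsilon> r \<omega>) + sqrt \<gamma> *\<^sub>R (W s \<omega> - Pe \<epsilon> s \<omega> + Pe \<epsilon> 0 \<omega>))"
      using regular_AE[OF e(1)]
    proof eventually_elim
      case (elim \<omega>)
      show ?case by (intro conjI allI impI regular_cont(2)[OF e(1) elim] regular_Xe_forced[OF e(1) elim])
    qed
  qed
  then have a: "adp t (\<lambda>\<omega>. B *v Xe \<epsilon> t \<omega>)" "adp t (\<lambda>\<omega>. B *v Pe \<epsilon> t \<omega>)" using P[OF t] by (intro adp_matrix, simp)+
  obtain c where c: "mom M 4 (\<lambda>\<omega>. B *v Xe \<epsilon> t \<omega>) c"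
    using order_momE[OF order_mom_matrix[OF Xe_order[OF t], of B]] e t by (metis atLeastAtMost_iff order_refl)
  obtain d where d: "mom M 4 (\<lambda>\<omega>. B *v Pe \<epsilon> t \<omega>) d"
    using order_momE[OF order_mom_matrix[OF Pe_order[of t], of B]] e t by (metis atLeastAtMost_iff order_refl)
  show "sq_adp t (\<lambda>\<omega>. B *v Xe \<epsilon> t \<omega>)" "sq_adp t (\<lambda>\<omega>. B *v Pe \<epsilon> t \<omega>)"
    unfolding sq_adp_def using a mom4_integrable[OF c adp_measurable[OF a(1)], of 2] mom4_integrable[OF d adp_measurable[OF a(2)], of 2]
    by auto
qed

text \<open>On a partition of mesh \<open>\<delta>\<close> the integrand \<open>A Xe\<close> at the left end points differs from \<open>A X\<close> by
  \<open>O(\<epsilon> + \<delta>)\<close> in mean square. The isometry bounds the sums accordingly, and \<open>\<delta>\<close> vanishes in the limit.\<close>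

lemma left_limit_order:
  assumes ab: "0 \<le> a" "a \<le> b" "b \<le> T"
    and I: "has_ito_integral M (init_filtration M (X 0) W) W (\<lambda>t \<omega>. A *v X t \<omega>) a b I"
  shows "order_mom M T 2 1 (\<lambda>\<epsilon> t \<omega>. smooth_path.left_limit A (sqrt \<gamma>) \<epsilon> \<beta> a b (\<lambda>t. Xe \<epsilon> t \<omega>) (\<lambda>t. Pe \<epsilon> t \<omega>) - I \<omega>)"
proof -
  have T: "0 \<le> T" using ab by simp
  obtain K where K: "\<And>s t. 0 \<le> s \<Longrightarrow> s \<le> t \<Longrightarrow> t \<le> T \<Longrightarrow> mom M 2 (\<lambda>\<omega>. X t \<omega> - X s \<omega>) (K * (t - s))"
    using X_increment_mom2[OF T] by blast
  have "order_mom M T 2 1 (\<lambda>\<epsilon> t \<omega>. Xe \<epsilon> t \<omega> - X t \<omega>)" using D_order[OF T] by (intro order_mom_4_imp_2) simp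
  then obtain c where c: "\<And>\<epsilon> t. 0 < \<epsilon> \<Longrightarrow> \<epsilon> \<le> 1 \<Longrightarrow> t \<in> {0..T} \<Longrightarrow> mom M 2 (\<lambda>\<omega>. Xe \<epsilon> t \<omega> - X t \<omega>) (c * \<epsilon> ^ 1)"
    by (rule order_momE) blast
  define L where "L = onorm ((*v) A) ^ 2"
  obtain G :: "real^2^2" where G: "\<And>x y. x \<bullet> (G *v y) = y \<bullet> (G *v x)" "\<And>x. (G *v x) \<bullet> (mat_M \<beta> *v x) = x \<bullet> (A *v (mat_M \<beta> *v x))"
    using quadratic_corrector_exists[of \<beta> A] by blast
  show ?thesis
  proof (rule order_momI[of T M 2 _ "8 * ((b - a) * (L * (4 * c)))"])
    fix \<epsilon> t :: real assume e: "0 < \<epsilon>" "\<epsilon> \<le> 1"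
    have K0: "0 \<le> K * (b - a)" using mom_nonneg[OF K[OF ab]] .
    let ?\<eta> = "\<lambda>N i \<omega>. A *v Xe \<epsilon> (grid a b N i) \<omega>"
    let ?S = "\<lambda>N \<omega>. \<Sum>i<N. ?\<eta> N i \<omega> \<bullet> (W (grid a b N (Suc i)) \<omega> - W (grid a b N i) \<omega>)"
    have "mom M 2 (\<lambda>\<omega>. smooth_path.left_limit A (sqrt \<gamma>) \<epsilon> \<beta> a b (\<lambda>t. Xe \<epsilon> t \<omega>) (\<lambda>t. Pe \<epsilon> t \<omega>) - I \<omega>)
       (8 * ((b - a) * (L * (2 ^ 2 * (c * \<epsilon> ^ 1 + 0)))))"
    proof (rule mom_tendsto)
      let ?c = "\<lambda>N. L * (2 ^ 2 * (c * \<epsilon> ^ 1 + K * (b - a) * (1 / real (Suc N))))"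
      show "(\<lambda>N. 8 * ((b - a) * ?c N)) \<longlonglongrightarrow> 8 * ((b - a) * (L * (2 ^ 2 * (c * \<epsilon> ^ 1 + 0))))"
        by (intro tendsto_mult tendsto_add tendsto_const) (rule tendsto_mult_right_zero, rule LIMSEQ_Suc[OF lim_1_over_n])
      show "mom M 2 (\<lambda>\<omega>. ?S (Suc N) \<omega> - I \<omega>) (8 * ((b - a) * ?c N))" for N
      proof (rule left_sum_ito_integral[OF e(1) ab(1,2) _ I])
        show "brownian_inputs.sq_adp M W (X 0) (Pe \<epsilon> 0) (grid a b (Suc N) i) (?\<eta> (Suc N) i)" if "i < Suc N" for i
          using grid_bounds[OF ab(2), of i "Suc N"] that ab by (intro sq_adp_solution e) auto
        show "AE \<omega> in M. continuous_on {a..b} (\<lambda>r. A *v X r \<omega>)" using regular_AE[OF e(1)]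
        proof eventually_elim
          case (elim \<omega>)
          show ?case by (intro continuous_intros continuous_on_subset[OF regular_cont(1)[OF e(1) elim]]) (use ab in auto)
        qed
        show "mom M 2 (\<lambda>\<omega>. ?\<eta> (Suc N) i \<omega> - A *v X r \<omega>) (?c N)"
          if i: "i < Suc N" and r: "r \<in> {grid a b (Suc N) i..grid a b (Suc N) (Suc i)}" for i r
        proof -
          let ?s = "grid a b (Suc N) i"
          have s: "a \<le> ?s" "?s \<le> b" "grid a b (Suc N) (Suc i) \<le> b"
            using grid_bounds[OF ab(2), of i "Suc N"] grid_bounds[OF ab(2), of "Suc i" "Suc N"] i by auto
          have rs: "?s \<le> r" "r \<le> b" "r - ?s \<le> (b - a) / real (Suc N)" using r s grid_Suc[of a b "Suc N" i] by auto
          have m1: "mom M 2 (\<lambda>\<omega>. Xe \<epsilon> ?s \<omega> - X ?s \<omega>) (c * \<epsilon> ^ 1)" using s ab e by (intro c) auto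
          have "mom M 2 (\<lambda>\<omega>. X r \<omega> - X ?s \<omega>) (K * (r - ?s))" using s rs ab by (intro K) auto
          from mom_scaleR[OF this, of "-1"] have m2: "mom M 2 (\<lambda>\<omega>. X ?s \<omega> - X r \<omega>) (K * (r - ?s))" by simp
          have "K * (r - ?s) \<le> K * (b - a) * (1 / real (Suc N))"
          proof (cases "a = b")
            case True
            then have "r = ?s" using rs by simp
            then show ?thesis using True by simp
          next
            case False
            then have "0 \<le> K" using K0 ab by (simp add: zero_le_mult_iff)
            then show ?thesis using mult_left_mono[OF rs(3), of K] by simp
          qed
          from mom_matrix[OF mom_add[OF m1 mom_mono[OF m2 this]], of A]
          show ?thesis unfolding L_def by (simp add: matrix_vector_mult_diff_distrib)
        qed
      qed simp
      show "AE \<omega> in M. (\<lambda>N. ?S (Suc N) \<omega> - I \<omega>) \<longlonglongrightarrow>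
          smooth_path.left_limit A (sqrt \<gamma>) \<epsilon> \<beta> a b (\<lambda>t. Xe \<epsilon> t \<omega>) (\<lambda>t. Pe \<epsilon> t \<omega>) - I \<omega>"
        using regular_AE[OF e(1)]
      proof eventually_elim
        case (elim \<omega>)
        show ?case
          by (intro tendsto_diff tendsto_const)
            (rule LIMSEQ_Suc[OF smooth_path.left_sums_tendsto[OF regular_smooth_path[OF e(1) elim ab(1,2) G]]])
      qed
    qed
    then show "mom M 2 (\<lambda>\<omega>. smooth_path.left_limit A (sqrt \<gamma>) \<epsilon> \<beta> a b (\<lambda>t. Xe \<epsilon> t \<omega>) (\<lambda>t. Pe \<epsilon> t \<omega>) - I \<omega>)
       (8 * ((b - a) * (L * (4 * c))) * \<epsilon> ^ 1)" by (simp add: mult_ac)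
  qed
qed

end

context two_scale begin

text \<open>Comparison with the zero process turns \<open>left_sum_ito_integral\<close> into a bound for the second moment of
  left-point sums.\<close>

lemma has_ito_integral_zero:
  assumes "a \<le> b"
  shows "has_ito_integral M F W (\<lambda>_ _. 0) a b (\<lambda>_. 0)"
proof -
  have v: "simple_value 1 (\<lambda>i. if i = 0 then a else b) (\<lambda>_ _. 0) t \<omega> = (0::real^2)" for t and \<omega> :: 'w by (simp add: simple_value_def)
  have i: "simple_integral W 1 (\<lambda>i. if i = 0 then a else b) (\<lambda>_ _. 0) \<omega> = 0" for \<omega> by (simp add: simple_integral_def)
  have p: "simple_process F a b 1 (\<lambda>i. if i = 0 then a else b) (\<lambda>_ _. 0)"
    using assms by (auto simp: simple_process_def bounded_iff)
  show ?thesis unfolding has_ito_integral_def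
    using p v i
    by (intro conjI exI[of _ "\<lambda>_. 1"] exI[of _ "\<lambda>_ i. if i = 0 then a else b"] exI[of _ "\<lambda>_ _ _. 0"]) simp_all
qed

text \<open>The integrand \<open>G *v Pe\<close> is \<open>O(\<epsilon>)\<close> in mean square, and the centred quadratic variation disappears as
  the partition is refined.\<close>

lemma square_limit_order:
  assumes ab: "0 \<le> a" "a \<le> b" "b \<le> T"
    and G: "\<And>x y. x \<bullet> (G *v y) = y \<bullet> (G *v x)" "\<And>x. (G *v x) \<bullet> (mat_M \<beta> *v x) = x \<bullet> (A *v (mat_M \<beta> *v x))"
  shows "order_mom M T 2 1 (\<lambda>\<epsilon> t \<omega>. smooth_path.square_limit G \<epsilon> \<beta> a b (\<lambda>t. Pe \<epsilon> t \<omega>))"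
proof -
  have "order_mom M T 2 1 (\<lambda>\<epsilon> t \<omega>. G *v Pe \<epsilon> t \<omega>)" using Pe_order by (intro order_mom_4_imp_2 order_mom_matrix) simp
  then obtain c where c: "\<And>\<epsilon> t. 0 < \<epsilon> \<Longrightarrow> \<epsilon> \<le> 1 \<Longrightarrow> t \<in> {0..T} \<Longrightarrow> mom M 2 (\<lambda>\<omega>. G *v Pe \<epsilon> t \<omega>) (c * \<epsilon> ^ 1)"
    by (rule order_momE) blast
  show ?thesis
  proof (rule order_momI[of T M 2 _ "128 * ((b - a) * c)"])
    fix \<epsilon> t :: real assume e: "0 < \<epsilon>" "\<epsilon> \<le> 1"
    interpret brownian_inputs M W "X 0" "Pe \<epsilon> 0" by (rule inputs[OF e(1)])
    let ?d = "\<lambda>N i \<omega>. W (grid a b N (Suc i)) \<omega> - W (grid a b N i) \<omega>"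
    let ?S = "\<lambda>N \<omega>. \<Sum>i<N. (G *v Pe \<epsilon> (grid a b N i) \<omega>) \<bullet> ?d N i \<omega>"
    let ?Q = "\<lambda>N \<omega>. (\<Sum>i<N. ?d N i \<omega> \<bullet> (G *v ?d N i \<omega>)) - (b - a) * (G $ 1 $ 1 + G $ 2 $ 2)"
    define q where "q = 4 * (12 * (onorm ((*v) G))\<^sup>2 + (G $ 1 $ 1 + G $ 2 $ 2)\<^sup>2) * (b - a)\<^sup>2"
    have "mom M 2 (\<lambda>\<omega>. smooth_path.square_limit G \<epsilon> \<beta> a b (\<lambda>t. Pe \<epsilon> t \<omega>)) (2 ^ 2 * (\<bar>2\<bar> ^ 2 * (8 * ((b - a) * (c * \<epsilon> ^ 1))) + 0))"
    proof (rule mom_tendsto)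
      show "mom M 2 (\<lambda>\<omega>. 2 *\<^sub>R ?S (Suc N) \<omega> + ?Q (Suc N) \<omega>) (2 ^ 2 * (\<bar>2\<bar> ^ 2 * (8 * ((b - a) * (c * \<epsilon> ^ 1))) + q * (1 / real (Suc N))))" for N
      proof (intro mom_add mom_scaleR)
        have "mom M 2 (\<lambda>\<omega>. ?S (Suc N) \<omega> - 0) (8 * ((b - a) * (c * \<epsilon> ^ 1)))"
        proof (rule left_sum_ito_integral[OF e(1) ab(1,2) _ has_ito_integral_zero[OF ab(2)]])
          show "brownian_inputs.sq_adp M W (X 0) (Pe \<epsilon> 0) (grid a b (Suc N) i) (\<lambda>\<omega>. G *v Pe \<epsilon> (grid a b (Suc N) i) \<omega>)" if "i < Suc N" for i
            using grid_bounds[OF ab(2), of i "Suc N"] that ab by (intro sq_adp_solution e) auto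
          show "mom M 2 (\<lambda>\<omega>. G *v Pe \<epsilon> (grid a b (Suc N) i) \<omega> - 0) (c * \<epsilon> ^ 1)" if "i < Suc N" for i
            using grid_bounds[OF ab(2), of i "Suc N"] that ab e c[of \<epsilon> "grid a b (Suc N) i"] by simp
        qed auto
        then show "mom M 2 (?S (Suc N)) (8 * ((b - a) * (c * \<epsilon> ^ 1)))" by simp
        show "mom M 2 (?Q (Suc N)) (q * (1 / real (Suc N)))"
          using quadratic_variation_mom2[OF ab(1,2), of "Suc N" G] by (simp add: q_def)
      qed
      show "AE \<omega> in M. (\<lambda>N. 2 *\<^sub>R ?S (Suc N) \<omega> + ?Q (Suc N) \<omega>) \<longlonglongrightarrow> smooth_path.square_limit G \<epsilon> \<beta> a b (\<lambda>t. Pe \<epsilon> t \<omega>)"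
        using regular_AE[OF e(1)]
      proof eventually_elim
        case (elim \<omega>)
        show ?case
          using LIMSEQ_Suc[OF smooth_path.square_sums_tendsto[OF regular_smooth_path[OF e(1) elim ab(1,2) G]]]
          by (simp only: real_scaleR_def)
      qed
      show "(\<lambda>N. 2 ^ 2 * (\<bar>2\<bar> ^ 2 * (8 * ((b - a) * (c * \<epsilon> ^ 1))) + q * (1 / real (Suc N)))) \<longlonglongrightarrow> 2 ^ 2 * (\<bar>2\<bar> ^ 2 * (8 * ((b - a) * (c * \<epsilon> ^ 1))) + 0)"
        by (intro tendsto_mult tendsto_add tendsto_const) (rule tendsto_mult_right_zero, rule LIMSEQ_Suc[OF lim_1_over_n])
    qed
    then show "mom M 2 (\<lambda>\<omega>. smooth_path.square_limit G \<epsilon> \<beta> a b (\<lambda>t. Pe \<epsilon> t \<omega>)) (128 * ((b - a) * c) * \<epsilon> ^ 1)"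
      by (simp add: mult_ac)
  qed
qed

text \<open>Each term of \<open>rs_integral_decomposition\<close> is estimated on its own.\<close>

lemma smooth_integral_order:
  assumes ab: "0 \<le> a" "a \<le> b" "b \<le> T"
    and J: "has_ito_integral_process M (init_filtration M (X 0) W) W (\<lambda>t \<omega>. A *v X t \<omega>) (sqrt \<gamma>) (\<lambda>t \<omega>. A *v X t \<omega>) a b J"
  shows "order_mom M T 2 1 (\<lambda>\<epsilon> t \<omega>. rs_integral (\<lambda>s. A *v Xe \<epsilon> s \<omega>) (\<lambda>s. Xe \<epsilon> s \<omega>) a b
      - \<gamma> / 2 * (b - a) * (transpose A ::\<^sub>F mat_M \<beta>) - J \<omega>)"
proof -
  have T: "0 \<le> T" using ab by simp
  have aT: "a \<in> {0..T}" and bT: "b \<in> {0..T}" using ab by auto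
  obtain I where I: "has_ito_integral M (init_filtration M (X 0) W) W (\<lambda>t \<omega>. A *v X t \<omega>) a b I"
    and JI: "AE \<omega> in M. J \<omega> = integral {a..b} (\<lambda>t. (A *v X t \<omega>) \<bullet> (A *v X t \<omega>)) + sqrt \<gamma> * I \<omega>"
    using J unfolding has_ito_integral_process_def by (auto elim: eventually_mono)
  obtain G :: "real^2^2" where G: "\<And>x y. x \<bullet> (G *v y) = y \<bullet> (G *v x)" "\<And>x. (G *v x) \<bullet> (mat_M \<beta> *v x) = x \<bullet> (A *v (mat_M \<beta> *v x))"
    and trG: "G $ 1 $ 1 + G $ 2 $ 2 = transpose A ::\<^sub>F mat_M \<beta>"
    using quadratic_corrector_exists[of \<beta> A] by blast
  let ?L = "\<lambda>\<epsilon> \<omega>. smooth_path.left_limit A (sqrt \<gamma>) \<epsilon> \<beta> a b (\<lambda>t. Xe \<epsilon> t \<omega>) (\<lambda>t. Pe \<epsilon> t \<omega>)"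
  let ?Z = "\<lambda>\<epsilon> \<omega>. smooth_path.square_limit G \<epsilon> \<beta> a b (\<lambda>t. Pe \<epsilon> t \<omega>)"
  let ?D = "\<lambda>\<epsilon> t \<omega>. (A *v (Xe \<epsilon> t \<omega> - X t \<omega>)) \<bullet> (A *v (Xe \<epsilon> t \<omega> + X t \<omega>))"
  have contD: "AE \<omega> in M. continuous_on {a..b} (\<lambda>t. ?D \<epsilon> t \<omega>)" if e: "0 < \<epsilon>" for \<epsilon>
    using regular_AE[OF e]
  proof eventually_elim
    case (elim \<omega>)
    show ?case
      by (intro continuous_intros continuous_on_subset[OF regular_cont(1)[OF e elim]] continuous_on_subset[OF regular_cont(2)[OF e elim]])
        (use ab in auto)
  qed
  have contP: "AE \<omega> in M. continuous_on {a..b} (\<lambda>t. Pe \<epsilon> t \<omega> \<bullet> (A *v (A *v Xe \<epsilon> t \<omega>)))" if e: "0 < \<epsilon>" for \<epsilon>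
    using regular_AE[OF e]
  proof eventually_elim
    case (elim \<omega>)
    show ?case
      by (intro continuous_intros continuous_on_subset[OF regular_cont(3)[OF e elim]] continuous_on_subset[OF regular_cont(2)[OF e elim]])
        (use ab in auto)
  qed
  note Xeo = Xe_order[OF T] and Xo = X_order[OF T] and Do = D_order[OF T] and Po = Pe_order[of T]
  have X0: "order_mom M T 4 (2 * 0) (\<lambda>\<epsilon> t \<omega>. B *v Xe \<epsilon> t \<omega>)" for B :: "real^2^2" using order_mom_matrix[OF Xeo] by simp
  have P2: "order_mom M T 4 (2 * 1) (\<lambda>\<epsilon> t \<omega>. B *v Pe \<epsilon> t \<omega>)" for B :: "real^2^2" using order_mom_matrix[OF Po] by simp
  have P1: "order_mom M T 4 (2 * 1) Pe" using Po by simp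
  have "order_mom M T 2 (1 + 0) ?D"
  proof (rule order_mom_inner)
    show "order_mom M T 4 (2 * 1) (\<lambda>\<epsilon> t \<omega>. A *v (Xe \<epsilon> t \<omega> - X t \<omega>))" using order_mom_matrix[OF Do] by simp
    show "order_mom M T 4 (2 * 0) (\<lambda>\<epsilon> t \<omega>. A *v (Xe \<epsilon> t \<omega> + X t \<omega>))" using order_mom_matrix[OF order_mom_add[OF Xeo Xo]] by simp
  qed
  then have t1: "order_mom M T 2 1 (\<lambda>\<epsilon> t \<omega>. integral {a..b} (\<lambda>t. ?D \<epsilon> t \<omega>))"
    by (intro order_mom_integral ab contD) auto
  have t2: "order_mom M T 2 1 (\<lambda>\<epsilon> t \<omega>. sqrt \<gamma> *\<^sub>R (?L \<epsilon> \<omega> - I \<omega>))"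
    by (intro order_mom_scaleR left_limit_order[OF ab I])
  have AP: "order_mom M T 2 1 (\<lambda>\<epsilon> t \<omega>. (A *v Xe \<epsilon> t \<omega>) \<bullet> Pe \<epsilon> t \<omega>)" using order_mom_inner[OF X0 P1] by simp
  have t3: "order_mom M T 2 1 (\<lambda>\<epsilon> t \<omega>. sqrt \<gamma> *\<^sub>R ((A *v Xe \<epsilon> b \<omega>) \<bullet> Pe \<epsilon> b \<omega> - (A *v Xe \<epsilon> a \<omega>) \<bullet> Pe \<epsilon> a \<omega>))"
    by (intro order_mom_scaleR order_mom_diff order_mom_at[OF AP] aT bT)
  have "order_mom M T 2 1 (\<lambda>\<epsilon> t \<omega>. Pe \<epsilon> t \<omega> \<bullet> ((A ** A) *v Xe \<epsilon> t \<omega>))" using order_mom_inner[OF P1 X0] by simp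
  then have t4: "order_mom M T 2 1 (\<lambda>\<epsilon> t \<omega>. sqrt \<gamma> *\<^sub>R integral {a..b} (\<lambda>t. Pe \<epsilon> t \<omega> \<bullet> (A *v (A *v Xe \<epsilon> t \<omega>))))"
    by (intro order_mom_scaleR order_mom_integral ab contP) (simp_all add: matrix_vector_mul_assoc)
  have GP: "order_mom M T 2 1 (\<lambda>\<epsilon> t \<omega>. Pe \<epsilon> t \<omega> \<bullet> (G *v Pe \<epsilon> t \<omega>))"
    by (rule order_mom_weaken[OF order_mom_inner[OF P1 P2]]) simp
  have t5: "order_mom M T 2 1 (\<lambda>\<epsilon> t \<omega>. (\<gamma> / 2) *\<^sub>R (?Z \<epsilon> \<omega> - (Pe \<epsilon> b \<omega> \<bullet> (G *v Pe \<epsilon> b \<omega>) - Pe \<epsilon> a \<omega> \<bullet> (G *v Pe \<epsilon> a \<omega>))))"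
    by (intro order_mom_scaleR order_mom_diff order_mom_at[OF GP] aT bT square_limit_order[OF ab G])
  show ?thesis
  proof (rule order_mom_AE_cong[OF order_mom_add[OF order_mom_add[OF order_mom_diff[OF order_mom_add[OF t1 t2] t3] t4] t5]])
    fix \<epsilon> t :: real assume e: "0 < \<epsilon>"
    show "AE \<omega> in M. integral {a..b} (\<lambda>t. ?D \<epsilon> t \<omega>) + sqrt \<gamma> *\<^sub>R (?L \<epsilon> \<omega> - I \<omega>)
        - sqrt \<gamma> *\<^sub>R ((A *v Xe \<epsilon> b \<omega>) \<bullet> Pe \<epsilon> b \<omega> - (A *v Xe \<epsilon> a \<omega>) \<bullet> Pe \<epsilon> a \<omega>)
        + sqrt \<gamma> *\<^sub>R integral {a..b} (\<lambda>t. Pe \<epsilon> t \<omega> \<bullet> (A *v (A *v Xe \<epsilon> t \<omega>)))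
        + (\<gamma> / 2) *\<^sub>R (?Z \<epsilon> \<omega> - (Pe \<epsilon> b \<omega> \<bullet> (G *v Pe \<epsilon> b \<omega>) - Pe \<epsilon> a \<omega> \<bullet> (G *v Pe \<epsilon> a \<omega>)))
      = rs_integral (\<lambda>s. A *v Xe \<epsilon> s \<omega>) (\<lambda>s. Xe \<epsilon> s \<omega>) a b - \<gamma> / 2 * (b - a) * (transpose A ::\<^sub>F mat_M \<beta>) - J \<omega>"
      using regular_AE[OF e] JI
    proof eventually_elim
      case (elim \<omega>)
      have cX: "continuous_on {a..b} (\<lambda>t. X t \<omega>)" by (rule continuous_on_subset[OF regular_cont(1)[OF e elim(1)]]) (use ab in auto)
      have cXe: "continuous_on {a..b} (\<lambda>t. Xe \<epsilon> t \<omega>)" by (rule continuous_on_subset[OF regular_cont(2)[OF e elim(1)]]) (use ab in auto)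
      have "integral {a..b} (\<lambda>t. ?D \<epsilon> t \<omega>) = integral {a..b} (\<lambda>t. (A *v Xe \<epsilon> t \<omega>) \<bullet> (A *v Xe \<epsilon> t \<omega>) - (A *v X t \<omega>) \<bullet> (A *v X t \<omega>))"
        by (intro arg_cong[where f="integral _"] ext)
          (simp add: matrix_vector_mult_diff_distrib matrix_vector_right_distrib inner_diff_left inner_diff_right inner_add_right inner_commute)
      also have "\<dots> = integral {a..b} (\<lambda>t. (A *v Xe \<epsilon> t \<omega>) \<bullet> (A *v Xe \<epsilon> t \<omega>)) - integral {a..b} (\<lambda>t. (A *v X t \<omega>) \<bullet> (A *v X t \<omega>))"
        by (intro Henstock_Kurzweil_Integration.integral_diff integrable_continuous_real continuous_intros cX cXe)
      finally show ?case
        using smooth_path.rs_integral_decomposition[OF regular_smooth_path[OF e elim(1) ab(1,2) G]] elim(2) \<gamma> trG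
        by (simp add: algebra_simps)
    qed
  qed
qed

text \<open>The second moment of the Ito integral is bounded by comparing it with the sum whose coefficient
  is zero.\<close>

lemma ito_value_mom2:
  assumes ab: "0 \<le> a" "a \<le> b"
    and J: "has_ito_integral_process M (init_filtration M (X 0) W) W (\<lambda>t \<omega>. A *v X t \<omega>) (sqrt \<gamma>) (\<lambda>t \<omega>. A *v X t \<omega>) a b J"
  shows "\<exists>c. mom M 2 J c"
proof -
  interpret brownian_inputs M W "X 0" "Pe 1 0" by (rule inputs) simp
  have T: "0 \<le> b" using ab by simp
  obtain I where I: "has_ito_integral M (init_filtration M (X 0) W) W (\<lambda>t \<omega>. A *v X t \<omega>) a b I"
    and JI: "AE \<omega> in M. J \<omega> = integral {a..b} (\<lambda>t. (A *v X t \<omega>) \<bullet> (A *v X t \<omega>)) + sqrt \<gamma> * I \<omega>"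
    using J unfolding has_ito_integral_process_def by (auto elim: eventually_mono)
  have contX: "AE \<omega> in M. continuous_on {a..b} (\<lambda>t. A *v X t \<omega>)"
    using regular_AE[OF zero_less_one]
  proof eventually_elim
    case (elim \<omega>)
    show ?case
      by (intro continuous_intros continuous_on_subset[OF regular_cont(1)[OF zero_less_one elim]]) (use ab in auto)
  qed
  have AX: "order_mom M b 4 (2 * 0) (\<lambda>\<epsilon> t \<omega>. A *v X t \<omega>)" using order_mom_matrix[OF X_order[OF T]] by simp
  have "order_mom M b 2 (0 + 0) (\<lambda>\<epsilon> t \<omega>. integral {a..b} (\<lambda>t. (A *v X t \<omega>) \<bullet> (A *v X t \<omega>)))"
    by (intro order_mom_integral order_mom_inner AX ab order_refl)
      (use contX in \<open>auto elim!: eventually_mono intro: continuous_on_inner\<close>)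
  then obtain c1 where "\<And>\<epsilon> t. 0 < \<epsilon> \<Longrightarrow> \<epsilon> \<le> 1 \<Longrightarrow> t \<in> {0..b} \<Longrightarrow>
      mom M 2 (\<lambda>\<omega>. integral {a..b} (\<lambda>t. (A *v X t \<omega>) \<bullet> (A *v X t \<omega>))) (c1 * \<epsilon> ^ (0 + 0))"
    by (rule order_momE) blast
  from this[of 1 0] have c1: "mom M 2 (\<lambda>\<omega>. integral {a..b} (\<lambda>t. (A *v X t \<omega>) \<bullet> (A *v X t \<omega>))) c1" using T by simp
  obtain c2 where "\<And>\<epsilon> t. 0 < \<epsilon> \<Longrightarrow> \<epsilon> \<le> 1 \<Longrightarrow> t \<in> {0..b} \<Longrightarrow> mom M 2 (\<lambda>\<omega>. A *v X t \<omega>) (c2 * \<epsilon> ^ 0)"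
    by (rule order_momE[OF order_mom_4_imp_2[OF AX]]) blast
  from this[of 1] have c2: "t \<in> {0..b} \<Longrightarrow> mom M 2 (\<lambda>\<omega>. A *v X t \<omega>) c2" for t by simp
  have "mom M 2 (\<lambda>\<omega>. (\<Sum>i<1. (0::real^2) \<bullet> (W (grid a b 1 (Suc i)) \<omega> - W (grid a b 1 i) \<omega>)) - I \<omega>) (8 * ((b - a) * c2))"
  proof (rule left_sum_ito_integral[OF zero_less_one ab _ I _ contX])
    show "sq_adp (grid a b 1 i) (\<lambda>\<omega>. 0)" for i by (simp add: sq_adp_def adp_const)
    show "mom M 2 (\<lambda>\<omega>. 0 - A *v X r \<omega>) c2" if "i < 1" "r \<in> {grid a b 1 i..grid a b 1 (Suc i)}" for i r
    proof -
      have "r \<in> {0..b}" using grid_cell(1)[OF ab(2) that(1)] that(2) ab(1) by auto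
      from mom_scaleR[OF c2[OF this], of "-1"] show ?thesis by simp
    qed
  qed simp
  from mom_scaleR[OF this, of "-1"] have mI: "mom M 2 I (8 * ((b - a) * c2))" by simp
  have "mom M 2 (\<lambda>\<omega>. integral {a..b} (\<lambda>t. (A *v X t \<omega>) \<bullet> (A *v X t \<omega>)) + sqrt \<gamma> *\<^sub>R I \<omega>) (2 ^ 2 * (c1 + \<bar>sqrt \<gamma>\<bar> ^ 2 * (8 * ((b - a) * c2))))"
    by (intro mom_add c1 mom_scaleR mI)
  then have "mom M 2 J (2 ^ 2 * (c1 + \<bar>sqrt \<gamma>\<bar> ^ 2 * (8 * ((b - a) * c2))))"
    by (rule mom_AE_cong) (use JI in \<open>auto elim!: eventually_mono\<close>)
  then show ?thesis by blast
qed

end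

section \<open>Convergence in quadratic mean\<close>

text \<open>Vector-valued counterparts of \<^const>\<open>in_L2\<close> and \<^const>\<open>tendsto_L2\<close>, for the gains.\<close>

definition in_l2 :: "'w measure \<Rightarrow> ('w \<Rightarrow> 'b::euclidean_space) \<Rightarrow> bool" where
  "in_l2 M f \<longleftrightarrow> f \<in> borel_measurable (completion M) \<and> integrable (completion M) (\<lambda>\<omega>. (norm (f \<omega>))\<^sup>2)"

definition l2_tendsto :: "'w measure \<Rightarrow> ('e \<Rightarrow> 'w \<Rightarrow> 'b::euclidean_space) \<Rightarrow> ('w \<Rightarrow> 'b) \<Rightarrow> 'e filter \<Rightarrow> bool" where
  "l2_tendsto M f g F \<longleftrightarrow> in_l2 M g \<and> (\<forall>\<^sub>F e in F. in_l2 M (f e)) \<and>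
     ((\<lambda>e. \<integral>\<omega>. (norm (f e \<omega> - g \<omega>))\<^sup>2 \<partial>(completion M)) \<longlongrightarrow> 0) F"

lemma tendsto_L2_iff_l2_tendsto: "tendsto_L2 M f g F \<longleftrightarrow> l2_tendsto M f g F"
  unfolding tendsto_L2_def l2_tendsto_def in_L2_def in_l2_def by simp

lemma norm_add_square_le: "(norm (x + y))\<^sup>2 \<le> 2 * (norm x)\<^sup>2 + 2 * (norm y)\<^sup>2" for x y :: "'b::real_normed_vector"
proof -
  have "(norm (x + y))\<^sup>2 \<le> (norm x + norm y)\<^sup>2" by (intro power_mono norm_triangle_ineq) auto
  also have "\<dots> \<le> 2 * (norm x)\<^sup>2 + 2 * (norm y)\<^sup>2"
    using sum_squares_bound[of "norm x" "norm y"] unfolding power2_sum by linarith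
  finally show ?thesis .
qed

lemma in_l2_dominated:
  fixes f :: "'w \<Rightarrow> 'b::euclidean_space" and g :: "'w \<Rightarrow> 'c::euclidean_space"
  assumes g: "in_l2 M g" and f: "f \<in> borel_measurable (completion M)" and le: "AE \<omega> in M. norm (f \<omega>) \<le> k * norm (g \<omega>)"
  shows "in_l2 M f"
proof -
  have "integrable (completion M) (\<lambda>\<omega>. (norm (f \<omega>))\<^sup>2)"
  proof (rule Bochner_Integration.integrable_bound)
    show "integrable (completion M) (\<lambda>\<omega>. k\<^sup>2 * (norm (g \<omega>))\<^sup>2)" using g by (simp add: in_l2_def)
    have "AE \<omega> in M. norm ((norm (f \<omega>))\<^sup>2) \<le> norm (k\<^sup>2 * (norm (g \<omega>))\<^sup>2)"
      using le
    proof eventually_elim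
      case (elim \<omega>)
      then have "(norm (f \<omega>))\<^sup>2 \<le> (k * norm (g \<omega>))\<^sup>2" by (intro power_mono) auto
      then show ?case by (simp add: power_mult_distrib)
    qed
    then show "AE \<omega> in completion M. norm ((norm (f \<omega>))\<^sup>2) \<le> norm (k\<^sup>2 * (norm (g \<omega>))\<^sup>2)" by (rule AE_completion)
  qed (use f in measurable)
  then show ?thesis using f by (simp add: in_l2_def)
qed

lemma in_l2_add:
  assumes "in_l2 M f" "in_l2 M g" shows "in_l2 M (\<lambda>\<omega>. f \<omega> + g \<omega>)"
proof -
  have [measurable]: "f \<in> borel_measurable (completion M)" "g \<in> borel_measurable (completion M)" using assms by (auto simp: in_l2_def)
  have "integrable (completion M) (\<lambda>\<omega>. (norm (f \<omega> + g \<omega>))\<^sup>2)"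
  proof (rule Bochner_Integration.integrable_bound)
    show "integrable (completion M) (\<lambda>\<omega>. 2 * (norm (f \<omega>))\<^sup>2 + 2 * (norm (g \<omega>))\<^sup>2)"
      using assms by (simp add: in_l2_def)
    show "AE \<omega> in completion M. norm ((norm (f \<omega> + g \<omega>))\<^sup>2) \<le> norm (2 * (norm (f \<omega>))\<^sup>2 + 2 * (norm (g \<omega>))\<^sup>2)"
      using norm_add_square_le by (intro AE_I2) (auto intro: order_trans[OF _ abs_ge_self])
  qed measurable
  then show ?thesis by (simp add: in_l2_def)
qed

lemma in_l2_scaleR: "in_l2 M f \<Longrightarrow> in_l2 M (\<lambda>\<omega>. k *\<^sub>R f \<omega>)"
  by (rule in_l2_dominated[where k = "\<bar>k\<bar>"]) (auto simp: in_l2_def)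

lemma in_l2_diff: "in_l2 M f \<Longrightarrow> in_l2 M g \<Longrightarrow> in_l2 M (\<lambda>\<omega>. f \<omega> - g \<omega>)"
  using in_l2_add[of M f "\<lambda>\<omega>. (-1) *\<^sub>R g \<omega>"] in_l2_scaleR[of M g "-1"] by simp

lemma in_l2_norm: "in_l2 M f \<Longrightarrow> in_l2 M (\<lambda>\<omega>. norm (f \<omega>))"
  by (rule in_l2_dominated[where k = 1]) (auto simp: in_l2_def)

lemma l2_expectation_add:
  assumes "in_l2 M f" "in_l2 M g"
  shows "(\<integral>\<omega>. (norm (f \<omega> + g \<omega>))\<^sup>2 \<partial>completion M) \<le> 2 * (\<integral>\<omega>. (norm (f \<omega>))\<^sup>2 \<partial>completion M) + 2 * (\<integral>\<omega>. (norm (g \<omega>))\<^sup>2 \<partial>completion M)"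
proof -
  have "(\<integral>\<omega>. (norm (f \<omega> + g \<omega>))\<^sup>2 \<partial>completion M) \<le> (\<integral>\<omega>. 2 * (norm (f \<omega>))\<^sup>2 + 2 * (norm (g \<omega>))\<^sup>2 \<partial>completion M)"
    using assms in_l2_add[OF assms] by (intro integral_mono norm_add_square_le) (auto simp: in_l2_def)
  also have "\<dots> = 2 * (\<integral>\<omega>. (norm (f \<omega>))\<^sup>2 \<partial>completion M) + 2 * (\<integral>\<omega>. (norm (g \<omega>))\<^sup>2 \<partial>completion M)"
    using assms by (simp add: in_l2_def)
  finally show ?thesis .
qed

lemma l2_expectation_dominated:
  fixes f :: "'w \<Rightarrow> 'b::euclidean_space" and g :: "'w \<Rightarrow> 'c::euclidean_space"
  assumes g: "in_l2 M g" and f: "f \<in> borel_measurable (completion M)" and le: "AE \<omega> in M. norm (f \<omega>) \<le> k * norm (g \<omega>)"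
  shows "(\<integral>\<omega>. (norm (f \<omega>))\<^sup>2 \<partial>completion M) \<le> k\<^sup>2 * (\<integral>\<omega>. (norm (g \<omega>))\<^sup>2 \<partial>completion M)"
proof -
  have "AE \<omega> in M. (norm (f \<omega>))\<^sup>2 \<le> k\<^sup>2 * (norm (g \<omega>))\<^sup>2"
    using le
  proof eventually_elim
    case (elim \<omega>)
    then have "(norm (f \<omega>))\<^sup>2 \<le> (k * norm (g \<omega>))\<^sup>2" by (intro power_mono) auto
    then show ?case by (simp add: power_mult_distrib)
  qed
  then have "(\<integral>\<omega>. (norm (f \<omega>))\<^sup>2 \<partial>completion M) \<le> (\<integral>\<omega>. k\<^sup>2 * (norm (g \<omega>))\<^sup>2 \<partial>completion M)"
    using in_l2_dominated[OF g f le] g by (intro integral_mono_AE AE_completion) (auto simp: in_l2_def)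
  then show ?thesis by simp
qed

lemma l2_tendstoI:
  assumes g: "in_l2 M g" and f: "\<forall>\<^sub>F e in F. in_l2 M (f e)"
    and le: "\<forall>\<^sub>F e in F. (\<integral>\<omega>. (norm (f e \<omega> - g \<omega>))\<^sup>2 \<partial>(completion M)) \<le> b e" and b: "(b \<longlongrightarrow> 0) F"
  shows "l2_tendsto M f g F"
  unfolding l2_tendsto_def
proof (intro conjI g f)
  show "((\<lambda>e. \<integral>\<omega>. (norm (f e \<omega> - g \<omega>))\<^sup>2 \<partial>(completion M)) \<longlongrightarrow> 0) F"
    by (rule tendsto_sandwich[OF _ le tendsto_const b]) (auto intro!: always_eventually integral_nonneg_AE)
qed

lemma l2_tendsto_const: "in_l2 M f \<Longrightarrow> l2_tendsto M (\<lambda>_. f) f F"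
  by (simp add: l2_tendsto_def)

lemma l2_tendsto_add:
  assumes f: "l2_tendsto M f f0 F" and g: "l2_tendsto M g g0 F"
  shows "l2_tendsto M (\<lambda>e \<omega>. f e \<omega> + g e \<omega>) (\<lambda>\<omega>. f0 \<omega> + g0 \<omega>) F"
proof (rule l2_tendstoI)
  have ev: "\<forall>\<^sub>F e in F. in_l2 M (f e) \<and> in_l2 M (g e)" using f g by (auto simp: l2_tendsto_def eventually_conj_iff)
  show "in_l2 M (\<lambda>\<omega>. f0 \<omega> + g0 \<omega>)" using f g by (intro in_l2_add) (auto simp: l2_tendsto_def)
  show "\<forall>\<^sub>F e in F. in_l2 M (\<lambda>\<omega>. f e \<omega> + g e \<omega>)" using ev by eventually_elim (auto intro: in_l2_add)
  show "\<forall>\<^sub>F e in F. (\<integral>\<omega>. (norm (f e \<omega> + g e \<omega> - (f0 \<omega> + g0 \<omega>)))\<^sup>2 \<partial>(completion M)) \<le>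
     2 * (\<integral>\<omega>. (norm (f e \<omega> - f0 \<omega>))\<^sup>2 \<partial>(completion M)) + 2 * (\<integral>\<omega>. (norm (g e \<omega> - g0 \<omega>))\<^sup>2 \<partial>(completion M))"
    using ev
  proof eventually_elim
    case (elim e)
    have "in_l2 M (\<lambda>\<omega>. f e \<omega> - f0 \<omega>)" "in_l2 M (\<lambda>\<omega>. g e \<omega> - g0 \<omega>)"
      using elim f g by (auto simp: l2_tendsto_def intro: in_l2_diff)
    from l2_expectation_add[OF this] show ?case by (simp add: algebra_simps)
  qed
  have "((\<lambda>e. 2 * (\<integral>\<omega>. (norm (f e \<omega> - f0 \<omega>))\<^sup>2 \<partial>(completion M)) + 2 * (\<integral>\<omega>. (norm (g e \<omega> - g0 \<omega>))\<^sup>2 \<partial>(completion M))) \<longlongrightarrow> 2 * 0 + 2 * 0) F"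
    using f g by (intro tendsto_intros) (auto simp: l2_tendsto_def)
  then show "((\<lambda>e. 2 * (\<integral>\<omega>. (norm (f e \<omega> - f0 \<omega>))\<^sup>2 \<partial>(completion M)) + 2 * (\<integral>\<omega>. (norm (g e \<omega> - g0 \<omega>))\<^sup>2 \<partial>(completion M))) \<longlongrightarrow> 0) F" by simp
qed

lemma l2_tendsto_dominated:
  assumes f0: "in_l2 M f0" and f: "\<forall>\<^sub>F e in F. f e \<in> borel_measurable (completion M)"
    and h: "l2_tendsto M h (\<lambda>_. 0) F" and le: "\<forall>\<^sub>F e in F. AE \<omega> in M. norm (f e \<omega> - f0 \<omega>) \<le> k * norm (h e \<omega>)"
  shows "l2_tendsto M f f0 F"
proof (rule l2_tendstoI[OF f0])
  have h2: "\<forall>\<^sub>F e in F. in_l2 M (h e)" and h0: "((\<lambda>e. \<integral>\<omega>. (norm (h e \<omega>))\<^sup>2 \<partial>(completion M)) \<longlongrightarrow> 0) F"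
    using h by (auto simp: l2_tendsto_def)
  have d: "\<forall>\<^sub>F e in F. (\<lambda>\<omega>. f e \<omega> - f0 \<omega>) \<in> borel_measurable (completion M)"
    using f by eventually_elim (use f0 in \<open>auto simp: in_l2_def\<close>)
  show "\<forall>\<^sub>F e in F. in_l2 M (f e)" using d h2 le
  proof eventually_elim
    case (elim e)
    from in_l2_add[OF in_l2_dominated[OF elim(2,1,3)] f0] show ?case by simp
  qed
  show "\<forall>\<^sub>F e in F. (\<integral>\<omega>. (norm (f e \<omega> - f0 \<omega>))\<^sup>2 \<partial>(completion M)) \<le> k\<^sup>2 * (\<integral>\<omega>. (norm (h e \<omega>))\<^sup>2 \<partial>(completion M))"
    using d h2 le by eventually_elim (rule l2_expectation_dominated)
  show "((\<lambda>e. k\<^sup>2 * (\<integral>\<omega>. (norm (h e \<omega>))\<^sup>2 \<partial>(completion M))) \<longlongrightarrow> 0) F"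
    using tendsto_mult_right_zero[OF h0] by simp
qed

lemma l2_tendsto_scaleR: "l2_tendsto M f f0 F \<Longrightarrow> l2_tendsto M (\<lambda>e \<omega>. k *\<^sub>R f e \<omega>) (\<lambda>\<omega>. k *\<^sub>R f0 \<omega>) F"
proof (rule l2_tendsto_dominated[where h = "\<lambda>e \<omega>. f e \<omega> - f0 \<omega>" and k = "\<bar>k\<bar>"])
  assume f: "l2_tendsto M f f0 F"
  then have f0: "in_l2 M f0" and ev: "\<forall>\<^sub>F e in F. in_l2 M (f e)" by (auto simp: l2_tendsto_def)
  show "in_l2 M (\<lambda>\<omega>. k *\<^sub>R f0 \<omega>)" using f0 by (rule in_l2_scaleR)
  show "\<forall>\<^sub>F e in F. (\<lambda>\<omega>. k *\<^sub>R f e \<omega>) \<in> borel_measurable (completion M)" using ev by eventually_elim (auto simp: in_l2_def)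
  show "l2_tendsto M (\<lambda>e \<omega>. f e \<omega> - f0 \<omega>) (\<lambda>_. 0) F"
    using f ev f0 by (auto simp: l2_tendsto_def in_l2_def[of _ "\<lambda>_. 0"] elim!: eventually_mono intro: in_l2_diff)
  show "\<forall>\<^sub>F e in F. AE \<omega> in M. norm (k *\<^sub>R f e \<omega> - k *\<^sub>R f0 \<omega>) \<le> \<bar>k\<bar> * norm (f e \<omega> - f0 \<omega>)"
    by (simp flip: scaleR_diff_right)
qed

lemma l2_tendsto_diff_zero:
  assumes f: "l2_tendsto M f f0 F" shows "l2_tendsto M (\<lambda>e \<omega>. f e \<omega> - f0 \<omega>) (\<lambda>_. 0) F"
proof -
  have "in_l2 M f0" using f by (simp add: l2_tendsto_def)
  from l2_tendsto_add[OF f l2_tendsto_scaleR[OF l2_tendsto_const[OF this], of "-1"]] show ?thesis by simp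
qed

lemma l2_tendsto_norm_zero:
  assumes f: "l2_tendsto M f (\<lambda>_. 0) F" shows "l2_tendsto M (\<lambda>e \<omega>. norm (f e \<omega>)) (\<lambda>_. 0) F"
  using f unfolding l2_tendsto_def by (auto elim!: eventually_mono intro: in_l2_norm simp: in_l2_def[of _ "\<lambda>_. 0"])

text \<open>Split \<open>f g - f\<^sub>0 g\<^sub>0\<close> into \<open>f (g - g\<^sub>0)\<close>, where boundedness of \<open>f\<close> suffices, and \<open>(f - f\<^sub>0) g\<^sub>0\<close>. In the
  latter truncate \<open>g\<^sub>0\<close> at level \<open>n\<close>: below it \<open>f\<close> converges in \<open>L\<^sup>2\<close>, above it the tail of \<open>g\<^sub>0\<close> is small
  and \<open>f - f\<^sub>0\<close> bounded.\<close>

lemma l2_tendsto_inner_bounded: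
  fixes f g :: "'e \<Rightarrow> 'w \<Rightarrow> 'b::euclidean_space"
  assumes f: "l2_tendsto M f f0 F" and g: "l2_tendsto M g g0 F"
    and fB: "\<forall>\<^sub>F e in F. AE \<omega> in M. norm (f e \<omega>) \<le> B" and f0B: "AE \<omega> in M. norm (f0 \<omega>) \<le> B" and B: "0 \<le> B"
  shows "l2_tendsto M (\<lambda>e \<omega>. f e \<omega> \<bullet> g e \<omega>) (\<lambda>\<omega>. f0 \<omega> \<bullet> g0 \<omega>) F"
proof -
  let ?N = "completion M"
  have f0: "in_l2 M f0" and g0: "in_l2 M g0" using f g by (auto simp: l2_tendsto_def)
  have fe: "\<forall>\<^sub>F e in F. in_l2 M (f e)" and ge: "\<forall>\<^sub>F e in F. in_l2 M (g e)" using f g by (auto simp: l2_tendsto_def)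
  have [measurable]: "f0 \<in> borel_measurable ?N" "g0 \<in> borel_measurable ?N" using f0 g0 by (auto simp: in_l2_def)
  have prod0: "in_l2 M (\<lambda>\<omega>. f0 \<omega> \<bullet> g0 \<omega>)"
  proof (rule in_l2_dominated[OF g0, where k = B])
    show "AE \<omega> in M. norm (f0 \<omega> \<bullet> g0 \<omega>) \<le> B * norm (g0 \<omega>)" using f0B
      by eventually_elim (auto intro!: order_trans[OF Cauchy_Schwarz_ineq2] mult_right_mono)
  qed measurable
  have 1: "l2_tendsto M (\<lambda>e \<omega>. f e \<omega> \<bullet> (g e \<omega> - g0 \<omega>)) (\<lambda>_. 0) F"
  proof (rule l2_tendsto_dominated[OF _ _ l2_tendsto_diff_zero[OF g], where k = B])
    show "\<forall>\<^sub>F e in F. (\<lambda>\<omega>. f e \<omega> \<bullet> (g e \<omega> - g0 \<omega>)) \<in> borel_measurable ?N"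
      using fe ge by eventually_elim (auto simp: in_l2_def)
    show "\<forall>\<^sub>F e in F. AE \<omega> in M. norm (f e \<omega> \<bullet> (g e \<omega> - g0 \<omega>) - 0) \<le> B * norm (g e \<omega> - g0 \<omega>)"
      using fB
    proof eventually_elim
      case (elim e)
      then show ?case by eventually_elim (auto intro!: order_trans[OF Cauchy_Schwarz_ineq2] mult_right_mono)
    qed
  qed (simp add: in_l2_def)
  have 2: "l2_tendsto M (\<lambda>e \<omega>. (f e \<omega> - f0 \<omega>) \<bullet> g0 \<omega>) (\<lambda>_. 0) F"
  proof -
    define t where "t n = (\<integral>\<omega>. indicator {\<omega>. real n < norm (g0 \<omega>)} \<omega> * (norm (g0 \<omega>))\<^sup>2 \<partial>?N)" for n :: nat
    have t_int: "integrable ?N (\<lambda>\<omega>. indicator {\<omega>. real n < norm (g0 \<omega>)} \<omega> * (norm (g0 \<omega>))\<^sup>2)" for n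
    proof (rule Bochner_Integration.integrable_bound)
      show "integrable ?N (\<lambda>\<omega>. (norm (g0 \<omega>))\<^sup>2)" using g0 by (simp add: in_l2_def)
    qed (auto simp: indicator_def)
    have t0: "t \<longlonglongrightarrow> 0"
    proof -
      have "t \<longlonglongrightarrow> (\<integral>\<omega>. 0 \<partial>?N)" unfolding t_def
      proof (rule integral_dominated_convergence[where w = "\<lambda>\<omega>. (norm (g0 \<omega>))\<^sup>2"])
        show "integrable ?N (\<lambda>\<omega>. (norm (g0 \<omega>))\<^sup>2)" using g0 by (simp add: in_l2_def)
        show "AE \<omega> in ?N. (\<lambda>n. indicator {\<omega>. real n < norm (g0 \<omega>)} \<omega> * (norm (g0 \<omega>))\<^sup>2) \<longlonglongrightarrow> 0"
        proof (intro AE_I2)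
          fix \<omega>
          obtain k :: nat where k: "norm (g0 \<omega>) \<le> real k" using real_arch_simple by blast
          have "\<forall>\<^sub>F n in sequentially. indicator {\<omega>. real n < norm (g0 \<omega>)} \<omega> * (norm (g0 \<omega>))\<^sup>2 = (0::real)"
            using eventually_ge_at_top[of k] by eventually_elim (use k in \<open>auto simp: indicator_def\<close>)
          then show "(\<lambda>n. indicator {\<omega>. real n < norm (g0 \<omega>)} \<omega> * (norm (g0 \<omega>))\<^sup>2) \<longlonglongrightarrow> 0" by (rule tendsto_eventually)
        qed
      qed (auto simp: indicator_def)
      then show ?thesis by simp
    qed
    let ?d = "\<lambda>e. \<integral>\<omega>. (norm (f e \<omega> - f0 \<omega>))\<^sup>2 \<partial>?N"
    have d0: "(?d \<longlongrightarrow> 0) F" using f by (simp add: l2_tendsto_def)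
    have ev: "\<forall>\<^sub>F e in F. in_l2 M (f e) \<and> (AE \<omega> in M. norm (f e \<omega>) \<le> B)" using fe fB by eventually_elim simp
    have in2: "in_l2 M (\<lambda>\<omega>. (f e \<omega> - f0 \<omega>) \<bullet> g0 \<omega>)" and
      bound: "(\<integral>\<omega>. (norm ((f e \<omega> - f0 \<omega>) \<bullet> g0 \<omega>))\<^sup>2 \<partial>?N) \<le> (real n)\<^sup>2 * ?d e + (2 * B)\<^sup>2 * t n"
      if e: "in_l2 M (f e)" "AE \<omega> in M. norm (f e \<omega>) \<le> B" for e n
    proof -
      have [measurable]: "f e \<in> borel_measurable ?N" using e by (simp add: in_l2_def)
      have dB: "AE \<omega> in M. norm (f e \<omega> - f0 \<omega>) \<le> 2 * B" using e(2) f0B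
        by eventually_elim (auto intro: order_trans[OF norm_triangle_ineq4])
      show in2: "in_l2 M (\<lambda>\<omega>. (f e \<omega> - f0 \<omega>) \<bullet> g0 \<omega>)"
      proof (rule in_l2_dominated[OF g0, where k = "2 * B"])
        show "AE \<omega> in M. norm ((f e \<omega> - f0 \<omega>) \<bullet> g0 \<omega>) \<le> 2 * B * norm (g0 \<omega>)" using dB
          by eventually_elim (unfold real_norm_def, rule order_trans[OF Cauchy_Schwarz_ineq2], rule mult_right_mono, auto)
      qed measurable
      have di: "integrable ?N (\<lambda>\<omega>. (norm (f e \<omega> - f0 \<omega>))\<^sup>2)" using in_l2_diff[OF e(1) f0] by (simp add: in_l2_def)
      have "AE \<omega> in M. (norm ((f e \<omega> - f0 \<omega>) \<bullet> g0 \<omega>))\<^sup>2 \<le>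
          (real n)\<^sup>2 * (norm (f e \<omega> - f0 \<omega>))\<^sup>2 + (2 * B)\<^sup>2 * (indicator {\<omega>. real n < norm (g0 \<omega>)} \<omega> * (norm (g0 \<omega>))\<^sup>2)"
        using dB
      proof eventually_elim
        case (elim \<omega>)
        have "(norm ((f e \<omega> - f0 \<omega>) \<bullet> g0 \<omega>))\<^sup>2 \<le> (norm (f e \<omega> - f0 \<omega>) * norm (g0 \<omega>))\<^sup>2"
          by (intro power_mono) (auto simp: Cauchy_Schwarz_ineq2)
        also have "\<dots> = (norm (f e \<omega> - f0 \<omega>))\<^sup>2 * (norm (g0 \<omega>))\<^sup>2" by (simp add: power_mult_distrib)
        finally have p: "(norm ((f e \<omega> - f0 \<omega>) \<bullet> g0 \<omega>))\<^sup>2 \<le> (norm (f e \<omega> - f0 \<omega>))\<^sup>2 * (norm (g0 \<omega>))\<^sup>2" .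
        show ?case
        proof (cases "real n < norm (g0 \<omega>)")
          case True
          have "(norm (f e \<omega> - f0 \<omega>))\<^sup>2 * (norm (g0 \<omega>))\<^sup>2 \<le> (2 * B)\<^sup>2 * (norm (g0 \<omega>))\<^sup>2"
            using elim by (intro mult_right_mono power_mono) auto
          moreover have "0 \<le> (real n)\<^sup>2 * (norm (f e \<omega> - f0 \<omega>))\<^sup>2" by simp
          moreover have "indicator {\<omega>. real n < norm (g0 \<omega>)} \<omega> = (1::real)" using True by simp
          ultimately show ?thesis using p by (simp only: mult_1)
        next
          case False
          then have "(norm (f e \<omega> - f0 \<omega>))\<^sup>2 * (norm (g0 \<omega>))\<^sup>2 \<le> (norm (f e \<omega> - f0 \<omega>))\<^sup>2 * (real n)\<^sup>2"
            by (intro mult_left_mono power_mono) auto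
          then show ?thesis using p False by (simp add: mult.commute)
        qed
      qed
      then have "(\<integral>\<omega>. (norm ((f e \<omega> - f0 \<omega>) \<bullet> g0 \<omega>))\<^sup>2 \<partial>?N) \<le>
        (\<integral>\<omega>. (real n)\<^sup>2 * (norm (f e \<omega> - f0 \<omega>))\<^sup>2 + (2 * B)\<^sup>2 * (indicator {\<omega>. real n < norm (g0 \<omega>)} \<omega> * (norm (g0 \<omega>))\<^sup>2) \<partial>?N)"
        using in2 di t_int[of n]
        by (intro integral_mono_AE AE_completion Bochner_Integration.integrable_add integrable_mult_right) (auto simp: in_l2_def)
      also have "\<dots> = (real n)\<^sup>2 * ?d e + (2 * B)\<^sup>2 * t n"
        unfolding t_def using di t_int[of n] by simp
      finally show "(\<integral>\<omega>. (norm ((f e \<omega> - f0 \<omega>) \<bullet> g0 \<omega>))\<^sup>2 \<partial>?N) \<le> (real n)\<^sup>2 * ?d e + (2 * B)\<^sup>2 * t n" .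
    qed
    have "((\<lambda>e. \<integral>\<omega>. (norm ((f e \<omega> - f0 \<omega>) \<bullet> g0 \<omega>))\<^sup>2 \<partial>?N) \<longlongrightarrow> 0) F"
    proof (rule order_tendstoI)
      fix r :: real assume "r < 0"
      then show "\<forall>\<^sub>F e in F. r < (\<integral>\<omega>. (norm ((f e \<omega> - f0 \<omega>) \<bullet> g0 \<omega>))\<^sup>2 \<partial>?N)"
        by (intro always_eventually allI) (auto intro!: less_le_trans[OF _ integral_nonneg_AE])
    next
      fix r :: real assume r: "0 < r"
      have "(\<lambda>n. (2 * B)\<^sup>2 * t n) \<longlonglongrightarrow> (2 * B)\<^sup>2 * 0" by (intro tendsto_intros t0)
      then have "\<forall>\<^sub>F n in sequentially. (2 * B)\<^sup>2 * t n < r / 2" using r by (intro order_tendstoD(2)) auto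
      then obtain n where n: "(2 * B)\<^sup>2 * t n < r / 2" by (auto simp: eventually_sequentially)
      have "((\<lambda>e. (real n)\<^sup>2 * ?d e) \<longlongrightarrow> (real n)\<^sup>2 * 0) F" by (intro tendsto_intros d0)
      then have "\<forall>\<^sub>F e in F. (real n)\<^sup>2 * ?d e < r / 2" using r by (intro order_tendstoD(2)) auto
      then show "\<forall>\<^sub>F e in F. (\<integral>\<omega>. (norm ((f e \<omega> - f0 \<omega>) \<bullet> g0 \<omega>))\<^sup>2 \<partial>?N) < r"
        using ev
      proof eventually_elim
        case (elim e)
        then show ?case using bound[of e n] n by auto
      qed
    qed
    moreover have "\<forall>\<^sub>F e in F. in_l2 M (\<lambda>\<omega>. (f e \<omega> - f0 \<omega>) \<bullet> g0 \<omega>)" using ev by eventually_elim (rule in2, auto)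
    ultimately show ?thesis by (simp add: l2_tendsto_def in_l2_def[of _ "\<lambda>_. 0"])
  qed
  from l2_tendsto_add[OF l2_tendsto_add[OF 1 2] l2_tendsto_const[OF prod0]]
  show ?thesis by (simp add: inner_diff_left inner_diff_right)
qed

lemma (in prob_space) in_l2_bounded:
  fixes f :: "'a \<Rightarrow> 'b::euclidean_space"
  assumes "f \<in> borel_measurable (completion M)" "AE \<omega> in M. norm (f \<omega>) \<le> B"
  shows "in_l2 M f"
proof -
  interpret c: prob_space "completion M" by (rule prob_space_completion)
  have "in_l2 M (\<lambda>_. 1::real)" by (simp add: in_l2_def)
  from in_l2_dominated[OF this assms(1), of B] assms(2) show ?thesis by simp
qed

lemma mom_imp_in_l2: "mom M 2 f c \<Longrightarrow> in_l2 M f"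
  unfolding mom_def in_l2_def
  by (auto intro!: integrableI_bounded simp: nn_integral_completion intro: le_less_trans)

lemma order_mom_imp_l2_tendsto:
  assumes o: "order_mom M T 2 1 (\<lambda>\<epsilon> t \<omega>. f \<epsilon> \<omega> - g \<omega>)" and T: "0 \<le> T" and g: "in_l2 M g"
  shows "l2_tendsto M f g (at_right 0)"
proof -
  obtain c where "\<And>\<epsilon> t. 0 < \<epsilon> \<Longrightarrow> \<epsilon> \<le> 1 \<Longrightarrow> t \<in> {0..T} \<Longrightarrow> mom M 2 (\<lambda>\<omega>. f \<epsilon> \<omega> - g \<omega>) (c * \<epsilon> ^ 1)"
    using order_momE[OF o] by blast
  from this[of _ 0] have c: "mom M 2 (\<lambda>\<omega>. f \<epsilon> \<omega> - g \<omega>) (c * \<epsilon>)" if "0 < \<epsilon>" "\<epsilon> \<le> 1" for \<epsilon> using T that by simp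
  have ev: "\<forall>\<^sub>F \<epsilon> in at_right 0. 0 < \<epsilon> \<and> \<epsilon> \<le> (1::real)"
    unfolding eventually_at_right_field by (intro exI[of _ 1]) auto
  show ?thesis
  proof (rule l2_tendstoI[OF g])
    show "\<forall>\<^sub>F \<epsilon> in at_right 0. in_l2 M (f \<epsilon>)" using ev
    proof eventually_elim
      case (elim \<epsilon>)
      from in_l2_add[OF mom_imp_in_l2[OF c[of \<epsilon>]] g] elim show ?case by simp
    qed
    show "\<forall>\<^sub>F \<epsilon> in at_right 0. (\<integral>\<omega>. (norm (f \<epsilon> \<omega> - g \<omega>))\<^sup>2 \<partial>completion M) \<le> c * \<epsilon>" using ev
      by eventually_elim (rule mom_expectation_le[OF c], auto)
    have "((\<lambda>\<epsilon>. c * \<epsilon>) \<longlongrightarrow> c * 0) (at_right 0)" by (intro tendsto_intros)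
    then show "((\<lambda>\<epsilon>. c * \<epsilon>) \<longlongrightarrow> 0) (at_right 0)" by simp
  qed
qed

section \<open>The filters are affine in the initial value\<close>

text \<open>The coefficient of the initial value in the \<open>n\<close>-th iterate; \<open>s\<close> is the prior variance, and
  \<open>s * (slope ...)\<^sup>2\<close> the conditional variance. It is the same for all three schemes.\<close>

primrec slope :: "real \<Rightarrow> real^2^2 \<Rightarrow> real \<Rightarrow> real \<Rightarrow> (real \<Rightarrow> real^2) \<Rightarrow> nat \<Rightarrow> real" where
  "slope \<gamma> A h s x 0 = 1"
| "slope \<gamma> A h s x (Suc n) = slope \<gamma> A h s x n *
     (1 - h / 2 * (gain \<gamma> A h (s * (slope \<gamma> A h s x n)\<^sup>2) (x (real n * h)) \<bullet> (A *v x (real n * h))))"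

definition path_gain :: "real \<Rightarrow> real^2^2 \<Rightarrow> real \<Rightarrow> real \<Rightarrow> (real \<Rightarrow> real^2) \<Rightarrow> nat \<Rightarrow> real^2" where
  "path_gain \<gamma> A h s x n = gain \<gamma> A h (s * (slope \<gamma> A h s x n)\<^sup>2) (x (real n * h))"

text \<open>The conditional mean. The schemes differ only in the innovation \<open>U\<close>.\<close>

primrec centre :: "real \<Rightarrow> real^2^2 \<Rightarrow> real \<Rightarrow> real \<Rightarrow> real \<Rightarrow> (real \<Rightarrow> real^2) \<Rightarrow> (nat \<Rightarrow> real) \<Rightarrow> nat \<Rightarrow> real" where
  "centre \<gamma> A h s m x U 0 = m"
| "centre \<gamma> A h s m x U (Suc n) =
     (1 - h * (path_gain \<gamma> A h s x n \<bullet> (A *v x (real n * h)))) * centre \<gamma> A h s m x U n + U n"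

lemma slope_Suc: "slope \<gamma> A h s x (Suc n) = slope \<gamma> A h s x n * (1 - h / 2 * (path_gain \<gamma> A h s x n \<bullet> (A *v x (real n * h))))"
  by (simp add: path_gain_def)

lemma affine_law_moments:
  assumes M: "prob_space M" and D: "distributed M lborel \<Theta> (\<lambda>x. ennreal (normal_density m (sqrt s) x))" and s: "s > 0"
  shows "law_mean (distr (distr M borel \<Theta>) borel (\<lambda>\<theta>. c + k * (\<theta> - m))) = c"
    and "law_var (distr (distr M borel \<Theta>) borel (\<lambda>\<theta>. c + k * (\<theta> - m))) = s * k\<^sup>2"
proof -
  interpret prob_space M by (rule M)
  have [measurable]: "\<Theta> \<in> borel_measurable M" using distributed_measurable[OF D] by simp
  have sq: "sqrt s > 0" using s by simp
  note n = normal_moments[OF D sq]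
  have d: "distr (distr M borel \<Theta>) borel (\<lambda>\<theta>. c + k * (\<theta> - m)) = distr M borel (\<lambda>\<omega>. c + k * (\<Theta> \<omega> - m))"
    by (subst distr_distr) (auto simp: o_def)
  show mean: "law_mean (distr (distr M borel \<Theta>) borel (\<lambda>\<theta>. c + k * (\<theta> - m))) = c"
    unfolding d law_mean_def using n(1)[of 1] n(3) by (simp add: integral_distr prob_space)
  have "law_var (distr (distr M borel \<Theta>) borel (\<lambda>\<theta>. c + k * (\<theta> - m))) = expectation (\<lambda>\<omega>. (c + k * (\<Theta> \<omega> - m) - c)\<^sup>2)"
    unfolding law_var_def mean unfolding d by (simp add: integral_distr)
  also have "\<dots> = expectation (\<lambda>\<omega>. k\<^sup>2 * (\<Theta> \<omega> - m)\<^sup>2)" by (simp add: power_mult_distrib)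
  also have "\<dots> = s * k\<^sup>2" using n(2) s by simp
  finally show "law_var (distr (distr M borel \<Theta>) borel (\<lambda>\<theta>. c + k * (\<theta> - m))) = s * k\<^sup>2" .
qed

context
  fixes M :: "'w measure" and \<Theta> :: "'w \<Rightarrow> real" and m s \<gamma> h :: real and A :: "real^2^2"
  assumes M: "prob_space M" and D: "distributed M lborel \<Theta> (\<lambda>x. ennreal (normal_density m (sqrt s) x))" and s: "s > 0"
begin

lemma filter_increments_affine:
  "filter_increments \<gamma> A h (distr M borel \<Theta>) x n = (\<lambda>\<theta>. centre \<gamma> A h s m x
      (\<lambda>n. path_gain \<gamma> A h s x n \<bullet> (x (real (Suc n) * h) - x (real n * h))) n + slope \<gamma> A h s x n * (\<theta> - m))"
proof (induction n)
  case (Suc n)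
  show ?case
    unfolding filter_increments.simps(2) Let_def Suc affine_law_moments[OF M D s] path_gain_def[symmetric] centre.simps(2) slope_Suc
    by (simp add: fun_eq_iff inner_diff_right algebra_simps add_divide_distrib diff_divide_distrib)
qed simp

lemma filter_corrected_affine:
  "filter_corrected \<gamma> A B h (distr M borel \<Theta>) x n = (\<lambda>\<theta>. centre \<gamma> A h s m x
      (\<lambda>n. (s * (slope \<gamma> A h s x n)\<^sup>2) / \<gamma> * rs_integral (\<lambda>t. A *v x t) x (real n * h) (real (Suc n) * h)
          - h / 2 * (s * (slope \<gamma> A h s x n)\<^sup>2) * (transpose A ::\<^sub>F B)) n + slope \<gamma> A h s x n * (\<theta> - m))"
proof (induction n)
  case (Suc n)
  show ?case
    unfolding filter_corrected.simps(2) Let_def Suc affine_law_moments[OF M D s] path_gain_def[symmetric] centre.simps(2) slope_Suc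
    by (simp add: fun_eq_iff algebra_simps add_divide_distrib diff_divide_distrib)
qed simp

lemma filter_ito_affine:
  "filter_ito \<gamma> A h (distr M borel \<Theta>) x J n = (\<lambda>\<theta>. centre \<gamma> A h s m x
      (\<lambda>n. (s * (slope \<gamma> A h s x n)\<^sup>2) / \<gamma> * J n) n + slope \<gamma> A h s x n * (\<theta> - m))"
proof (induction n)
  case (Suc n)
  show ?case
    unfolding filter_ito.simps(2) Let_def Suc affine_law_moments[OF M D s] path_gain_def[symmetric] centre.simps(2) slope_Suc
    by (simp add: fun_eq_iff algebra_simps add_divide_distrib diff_divide_distrib)
qed simp

end

section \<open>The gain is bounded and Lipschitz\<close>

text \<open>The gain as a function of the variance \<open>\<sigma>\<close> and of \<open>y = A x\<close>.\<close>

definition sat :: "real \<Rightarrow> real \<Rightarrow> real \<Rightarrow> real^2 \<Rightarrow> real^2" where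
  "sat \<gamma> h \<sigma> y = (\<sigma> * inverse (\<gamma> + h * \<sigma> * (y \<bullet> y))) *\<^sub>R y"

lemma gain_sat: "gain \<gamma> A h \<sigma> x = sat \<gamma> h \<sigma> (A *v x)"
  by (simp add: gain_def sat_def)

context
  fixes \<gamma> h :: real
  assumes \<gamma>: "\<gamma> > 0" and h: "h > 0"
begin

lemma sat_denominator: "0 \<le> \<sigma> \<Longrightarrow> \<gamma> \<le> \<gamma> + h * \<sigma> * (y \<bullet> y)" for y :: "real^2"
  using h by simp

lemma sat_inner:
  assumes "0 \<le> \<sigma>"
  shows "0 \<le> h * (sat \<gamma> h \<sigma> y \<bullet> y)" "h * (sat \<gamma> h \<sigma> y \<bullet> y) \<le> 1"
proof -
  have d: "0 < \<gamma> + h * \<sigma> * (y \<bullet> y)" using sat_denominator[OF assms, of y] \<gamma> by linarith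
  have eq: "h * (sat \<gamma> h \<sigma> y \<bullet> y) = h * \<sigma> * (y \<bullet> y) / (\<gamma> + h * \<sigma> * (y \<bullet> y))"
    by (simp add: sat_def divide_inverse)
  have n: "0 \<le> h * \<sigma> * (y \<bullet> y)" using assms h by simp
  show "0 \<le> h * (sat \<gamma> h \<sigma> y \<bullet> y)" unfolding eq using d n by simp
  show "h * (sat \<gamma> h \<sigma> y \<bullet> y) \<le> 1" unfolding eq using d \<gamma> by (simp add: divide_le_eq_1)
qed

text \<open>For \<open>norm y \<le> 1\<close> the denominator is at least \<open>\<gamma>\<close>; otherwise \<open>norm y \<le> y \<bullet> y\<close> and the fraction is at
  most \<open>1 / h\<close>.\<close>

lemma sat_bounded:
  assumes "0 \<le> \<sigma>" "\<sigma> \<le> s"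
  shows "norm (sat \<gamma> h \<sigma> y) \<le> 1 / h + s / \<gamma>"
proof -
  have d: "0 < \<gamma> + h * \<sigma> * (y \<bullet> y)" using sat_denominator[OF assms(1), of y] \<gamma> by linarith
  have eq: "norm (sat \<gamma> h \<sigma> y) = \<sigma> * norm y / (\<gamma> + h * \<sigma> * (y \<bullet> y))"
    using d assms by (simp add: sat_def divide_inverse abs_mult)
  have s0: "0 \<le> s / \<gamma>" "0 \<le> 1 / h" using assms \<gamma> h by auto
  show ?thesis
  proof (cases "norm y \<le> 1")
    case True
    have "\<sigma> * norm y / (\<gamma> + h * \<sigma> * (y \<bullet> y)) \<le> (s * 1) / \<gamma>"
      using assms True \<gamma> sat_denominator[OF assms(1), of y] by (intro frac_le mult_mono) auto
    then show ?thesis unfolding eq using s0 by linarith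
  next
    case False
    then have "norm y \<le> y \<bullet> y"
      using mult_right_mono[of 1 "norm y" "norm y"] by (simp add: power2_norm_eq_inner[symmetric] power2_eq_square)
    then have "\<sigma> * norm y \<le> \<sigma> * (y \<bullet> y)" using assms by (intro mult_left_mono)
    also have "\<dots> \<le> 1 / h * (\<gamma> + h * \<sigma> * (y \<bullet> y))" using \<gamma> h by (simp add: field_simps)
    finally have "\<sigma> * norm y / (\<gamma> + h * \<sigma> * (y \<bullet> y)) \<le> 1 / h" using d by (simp add: divide_le_eq)
    then show ?thesis unfolding eq using s0 by linarith
  qed
qed

text \<open>This is the distance formula for the inversion at the unit sphere, free of denominators.\<close>

lemma norm_inversion_diff:
  "norm ((z \<bullet> z) *\<^sub>R y - (y \<bullet> y) *\<^sub>R z) = norm y * norm z * norm (y - z)" for y z :: "'b::real_inner"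
proof -
  have "(norm ((z \<bullet> z) *\<^sub>R y - (y \<bullet> y) *\<^sub>R z))\<^sup>2 = (norm y * norm z * norm (y - z))\<^sup>2"
    unfolding power_mult_distrib power2_norm_eq_inner
    by (simp add: inner_diff_left inner_diff_right inner_commute algebra_simps)
  then show ?thesis by (rule power2_eq_imp_eq) auto
qed

text \<open>Over the common denominator the numerator is \<open>\<gamma> (y - z)\<close> plus a multiple of the difference in
  \<open>norm_inversion_diff\<close>. Cauchy's inequality \<open>(\<gamma> + p)\<^sup>2 \<le> Dy Dz\<close> bounds the quotient.\<close>

lemma sat_lipschitz_right:
  assumes "0 \<le> \<sigma>" "\<sigma> \<le> s"
  shows "norm (sat \<gamma> h \<sigma> y - sat \<gamma> h \<sigma> z) \<le> s / \<gamma> * norm (y - z)"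
proof -
  define Dy Dz where "Dy = \<gamma> + h * \<sigma> * (y \<bullet> y)" and "Dz = \<gamma> + h * \<sigma> * (z \<bullet> z)"
  define p where "p = h * \<sigma> * (norm y * norm z)"
  have D: "\<gamma> \<le> Dy" "\<gamma> \<le> Dz" using sat_denominator[OF assms(1)] by (auto simp: Dy_def Dz_def)
  then have pos: "0 < Dy" "0 < Dz" using \<gamma> by linarith+
  have p0: "0 \<le> p" using h assms by (simp add: p_def)
  have "sat \<gamma> h \<sigma> y - sat \<gamma> h \<sigma> z = (\<sigma> / (Dy * Dz)) *\<^sub>R (\<gamma> *\<^sub>R (y - z) + (h * \<sigma>) *\<^sub>R ((z \<bullet> z) *\<^sub>R y - (y \<bullet> y) *\<^sub>R z))"
  proof -
    have "sat \<gamma> h \<sigma> y - sat \<gamma> h \<sigma> z = (\<sigma> / (Dy * Dz)) *\<^sub>R (Dz *\<^sub>R y - Dy *\<^sub>R z)"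
    proof -
      have "\<sigma> / (Dy * Dz) * Dz = \<sigma> * inverse Dy" "\<sigma> / (Dy * Dz) * Dy = \<sigma> * inverse Dz"
        using pos by (simp_all add: field_simps)
      then show ?thesis
        by (simp only: sat_def Dy_def[symmetric] Dz_def[symmetric] scaleR_diff_right scaleR_scaleR)
    qed
    also have "Dz *\<^sub>R y - Dy *\<^sub>R z = \<gamma> *\<^sub>R (y - z) + (h * \<sigma>) *\<^sub>R ((z \<bullet> z) *\<^sub>R y - (y \<bullet> y) *\<^sub>R z)"
      by (simp add: Dy_def Dz_def algebra_simps)
    finally show ?thesis .
  qed
  then have "norm (sat \<gamma> h \<sigma> y - sat \<gamma> h \<sigma> z) = \<sigma> / (Dy * Dz) * norm (\<gamma> *\<^sub>R (y - z) + (h * \<sigma>) *\<^sub>R ((z \<bullet> z) *\<^sub>R y - (y \<bullet> y) *\<^sub>R z))"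
    using pos assms by simp
  also have "\<dots> \<le> \<sigma> / (Dy * Dz) * ((\<gamma> + p) * norm (y - z))"
  proof (intro mult_left_mono)
    have "norm (\<gamma> *\<^sub>R (y - z) + (h * \<sigma>) *\<^sub>R ((z \<bullet> z) *\<^sub>R y - (y \<bullet> y) *\<^sub>R z))
       \<le> norm (\<gamma> *\<^sub>R (y - z)) + norm ((h * \<sigma>) *\<^sub>R ((z \<bullet> z) *\<^sub>R y - (y \<bullet> y) *\<^sub>R z))" by (rule norm_triangle_ineq)
    also have "\<dots> = (\<gamma> + p) * norm (y - z)"
    proof -
      have "norm (\<gamma> *\<^sub>R (y - z)) = \<gamma> * norm (y - z)" using \<gamma> by simp
      moreover have "norm ((h * \<sigma>) *\<^sub>R ((z \<bullet> z) *\<^sub>R y - (y \<bullet> y) *\<^sub>R z)) = p * norm (y - z)"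
        using h assms by (simp add: norm_inversion_diff p_def)
      ultimately show ?thesis by (simp only: distrib_right)
    qed
    finally show "norm (\<gamma> *\<^sub>R (y - z) + (h * \<sigma>) *\<^sub>R ((z \<bullet> z) *\<^sub>R y - (y \<bullet> y) *\<^sub>R z)) \<le> (\<gamma> + p) * norm (y - z)" .
  qed (use pos assms in auto)
  also have "\<dots> = \<sigma> * ((\<gamma> + p) / (Dy * Dz)) * norm (y - z)" by simp
  also have "\<dots> \<le> s * (1 / \<gamma>) * norm (y - z)"
  proof (intro mult_right_mono mult_mono assms)
    have "(\<gamma> + p)\<^sup>2 \<le> Dy * Dz"
    proof -
      define u v where "u = h * \<sigma> * (y \<bullet> y)" and "v = h * \<sigma> * (z \<bullet> z)"
      have "p\<^sup>2 = u * v"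
        by (simp add: p_def u_def v_def power2_norm_eq_inner[symmetric] power2_eq_square)
      moreover have "2 * (norm y * norm z) \<le> y \<bullet> y + z \<bullet> z"
        using sum_squares_bound[of "norm y" "norm z"] by (simp add: power2_norm_eq_inner)
      then have "(h * \<sigma>) * (2 * (norm y * norm z)) \<le> (h * \<sigma>) * (y \<bullet> y + z \<bullet> z)"
        using h assms by (intro mult_left_mono) auto
      then have "2 * p \<le> u + v" by (simp add: p_def u_def v_def algebra_simps)
      then have "\<gamma> * (2 * p) \<le> \<gamma> * (u + v)" using \<gamma> by (intro mult_left_mono) auto
      moreover have "Dy * Dz = \<gamma>\<^sup>2 + \<gamma> * (u + v) + u * v"
        by (simp add: Dy_def Dz_def u_def v_def power2_eq_square algebra_simps)
      ultimately show ?thesis by (simp add: power2_sum algebra_simps)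
    qed
    moreover have "\<gamma> * (\<gamma> + p) \<le> (\<gamma> + p)\<^sup>2" using p0 \<gamma> by (simp add: power2_eq_square mult_right_mono)
    ultimately show "(\<gamma> + p) / (Dy * Dz) \<le> 1 / \<gamma>" using pos \<gamma> by (simp add: field_simps)
  qed (use pos \<gamma> p0 assms in auto)
  finally show ?thesis by simp
qed

lemma sat_lipschitz_left:
  assumes "0 \<le> \<sigma>" "0 \<le> \<tau>"
  shows "norm (sat \<gamma> h \<sigma> y - sat \<gamma> h \<tau> y) \<le> \<bar>\<sigma> - \<tau>\<bar> * norm y / \<gamma>"
proof -
  define D E where "D = \<gamma> + h * \<sigma> * (y \<bullet> y)" and "E = \<gamma> + h * \<tau> * (y \<bullet> y)"
  have DE: "\<gamma> \<le> D" "\<gamma> \<le> E" using sat_denominator[of _ y] assms by (auto simp: D_def E_def)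
  then have pos: "0 < D" "0 < E" using \<gamma> by linarith+
  have "\<sigma> * inverse D - \<tau> * inverse E = \<gamma> * (\<sigma> - \<tau>) / (D * E)"
  proof -
    have "\<sigma> * inverse D - \<tau> * inverse E = (\<sigma> * E - \<tau> * D) / (D * E)" using pos by (simp add: field_simps)
    also have "\<sigma> * E - \<tau> * D = \<gamma> * (\<sigma> - \<tau>)" by (simp add: D_def E_def algebra_simps)
    finally show ?thesis .
  qed
  then have "sat \<gamma> h \<sigma> y - sat \<gamma> h \<tau> y = (\<gamma> * (\<sigma> - \<tau>) / (D * E)) *\<^sub>R y"
    by (simp add: sat_def D_def[symmetric] E_def[symmetric] scaleR_diff_left[symmetric])
  then have "norm (sat \<gamma> h \<sigma> y - sat \<gamma> h \<tau> y) = (\<gamma> / (D * E)) * (\<bar>\<sigma> - \<tau>\<bar> * norm y)"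
    using pos \<gamma> by (simp add: abs_mult)
  also have "\<dots> \<le> (1 / \<gamma>) * (\<bar>\<sigma> - \<tau>\<bar> * norm y)"
  proof (rule mult_right_mono)
    have "\<gamma> * \<gamma> \<le> D * E" using DE \<gamma> by (intro mult_mono) auto
    then show "\<gamma> / (D * E) \<le> 1 / \<gamma>" using pos \<gamma> by (simp add: field_simps)
  qed simp
  finally show ?thesis by simp
qed

lemma slope_bounds:
  assumes "0 \<le> s"
  shows "0 \<le> slope \<gamma> A h s x n \<and> slope \<gamma> A h s x n \<le> 1"
proof (induction n)
  case (Suc n)
  let ?k = "h * (path_gain \<gamma> A h s x n \<bullet> (A *v x (real n * h)))"
  have "0 \<le> ?k" "?k \<le> 1" unfolding path_gain_def gain_sat using assms by (intro sat_inner; simp)+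
  then have "0 \<le> 1 - h / 2 * (path_gain \<gamma> A h s x n \<bullet> (A *v x (real n * h)))" "1 - h / 2 * (path_gain \<gamma> A h s x n \<bullet> (A *v x (real n * h))) \<le> 1"
    by auto
  then show ?case unfolding slope_Suc using Suc by (auto intro: mult_le_one)
qed simp

end

section \<open>Convergence of the filters\<close>

lemma l2_tendsto_matrix:
  fixes f :: "'e \<Rightarrow> 'w \<Rightarrow> real^'n" and B :: "real^'n^'m"
  assumes f: "l2_tendsto M f f0 F" shows "l2_tendsto M (\<lambda>e \<omega>. B *v f e \<omega>) (\<lambda>\<omega>. B *v f0 \<omega>) F"
proof (rule l2_tendsto_dominated[OF _ _ l2_tendsto_diff_zero[OF f], where k = "onorm ((*v) B)"])
  show "in_l2 M (\<lambda>\<omega>. B *v f0 \<omega>)"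
    by (rule in_l2_dominated[where g = f0 and k = "onorm ((*v) B)"]) (use f in \<open>auto simp: l2_tendsto_def in_l2_def norm_matrix_vector_le\<close>)
  have "\<forall>\<^sub>F e in F. in_l2 M (f e)" using f by (simp add: l2_tendsto_def)
  then show "\<forall>\<^sub>F e in F. (\<lambda>\<omega>. B *v f e \<omega>) \<in> borel_measurable (completion M)" by eventually_elim (auto simp: in_l2_def intro: borel_measurable_matrix_vector)
  show "\<forall>\<^sub>F e in F. AE \<omega> in M. norm (B *v f e \<omega> - B *v f0 \<omega>) \<le> onorm ((*v) B) * norm (f e \<omega> - f0 \<omega>)"
    using norm_matrix_vector_le[of B] by (simp flip: matrix_vector_mult_diff_distrib)
qed

lemma l2_tendsto_diff:
  assumes "l2_tendsto M f f0 F" "l2_tendsto M g g0 F"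
  shows "l2_tendsto M (\<lambda>e \<omega>. f e \<omega> - g e \<omega>) (\<lambda>\<omega>. f0 \<omega> - g0 \<omega>) F"
  using l2_tendsto_add[OF assms(1) l2_tendsto_scaleR[OF assms(2), of "-1"]] by simp

lemma l2_tendsto_mult_bounded:
  fixes f g :: "'e \<Rightarrow> 'w \<Rightarrow> real"
  assumes "l2_tendsto M f f0 F" "l2_tendsto M g g0 F" "\<And>e \<omega>. norm (f e \<omega>) \<le> B" "\<And>\<omega>. norm (f0 \<omega>) \<le> B"
  shows "l2_tendsto M (\<lambda>e \<omega>. f e \<omega> * g e \<omega>) (\<lambda>\<omega>. f0 \<omega> * g0 \<omega>) F"
  using l2_tendsto_inner_bounded[OF assms(1,2), of B] assms(3,4) order_trans[OF norm_ge_zero assms(4)] by simp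

context two_scale begin

lemma X_l2_tendsto:
  assumes t: "0 \<le> t" shows "l2_tendsto M (\<lambda>\<epsilon>. Xe \<epsilon> t) (X t) (at_right 0)"
proof (rule order_mom_imp_l2_tendsto[OF _ t])
  have "order_mom M t 2 1 (\<lambda>\<epsilon> t \<omega>. Xe \<epsilon> t \<omega> - X t \<omega>)" using D_order[OF t] by (intro order_mom_4_imp_2) simp
  then show "order_mom M t 2 1 (\<lambda>\<epsilon> _ \<omega>. Xe \<epsilon> t \<omega> - X t \<omega>)" by (rule order_mom_at) (use t in simp)
  have "order_mom M t 2 0 (\<lambda>_. X)" using X_order[OF t] by (intro order_mom_4_imp_2) simp
  then obtain c where "\<And>\<epsilon> r. 0 < \<epsilon> \<Longrightarrow> \<epsilon> \<le> 1 \<Longrightarrow> r \<in> {0..t} \<Longrightarrow> mom M 2 (X r) (c * \<epsilon> ^ 0)"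
    by (rule order_momE) blast
  from this[of 1 t] t show "in_l2 M (X t)" by (auto intro: mom_imp_in_l2)
qed

context
  fixes h s :: real
  assumes h: "h > 0" and s: "s > 0"
begin

abbreviation slope_e :: "nat \<Rightarrow> real \<Rightarrow> 'w \<Rightarrow> real" where "slope_e n \<epsilon> \<omega> \<equiv> slope \<gamma> A h s (\<lambda>t. Xe \<epsilon> t \<omega>) n"
abbreviation slope_0 :: "nat \<Rightarrow> 'w \<Rightarrow> real" where "slope_0 n \<omega> \<equiv> slope \<gamma> A h s (\<lambda>t. X t \<omega>) n"
abbreviation gain_e :: "nat \<Rightarrow> real \<Rightarrow> 'w \<Rightarrow> real^2" where "gain_e n \<epsilon> \<omega> \<equiv> path_gain \<gamma> A h s (\<lambda>t. Xe \<epsilon> t \<omega>) n"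
abbreviation gain_0 :: "nat \<Rightarrow> 'w \<Rightarrow> real^2" where "gain_0 n \<omega> \<equiv> path_gain \<gamma> A h s (\<lambda>t. X t \<omega>) n"

lemma slope_01: "0 \<le> slope \<gamma> A h s x n" "slope \<gamma> A h s x n \<le> 1"
  using slope_bounds[OF \<gamma> h, of s A x n] s by auto

lemma slope_norm: "norm (slope \<gamma> A h s x n) \<le> 1" using slope_01[of x n] by simp

lemma variance_bounds: "0 \<le> s * (slope \<gamma> A h s x n)\<^sup>2" "s * (slope \<gamma> A h s x n)\<^sup>2 \<le> s"
  using slope_01[of x n] s by (auto simp: power_le_one mult_left_le)

lemma gain_norm: "norm (path_gain \<gamma> A h s x n) \<le> 1 / h + s / \<gamma>"
  unfolding path_gain_def gain_sat by (rule sat_bounded[OF \<gamma> h variance_bounds])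

lemma gain_drift: "0 \<le> h * (path_gain \<gamma> A h s x n \<bullet> (A *v x (real n * h)))" "h * (path_gain \<gamma> A h s x n \<bullet> (A *v x (real n * h))) \<le> 1"
  unfolding path_gain_def gain_sat by (intro sat_inner[OF \<gamma> h] variance_bounds)+

lemma X_grid_l2: "l2_tendsto M (\<lambda>\<epsilon> \<omega>. Xe \<epsilon> (real n * h) \<omega>) (\<lambda>\<omega>. X (real n * h) \<omega>) (at_right 0)"
  using X_l2_tendsto[of "real n * h"] h by simp

lemma variance_l2:
  assumes "l2_tendsto M (slope_e n) (slope_0 n) (at_right 0)"
  shows "l2_tendsto M (\<lambda>\<epsilon> \<omega>. s * (slope_e n \<epsilon> \<omega>)\<^sup>2) (\<lambda>\<omega>. s * (slope_0 n \<omega>)\<^sup>2) (at_right 0)"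
  using l2_tendsto_scaleR[OF l2_tendsto_mult_bounded[OF assms assms slope_norm slope_norm], of s]
  by (simp add: power2_eq_square)

text \<open>The Lipschitz constant of the gain in the variance is \<open>norm y / \<gamma>\<close>, which is unbounded; the
  corresponding error is a bounded factor that converges to zero times \<open>norm y\<close>.\<close>

lemma gain_l2:
  assumes sl: "l2_tendsto M (slope_e n) (slope_0 n) (at_right 0)"
  shows "l2_tendsto M (gain_e n) (gain_0 n) (at_right 0)"
proof -
  let ?ve = "\<lambda>\<epsilon> \<omega>. s * (slope_e n \<epsilon> \<omega>)\<^sup>2" and ?v = "\<lambda>\<omega>. s * (slope_0 n \<omega>)\<^sup>2"
  let ?ye = "\<lambda>\<epsilon> \<omega>. A *v Xe \<epsilon> (real n * h) \<omega>" and ?y = "\<lambda>\<omega>. A *v X (real n * h) \<omega>"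
  note v = variance_l2[OF sl]
  have y: "l2_tendsto M ?ye ?y (at_right 0)" by (rule l2_tendsto_matrix[OF X_grid_l2])
  have in_y: "in_l2 M ?y" and in_v: "in_l2 M ?v" using y v by (auto simp: l2_tendsto_def)
  have meas_sat: "(\<lambda>\<omega>. sat \<gamma> h (f \<omega>) (g \<omega>)) \<in> borel_measurable (completion M)"
    if "f \<in> borel_measurable (completion M)" "g \<in> borel_measurable (completion M)" for f g
    unfolding sat_def using that by measurable
  have "l2_tendsto M (\<lambda>\<epsilon> \<omega>. norm (?ve \<epsilon> \<omega> - ?v \<omega>) \<bullet> norm (?y \<omega>)) (\<lambda>\<omega>. 0 \<bullet> norm (?y \<omega>)) (at_right 0)"
  proof (rule l2_tendsto_inner_bounded[OF l2_tendsto_norm_zero[OF l2_tendsto_diff_zero[OF v]] l2_tendsto_const[OF in_l2_norm[OF in_y]], where B = s])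
    have "norm (norm (?ve \<epsilon> \<omega> - ?v \<omega>)) \<le> s" for \<epsilon> \<omega>
    proof -
      have "\<bar>u - v\<bar> \<le> s" if "0 \<le> u" "u \<le> s" "0 \<le> v" "v \<le> s" for u v using that by linarith
      from this[OF variance_bounds variance_bounds] show ?thesis by simp
    qed
    then show "\<forall>\<^sub>F \<epsilon> in at_right 0. AE \<omega> in M. norm (norm (?ve \<epsilon> \<omega> - ?v \<omega>)) \<le> s" by simp
  qed (use s in auto)
  then have "l2_tendsto M (\<lambda>\<epsilon> \<omega>. (s / \<gamma>) *\<^sub>R norm (?ye \<epsilon> \<omega> - ?y \<omega>) + (1 / \<gamma>) *\<^sub>R (norm (?ve \<epsilon> \<omega> - ?v \<omega>) * norm (?y \<omega>)))
      (\<lambda>\<omega>. (s / \<gamma>) *\<^sub>R 0 + (1 / \<gamma>) *\<^sub>R 0) (at_right 0)"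
    by (intro l2_tendsto_add l2_tendsto_scaleR l2_tendsto_norm_zero l2_tendsto_diff_zero y) simp
  then have z: "l2_tendsto M (\<lambda>\<epsilon> \<omega>. s / \<gamma> * norm (?ye \<epsilon> \<omega> - ?y \<omega>) + 1 / \<gamma> * (norm (?ve \<epsilon> \<omega> - ?v \<omega>) * norm (?y \<omega>))) (\<lambda>\<omega>. 0) (at_right 0)"
    by (simp only: real_scaleR_def mult_zero_right add_0_right)
  have g: "gain_e n = (\<lambda>\<epsilon> \<omega>. sat \<gamma> h (?ve \<epsilon> \<omega>) (?ye \<epsilon> \<omega>))" "gain_0 n = (\<lambda>\<omega>. sat \<gamma> h (?v \<omega>) (?y \<omega>))"
    by (simp_all add: path_gain_def gain_sat)
  show ?thesis unfolding g
  proof (rule l2_tendsto_dominated[OF _ _ z, where k = 1])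
    show "in_l2 M (\<lambda>\<omega>. sat \<gamma> h (?v \<omega>) (?y \<omega>))"
    proof (rule in_l2_bounded)
      show "(\<lambda>\<omega>. sat \<gamma> h (?v \<omega>) (?y \<omega>)) \<in> borel_measurable (completion M)"
        using in_y in_v by (intro meas_sat) (auto simp: in_l2_def)
      show "AE \<omega> in M. norm (sat \<gamma> h (?v \<omega>) (?y \<omega>)) \<le> 1 / h + s / \<gamma>"
        using sat_bounded[OF \<gamma> h variance_bounds] by simp
    qed
    have "\<forall>\<^sub>F \<epsilon> in at_right 0. in_l2 M (?ye \<epsilon>)" "\<forall>\<^sub>F \<epsilon> in at_right 0. in_l2 M (?ve \<epsilon>)" using y v by (auto simp: l2_tendsto_def)
    then show "\<forall>\<^sub>F \<epsilon> in at_right 0. (\<lambda>\<omega>. sat \<gamma> h (?ve \<epsilon> \<omega>) (?ye \<epsilon> \<omega>)) \<in> borel_measurable (completion M)"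
      by eventually_elim (auto simp: in_l2_def intro: meas_sat)
    have "norm (sat \<gamma> h (?ve \<epsilon> \<omega>) (?ye \<epsilon> \<omega>) - sat \<gamma> h (?v \<omega>) (?y \<omega>)) \<le>
       s / \<gamma> * norm (?ye \<epsilon> \<omega> - ?y \<omega>) + 1 / \<gamma> * (norm (?ve \<epsilon> \<omega> - ?v \<omega>) * norm (?y \<omega>))" for \<epsilon> \<omega>
    proof -
      have "norm (sat \<gamma> h (?ve \<epsilon> \<omega>) (?ye \<epsilon> \<omega>) - sat \<gamma> h (?ve \<epsilon> \<omega>) (?y \<omega>)) \<le> s / \<gamma> * norm (?ye \<epsilon> \<omega> - ?y \<omega>)"
        by (rule sat_lipschitz_right[OF \<gamma> h variance_bounds])
      moreover have "norm (sat \<gamma> h (?ve \<epsilon> \<omega>) (?y \<omega>) - sat \<gamma> h (?v \<omega>) (?y \<omega>)) \<le> \<bar>?ve \<epsilon> \<omega> - ?v \<omega>\<bar> * norm (?y \<omega>) / \<gamma>"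
        by (rule sat_lipschitz_left[OF \<gamma> h variance_bounds(1) variance_bounds(1)])
      moreover have "norm (sat \<gamma> h (?ve \<epsilon> \<omega>) (?ye \<epsilon> \<omega>) - sat \<gamma> h (?v \<omega>) (?y \<omega>)) \<le>
          norm (sat \<gamma> h (?ve \<epsilon> \<omega>) (?ye \<epsilon> \<omega>) - sat \<gamma> h (?ve \<epsilon> \<omega>) (?y \<omega>)) + norm (sat \<gamma> h (?ve \<epsilon> \<omega>) (?y \<omega>) - sat \<gamma> h (?v \<omega>) (?y \<omega>))"
        by norm
      ultimately show ?thesis by simp
    qed
    then show "\<forall>\<^sub>F \<epsilon> in at_right 0. AE \<omega> in M. norm (sat \<gamma> h (?ve \<epsilon> \<omega>) (?ye \<epsilon> \<omega>) - sat \<gamma> h (?v \<omega>) (?y \<omega>)) \<le>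
       1 * norm (s / \<gamma> * norm (?ye \<epsilon> \<omega> - ?y \<omega>) + 1 / \<gamma> * (norm (?ve \<epsilon> \<omega> - ?v \<omega>) * norm (?y \<omega>)))"
      by (intro always_eventually allI AE_I2) (auto intro: order_trans[OF _ abs_ge_self])
  qed
qed

lemma drift_l2:
  assumes sl: "l2_tendsto M (slope_e n) (slope_0 n) (at_right 0)"
  shows "l2_tendsto M (\<lambda>\<epsilon> \<omega>. 1 - k * (gain_e n \<epsilon> \<omega> \<bullet> (A *v Xe \<epsilon> (real n * h) \<omega>)))
     (\<lambda>\<omega>. 1 - k * (gain_0 n \<omega> \<bullet> (A *v X (real n * h) \<omega>))) (at_right 0)"
proof -
  have B: "0 \<le> 1 / h + s / \<gamma>" using h s \<gamma> by simp
  have "l2_tendsto M (\<lambda>\<epsilon> \<omega>. gain_e n \<epsilon> \<omega> \<bullet> (A *v Xe \<epsilon> (real n * h) \<omega>)) (\<lambda>\<omega>. gain_0 n \<omega> \<bullet> (A *v X (real n * h) \<omega>)) (at_right 0)"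
    by (rule l2_tendsto_inner_bounded[OF gain_l2[OF sl] l2_tendsto_matrix[OF X_grid_l2] _ _ B]) (simp_all add: gain_norm)
  from l2_tendsto_diff[OF l2_tendsto_const[OF in_l2_bounded[of "\<lambda>_. 1::real" 1]] l2_tendsto_scaleR[OF this, of k]]
  show ?thesis by simp
qed

lemma slope_l2: "l2_tendsto M (slope_e n) (slope_0 n) (at_right 0)"
proof (induction n)
  case 0
  show ?case by (simp add: l2_tendsto_const in_l2_bounded[where B = 1])
next
  case (Suc n)
  show ?case unfolding slope_Suc
    by (rule l2_tendsto_mult_bounded[OF Suc drift_l2[OF Suc] slope_norm slope_norm])
qed

text \<open>The old mean is multiplied by a number between 0 and 1, which is the bounded factor.\<close>

lemma centre_l2:
  assumes U: "\<And>n. l2_tendsto M (\<lambda>\<epsilon> \<omega>. U \<epsilon> \<omega> n) (\<lambda>\<omega>. U0 \<omega> n) (at_right 0)"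
  shows "l2_tendsto M (\<lambda>\<epsilon> \<omega>. centre \<gamma> A h s m (\<lambda>t. Xe \<epsilon> t \<omega>) (U \<epsilon> \<omega>) n) (\<lambda>\<omega>. centre \<gamma> A h s m (\<lambda>t. X t \<omega>) (U0 \<omega>) n) (at_right 0)"
proof (induction n)
  case 0
  show ?case by (simp add: l2_tendsto_const in_l2_bounded[where B = "\<bar>m\<bar>"])
next
  case (Suc n)
  have b: "norm (1 - h * (path_gain \<gamma> A h s x n \<bullet> (A *v x (real n * h)))) \<le> 1" for x
    using gain_drift[of x n] by simp
  have "l2_tendsto M (\<lambda>\<epsilon> \<omega>. (1 - h * (gain_e n \<epsilon> \<omega> \<bullet> (A *v Xe \<epsilon> (real n * h) \<omega>))) * centre \<gamma> A h s m (\<lambda>t. Xe \<epsilon> t \<omega>) (U \<epsilon> \<omega>) n)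
     (\<lambda>\<omega>. (1 - h * (gain_0 n \<omega> \<bullet> (A *v X (real n * h) \<omega>))) * centre \<gamma> A h s m (\<lambda>t. X t \<omega>) (U0 \<omega>) n) (at_right 0)"
    by (rule l2_tendsto_mult_bounded[OF drift_l2[OF slope_l2] Suc b b])
  from l2_tendsto_add[OF this U[of n]] show ?case by simp
qed

lemma filter_l2:
  assumes U: "\<And>n. l2_tendsto M (\<lambda>\<epsilon> \<omega>. U \<epsilon> \<omega> n) (\<lambda>\<omega>. U0 \<omega> n) (at_right 0)"
    and \<Theta>: "in_l2 M (\<lambda>\<omega>. \<Theta> \<omega> - m)"
  shows "l2_tendsto M (\<lambda>\<epsilon> \<omega>. centre \<gamma> A h s m (\<lambda>t. Xe \<epsilon> t \<omega>) (U \<epsilon> \<omega>) n + slope_e n \<epsilon> \<omega> * (\<Theta> \<omega> - m))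
     (\<lambda>\<omega>. centre \<gamma> A h s m (\<lambda>t. X t \<omega>) (U0 \<omega>) n + slope_0 n \<omega> * (\<Theta> \<omega> - m)) (at_right 0)"
proof -
  have "l2_tendsto M (\<lambda>\<epsilon> \<omega>. slope_e n \<epsilon> \<omega> * (\<Theta> \<omega> - m)) (\<lambda>\<omega>. slope_0 n \<omega> * (\<Theta> \<omega> - m)) (at_right 0)"
    by (rule l2_tendsto_mult_bounded[OF slope_l2 l2_tendsto_const[OF \<Theta>] slope_norm slope_norm])
  from l2_tendsto_add[OF centre_l2[of U U0 m n, OF U] this] show ?thesis .
qed

lemma increments_l2:
  "l2_tendsto M (\<lambda>\<epsilon> \<omega>. gain_e n \<epsilon> \<omega> \<bullet> (Xe \<epsilon> (real (Suc n) * h) \<omega> - Xe \<epsilon> (real n * h) \<omega>))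
     (\<lambda>\<omega>. gain_0 n \<omega> \<bullet> (X (real (Suc n) * h) \<omega> - X (real n * h) \<omega>)) (at_right 0)"
proof -
  have B: "0 \<le> 1 / h + s / \<gamma>" using h s \<gamma> by simp
  show ?thesis
    by (rule l2_tendsto_inner_bounded[OF gain_l2[OF slope_l2] l2_tendsto_diff[OF X_grid_l2[of "Suc n"] X_grid_l2[of n]] _ _ B])
      (simp_all add: gain_norm)
qed

text \<open>The correction of the scheme is \<open>\<sigma>\<^sub>n / \<gamma>\<close> times the correction \<open>(\<gamma> / 2) h (A\<^sup>T : M)\<close> of the
  integral.\<close>

lemma corrected_integral_l2:
  assumes J: "has_ito_integral_process M (init_filtration M (X 0) W) W (\<lambda>t \<omega>. A *v X t \<omega>) (sqrt \<gamma>) (\<lambda>t \<omega>. A *v X t \<omega>)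
      (real n * h) (real (Suc n) * h) J"
  shows "l2_tendsto M (\<lambda>\<epsilon> \<omega>. s * (slope_e n \<epsilon> \<omega>)\<^sup>2 / \<gamma> * rs_integral (\<lambda>t. A *v Xe \<epsilon> t \<omega>) (\<lambda>t. Xe \<epsilon> t \<omega>) (real n * h) (real (Suc n) * h)
          - h / 2 * (s * (slope_e n \<epsilon> \<omega>)\<^sup>2) * (transpose A ::\<^sub>F mat_M \<beta>))
     (\<lambda>\<omega>. s * (slope_0 n \<omega>)\<^sup>2 / \<gamma> * J \<omega>) (at_right 0)"
proof -
  let ?a = "real n * h" and ?b = "real (Suc n) * h"
  have ab: "0 \<le> ?a" "?a \<le> ?b" "0 \<le> ?b" using h by (auto simp: mult_right_mono)
  obtain c where "mom M 2 J c" using ito_value_mom2[OF ab(1,2) J] by blast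
  then have J2: "in_l2 M J" by (rule mom_imp_in_l2)
  have conv: "l2_tendsto M (\<lambda>\<epsilon> \<omega>. rs_integral (\<lambda>t. A *v Xe \<epsilon> t \<omega>) (\<lambda>t. Xe \<epsilon> t \<omega>) ?a ?b - \<gamma> / 2 * (?b - ?a) * (transpose A ::\<^sub>F mat_M \<beta>)) J (at_right 0)"
    by (rule order_mom_imp_l2_tendsto[OF smooth_integral_order[OF ab(1,2) order_refl J] ab(3) J2])
  have vb: "norm (s * (slope \<gamma> A h s x n)\<^sup>2) \<le> s" for x using variance_bounds[of x n] by simp
  have "l2_tendsto M (\<lambda>\<epsilon> \<omega>. (s * (slope_e n \<epsilon> \<omega>)\<^sup>2) * (rs_integral (\<lambda>t. A *v Xe \<epsilon> t \<omega>) (\<lambda>t. Xe \<epsilon> t \<omega>) ?a ?b - \<gamma> / 2 * (?b - ?a) * (transpose A ::\<^sub>F mat_M \<beta>)))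
     (\<lambda>\<omega>. (s * (slope_0 n \<omega>)\<^sup>2) * J \<omega>) (at_right 0)"
    by (rule l2_tendsto_mult_bounded[OF variance_l2[OF slope_l2] conv vb vb])
  from l2_tendsto_scaleR[OF this, of "1 / \<gamma>"]
  have "l2_tendsto M (\<lambda>\<epsilon> \<omega>. (1 / \<gamma>) * ((s * (slope_e n \<epsilon> \<omega>)\<^sup>2) * (rs_integral (\<lambda>t. A *v Xe \<epsilon> t \<omega>) (\<lambda>t. Xe \<epsilon> t \<omega>) ?a ?b - \<gamma> / 2 * (?b - ?a) * (transpose A ::\<^sub>F mat_M \<beta>))))
     (\<lambda>\<omega>. (1 / \<gamma>) * ((s * (slope_0 n \<omega>)\<^sup>2) * J \<omega>)) (at_right 0)"
    by (simp only: real_scaleR_def inner_real_def)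
  moreover have "(1 / \<gamma>) * (v * (R - \<gamma> / 2 * (?b - ?a) * tr)) = v / \<gamma> * R - h / 2 * v * tr" for v R tr
    using \<gamma> by (simp add: field_simps)
  moreover have "(1 / \<gamma>) * (v * R) = v / \<gamma> * R" for v R by simp
  ultimately show ?thesis by (simp only:)
qed

end

end

theorem proposition3:
  fixes \<Omega> :: "'w measure"
    and \<gamma> \<Delta>t m_prior \<sigma>_prior :: real
    and A M C :: "real^2^2"
    and W X :: "real \<Rightarrow> 'w \<Rightarrow> real^2"
    and X\<^sub>\<epsilon> P\<^sub>\<epsilon> :: "real \<Rightarrow> real \<Rightarrow> 'w \<Rightarrow> real^2"
    and \<Theta>\<^sub>0 :: "'w \<Rightarrow> real"
    and \<mu> :: "real measure"
  defines "M \<equiv> mat_M 2"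
    and "C \<equiv> - \<gamma> *\<^sub>R matrix_inv (A + transpose A)"
    and "\<mu> \<equiv> distr \<Omega> borel \<Theta>\<^sub>0"
  assumes "prob_space \<Omega>"
    and "\<gamma> > 0" and "\<Delta>t > 0"
    and "normal_matrix A"
    and "\<And>z. complex_eigenvalue A z \<Longrightarrow> Re z < 0"
    and "brownian_motion \<Omega> W"
    \<comment> \<open>reference process\<close>
    and "additive_process \<Omega> W (\<lambda>t \<omega>. A *v X t \<omega>) (sqrt \<gamma>) X"
    and "gaussian_rv \<Omega> 0 C (X 0)"
    \<comment> \<open>two-scale process\<close>
    and "\<And>\<epsilon>. \<epsilon> > 0 \<Longrightarrow>
           additive_process \<Omega> W (\<lambda>t \<omega>. A *v X\<^sub>\<epsilon> \<epsilon> t \<omega> + (sqrt \<gamma> / \<epsilon>) *\<^sub>R (M *v P\<^sub>\<epsilon> \<epsilon> t \<omega>)) 0 (X\<^sub>\<epsilon> \<epsilon>)"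
    and "\<And>\<epsilon>. \<epsilon> > 0 \<Longrightarrow>
           additive_process \<Omega> W (\<lambda>t \<omega>. - (1 / \<epsilon>) *\<^sub>R (M *v P\<^sub>\<epsilon> \<epsilon> t \<omega>)) 1 (P\<^sub>\<epsilon> \<epsilon>)"
    and "\<And>\<epsilon>. \<epsilon> > 0 \<Longrightarrow> AE \<omega> in \<Omega>. X\<^sub>\<epsilon> \<epsilon> 0 \<omega> = X 0 \<omega>"
    and "\<And>\<epsilon>. \<epsilon> > 0 \<Longrightarrow> gaussian_rv \<Omega> 0 ((\<epsilon> / 2) *\<^sub>R mat 1) (P\<^sub>\<epsilon> \<epsilon> 0)"
    \<comment> \<open>prior\<close>
    and "\<sigma>_prior > 0"
    and "distributed \<Omega> lborel \<Theta>\<^sub>0 (normal_density m_prior (sqrt \<sigma>_prior))"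
    \<comment> \<open>mutual independence of \<open>\<Theta>\<^sub>0\<close>, \<open>X 0\<close>, \<open>P\<^sub>\<epsilon> \<epsilon> 0\<close> and \<open>W\<close>\<close>
    and "\<And>\<epsilon>. \<epsilon> > 0 \<Longrightarrow>
           indep_rv \<Omega> borel \<Theta>\<^sub>0 (borel \<Otimes>\<^sub>M borel \<Otimes>\<^sub>M path_space {0..})
             (\<lambda>\<omega>. (X 0 \<omega>, P\<^sub>\<epsilon> \<epsilon> 0 \<omega>, traj {0..} W \<omega>))"
    and "\<And>\<epsilon>. \<epsilon> > 0 \<Longrightarrow>
           indep_rv \<Omega> borel (X 0) (borel \<Otimes>\<^sub>M path_space {0..}) (\<lambda>\<omega>. (P\<^sub>\<epsilon> \<epsilon> 0 \<omega>, traj {0..} W \<omega>))"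
    and "\<And>\<epsilon>. \<epsilon> > 0 \<Longrightarrow> indep_rv \<Omega> borel (P\<^sub>\<epsilon> \<epsilon> 0) (path_space {0..}) (traj {0..} W)"
  shows "(\<forall>n. tendsto_L2 \<Omega>
            (\<lambda>\<epsilon> \<omega>. filter_increments \<gamma> A \<Delta>t \<mu> (\<lambda>t. X\<^sub>\<epsilon> \<epsilon> t \<omega>) n (\<Theta>\<^sub>0 \<omega>))
            (\<lambda>\<omega>. filter_increments \<gamma> A \<Delta>t \<mu> (\<lambda>t. X t \<omega>) n (\<Theta>\<^sub>0 \<omega>))
            (at_right 0)) \<and>
         (\<forall>J. (\<forall>n. has_ito_integral_process \<Omega> (init_filtration \<Omega> (X 0) W) W
                    (\<lambda>t \<omega>. A *v X t \<omega>) (sqrt \<gamma>) (\<lambda>t \<omega>. A *v X t \<omega>)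
                    (real n * \<Delta>t) (real (Suc n) * \<Delta>t) (J n)) \<longrightarrow>
          (\<forall>n. tendsto_L2 \<Omega>
            (\<lambda>\<epsilon> \<omega>. filter_corrected \<gamma> A M \<Delta>t \<mu> (\<lambda>t. X\<^sub>\<epsilon> \<epsilon> t \<omega>) n (\<Theta>\<^sub>0 \<omega>))
            (\<lambda>\<omega>. filter_ito \<gamma> A \<Delta>t \<mu> (\<lambda>t. X t \<omega>) (\<lambda>k. J k \<omega>) n (\<Theta>\<^sub>0 \<omega>))
            (at_right 0)))"
proof -
  interpret two_scale \<Omega> W X X\<^sub>\<epsilon> P\<^sub>\<epsilon> \<gamma> 2 A C
    unfolding two_scale_def two_scale_axioms_def
    using assms(4-) unfolding M_def by blast
  have \<Theta>: "distributed \<Omega> lborel \<Theta>\<^sub>0 (\<lambda>x. ennreal (normal_density m_prior (sqrt \<sigma>_prior) x))" by fact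
  have h: "\<Delta>t > 0" and s: "\<sigma>_prior > 0" by fact+
  have \<Theta>_l2: "in_l2 \<Omega> (\<lambda>\<omega>. \<Theta>\<^sub>0 \<omega> - m_prior)"
  proof -
    have [measurable]: "\<Theta>\<^sub>0 \<in> borel_measurable \<Omega>" using distributed_measurable[OF \<Theta>] by simp
    have "integrable \<Omega> (\<lambda>\<omega>. (\<Theta>\<^sub>0 \<omega> - m_prior) ^ 2)" by (rule normal_moments(1)[OF \<Theta>]) (use s in simp)
    then show ?thesis by (simp add: in_l2_def integrable_completion measurable_completion)
  qed
  note aff = filter_increments_affine[OF prob_space_axioms \<Theta> s] filter_corrected_affine[OF prob_space_axioms \<Theta> s]
    filter_ito_affine[OF prob_space_axioms \<Theta> s]
  show ?thesis
    unfolding tendsto_L2_iff_l2_tendsto \<mu>_def M_def aff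
    by (intro conjI allI impI filter_l2[OF h s _ \<Theta>_l2] increments_l2[OF h s] corrected_integral_l2[OF h s]) auto
qed

end
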